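(* Let $N\ge2$, $\mathsf{A}=(A_1,\ldots,A_N)\in GL_2(\mathbb{R})^N$ be irreducible, $s>0$, and let $\mu$ be an equilibrium state for $\Phi^s$. Then the following four statements are equivalent: (1) $\mu$ is a quasi-Bernoulli measure; (2) the semigroup $\mathcal{S}(\mathsf{A})$ generated by $\{A_1,\dots,A_N\}$ is almost multiplicative; (3) $\{A_1,\ldots,A_N\}$ can be decomposed into two sets $\mathsf{A}_e$ and $\mathsf{A}_h$ such that $\mathsf{A}_e$ is strongly conformal and, if $\mathsf{A}_h\neq\emptyset$, then $\mathsf{A}_h$ has a strongly invariant multicone $\mathcal{C}$ such that $A\mathcal{C}=\mathcal{C}$ for all $A\in\mathsf{A}_e$; (4) there exist a constant $C>0$ and a $\mu$-almost everywhere continuous function $f\in L^1(\mu)$, $f:\Sigma\to\mathbb{R}$, such that $\bigl|\sum_{k=0}^{n-1}f(\sigma^k\mathtt{i})-\log\|A_{\mathtt{i}|_n}\|\bigr|\le C$ for all $\mathtt{i}\in\Sigma$ and $n\in\mathbb{N}$.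
   Context: $\|\cdot\|$ is the operator norm. $\Sigma=\{1,\ldots,N\}^{\mathbb{N}}$ with the product discrete topology and left shift $\sigma$; $\Sigma_n$ is the set of words of length $n$, $\mathtt{i}|_n$ the first $n$ symbols of $\mathtt{i}$, $[\mathtt{i}]$ the cylinder of words beginning with the finite word $\mathtt{i}$, and $A_{i_1\cdots i_n}=A_{i_1}\cdots A_{i_n}$. $\Phi^s=(\phi^s_n)$ with $\phi^s_n(\mathtt{i})=\log\|A_{\mathtt{i}|_n}\|^s$. The pressure is $P(\Phi^s)=\lim_n\frac1n\log\sum_{\mathtt{i}\in\Sigma_n}\exp\max_{\mathtt{j}\in[\mathtt{i}]}\phi^s_n(\mathtt{j})$; an equilibrium state is a $\sigma$-invariant Borel probability measure $\mu$ with $P(\Phi^s)=h_\mu+\lim_n\frac1n\int\phi^s_n\,d\mu$, $h_\mu$ the Kolmogorov–Sinai entropy. $\mathsf{A}$ is irreducible if there is no 1-dimensional subspace $V$ with $A_iV=V$ for all $i$. A probability measure $\mu$ on $\Sigma$ is quasi-Bernoulli if there is $C\ge1$ with $C^{-1}\mu([\mathtt{i}])\mu([\mathtt{j}])\le\mu([\mathtt{i}\mathtt{j}])\le C\mu([\mathtt{i}])\mu([\mathtt{j}])$ for all finite words $\mathtt{i},\mathtt{j}$. A semigroup $\mathcal{S}$ is almost multiplicative if there is $\kappa>0$ with $\|AB\|\ge\kappa\|A\|\|B\|$ for all $A,B\in\mathcal{S}$. A matrix is conformal if its two eigenvalues have equal absolute value; a set of matrices is strongly conformal if there is a single invertible $M$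 with $|\det A|^{-1/2}MAM^{-1}\in O(2)$ for all $A$ in the set. $\mathbb{RP}^1$ is the real projective line; a multicone is a proper subset of $\mathbb{RP}^1$ that is a finite union of closed projective intervals; a multicone $\mathcal{C}$ is strongly invariant for a set $\mathsf{B}$ if $A\mathcal{C}\subset\mathcal{C}^o$ (interior) for all $A\in\mathsf{B}$. *)

theory Defs
  imports "HOL-Analysis.Analysis" "HOL-Probability.Probability"
begin

type_synonym mat2 = "real^2^2"

text \<open>Symbols are 0,...,N-1. The full shift Sigma is a subset of nat => nat with the
product (of discrete) topology, which is the product topology of the type nat => nat.\<close>

definition Sigma_space :: "nat \<Rightarrow> (nat \<Rightarrow> nat) set" where
  "Sigma_space N = {x. \<forall>k. x k < N}"

definition shift :: "(nat \<Rightarrow> nat) \<Rightarrow> (nat \<Rightarrow> nat)" where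
  "shift x = (\<lambda>k. x (Suc k))"

definition words :: "nat \<Rightarrow> nat \<Rightarrow> nat list set" where
  "words N n = {w. length w = n \<and> set w \<subseteq> {..<N}}"

definition finite_words :: "nat \<Rightarrow> nat list set" where
  "finite_words N = {w. set w \<subseteq> {..<N}}"

definition cyl :: "nat \<Rightarrow> nat list \<Rightarrow> (nat \<Rightarrow> nat) set" where
  "cyl N w = {x \<in> Sigma_space N. \<forall>k<length w. x k = w ! k}"

definition prefix_word :: "(nat \<Rightarrow> nat) \<Rightarrow> nat \<Rightarrow> nat list" where
  "prefix_word x n = map x [0..<n]"

definition wprod :: "(nat \<Rightarrow> mat2) \<Rightarrow> nat list \<Rightarrow> mat2" where
  "wprod A w = foldr (\<lambda>i M. A i ** M) w (mat 1)"

definition opnorm :: "mat2 \<Rightarrow> real" where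
  "opnorm M = onorm (\<lambda>v. M *v v)"

definition phi :: "(nat \<Rightarrow> mat2) \<Rightarrow> real \<Rightarrow> nat \<Rightarrow> (nat \<Rightarrow> nat) \<Rightarrow> real" where
  "phi A s n x = ln (opnorm (wprod A (prefix_word x n)) powr s)"

definition pressure :: "nat \<Rightarrow> (nat \<Rightarrow> mat2) \<Rightarrow> real \<Rightarrow> real" where
  "pressure N A s = lim (\<lambda>n. ln (\<Sum>w\<in>words N n. exp (SUP y\<in>cyl N w. phi A s n y)) / real n)"

definition meas_partition :: "'a measure \<Rightarrow> 'a set set \<Rightarrow> bool" where
  "meas_partition M P \<longleftrightarrow> finite P \<and> P \<subseteq> sets M \<and> disjoint P \<and> \<Union>P = space M"

definition partition_entropy :: "'a measure \<Rightarrow> 'a set set \<Rightarrow> real" where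
  "partition_entropy M P = - (\<Sum>B\<in>P. measure M B * ln (measure M B))"

definition join_iter :: "'a measure \<Rightarrow> ('a \<Rightarrow> 'a) \<Rightarrow> 'a set set \<Rightarrow> nat \<Rightarrow> 'a set set" where
  "join_iter M T P n = {space M \<inter> (\<Inter>k<n. (T ^^ k) -` c k) | c. \<forall>k<n. c k \<in> P}"

definition ks_entropy :: "'a measure \<Rightarrow> ('a \<Rightarrow> 'a) \<Rightarrow> real" where
  "ks_entropy M T = (SUP P\<in>{P. meas_partition M P}.
      lim (\<lambda>n. partition_entropy M (join_iter M T P n) / real n))"

definition invariant_borel_prob :: "nat \<Rightarrow> (nat \<Rightarrow> nat) measure \<Rightarrow> bool" where
  "invariant_borel_prob N \<mu> \<longleftrightarrow> prob_space \<mu> \<and> space \<mu> = Sigma_space N \<and>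
     sets \<mu> = sets (restrict_space borel (Sigma_space N)) \<and>
     (\<forall>B\<in>sets \<mu>. emeasure \<mu> (shift -` B \<inter> space \<mu>) = emeasure \<mu> B)"

definition equilibrium_state :: "nat \<Rightarrow> (nat \<Rightarrow> mat2) \<Rightarrow> real \<Rightarrow> (nat \<Rightarrow> nat) measure \<Rightarrow> bool" where
  "equilibrium_state N A s \<mu> \<longleftrightarrow> invariant_borel_prob N \<mu> \<and>
     pressure N A s = ks_entropy \<mu> shift + lim (\<lambda>n. (\<integral>x. phi A s n x \<partial>\<mu>) / real n)"

definition irreducible_tuple :: "nat \<Rightarrow> (nat \<Rightarrow> mat2) \<Rightarrow> bool" where
  "irreducible_tuple N A \<longleftrightarrow>
     \<not> (\<exists>V::(real^2) set. subspace V \<and> dim V = 1 \<and> (\<forall>i<N. (\<lambda>v. A i *v v) ` V = V))"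

definition quasi_bernoulli :: "nat \<Rightarrow> (nat \<Rightarrow> nat) measure \<Rightarrow> bool" where
  "quasi_bernoulli N \<mu> \<longleftrightarrow> (\<exists>C\<ge>1. \<forall>u\<in>finite_words N. \<forall>w\<in>finite_words N.
      measure \<mu> (cyl N u) * measure \<mu> (cyl N w) / C \<le> measure \<mu> (cyl N (u @ w)) \<and>
      measure \<mu> (cyl N (u @ w)) \<le> C * measure \<mu> (cyl N u) * measure \<mu> (cyl N w))"

definition gen_semigroup :: "nat \<Rightarrow> (nat \<Rightarrow> mat2) \<Rightarrow> mat2 set" where
  "gen_semigroup N A = {wprod A w | w. w \<noteq> [] \<and> set w \<subseteq> {..<N}}"

definition almost_multiplicative :: "mat2 set \<Rightarrow> bool" where
  "almost_multiplicative S \<longleftrightarrow>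
     (\<exists>\<kappa>>0. \<forall>X\<in>S. \<forall>Y\<in>S. opnorm (X ** Y) \<ge> \<kappa> * opnorm X * opnorm Y)"

definition strongly_conformal :: "mat2 set \<Rightarrow> bool" where
  "strongly_conformal B \<longleftrightarrow> (\<exists>M::mat2. invertible M \<and>
     (\<forall>X\<in>B. orthogonal_matrix (\<bar>det X\<bar> powr (-1/2) *\<^sub>R (M ** X ** matrix_inv M))))"

text \<open>Points of RP^1 are the lines (1-dimensional subspaces) of R^2. They are parametrised
by angles via the quotient map ang, which is an open map; the topology of RP^1 is the
quotient topology.\<close>

definition ang :: "real \<Rightarrow> (real^2) set" where
  "ang \<theta> = span {vector [cos \<theta>, sin \<theta>]}"

definition RP1 :: "(real^2) set set" where
  "RP1 = range ang"

definition proj_interior :: "(real^2) set set \<Rightarrow> (real^2) set set" where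
  "proj_interior S = ang ` interior (ang -` S)"

definition closed_proj_interval :: "(real^2) set set \<Rightarrow> bool" where
  "closed_proj_interval I \<longleftrightarrow> (\<exists>a b. a < b \<and> b < a + pi \<and> I = ang ` {a..b})"

definition multicone :: "(real^2) set set \<Rightarrow> bool" where
  "multicone C \<longleftrightarrow> C \<subset> RP1 \<and>
     (\<exists>\<I>. finite \<I> \<and> \<I> \<noteq> {} \<and> (\<forall>I\<in>\<I>. closed_proj_interval I) \<and> C = \<Union>\<I>)"

definition proj_act :: "mat2 \<Rightarrow> (real^2) set set \<Rightarrow> (real^2) set set" where
  "proj_act X C = (\<lambda>L. (\<lambda>v. X *v v) ` L) ` C"

definition strongly_invariant :: "(real^2) set set \<Rightarrow> mat2 set \<Rightarrow> bool" where
  "strongly_invariant C B \<longleftrightarrow> (\<forall>X\<in>B. proj_act X C \<subseteq> proj_interior C)"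

definition decomposable :: "nat \<Rightarrow> (nat \<Rightarrow> mat2) \<Rightarrow> bool" where
  "decomposable N A \<longleftrightarrow> (\<exists>E H. E \<union> H = {..<N} \<and> E \<inter> H = {} \<and>
     strongly_conformal (A ` E) \<and>
     (H \<noteq> {} \<longrightarrow> (\<exists>C. multicone C \<and> strongly_invariant C (A ` H) \<and>
                         (\<forall>i\<in>E. proj_act (A i) C = C))))"

definition additive_cocycle_cond :: "nat \<Rightarrow> (nat \<Rightarrow> mat2) \<Rightarrow> (nat \<Rightarrow> nat) measure \<Rightarrow> bool" where
  "additive_cocycle_cond N A \<mu> \<longleftrightarrow> (\<exists>C>0. \<exists>f::(nat \<Rightarrow> nat) \<Rightarrow> real.
     (AE x in \<mu>. (f \<longlongrightarrow> f x) (at x within Sigma_space N)) \<and> integrable \<mu> f \<and>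
     (\<forall>x\<in>Sigma_space N. \<forall>n.
        \<bar>(\<Sum>k<n. f ((shift ^^ k) x)) - ln (opnorm (wprod A (prefix_word x n)))\<bar> \<le> C))"

end

theory Submission
  imports Defs
begin

text \<open>
  Write $m(w) = e^{-P|w|} \|A_w\|^s$. Irreducibility makes $m$ quasi-multiplicative with gaps of length
  at most one, so $m$ has comparable total mass on all levels, and
  $\nu_T(u) = Z_T^{-1} \sum_v m(uv)$ (over words with $|uv| = T$) is a consistent family comparable to $m$.
  For an equilibrium state $\mu$ the divergence of $\mu$ from $\nu_T$ on words of length $n \le T$ is
  increasing in $n$ and bounded independently of $T$. Hence some increment is small, and there the
  conditional laws of $\mu$ and $\nu_T$ nearly agree; by shift invariance this gives $\mu[w] \asymp m(w)$.
  With this Gibbs property, quasi-Bernoulli and almost multiplicative are the same condition.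

  Let $q(w) = |\det A_w| / \|A_w\|^2$. If $q$ is bounded below, the form of maximal determinant
  in the closed convex hull of the normalised $A_w^T A_w$ is unique, hence invariant, and all matrices
  are conformal. Otherwise a rank one limit of the semigroup gives a vector $x_0$ that is expanded by
  all products at the rate of their norms. Let $F$ be the closed cone spanned by its orbit. The letters
  with $A_i F = F$ form the conformal part, and every other letter decreases $q$
  exponentially, by a packing argument. The set of lines $x$ such that the distances of $A_w x$ to $F$,
  weighted exponentially in the number of hyperbolic letters of $w$, stay below a small constant
  is mapped into its interior by the hyperbolic letters, and a thickening of it is the multicone.
\<close>

section \<open>Finite words and relative entropy\<close>

text \<open>Three obstacles shape the proof. The Gibbs property is obtained without any uniqueness
  or ergodicity of the equilibrium state: entropy rate and energy rate are bounded by their values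
  on every finite level, so each level has nonnegative free energy, and of the Kolmogorov-Sinai
  theorem only the upper bound by cylinder entropies has to be proved. The gap of length one is a
  feature of the plane: x and some A_i x already span it, so no unit vector is orthogonal to all of
  them.

  The multicone has to be mapped strictly inside itself by the hyperbolic letters but exactly onto
  itself by the conformal ones, so a plain neighbourhood of F will not do. The weight gives each
  hyperbolic letter a fixed gain, and it is affordable because q decays at the same exponential
  rate. The final thickening uses a projective metric for which the conformal letters are
  isometries.

  The potential of the fourth condition is shown continuous only at sequences with infinitely many
  hyperbolic letters. That almost every sequence is of this kind comes from the quasi-Bernoulli
  property, so the second condition reaches the fourth with the help of the first.\<close>

lemma finite_words_fin [simp]: "finite (words N n)"
  unfolding words_def using finite_lists_length_eq[of "{..<N}" n] by (simp add: conj_commute)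

lemma words_0 [simp]: "words N 0 = {[]}"
  by (auto simp: words_def)

lemma sum_words_Suc:
  "(\<Sum>w\<in>words N (Suc n). g w) = (\<Sum>i<N. \<Sum>w\<in>words N n. g (i # w))" for g :: "nat list \<Rightarrow> real"
proof -
  have eq: "words N (Suc n) = (\<lambda>(i,w). i # w) ` ({..<N} \<times> words N n)"
    by (auto simp: words_def image_iff length_Suc_conv)
  have "(\<Sum>w\<in>words N (Suc n). g w) = (\<Sum>x\<in>{..<N} \<times> words N n. g (fst x # snd x))"
    unfolding eq by (subst sum.reindex) (auto simp: inj_on_def case_prod_beta)
  also have "\<dots> = (\<Sum>i<N. \<Sum>w\<in>words N n. g (i # w))"
    by (subst sum.cartesian_product) (simp add: case_prod_beta)
  finally show ?thesis .
qed

lemma sum_words_add: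
  "(\<Sum>w\<in>words N (n + k). g w) = (\<Sum>u\<in>words N n. \<Sum>v\<in>words N k. g (u @ v))" for g :: "nat list \<Rightarrow> real"
  by (induction n arbitrary: g) (simp_all add: sum_words_Suc)

lemma sum_words_1: "(\<Sum>w\<in>words N (Suc 0). g w) = (\<Sum>i<N. g [i])" for g :: "nat list \<Rightarrow> real"
  by (simp add: sum_words_Suc)

text \<open>A Hellinger argument. The bound \<open>ln t \<le> t - 1\<close> at
  \<open>sqrt (q / p)\<close> shows that the divergence dominates the sum of the squares of
  \<open>sqrt p - sqrt q\<close>. Cauchy-Schwarz against \<open>sqrt p + sqrt q\<close>, whose
  squares sum to at most 4, turns this into a bound on the total variation.\<close>

lemma weak_Pinsker:
  fixes p q :: "'a \<Rightarrow> real"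
  assumes "finite S" and p: "\<And>x. x \<in> S \<Longrightarrow> p x \<ge> 0" and q: "\<And>x. x \<in> S \<Longrightarrow> q x \<ge> 0"
    and ac: "\<And>x. x \<in> S \<Longrightarrow> q x = 0 \<Longrightarrow> p x = 0"
    and sp: "sum p S = 1" and sq: "sum q S = 1" and "B \<subseteq> S"
  shows "(sum p B - sum q B)\<^sup>2 \<le> 4 * (\<Sum>x\<in>S. p x * ln (p x / q x))"
proof -
  define a where "a x = \<bar>sqrt (p x) - sqrt (q x)\<bar>" for x
  define b where "b x = sqrt (p x) + sqrt (q x)" for x
  \<comment> \<open>The added \<open>p x - q x\<close> has total zero. It cancels \<open>q x\<close>
    and leaves \<open>2 * p x - 2 * sqrt (p x) * sqrt (q x)\<close>, which can be bounded term by
    term.\<close>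
  have pt: "p x + q x - 2 * sqrt (p x) * sqrt (q x) + (p x - q x) \<le> p x * ln (p x / q x)" if "x \<in> S" for x
  proof (cases "p x = 0")
    case False
    then have pp: "p x > 0" "q x > 0" using p[OF that] q[OF that] ac[OF that] by force+
    have "ln (sqrt (q x) / sqrt (p x)) \<le> sqrt (q x) / sqrt (p x) - 1"
      using pp by (intro ln_le_minus_one) auto
    moreover have "ln (sqrt (q x) / sqrt (p x)) = - ln (p x / q x) / 2"
      using pp by (simp add: ln_div ln_sqrt)
    ultimately have "ln (p x / q x) \<ge> 2 - 2 * (sqrt (q x) / sqrt (p x))" by simp
    then have "p x * ln (p x / q x) \<ge> p x * (2 - 2 * (sqrt (q x) / sqrt (p x)))"
      using pp by (intro mult_left_mono) auto
    moreover have "p x * (2 - 2 * (sqrt (q x) / sqrt (p x))) = 2 * p x - 2 * sqrt (p x) * sqrt (q x)"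
      using pp by (simp add: field_simps)
    ultimately show ?thesis by simp
  qed auto
  have "(\<Sum>x\<in>S. (a x)\<^sup>2) = (\<Sum>x\<in>S. p x + q x - 2 * sqrt (p x) * sqrt (q x))"
    using p q by (intro sum.cong) (auto simp: a_def power2_diff)
  also have "\<dots> = (\<Sum>x\<in>S. p x + q x - 2 * sqrt (p x) * sqrt (q x) + (p x - q x))"
    using sp sq by (simp only: sum.distrib sum_subtractf)
  also have "\<dots> \<le> (\<Sum>x\<in>S. p x * ln (p x / q x))" by (intro sum_mono pt)
  finally have A: "(\<Sum>x\<in>S. (a x)\<^sup>2) \<le> (\<Sum>x\<in>S. p x * ln (p x / q x))" .
  have "(b x)\<^sup>2 \<le> 2 * (p x + q x)" if "x \<in> S" for x
    using p[OF that] q[OF that] sum_squares_bound[of "sqrt (p x)" "sqrt (q x)"] by (simp add: b_def power2_sum)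
  then have "(\<Sum>x\<in>S. (b x)\<^sup>2) \<le> (\<Sum>x\<in>S. 2 * (p x + q x))" by (intro sum_mono)
  also have "\<dots> = 4" using sp sq by (simp add: sum_distrib_left[symmetric] sum.distrib)
  finally have B: "(\<Sum>x\<in>S. (b x)\<^sup>2) \<le> 4" .
  have "\<bar>sum p B - sum q B\<bar> \<le> (\<Sum>x\<in>B. \<bar>p x - q x\<bar>)"
    by (simp add: sum_subtractf[symmetric] sum_abs)
  also have "\<dots> \<le> (\<Sum>x\<in>S. \<bar>p x - q x\<bar>)" using assms by (intro sum_mono2) auto
  also have "\<dots> = (\<Sum>x\<in>S. a x * b x)"
  proof (intro sum.cong refl)
    fix x assume "x \<in> S"
    then have "p x = (sqrt (p x))\<^sup>2" "q x = (sqrt (q x))\<^sup>2" and b: "b x \<ge> 0"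
      using p q by (auto simp: b_def)
    then have "p x - q x = (sqrt (p x) - sqrt (q x)) * b x"
      unfolding b_def by (metis mult.commute square_diff_square_factored power2_eq_square)
    then show "\<bar>p x - q x\<bar> = a x * b x" using b by (simp add: a_def abs_mult)
  qed
  finally have "\<bar>sum p B - sum q B\<bar>\<^sup>2 \<le> (\<Sum>x\<in>S. a x * b x)\<^sup>2" by (intro power_mono) auto
  also have "\<dots> \<le> (\<Sum>x\<in>S. (a x)\<^sup>2) * (\<Sum>x\<in>S. (b x)\<^sup>2)" by (rule Cauchy_Schwarz_ineq_sum)
  also have "\<dots> \<le> (\<Sum>x\<in>S. p x * ln (p x / q x)) * 4"
    by (intro mult_mono A B sum_nonneg order_trans[OF sum_nonneg A]) auto
  finally show ?thesis by simp
qed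

lemma KL_nonneg_finite:
  fixes p q :: "'a \<Rightarrow> real"
  assumes "finite S" "\<And>x. x \<in> S \<Longrightarrow> p x \<ge> 0" "\<And>x. x \<in> S \<Longrightarrow> q x \<ge> 0"
    "\<And>x. x \<in> S \<Longrightarrow> q x = 0 \<Longrightarrow> p x = 0" "sum p S = 1" "sum q S = 1"
  shows "0 \<le> (\<Sum>x\<in>S. p x * ln (p x / q x))"
proof -
  have "(sum p {} - sum q {})\<^sup>2 \<le> 4 * (\<Sum>x\<in>S. p x * ln (p x / q x))"
    by (rule weak_Pinsker) (use assms in auto)
  then show ?thesis by simp
qed

text \<open>Pins down partition sums: if \<open>Z\<close> has exponential rate zero, then along the
  multiples of \<open>n\<close> neither a geometric lower bound with ratio above 1 nor a geometric
  upper bound with ratio below 1 can persist, whatever the prefactor \<open>b\<close>.\<close>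

lemma geometric_rate_zero:
  fixes Z :: "nat \<Rightarrow> real"
  assumes lim: "(\<lambda>n. ln (Z n) / real n) \<longlonglongrightarrow> 0" and "n > 0" "x > 0" "b > 0"
  shows "(\<And>k. k > 0 \<Longrightarrow> b * x ^ k \<le> Z (k * n)) \<Longrightarrow> x \<le> 1"
    and "(\<And>k. k > 0 \<Longrightarrow> Z (k * n) > 0) \<Longrightarrow> (\<And>k. k > 0 \<Longrightarrow> Z (k * n) \<le> b * x ^ k) \<Longrightarrow> 1 \<le> x"
proof -
  have mono: "strict_mono (\<lambda>k. Suc k * n)" using \<open>n > 0\<close> by (simp add: strict_mono_def)
  from LIMSEQ_subseq_LIMSEQ[OF lim this]
  have "(\<lambda>k. ln (Z (Suc k * n)) / real (Suc k * n) * n) \<longlonglongrightarrow> 0 * real n"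
    by (intro tendsto_intros) (simp add: o_def)
  moreover have "ln (Z (Suc k * n)) / real (Suc k * n) * n = ln (Z (Suc k * n)) / Suc k" for k
    using \<open>n > 0\<close> by (simp only: of_nat_mult times_divide_eq_left mult.commute[of "ln _"]) simp
  ultimately have l1: "(\<lambda>k. ln (Z (Suc k * n)) / Suc k) \<longlonglongrightarrow> 0" by simp
  have "(\<lambda>k. ln b / Suc k) \<longlonglongrightarrow> 0"
    by (intro LIMSEQ_Suc[where f="\<lambda>k. ln b / real k"] lim_const_over_n)
  from tendsto_diff[OF l1 this]
  have l2: "(\<lambda>k. (ln (Z (Suc k * n)) - ln b) / Suc k) \<longlonglongrightarrow> 0" by (simp add: diff_divide_distrib)
  {
    assume *: "\<And>k. k > 0 \<Longrightarrow> b * x ^ k \<le> Z (k * n)"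
    have "ln x \<le> (ln (Z (Suc k * n)) - ln b) / Suc k" for k
    proof -
      have "ln (b * x ^ Suc k) \<le> ln (Z (Suc k * n))" using *[of "Suc k"] assms
        by (intro ln_mono) (auto intro: mult_pos_pos)
      then have "ln b + Suc k * ln x \<le> ln (Z (Suc k * n))" using assms
        by (subst (asm) ln_mult) (auto simp: ln_mult ln_realpow algebra_simps)
      then show ?thesis by (simp add: field_simps)
    qed
    then have "ln x \<le> 0" by (intro LIMSEQ_le_const[OF l2]) auto
    then show "x \<le> 1" using assms by simp
  }
  {
    assume **: "\<And>k. k > 0 \<Longrightarrow> Z (k * n) > 0" and *: "\<And>k. k > 0 \<Longrightarrow> Z (k * n) \<le> b * x ^ k"
    have "(ln (Z (Suc k * n)) - ln b) / Suc k \<le> ln x" for k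
    proof -
      have "ln (Z (Suc k * n)) \<le> ln (b * x ^ Suc k)" using *[of "Suc k"] **[of "Suc k"] assms
        by (intro ln_mono) auto
      then have "ln (Z (Suc k * n)) \<le> ln b + Suc k * ln x" using assms
        by (subst (asm) ln_mult) (auto simp: ln_mult ln_realpow algebra_simps)
      then show ?thesis by (simp add: field_simps)
    qed
    then have "0 \<le> ln x" by (intro LIMSEQ_le_const2[OF l2]) auto
    then show "1 \<le> x" using assms by simp
  }
qed

section \<open>The Gibbs property of a measure with zero free energy\<close>

text \<open>Separates the thermodynamic argument from matrices. \<open>m\<close> will be the weight
  normalised by the pressure, so \<open>rate\<close> says that its own pressure is zero.\<close>

locale quasi_mult_weight =
  fixes N :: nat and m :: "nat list \<Rightarrow> real" and c :: real
  assumes pos: "w \<in> finite_words N \<Longrightarrow> m w > 0"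
    and submult: "u \<in> finite_words N \<Longrightarrow> w \<in> finite_words N \<Longrightarrow> m (u @ w) \<le> m u * m w"
    and c_pos: "c > 0"
    and quasi_mult: "u \<in> finite_words N \<Longrightarrow> w \<in> finite_words N \<Longrightarrow>
      c * m u * m w \<le> m (u @ w) + (\<Sum>i<N. m (u @ i # w))"
    and rate: "(\<lambda>n. ln (\<Sum>w\<in>words N n. m w) / real n) \<longlonglongrightarrow> 0"
    and N_pos: "N > 0"
begin

definition Z :: "nat \<Rightarrow> real" where "Z n = (\<Sum>w\<in>words N n. m w)"

text \<open>The single constant of this section: joining two words costs \<open>c\<close>, and the
  detour through one extra letter costs a factor \<open>Z 1\<close>; see
  \<open>tail_sum_lower\<close>.\<close>

definition D :: real where "D = max 1 ((1 + Z 1) / c)"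

lemma words_fin: "w \<in> words N n \<Longrightarrow> w \<in> finite_words N"
  by (auto simp: words_def finite_words_def)

lemma words_ne: "words N n \<noteq> {}"
  using N_pos by (auto simp: words_def intro!: exI[of _ "replicate n 0"])

lemma Z_pos: "Z n > 0"
  unfolding Z_def using words_ne by (intro sum_pos pos words_fin) auto

lemma tail_sum_submult:
  assumes "u \<in> finite_words N"
  shows "(\<Sum>v\<in>words N (L + k). m (u @ v)) \<le> (\<Sum>v\<in>words N L. m (u @ v)) * Z k"
proof -
  have "(\<Sum>v\<in>words N (L + k). m (u @ v)) = (\<Sum>v\<in>words N L. \<Sum>x\<in>words N k. m ((u @ v) @ x))"
    by (simp add: sum_words_add)
  also have "\<dots> \<le> (\<Sum>v\<in>words N L. \<Sum>x\<in>words N k. m (u @ v) * m x)"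
    using assms by (intro sum_mono submult) (auto simp: words_def finite_words_def)
  finally show ?thesis by (simp add: Z_def sum_product)
qed

lemma Z_submult: "Z (n + k) \<le> Z n * Z k"
  using tail_sum_submult[of "[]" n k] by (simp add: Z_def finite_words_def)

lemma D_ge_1: "D \<ge> 1" by (simp add: D_def)

text \<open>Sum \<open>quasi_mult\<close> over all continuations of length \<open>L\<close>. The
  connecting letter merges with the continuation into one of length \<open>L + 1\<close>, and
  submultiplicativity trades the surplus letter for a factor \<open>Z 1\<close>.\<close>

lemma tail_sum_lower:
  assumes u: "u \<in> finite_words N"
  shows "m u * Z L \<le> D * (\<Sum>v\<in>words N L. m (u @ v))"
proof -
  have "c * (m u * Z L) = (\<Sum>v\<in>words N L. c * m u * m v)"
    by (simp add: Z_def sum_distrib_left algebra_simps)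
  also have "\<dots> \<le> (\<Sum>v\<in>words N L. m (u @ v) + (\<Sum>i<N. m (u @ i # v)))"
    by (intro sum_mono quasi_mult u words_fin)
  also have "\<dots> = (\<Sum>v\<in>words N L. m (u @ v)) + (\<Sum>v\<in>words N (L + 1). m (u @ v))"
    by (simp add: sum.distrib sum_words_Suc) (rule sum.swap)
  also have "\<dots> \<le> (1 + Z 1) * (\<Sum>v\<in>words N L. m (u @ v))"
    using tail_sum_submult[OF u, of L 1] by (simp add: algebra_simps)
  finally have "m u * Z L \<le> (1 + Z 1) / c * (\<Sum>v\<in>words N L. m (u @ v))"
    using c_pos by (simp add: field_simps)
  also have "\<dots> \<le> D * (\<Sum>v\<in>words N L. m (u @ v))"
    using u by (intro mult_right_mono sum_nonneg less_imp_le[OF pos])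
      (auto simp: D_def words_def finite_words_def)
  finally show ?thesis .
qed

lemma Z_supermult: "Z n * Z k \<le> D * Z (n + k)"
proof -
  have "Z n * Z k = (\<Sum>u\<in>words N n. m u * Z k)" by (simp add: Z_def sum_distrib_right)
  also have "\<dots> \<le> (\<Sum>u\<in>words N n. D * (\<Sum>v\<in>words N k. m (u @ v)))"
    by (intro sum_mono tail_sum_lower words_fin)
  finally show ?thesis by (simp add: Z_def sum_words_add sum_distrib_left)
qed

lemma rate_Z: "(\<lambda>n. ln (Z n) / real n) \<longlonglongrightarrow> 0"
  using rate by (simp add: Z_def)

lemma Z_0: "Z 0 = m []" by (simp add: Z_def)

text \<open>By submultiplicativity \<open>Z (k * n)\<close> is at most \<open>Z n ^ k\<close>; a
  value below 1 would contradict rate zero.\<close>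

lemma Z_ge_1: assumes "n > 0" shows "Z n \<ge> 1"
proof -
  have "Z (Suc k * n) \<le> 1 * Z n ^ Suc k" for k
  proof (induction k)
    case (Suc k)
    have "Z (Suc (Suc k) * n) \<le> Z n * Z (Suc k * n)" using Z_submult[of n "Suc k * n"] by simp
    also have "\<dots> \<le> Z n * Z n ^ Suc k" using Suc Z_pos[of n] by (intro mult_left_mono) auto
    finally show ?case by simp
  qed auto
  then show ?thesis
    using geometric_rate_zero(2)[OF rate_Z assms Z_pos, of 1 n] Z_pos by (metis Suc_pred zero_less_one)
qed

text \<open>\<open>Z / D\<close> is supermultiplicative, so a value above 1 would grow geometrically
  along the multiples of \<open>n\<close>, again against rate zero.\<close>

lemma Z_le_D: assumes "n > 0" shows "Z n \<le> D"
proof -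
  have *: "D * (Z n / D) ^ Suc k \<le> Z (Suc k * n)" for k
  proof (induction k)
    case (Suc k)
    have "D * (Z n / D) ^ Suc (Suc k) = Z n / D * (D * (Z n / D) ^ Suc k)" by simp
    also have "\<dots> \<le> Z n / D * Z (Suc k * n)" using Suc Z_pos[of n] D_ge_1 by (intro mult_left_mono) auto
    also have "\<dots> \<le> Z (n + Suc k * n)" using Z_supermult[of n "Suc k * n"] D_ge_1 by (simp add: field_simps)
    finally show ?case by simp
  qed (use D_ge_1 in simp)
  have "Z n / D \<le> 1"
  proof (rule geometric_rate_zero(1)[OF rate_Z assms])
    show "0 < Z n / D" "0 < D" using Z_pos[of n] D_ge_1 by auto
    fix k :: nat assume "k > 0"
    then show "D * (Z n / D) ^ k \<le> Z (k * n)" using *[of "k - 1"] by simp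
  qed
  then show ?thesis using D_ge_1 by (simp add: field_simps)
qed

lemma m_Nil: "m [] \<ge> 1"
  using submult[of "[]" "[]"] pos[of "[]"] by (simp add: finite_words_def)

lemma Z_0_ge: "Z n \<ge> 1"
  using Z_ge_1[of n] m_Nil Z_0 by (cases n) auto

text \<open>A finite-horizon substitute for the Gibbs measure, so that no weak limit has to be
  taken. As subtraction is truncated, this is a marginal of the level-\<open>T\<close> distribution
  only for \<open>length u \<le> T\<close>.\<close>

definition nu :: "nat \<Rightarrow> nat list \<Rightarrow> real" where
  "nu T u = (\<Sum>v\<in>words N (T - length u). m (u @ v)) / Z T"

lemma nu_lower:
  assumes "u \<in> finite_words N" "T > 0" shows "m u / D\<^sup>2 \<le> nu T u"
proof -
  have "m u \<le> m u * Z (T - length u)" using Z_0_ge[of "T - length u"] pos[OF assms(1)] by simp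
  also have "\<dots> \<le> D * (Z T * nu T u)"
    using tail_sum_lower[OF assms(1), of "T - length u"] Z_pos[of T] by (simp add: nu_def)
  also have "\<dots> \<le> D * (D * nu T u)"
    using D_ge_1 Z_le_D[OF assms(2)] Z_pos[of T] assms
    by (intro mult_left_mono mult_right_mono) (auto simp: nu_def words_def finite_words_def intro!: divide_nonneg_pos sum_nonneg less_imp_le[OF pos])
  finally show ?thesis using D_ge_1 by (simp add: field_simps power2_eq_square)
qed

text \<open>The strict inequality \<open>length u < T\<close> keeps the remaining length positive,
  where \<open>Z_le_D\<close> applies; of \<open>Z 0 = m []\<close> only a lower bound is
  known.\<close>

lemma nu_upper:
  assumes "u \<in> finite_words N" "T > 0" "length u < T" shows "nu T u \<le> D * m u"
proof -
  have DZ: "D \<le> D * Z T" using Z_ge_1[OF assms(2)] D_ge_1 by simp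
  have "nu T u * Z T \<le> m u * Z (T - length u)"
    using tail_sum_submult[OF assms(1), of 0 "T - length u"] Z_pos[of T] by (simp add: nu_def)
  also have "\<dots> \<le> m u * (D * Z T)"
    using order_trans[OF Z_le_D DZ, of "T - length u"] assms(3) pos[OF assms(1)]
    by (intro mult_left_mono) auto
  finally show ?thesis using Z_pos[of T] by (simp add: field_simps)
qed

lemma nu_pos: "u \<in> finite_words N \<Longrightarrow> T > 0 \<Longrightarrow> nu T u > 0"
  using nu_lower[of u T] pos[of u] D_ge_1 by (smt (verit) divide_pos_pos zero_less_power)

lemma nu_consistent:
  assumes "length u + k \<le> T" shows "(\<Sum>v\<in>words N k. nu T (u @ v)) = nu T u"
proof -
  have "(\<Sum>v\<in>words N k. nu T (u @ v)) = (\<Sum>v\<in>words N k. \<Sum>x\<in>words N (T - length u - k). m (u @ v @ x)) / Z T"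
    unfolding nu_def sum_divide_distrib by (intro sum.cong) (auto simp: words_def)
  also have "\<dots> = nu T u"
    using assms by (subst sum_words_add[where g="\<lambda>v. m (u @ v)", symmetric]) (simp add: nu_def)
  finally show ?thesis .
qed

end

text \<open>Cylinder masses of a shift-invariant probability measure: \<open>p_right\<close> is
  additivity over the next symbol, \<open>p_left\<close> is invariance under the shift.\<close>

locale invariant_weights =
  fixes N :: nat and p :: "nat list \<Rightarrow> real"
  assumes p_nonneg: "p w \<ge> 0" and p_Nil: "p [] = 1"
    and p_right: "w \<in> finite_words N \<Longrightarrow> (\<Sum>i<N. p (w @ [i])) = p w"
    and p_left: "w \<in> finite_words N \<Longrightarrow> (\<Sum>i<N. p (i # w)) = p w"
begin

lemma p_append_right: "u \<in> finite_words N \<Longrightarrow> (\<Sum>v\<in>words N k. p (u @ v)) = p u"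
proof (induction k arbitrary: u)
  case (Suc k)
  have "(\<Sum>v\<in>words N (Suc k). p (u @ v)) = (\<Sum>i<N. \<Sum>v\<in>words N k. p ((u @ [i]) @ v))"
    by (simp add: sum_words_Suc)
  also have "\<dots> = (\<Sum>i<N. p (u @ [i]))"
    using Suc.prems by (intro sum.cong Suc.IH) (auto simp: finite_words_def)
  finally show ?case using p_right[OF Suc.prems] by simp
qed auto

lemma p_append_left: "w \<in> finite_words N \<Longrightarrow> (\<Sum>u\<in>words N k. p (u @ w)) = p w"
proof (induction k)
  case (Suc k)
  have "(\<Sum>u\<in>words N (Suc k). p (u @ w)) = (\<Sum>u\<in>words N k. \<Sum>i<N. p (i # u @ w))"
    by (simp add: sum_words_Suc) (rule sum.swap)
  also have "\<dots> = (\<Sum>u\<in>words N k. p (u @ w))"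
    using Suc.prems by (intro sum.cong p_left) (auto simp: words_def finite_words_def)
  finally show ?case using Suc by simp
qed auto

lemma p_sum_1: "(\<Sum>u\<in>words N k. p u) = 1"
  using p_append_right[of "[]" k] p_Nil by (simp add: finite_words_def)

end

text \<open>Since \<open>m\<close> has pressure zero, \<open>free_energy\<close> says that entropy
  plus energy is nonnegative on every level. This is the only trace of the equilibrium property that
  enters the Gibbs argument.\<close>

locale zero_free_energy = quasi_mult_weight N m c + invariant_weights N p for N m c p +
  assumes free_energy: "(\<Sum>w\<in>words N n. p w * ln (p w)) \<le> (\<Sum>w\<in>words N n. p w * ln (m w))"
begin

definition KL :: "nat \<Rightarrow> nat \<Rightarrow> real" where
  "KL T n = (\<Sum>u\<in>words N n. p u * ln (p u / nu T u))"

lemma KL_nonneg: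
  assumes "n \<le> T" "T > 0" shows "KL T n \<ge> 0"
  unfolding KL_def
proof (rule KL_nonneg_finite)
  have "nu T [] = 1" using Z_pos[of T] by (simp add: nu_def Z_def)
  then show "sum (nu T) (words N n) = 1" using nu_consistent[of "[]" n T] assms by simp
next
  fix x assume "x \<in> words N n"
  then have "nu T x > 0" using assms by (intro nu_pos words_fin)
  then show "nu T x \<ge> 0" "nu T x = 0 \<Longrightarrow> p x = 0" by auto
qed (auto simp: p_nonneg p_sum_1)

text \<open>Replacing \<open>nu\<close> by its lower bound \<open>m / D\<^sup>2\<close> costs
  \<open>ln (D\<^sup>2)\<close>, and what remains is nonpositive by \<open>free_energy\<close>. The
  bound depends neither on \<open>n\<close> nor on \<open>T\<close>.\<close>

lemma KL_le:
  assumes "T > 0" shows "KL T n \<le> ln (D\<^sup>2)"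
proof -
  have "KL T n \<le> (\<Sum>u\<in>words N n. p u * ln (p u) - p u * ln (m u) + p u * ln (D\<^sup>2))"
    unfolding KL_def
  proof (rule sum_mono)
    fix u assume "u \<in> words N n"
    then have u: "u \<in> finite_words N" by (rule words_fin)
    show "p u * ln (p u / nu T u) \<le> p u * ln (p u) - p u * ln (m u) + p u * ln (D\<^sup>2)"
    proof (cases "p u = 0")
      case False
      then have pu: "p u > 0" using p_nonneg[of u] by simp
      have D: "D\<^sup>2 > 0" using D_ge_1 by (intro zero_less_power) linarith
      have "ln (m u / D\<^sup>2) \<le> ln (nu T u)" using nu_lower[OF u assms] nu_pos[OF u assms] pos[OF u] D
        by (intro ln_mono) auto
      then have "ln (p u / nu T u) \<le> ln (p u) - ln (m u) + ln (D\<^sup>2)"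
        using pu nu_pos[OF u assms] pos[OF u] D by (simp add: ln_div)
      then have "p u * ln (p u / nu T u) \<le> p u * (ln (p u) - ln (m u) + ln (D\<^sup>2))"
        using pu by (intro mult_left_mono) auto
      then show ?thesis by (simp add: algebra_simps)
    qed auto
  qed
  also have "\<dots> = (\<Sum>u\<in>words N n. p u * ln (p u)) - (\<Sum>u\<in>words N n. p u * ln (m u)) + ln (D\<^sup>2)"
    by (simp add: sum.distrib sum_subtractf sum_distrib_right[symmetric] p_sum_1)
  finally show ?thesis using free_energy[of n] by simp
qed

text \<open>Chain rule for relative entropy: the increment is the divergence of the joint law
  \<open>P\<close> of the first \<open>n\<close> and next \<open>k\<close> symbols under
  \<open>p\<close> from the law \<open>Q\<close> that keeps the \<open>p\<close>-marginal of the
  first block but continues with the conditional weights of \<open>nu\<close>. Pinsker then compares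
  the probabilities of the event that the second block lies in \<open>B\<close>.\<close>

lemma KL_increment:
  assumes T: "T > 0" and nk: "n + k \<le> T" and B: "B \<subseteq> words N k"
  shows "((\<Sum>u\<in>words N n. \<Sum>v\<in>B. p (u @ v)) - (\<Sum>u\<in>words N n. \<Sum>v\<in>B. p u * nu T (u @ v) / nu T u))\<^sup>2
    \<le> 4 * (KL T (n + k) - KL T n)"
proof -
  define S where "S = words N n \<times> words N k"
  define P where "P = (\<lambda>(u,v). p (u @ v))"
  define Q where "Q = (\<lambda>(u,v). p u * nu T (u @ v) / nu T u)"
  have fw: "u \<in> finite_words N" "v \<in> finite_words N" "u @ v \<in> finite_words N" "length u = n" if "(u,v) \<in> S" for u v
    using that by (auto simp: S_def words_def finite_words_def)
  have zero: "p (u @ v) = 0" if "(u,v) \<in> S" "p u = 0" for u v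
  proof -
    have "(\<Sum>v\<in>words N k. p (u @ v)) = 0" using p_append_right[of u k] fw(1)[OF that(1)] that by simp
    then show ?thesis using that p_nonneg by (subst (asm) sum_nonneg_eq_0_iff) (auto simp: S_def)
  qed
  have prod: "(\<Sum>u\<in>words N n. \<Sum>v\<in>C. g u v) = (\<Sum>x\<in>words N n \<times> C. (case x of (u, v) \<Rightarrow> g u v))"
    for g :: "nat list \<Rightarrow> nat list \<Rightarrow> real" and C
    by (rule sum.cartesian_product)
  have "(sum P (words N n \<times> B) - sum Q (words N n \<times> B))\<^sup>2 \<le> 4 * (\<Sum>x\<in>S. P x * ln (P x / Q x))"
  proof (rule weak_Pinsker)
    show "finite S" by (simp add: S_def)
    show "words N n \<times> B \<subseteq> S" using B by (auto simp: S_def)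
    show "sum P S = 1"
      unfolding S_def P_def prod[symmetric] by (simp add: sum_words_add[symmetric] p_sum_1)
    have "(\<Sum>v\<in>words N k. p u * nu T (u @ v) / nu T u) = p u" if "u \<in> words N n" for u
    proof -
      have "(\<Sum>v\<in>words N k. p u * nu T (u @ v) / nu T u) = p u * (\<Sum>v\<in>words N k. nu T (u @ v)) / nu T u"
        by (simp add: sum_distrib_left sum_divide_distrib)
      also have "\<dots> = p u"
        using nu_pos[OF words_fin[OF that] T] nu_consistent[of u k T] nk that by (simp add: words_def)
      finally show ?thesis .
    qed
    then show "sum Q S = 1"
      unfolding S_def Q_def prod[symmetric] by (simp add: p_sum_1)
    fix x assume x: "x \<in> S"
    obtain u v where uv: "x = (u,v)" by (cases x)
    have n: "nu T u > 0" "nu T (u @ v) > 0" using nu_pos fw x uv T by blast+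
    show "P x \<ge> 0" "Q x \<ge> 0" using n uv p_nonneg by (auto simp: P_def Q_def intro!: divide_nonneg_pos mult_nonneg_nonneg)
    show "P x = 0" if "Q x = 0" using that n uv zero x by (auto simp: P_def Q_def)
  qed
  also have "(\<Sum>x\<in>S. P x * ln (P x / Q x)) =
      (\<Sum>x\<in>S. (\<lambda>(u,v). p (u @ v) * ln (p (u @ v) / nu T (u @ v)) - p (u @ v) * ln (p u / nu T u)) x)"
  proof (rule sum.cong[OF refl])
    fix x assume x: "x \<in> S"
    obtain u v where uv: "x = (u,v)" by (cases x)
    have n: "nu T u > 0" "nu T (u @ v) > 0" using nu_pos fw x uv T by blast+
    show "P x * ln (P x / Q x) = (\<lambda>(u,v). p (u @ v) * ln (p (u @ v) / nu T (u @ v)) - p (u @ v) * ln (p u / nu T u)) x"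
    proof (cases "p (u @ v) = 0")
      case False
      then have "p (u @ v) > 0" "p u > 0" using zero[of u v] x uv p_nonneg[of u] p_nonneg[of "u @ v"] by force+
      then show ?thesis using n uv by (simp add: P_def Q_def ln_div ln_mult algebra_simps)
    qed (simp add: P_def uv)
  qed
  also have "\<dots> = (\<Sum>u\<in>words N n. \<Sum>v\<in>words N k. p (u @ v) * ln (p (u @ v) / nu T (u @ v)))
      - (\<Sum>u\<in>words N n. \<Sum>v\<in>words N k. p (u @ v) * ln (p u / nu T u))"
    unfolding S_def prod[symmetric] by (simp add: sum_subtractf)
  also have "(\<Sum>u\<in>words N n. \<Sum>v\<in>words N k. p (u @ v) * ln (p u / nu T u)) = KL T n"
    unfolding KL_def sum_distrib_right[symmetric] by (intro sum.cong) (auto simp: p_append_right words_fin)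
  also have "(\<Sum>u\<in>words N n. \<Sum>v\<in>words N k. p (u @ v) * ln (p (u @ v) / nu T (u @ v))) = KL T (n + k)"
    by (simp add: KL_def sum_words_add)
  finally show ?thesis unfolding P_def Q_def prod[symmetric] .
qed

text \<open>The divergences increase in $n$ and stay bounded, so over a long horizon some increment is small.\<close>

lemma small_increment:
  assumes "k > 0" "\<epsilon> > 0"
  shows "\<exists>T n. T > 0 \<and> n + k < T \<and> KL T (n + k) - KL T n \<le> \<epsilon>"
proof -
  obtain J :: nat where J: "ln (D\<^sup>2) < of_nat J * \<epsilon>" using ex_less_of_nat_mult[OF assms(2)] by blast
  have J0: "J > 0" using J assms(2) KL_le[of 1 0] KL_nonneg[of 0 1] by (cases J) auto
  \<comment> \<open>Room for \<open>J\<close> consecutive blocks of length \<open>k\<close>. The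
    extra 1 makes \<open>n + k < T\<close> strict, as \<open>nu_upper\<close> demands.\<close>
  define T where "T = k * J + 1"
  have "\<exists>j<J. KL T (k * j + k) - KL T (k * j) \<le> \<epsilon>"
  proof (rule ccontr)
    assume "\<not> ?thesis"
    then have "(\<Sum>j<J. \<epsilon>) \<le> (\<Sum>j<J. KL T (k * Suc j) - KL T (k * j))"
      by (intro sum_mono) (force simp: algebra_simps)
    also have "\<dots> = KL T (k * J) - KL T (k * 0)" by (rule sum_lessThan_telescope)
    also have "\<dots> \<le> ln (D\<^sup>2)" using KL_le[of T "k * J"] KL_nonneg[of 0 T] by (simp add: T_def)
    finally show False using J by simp
  qed
  then obtain j where j: "j < J" "KL T (k * j + k) - KL T (k * j) \<le> \<epsilon>" by blast
  have "k * j + k \<le> k * J" using j(1) by (metis Suc_leI mult_Suc_right mult_le_mono2 add.commute)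
  then show ?thesis using j by (intro exI[of _ T] exI[of _ "k * j"]) (auto simp: T_def)
qed

text \<open>By invariance the \<open>p\<close>-mass of seeing \<open>w\<close> after
  \<open>n\<close> arbitrary symbols is \<open>p w\<close> for every \<open>n\<close>, while the
  conditional \<open>nu\<close>-weight of \<open>w\<close> after any \<open>u\<close> is comparable
  to \<open>m w\<close>. Choosing \<open>n\<close> where the increment of the divergence is small
  makes the two nearly equal. The constants involve \<open>D\<close> and \<open>c\<close> only,
  although \<open>T\<close> and \<open>n\<close> depend on \<open>w\<close> and
  \<open>\<epsilon>\<close>.\<close>

lemma gibbs_approx:
  assumes w: "w \<in> finite_words N" and e: "\<epsilon> > 0"
  shows "p w \<le> D ^ 3 * m w + 2 * \<epsilon>" "c / D ^ 3 * m w \<le> 2 * p w + 4 * \<epsilon>"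
proof -
  \<comment> \<open>One position more than \<open>w\<close>, so that \<open>w\<close> can be read
    either at once (\<open>B0\<close>, padded on the right) or after a connecting letter
    (\<open>B1\<close>) inside the same window.\<close>
  define k where "k = length w + 1"
  obtain T n where T: "T > 0" "n + k < T" "KL T (n + k) - KL T n \<le> \<epsilon>\<^sup>2"
    using small_increment[of k "\<epsilon>\<^sup>2"] e by (auto simp: k_def)
  define B0 where "B0 = (\<lambda>i. w @ [i]) ` {..<N}"
  define B1 where "B1 = (\<lambda>i. i # w) ` {..<N}"
  define q where "q B = (\<Sum>u\<in>words N n. \<Sum>v\<in>B. p u * nu T (u @ v) / nu T u)" for B
  have B: "B0 \<subseteq> words N k" "B1 \<subseteq> words N k" using w by (auto simp: B0_def B1_def words_def k_def finite_words_def)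
  have close: "\<bar>(\<Sum>u\<in>words N n. \<Sum>v\<in>B. p (u @ v)) - q B\<bar> \<le> 2 * \<epsilon>" if "B \<subseteq> words N k" for B
  proof -
    have "((\<Sum>u\<in>words N n. \<Sum>v\<in>B. p (u @ v)) - q B)\<^sup>2 \<le> (2 * \<epsilon>)\<^sup>2"
      using KL_increment[OF T(1) _ that, of n] T unfolding q_def by (simp add: power_mult_distrib)
    then have "\<bar>(\<Sum>u\<in>words N n. \<Sum>v\<in>B. p (u @ v)) - q B\<bar> \<le> \<bar>2 * \<epsilon>\<bar>" by (simp only: abs_le_square_iff)
    then show ?thesis using e by simp
  qed
  have inj: "inj_on (\<lambda>i. w @ [i]) {..<N}" "inj_on (\<lambda>i. i # w) {..<N}" by (auto simp: inj_on_def)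
  have fw: "u @ w \<in> finite_words N" "u \<in> finite_words N" "length u = n" "\<And>i. i < N \<Longrightarrow> u @ i # w \<in> finite_words N"
    if "u \<in> words N n" for u
    using that w by (auto simp: words_def finite_words_def)
  have "(\<Sum>u\<in>words N n. \<Sum>v\<in>B0. p (u @ v)) = (\<Sum>u\<in>words N n. p (u @ w))"
    using p_right[OF fw(1)] by (intro sum.cong) (auto simp: B0_def sum.reindex inj)
  then have p0: "(\<Sum>u\<in>words N n. \<Sum>v\<in>B0. p (u @ v)) = p w" using p_append_left[OF w] by simp
  have "(\<Sum>u\<in>words N n. \<Sum>v\<in>B1. p (u @ v)) = (\<Sum>i<N. \<Sum>u\<in>words N n. p (u @ i # w))"
    by (simp add: B1_def sum.reindex inj) (rule sum.swap)
  also have "\<dots> = (\<Sum>i<N. p (i # w))" using w by (intro sum.cong p_append_left) (auto simp: finite_words_def)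
  finally have p1: "(\<Sum>u\<in>words N n. \<Sum>v\<in>B1. p (u @ v)) = p w" using p_left[OF w] by simp
  have cons: "(\<Sum>i<N. nu T (u @ w @ [i])) = nu T (u @ w)" if "u \<in> words N n" for u
    using nu_consistent[of "u @ w" 1 T] fw[OF that] T(2) by (simp add: sum_words_1 k_def)
  have q0: "q B0 = (\<Sum>u\<in>words N n. p u * (nu T (u @ w) / nu T u))"
    unfolding q_def B0_def using cons
    by (intro sum.cong) (auto simp: sum.reindex inj sum_distrib_left[symmetric] sum_divide_distrib[symmetric])
  have q1: "q B1 = (\<Sum>u\<in>words N n. p u * ((\<Sum>i<N. nu T (u @ i # w)) / nu T u))"
    unfolding q_def B1_def
    by (intro sum.cong) (auto simp: sum.reindex inj sum_distrib_left[symmetric] sum_divide_distrib[symmetric])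
  have D0: "D > 0" using D_ge_1 by linarith
  have "q B0 \<le> (\<Sum>u\<in>words N n. p u * (D ^ 3 * m w))"
    unfolding q0
  proof (intro sum_mono mult_left_mono p_nonneg)
    fix u assume u: "u \<in> words N n"
    have "nu T (u @ w) \<le> D * m (u @ w)" using fw[OF u] T by (intro nu_upper) (auto simp: k_def)
    also have "\<dots> \<le> D * (m u * m w)" using fw[OF u] w D0 by (intro mult_left_mono submult) auto
    also have "\<dots> \<le> D * ((D\<^sup>2 * nu T u) * m w)"
      using nu_lower[OF fw(2)[OF u] T(1)] D0 pos[OF w]
      by (intro mult_left_mono mult_right_mono) (auto simp: field_simps)
    finally show "nu T (u @ w) / nu T u \<le> D ^ 3 * m w"
      using nu_pos[OF fw(2)[OF u] T(1)] by (simp add: field_simps power2_eq_square power3_eq_cube)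
  qed
  also have "\<dots> = D ^ 3 * m w" by (simp add: sum_distrib_right[symmetric] p_sum_1)
  finally show "p w \<le> D ^ 3 * m w + 2 * \<epsilon>" using close[OF B(1)] p0 by simp
  have low: "m x \<le> D\<^sup>2 * nu T x" if "x \<in> finite_words N" for x
    using nu_lower[OF that T(1)] D0 by (simp add: field_simps)
  \<comment> \<open>The lower bound has to allow both ways of joining, hence the sum of
    \<open>q B0\<close> and \<open>q B1\<close>; each is close to \<open>p w\<close>, which explains
    the factor 2 in the conclusion.\<close>
  have "c / D ^ 3 * m w = (\<Sum>u\<in>words N n. p u * (c / D ^ 3 * m w))"
    by (simp only: sum_distrib_right[symmetric] p_sum_1)
  also have "\<dots> \<le> (\<Sum>u\<in>words N n. p u * ((nu T (u @ w) + (\<Sum>i<N. nu T (u @ i # w))) / nu T u))"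
  proof (intro sum_mono mult_left_mono p_nonneg)
    fix u assume u: "u \<in> words N n"
    have "nu T u \<le> D * m u" using fw[OF u] T by (intro nu_upper) auto
    then have "c * m w * nu T u \<le> c * m w * (D * m u)" using c_pos pos[OF w] by (intro mult_left_mono) auto
    also have "\<dots> = D * (c * m u * m w)" by simp
    also have "\<dots> \<le> D * (m (u @ w) + (\<Sum>i<N. m (u @ i # w)))"
      using D0 fw[OF u] w by (intro mult_left_mono quasi_mult) auto
    also have "\<dots> \<le> D * (D\<^sup>2 * nu T (u @ w) + (\<Sum>i<N. D\<^sup>2 * nu T (u @ i # w)))"
      using low fw[OF u] D0 by (intro mult_left_mono add_mono sum_mono) auto
    also have "\<dots> = D ^ 3 * (nu T (u @ w) + (\<Sum>i<N. nu T (u @ i # w)))"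
      by (simp add: sum_distrib_left[symmetric] algebra_simps power2_eq_square power3_eq_cube)
    finally show "c / D ^ 3 * m w \<le> (nu T (u @ w) + (\<Sum>i<N. nu T (u @ i # w))) / nu T u"
      using nu_pos[OF fw(2)[OF u] T(1)] D0 by (simp add: field_simps)
  qed
  also have "\<dots> = q B0 + q B1"
    unfolding q0 q1 by (simp add: sum.distrib[symmetric] add_divide_distrib algebra_simps)
  finally show "c / D ^ 3 * m w \<le> 2 * p w + 4 * \<epsilon>"
    using close[OF B(1)] close[OF B(2)] p0 p1 by simp
qed

text \<open>For fixed \<open>w\<close> the error in \<open>gibbs_approx\<close> can be sent to zero,
  since its constants do not depend on the chosen horizon.\<close>

theorem gibbs:
  "\<exists>K>0. \<forall>w\<in>finite_words N. p w \<le> K * m w \<and> m w \<le> K * p w"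
proof -
  have D0: "D > 0" using D_ge_1 by linarith
  define K where "K = max (D ^ 3) (2 * D ^ 3 / c)"
  have "p w \<le> K * m w \<and> m w \<le> K * p w" if w: "w \<in> finite_words N" for w
  proof
    have "p w \<le> D ^ 3 * m w"
    proof (rule field_le_epsilon)
      fix \<delta> :: real assume "\<delta> > 0"
      then show "p w \<le> D ^ 3 * m w + \<delta>" using gibbs_approx(1)[OF w, of "\<delta> / 2"] by simp
    qed
    also have "\<dots> \<le> K * m w" using pos[OF w] by (intro mult_right_mono) (auto simp: K_def)
    finally show "p w \<le> K * m w" .
    have "c / D ^ 3 * m w \<le> 2 * p w"
    proof (rule field_le_epsilon)
      fix \<delta> :: real assume "\<delta> > 0"
      then show "c / D ^ 3 * m w \<le> 2 * p w + \<delta>" using gibbs_approx(2)[OF w, of "\<delta> / 4"] by simp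
    qed
    then have "m w \<le> 2 * D ^ 3 / c * p w" using c_pos D0 by (simp add: field_simps)
    also have "\<dots> \<le> K * p w" using p_nonneg by (intro mult_right_mono) (auto simp: K_def)
    finally show "m w \<le> K * p w" .
  qed
  moreover have "K > 0" using D0 by (simp add: K_def less_max_iff_disj)
  ultimately show ?thesis by blast
qed

end

section \<open>Entropy of finite-valued functions\<close>

lemma fekete_bound:
  fixes a :: "nat \<Rightarrow> real"
  assumes sub: "\<And>n k. a (n + k) \<le> a n + a k" and k: "k > 0"
  shows "\<exists>C. \<forall>n>0. a n / n \<le> a k / k + C / n"
proof -
  have mult: "a (q * k + r) \<le> q * a k + a r" for q r
  proof (induction q)
    case (Suc q)
    have "a (Suc q * k + r) \<le> a k + a (q * k + r)" using sub[of k "q * k + r"] by (simp add: algebra_simps)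
    then show ?case using Suc by (simp add: algebra_simps)
  qed simp
  define C where "C = \<bar>a k\<bar> + (\<Sum>r<k. \<bar>a r\<bar>)"
  have "a n / n \<le> a k / k + C / n" if "n > 0" for n
  proof -
    define q r where "q = n div k" and "r = n mod k"
    have n: "n = q * k + r" "r < k" using k by (auto simp: q_def r_def)
    have "real n = q * real k + r" using n(1) by (metis of_nat_add of_nat_mult)
    then have "real q * a k = n * (a k / k) - real r / k * a k" using k by (simp add: field_simps)
    moreover have "- (real r / k * a k) \<le> \<bar>a k\<bar>"
    proof -
      have "\<bar>real r / k * a k\<bar> \<le> 1 * \<bar>a k\<bar>" unfolding abs_mult using n(2) by (intro mult_right_mono) auto
      then show ?thesis by linarith
    qed
    moreover have "a r \<le> (\<Sum>r<k. \<bar>a r\<bar>)"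
      using n(2) member_le_sum[of r "{..<k}" "\<lambda>r. \<bar>a r\<bar>"] by auto
    ultimately have "a n \<le> n * (a k / k) + C" using mult[of q r] n(1) by (simp add: C_def)
    then have "a n / n \<le> (n * (a k / k) + C) / n" using that by (intro divide_right_mono) auto
    then show ?thesis using that by (simp add: add_divide_distrib)
  qed
  then show ?thesis by blast
qed

lemma fekete:
  fixes a :: "nat \<Rightarrow> real"
  assumes sub: "\<And>n k. a (n + k) \<le> a n + a k" and lb: "\<And>n. n > 0 \<Longrightarrow> K * n \<le> a n"
  shows "convergent (\<lambda>n. a n / n)" "\<And>n. n > 0 \<Longrightarrow> lim (\<lambda>n. a n / n) \<le> a n / n"
proof -
  define L where "L = (INF n\<in>{0<..}. a n / real n)"
  have bd: "bdd_below ((\<lambda>n. a n / real n) ` {0<..})"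
    by (rule bdd_belowI2[of _ K]) (simp add: pos_le_divide_eq lb)
  have low: "L \<le> a n / n" if "n > 0" for n unfolding L_def using that by (intro cINF_lower[OF bd]) simp
  have "(\<lambda>n. a n / n) \<longlonglongrightarrow> L"
  proof (rule order_tendstoI)
    fix l assume "l < L"
    show "\<forall>\<^sub>F n in sequentially. l < a n / n"
      using eventually_gt_at_top[of 0] by eventually_elim (rule less_le_trans[OF \<open>l < L\<close> low])
  next
    fix u assume "L < u"
    then have "\<exists>k\<in>{0<..}. a k / real k < u" unfolding L_def by (subst (asm) cINF_less_iff[OF _ bd]) auto
    then obtain k where k: "k > 0" "a k / real k < u" by auto
    obtain C where C: "\<And>n. n > 0 \<Longrightarrow> a n / n \<le> a k / k + C / n" using fekete_bound[of a, OF sub k(1)] by blast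
    have "(\<lambda>n. a k / k + C / real n) \<longlonglongrightarrow> a k / k + 0" by (intro tendsto_intros lim_const_over_n)
    then have "\<forall>\<^sub>F n in sequentially. a k / k + C / real n < u" using k by (intro order_tendstoD) auto
    then show "\<forall>\<^sub>F n in sequentially. a n / n < u"
      using eventually_gt_at_top[of 0] by eventually_elim (rule le_less_trans[OF C])
  qed
  then show "convergent (\<lambda>n. a n / n)" "\<And>n. n > 0 \<Longrightarrow> lim (\<lambda>n. a n / n) \<le> a n / n"
    using low by (auto simp: convergent_def limI)
qed

lemma continuous_on_x_ln_x: "continuous_on {0..1} (\<lambda>x::real. x * ln x)"
proof -
  have b: "\<bar>x * ln x\<bar> \<le> 2 * sqrt x" if "x \<ge> 0" "x \<le> 1" for x :: real
  proof (cases "x = 0")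
    case False
    then have x: "x > 0" using that by simp
    have "ln (1 / sqrt x) \<le> 1 / sqrt x - 1" using x by (intro ln_le_minus_one) auto
    then have "- ln x \<le> 2 / sqrt x" using x by (simp add: ln_div ln_sqrt)
    then have "x * (- ln x) \<le> x * (2 / sqrt x)" using x by (intro mult_left_mono) auto
    also have "\<dots> = 2 * sqrt x" using x by (simp add: field_simps)
    finally show ?thesis using x that by (simp add: abs_mult)
  qed simp
  have "continuous (at x within {0..1}) (\<lambda>x. x * ln x)" if x: "x \<in> {0..1}" for x :: real
  proof (cases "x = 0")
    case True
    have "((\<lambda>y. 2 * sqrt y) \<longlongrightarrow> 2 * sqrt 0) (at (0::real) within {0..1})" by (intro tendsto_intros)
    then have "((\<lambda>y. 2 * sqrt y) \<longlongrightarrow> 0) (at (0::real) within {0..1})" by simp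
    then have "((\<lambda>y. y * ln y) \<longlongrightarrow> 0) (at (0::real) within {0..1})"
      by (rule Lim_null_comparison[rotated]) (auto simp: eventually_at_filter b intro!: always_eventually)
    then show ?thesis using True by (simp add: continuous_within)
  next
    case False
    then show ?thesis using x by (intro continuous_intros continuous_at_imp_continuous_at_within) auto
  qed
  then show ?thesis by (simp add: continuous_on_eq_continuous_within)
qed

context prob_space begin

text \<open>Entropy is attached to finite-valued functions instead of partitions: a join becomes a
  pair, a refinement becomes a composition, and empty cells do not occur.\<close>

definition ent :: "('a \<Rightarrow> 'c) \<Rightarrow> real" where
  "ent X = - (\<Sum>v\<in>X ` space M. prob (X -` {v} \<inter> space M) * ln (prob (X -` {v} \<inter> space M)))"

lemma ent_superset:
  assumes "finite S" "X ` space M \<subseteq> S"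
  shows "ent X = - (\<Sum>v\<in>S. prob (X -` {v} \<inter> space M) * ln (prob (X -` {v} \<inter> space M)))"
proof -
  have "X -` {v} \<inter> space M = {}" if "v \<notin> X ` space M" for v using that by auto
  then show ?thesis unfolding ent_def using assms by (intro arg_cong[of _ _ uminus] sum.mono_neutral_left) auto
qed

lemma simple_meas: "simple_function M X \<Longrightarrow> X -` S \<inter> space M \<in> events"
  by (rule simple_functionD)

lemma marginal:
  assumes "simple_function M X" "simple_function M Y" "finite S" "Y ` space M \<subseteq> S"
  shows "(\<Sum>b\<in>S. prob ((\<lambda>x. (X x, Y x)) -` {(a, b)} \<inter> space M)) = prob (X -` {a} \<inter> space M)"
proof -
  have "prob (X -` {a} \<inter> space M) = prob (\<Union>b\<in>S. (\<lambda>x. (X x, Y x)) -` {(a, b)} \<inter> space M)"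
    using assms(4) by (intro arg_cong[of _ _ prob]) auto
  also have "\<dots> = (\<Sum>b\<in>S. prob ((\<lambda>x. (X x, Y x)) -` {(a, b)} \<inter> space M))"
    using assms simple_meas[OF simple_function_Pair[OF assms(1,2)]]
    by (intro finite_measure_finite_Union) (auto simp: disjoint_family_on_def)
  finally show ?thesis by simp
qed

lemma prob_sum_simple:
  assumes "simple_function M X" "finite S" "X ` space M \<subseteq> S"
  shows "(\<Sum>v\<in>S. prob (X -` {v} \<inter> space M)) = 1"
proof -
  have "1 = prob (\<Union>v\<in>S. X -` {v} \<inter> space M)"
    using assms(3) prob_space by (subst arg_cong[of _ "space M" prob]) auto
  also have "\<dots> = (\<Sum>v\<in>S. prob (X -` {v} \<inter> space M))"
    using assms simple_meas[OF assms(1)] by (intro finite_measure_finite_Union) (auto simp: disjoint_family_on_def)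
  finally show ?thesis by simp
qed

text \<open>Nonnegativity of conditional mutual information: the difference of the two sides is the
  divergence of the joint law from \<open>q\<close>, the law with the same marginals on (X,Z) and
  (Y,Z) that makes X and Y independent given Z.\<close>

lemma ent_strong_subadditive:
  assumes A: "simple_function M X" and B: "simple_function M Y" and C: "simple_function M Z"
  shows "ent (\<lambda>x. (X x, Y x, Z x)) + ent Z \<le> ent (\<lambda>x. (X x, Z x)) + ent (\<lambda>x. (Y x, Z x))"
proof -
  define SA SB SC where "SA = X ` space M" and "SB = Y ` space M" and "SC = Z ` space M"
  have fin: "finite SA" "finite SB" "finite SC" using A B C by (auto simp: SA_def SB_def SC_def dest: simple_functionD)
  define pABC where "pABC a b c = prob ((\<lambda>x. (X x, Y x, Z x)) -` {(a,b,c)} \<inter> space M)" for a b c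
  define pAC where "pAC a c = prob ((\<lambda>x. (X x, Z x)) -` {(a,c)} \<inter> space M)" for a c
  define pBC where "pBC b c = prob ((\<lambda>x. (Y x, Z x)) -` {(b,c)} \<inter> space M)" for b c
  define pC where "pC c = prob (Z -` {c} \<inter> space M)" for c
  note sf = A B C simple_function_Pair
  have mA: "(\<Sum>a\<in>SA. pABC a b c) = pBC b c" for b c
  proof -
    have "pABC a b c = prob ((\<lambda>x. ((Y x, Z x), X x)) -` {((b,c),a)} \<inter> space M)" for a
      unfolding pABC_def by (intro arg_cong[of _ _ prob]) auto
    then show ?thesis unfolding pBC_def using fin by (simp only:) (rule marginal, auto intro: sf simp: SA_def)
  qed
  have mB: "(\<Sum>b\<in>SB. pABC a b c) = pAC a c" for a c
  proof -
    have "pABC a b c = prob ((\<lambda>x. ((X x, Z x), Y x)) -` {((a,c),b)} \<inter> space M)" for b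
      unfolding pABC_def by (intro arg_cong[of _ _ prob]) auto
    then show ?thesis unfolding pAC_def using fin by (simp only:) (rule marginal, auto intro: sf simp: SB_def)
  qed
  have mAC: "(\<Sum>a\<in>SA. pAC a c) = pC c" for c
  proof -
    have "pAC a c = prob ((\<lambda>x. (Z x, X x)) -` {(c,a)} \<inter> space M)" for a
      unfolding pAC_def by (intro arg_cong[of _ _ prob]) auto
    then show ?thesis unfolding pC_def using fin by (simp only:) (rule marginal, auto intro: sf simp: SA_def)
  qed
  have mBC: "(\<Sum>b\<in>SB. pBC b c) = pC c" for c
  proof -
    have "pBC b c = prob ((\<lambda>x. (Z x, Y x)) -` {(c,b)} \<inter> space M)" for b
      unfolding pBC_def by (intro arg_cong[of _ _ prob]) auto
    then show ?thesis unfolding pC_def using fin by (simp only:) (rule marginal, auto intro: sf simp: SB_def)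
  qed
  have sC: "(\<Sum>c\<in>SC. pC c) = 1" unfolding pC_def SC_def using fin C by (intro prob_sum_simple) (auto simp: SC_def)
  have nn: "pABC a b c \<ge> 0" "pAC a c \<ge> 0" "pBC b c \<ge> 0" "pC c \<ge> 0" for a b c
    by (auto simp: pABC_def pAC_def pBC_def pC_def)
  have le: "pABC a b c \<le> pAC a c" "pABC a b c \<le> pBC b c" "pAC a c \<le> pC c" for a b c
    unfolding pABC_def pAC_def pBC_def pC_def
    by (auto intro!: finite_measure_mono simple_meas sf)
  define S where "S = SA \<times> SB \<times> SC"
  define p where "p = (\<lambda>(a,b,c). pABC a b c)"
  define q where "q = (\<lambda>(a,b,c). pAC a c * pBC b c / pC c)"
  have tri: "sum g S = (\<Sum>a\<in>SA. \<Sum>b\<in>SB. \<Sum>c\<in>SC. g (a,b,c))" for g :: "_ \<Rightarrow> real"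
    unfolding S_def by (simp add: sum.cartesian_product case_prod_beta)
  have "0 \<le> (\<Sum>x\<in>S. p x * ln (p x / q x))"
  proof (rule KL_nonneg_finite)
    show "finite S" using fin by (simp add: S_def)
    have "sum p S = (\<Sum>c\<in>SC. \<Sum>a\<in>SA. \<Sum>b\<in>SB. pABC a b c)"
      unfolding tri p_def by (simp add: sum.swap[of _ SC])
    then show "sum p S = 1" by (simp add: mB mAC sC)
    have "sum q S = (\<Sum>c\<in>SC. \<Sum>a\<in>SA. \<Sum>b\<in>SB. pAC a c * pBC b c / pC c)"
      unfolding tri q_def by (simp add: sum.swap[of _ SC])
    also have "\<dots> = (\<Sum>c\<in>SC. pC c * pC c / pC c)"
      unfolding sum_divide_distrib[symmetric] sum_product[symmetric] mAC mBC ..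
    finally show "sum q S = 1" using sC by simp
    fix x assume "x \<in> S"
    obtain a b c where x: "x = (a,b,c)" by (cases x)
    show "p x \<ge> 0" "q x \<ge> 0" using nn by (auto simp: p_def q_def x intro!: divide_nonneg_nonneg mult_nonneg_nonneg)
    show "p x = 0" if "q x = 0"
    proof -
      have "pAC a c = 0 \<or> pBC b c = 0 \<or> pC c = 0" using that by (simp add: q_def x)
      then have "pABC a b c \<le> 0" using le(1)[of a b c] le(2)[of a b c] le(3)[of a c] nn(1)[of a b c] by linarith
      then show ?thesis using nn(1)[of a b c] by (simp add: p_def x)
    qed
  qed
  also have "(\<Sum>x\<in>S. p x * ln (p x / q x)) =
     (\<Sum>a\<in>SA. \<Sum>b\<in>SB. \<Sum>c\<in>SC. pABC a b c * ln (pABC a b c) + pABC a b c * ln (pC c)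
        - pABC a b c * ln (pAC a c) - pABC a b c * ln (pBC b c))"
    unfolding tri
  proof (intro sum.cong refl)
    fix a b c
    show "p (a, b, c) * ln (p (a, b, c) / q (a, b, c)) = pABC a b c * ln (pABC a b c) + pABC a b c * ln (pC c)
        - pABC a b c * ln (pAC a c) - pABC a b c * ln (pBC b c)"
    proof (cases "pABC a b c = 0")
      case False
      then have "pABC a b c > 0" "pAC a c > 0" "pBC b c > 0" "pC c > 0"
        using le(1)[of a b c] le(2)[of a b c] le(3)[of a c] nn(1)[of a b c] by linarith+
      then show ?thesis by (simp add: p_def q_def ln_div ln_mult algebra_simps)
    qed (simp add: p_def)
  qed
  also have "\<dots> = (\<Sum>a\<in>SA. \<Sum>b\<in>SB. \<Sum>c\<in>SC. pABC a b c * ln (pABC a b c))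
      + (\<Sum>c\<in>SC. \<Sum>a\<in>SA. \<Sum>b\<in>SB. pABC a b c * ln (pC c))
      - (\<Sum>a\<in>SA. \<Sum>c\<in>SC. \<Sum>b\<in>SB. pABC a b c * ln (pAC a c))
      - (\<Sum>b\<in>SB. \<Sum>c\<in>SC. \<Sum>a\<in>SA. pABC a b c * ln (pBC b c))"
  proof -
    have "(\<Sum>c\<in>SC. \<Sum>a\<in>SA. \<Sum>b\<in>SB. pABC a b c * ln (pC c)) = (\<Sum>a\<in>SA. \<Sum>b\<in>SB. \<Sum>c\<in>SC. pABC a b c * ln (pC c))"
      by (simp add: sum.swap[of _ SC])
    moreover have "(\<Sum>a\<in>SA. \<Sum>c\<in>SC. \<Sum>b\<in>SB. pABC a b c * ln (pAC a c)) = (\<Sum>a\<in>SA. \<Sum>b\<in>SB. \<Sum>c\<in>SC. pABC a b c * ln (pAC a c))"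
      by (intro sum.cong refl sum.swap)
    moreover have "(\<Sum>b\<in>SB. \<Sum>c\<in>SC. \<Sum>a\<in>SA. pABC a b c * ln (pBC b c)) = (\<Sum>a\<in>SA. \<Sum>b\<in>SB. \<Sum>c\<in>SC. pABC a b c * ln (pBC b c))"
      by (simp add: sum.swap[of _ _ SA])
    ultimately show ?thesis by (simp add: sum.distrib sum_subtractf)
  qed
  also have "(\<Sum>c\<in>SC. \<Sum>a\<in>SA. \<Sum>b\<in>SB. pABC a b c * ln (pC c)) = - ent Z"
    by (simp add: sum_distrib_right[symmetric] mB mAC ent_def pC_def SC_def)
  also have "(\<Sum>a\<in>SA. \<Sum>c\<in>SC. \<Sum>b\<in>SB. pABC a b c * ln (pAC a c)) = - ent (\<lambda>x. (X x, Z x))"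
  proof -
    have "(\<lambda>x. (X x, Z x)) ` space M \<subseteq> SA \<times> SC" by (auto simp: SA_def SC_def)
    then show ?thesis using fin
      by (subst ent_superset[of "SA \<times> SC"])
        (auto simp: sum_distrib_right[symmetric] mB pAC_def sum.cartesian_product case_prod_beta)
  qed
  also have "(\<Sum>b\<in>SB. \<Sum>c\<in>SC. \<Sum>a\<in>SA. pABC a b c * ln (pBC b c)) = - ent (\<lambda>x. (Y x, Z x))"
  proof -
    have "(\<lambda>x. (Y x, Z x)) ` space M \<subseteq> SB \<times> SC" by (auto simp: SB_def SC_def)
    then show ?thesis using fin
      by (subst ent_superset[of "SB \<times> SC"])
        (auto simp: sum_distrib_right[symmetric] mA pBC_def sum.cartesian_product case_prod_beta)
  qed
  also have "(\<Sum>a\<in>SA. \<Sum>b\<in>SB. \<Sum>c\<in>SC. pABC a b c * ln (pABC a b c)) = - ent (\<lambda>x. (X x, Y x, Z x))"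
  proof -
    have "(\<lambda>x. (X x, Y x, Z x)) ` space M \<subseteq> S" by (auto simp: SB_def SC_def SA_def S_def)
    moreover have "finite S" using fin by (simp add: S_def)
    ultimately show ?thesis by (subst ent_superset[of S]) (auto simp: tri pABC_def)
  qed
  finally show ?thesis by simp
qed

lemma ent_mono:
  assumes A: "simple_function M X" and Y: "\<And>x. x \<in> space M \<Longrightarrow> Y x = g (X x)"
  shows "ent Y \<le> ent X"
proof -
  define SA where "SA = X ` space M"
  have fin: "finite SA" using A by (auto simp: SA_def dest: simple_functionD)
  define p where "p a = prob (X -` {a} \<inter> space M)" for a
  define r where "r b = prob (Y -` {b} \<inter> space M)" for b
  have Yim: "Y ` space M = g ` SA" using Y by (auto simp: SA_def image_iff)
  have rsum: "r b = (\<Sum>a\<in>{a\<in>SA. g a = b}. p a)" for b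
  proof -
    have "Y -` {b} \<inter> space M = (\<Union>a\<in>{a\<in>SA. g a = b}. X -` {a} \<inter> space M)" using Y by (auto simp: SA_def)
    then show ?thesis unfolding r_def p_def using fin A
      by (simp only:) (intro finite_measure_finite_Union, auto simp: disjoint_family_on_def simple_meas)
  qed
  have "ent Y = - (\<Sum>b\<in>g ` SA. r b * ln (r b))" by (simp add: ent_def Yim r_def)
  also have "\<dots> = - (\<Sum>b\<in>g ` SA. \<Sum>a\<in>{a\<in>SA. g a = b}. p a * ln (r b))"
    by (simp add: rsum sum_distrib_right[symmetric])
  also have "\<dots> = - (\<Sum>a\<in>SA. p a * ln (r (g a)))"
    using fin by (simp add: sum.image_gen[of SA "\<lambda>a. p a * ln (r (g a))" g])
  also have "\<dots> \<le> - (\<Sum>a\<in>SA. p a * ln (p a))"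
  proof -
    have "p a * ln (p a) \<le> p a * ln (r (g a))" if "a \<in> SA" for a
    proof (cases "p a = 0")
      case False
      then have "p a > 0" by (simp add: p_def zero_less_measure_iff)
      moreover have "p a \<le> r (g a)" unfolding rsum using that fin
        by (intro member_le_sum) (auto simp: p_def)
      ultimately show ?thesis by (intro mult_left_mono ln_mono) auto
    qed simp
    then show ?thesis by (simp add: sum_mono)
  qed
  finally show ?thesis by (simp add: ent_def p_def SA_def)
qed

lemma ent_eq:
  assumes "simple_function M X" "simple_function M Y"
    and "\<And>x. x \<in> space M \<Longrightarrow> Y x = g (X x)" "\<And>x. x \<in> space M \<Longrightarrow> X x = h (Y x)"
  shows "ent Y = ent X"
  by (intro antisym ent_mono[where g=g] ent_mono[where g=h]) (use assms in auto)

lemma ent_const: "ent (\<lambda>x. c) = 0"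
  using not_empty prob_space by (auto simp: ent_def image_constant_conv)

lemma ent_subadditive:
  assumes "simple_function M X" "simple_function M Y"
  shows "ent (\<lambda>x. (X x, Y x)) \<le> ent X + ent Y"
proof -
  have c: "simple_function M (\<lambda>x. ())" by simp
  have "ent (\<lambda>x. (X x, Y x, ())) + ent (\<lambda>x. ()) \<le> ent (\<lambda>x. (X x, ())) + ent (\<lambda>x. (Y x, ()))"
    by (rule ent_strong_subadditive) (use assms c in auto)
  moreover have "ent (\<lambda>x. (X x, Y x)) = ent (\<lambda>x. (X x, Y x, ()))"
    by (rule ent_eq[where g="\<lambda>(a,b,c). (a,b)" and h="\<lambda>(a,b). (a,b,())"]) (use assms c in auto)
  moreover have "ent X = ent (\<lambda>x. (X x, ()))" "ent Y = ent (\<lambda>x. (Y x, ()))"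
    by (rule ent_eq[where g="\<lambda>(a,b). a" and h="\<lambda>a. (a,())"], use assms c in auto)+
  ultimately show ?thesis by (simp add: ent_const)
qed

lemma ent_nonneg: "simple_function M X \<Longrightarrow> ent X \<ge> 0"
  using ent_mono[of X "\<lambda>x. ()" "\<lambda>x. ()"] by (simp add: ent_const)

text \<open>Conditional entropy of X given Y, defined through the chain rule so that no conditional
  measures appear.\<close>

definition cent :: "('a \<Rightarrow> 'c) \<Rightarrow> ('a \<Rightarrow> 'd) \<Rightarrow> real" where
  "cent X Y = ent (\<lambda>x. (X x, Y x)) - ent Y"

lemma cent_Pair_le:
  assumes "simple_function M X" "simple_function M X'" "simple_function M Y" "simple_function M Y'"
  shows "cent (\<lambda>x. (X x, X' x)) (\<lambda>x. (Y x, Y' x)) \<le> cent X Y + cent X' Y'"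
proof -
  have 1: "ent (\<lambda>x. (X x, X' x, Y x, Y' x)) + ent (\<lambda>x. (Y x, Y' x)) \<le> ent (\<lambda>x. (X x, Y x, Y' x)) + ent (\<lambda>x. (X' x, Y x, Y' x))"
    using assms by (intro ent_strong_subadditive) auto
  have 2: "ent (\<lambda>x. (X x, Y' x, Y x)) + ent Y \<le> ent (\<lambda>x. (X x, Y x)) + ent (\<lambda>x. (Y' x, Y x))"
    using assms by (intro ent_strong_subadditive) auto
  have 3: "ent (\<lambda>x. (X' x, Y x, Y' x)) + ent Y' \<le> ent (\<lambda>x. (X' x, Y' x)) + ent (\<lambda>x. (Y x, Y' x))"
    using assms by (intro ent_strong_subadditive) auto
  have 4: "ent (\<lambda>x. (X x, Y' x, Y x)) = ent (\<lambda>x. (X x, Y x, Y' x))"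
    by (rule ent_eq[where g="\<lambda>(a,b,c). (a,c,b)" and h="\<lambda>(a,b,c). (a,c,b)"]) (use assms in auto)
  have 5: "ent (\<lambda>x. (Y' x, Y x)) = ent (\<lambda>x. (Y x, Y' x))"
    by (rule ent_eq[where g="\<lambda>(b,c). (c,b)" and h="\<lambda>(b,c). (c,b)"]) (use assms in auto)
  have 6: "ent (\<lambda>x. ((X x, X' x), Y x, Y' x)) = ent (\<lambda>x. (X x, X' x, Y x, Y' x))"
    by (rule ent_eq[where g="\<lambda>(a,b,c). ((a,b),c)" and h="\<lambda>((a,b),c). (a,b,c)"]) (use assms in auto)
  show ?thesis using 1 2 3 unfolding cent_def 4 5 6 by linarith
qed

text \<open>All values lie in one finite set \<open>V\<close>, so the laws of \<open>Y n\<close> and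
  of the pair \<open>(X, Y n)\<close> are finite vectors converging to those of \<open>X\<close> and
  \<open>(X, X)\<close>. Continuity of \<open>x * ln x\<close>, including at 0, passes to the limit,
  where the conditional entropy vanishes.\<close>

lemma cent_tendsto_0:
  assumes X: "simple_function M X" and Y: "\<And>n. simple_function M (Y n)"
    and V: "finite V" "X ` space M \<subseteq> V" "\<And>n. Y n ` space M \<subseteq> V"
    and lim: "(\<lambda>n. prob {x \<in> space M. X x \<noteq> Y n x}) \<longlonglongrightarrow> 0"
  shows "(\<lambda>n::nat. cent X (Y n)) \<longlonglongrightarrow> 0"
proof -
  define \<eta> where "\<eta> t = t * ln t" for t :: real
  have ev: "{x \<in> space M. X x \<noteq> Y n x} \<in> events" for n
  proof -
    have "{x \<in> space M. X x \<noteq> Y n x} = (\<lambda>x. (X x, Y n x)) -` {(a,b). a \<noteq> b} \<inter> space M" by auto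
    then show ?thesis using X Y by (simp only:) (intro simple_meas simple_function_Pair)
  qed
  have \<eta>: "(\<lambda>n. \<eta> (f n)) \<longlonglongrightarrow> \<eta> l" if "f \<longlonglongrightarrow> l" "\<And>n. f n \<in> {0..1}" "l \<in> {0..1}" for f l
    unfolding \<eta>_def using continuous_on_tendsto_compose[OF continuous_on_x_ln_x that(1)] that by simp
  have close: "(\<lambda>n. prob (S n)) \<longlonglongrightarrow> prob S'"
    if "\<And>n. S n \<in> events" "S' \<in> events" "\<And>n. S n \<subseteq> S' \<union> {x \<in> space M. X x \<noteq> Y n x}"
      "\<And>n. S' \<subseteq> S n \<union> {x \<in> space M. X x \<noteq> Y n x}" for S S'
  proof -
    have "norm (prob (S n) - prob S') \<le> prob {x \<in> space M. X x \<noteq> Y n x}" for n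
    proof -
      have "prob (S n) \<le> prob (S' \<union> {x \<in> space M. X x \<noteq> Y n x})" "prob S' \<le> prob (S n \<union> {x \<in> space M. X x \<noteq> Y n x})"
        by (intro finite_measure_mono that sets.Un ev)+
      moreover have "prob (S' \<union> {x \<in> space M. X x \<noteq> Y n x}) \<le> prob S' + prob {x \<in> space M. X x \<noteq> Y n x}"
        "prob (S n \<union> {x \<in> space M. X x \<noteq> Y n x}) \<le> prob (S n) + prob {x \<in> space M. X x \<noteq> Y n x}"
        by (intro measure_Un_le that ev)+
      ultimately show ?thesis by simp
    qed
    then have "(\<lambda>n. prob (S n) - prob S') \<longlonglongrightarrow> 0"
      by (intro Lim_null_comparison[OF always_eventually lim]) auto
    then show ?thesis by (simp add: LIM_zero_iff)
  qed
  define E where "E = - (\<Sum>v\<in>V. \<eta> (prob (X -` {v} \<inter> space M)))"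
  have "(\<lambda>n. \<Sum>v\<in>V. \<eta> (prob (Y n -` {v} \<inter> space M))) \<longlonglongrightarrow> (\<Sum>v\<in>V. \<eta> (prob (X -` {v} \<inter> space M)))"
    by (intro tendsto_sum \<eta> close) (use X Y in \<open>auto intro: simple_meas\<close>)
  then have "(\<lambda>n. - (\<Sum>v\<in>V. \<eta> (prob (Y n -` {v} \<inter> space M)))) \<longlonglongrightarrow> E"
    unfolding E_def by (rule tendsto_minus)
  moreover have "ent (Y n) = - (\<Sum>v\<in>V. \<eta> (prob (Y n -` {v} \<inter> space M)))" for n
    unfolding \<eta>_def using V by (intro ent_superset)
  ultimately have lY: "(\<lambda>n. ent (Y n)) \<longlonglongrightarrow> E" by simp
  have "(\<lambda>n. \<Sum>v\<in>V\<times>V. \<eta> (prob ((\<lambda>x. (X x, Y n x)) -` {v} \<inter> space M))) \<longlonglongrightarrow>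
      (\<Sum>v\<in>V\<times>V. \<eta> (prob ((\<lambda>x. (X x, X x)) -` {v} \<inter> space M)))"
    by (intro tendsto_sum \<eta> close) (use X Y in \<open>auto intro: simple_meas\<close>)
  moreover have "(\<Sum>v\<in>V\<times>V. \<eta> (prob ((\<lambda>x. (X x, X x)) -` {v} \<inter> space M))) = - ent (\<lambda>x. (X x, X x))"
    unfolding \<eta>_def using V by (subst ent_superset[of "V \<times> V"]) auto
  moreover have "ent (\<lambda>x. (X x, X x)) = ent X"
    by (rule ent_eq[where g="\<lambda>a. (a,a)" and h="\<lambda>(a,b). a"]) (use X in auto)
  moreover have "ent X = E" unfolding E_def \<eta>_def using V by (intro ent_superset)
  moreover have "ent (\<lambda>x. (X x, Y n x)) = - (\<Sum>v\<in>V\<times>V. \<eta> (prob ((\<lambda>x. (X x, Y n x)) -` {v} \<inter> space M)))" for n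
    unfolding \<eta>_def using V by (intro ent_superset) (auto simp: image_subset_iff)
  ultimately have "(\<lambda>n. ent (\<lambda>x. (X x, Y n x))) \<longlonglongrightarrow> E"
    using tendsto_minus by fastforce
  from tendsto_diff[OF this lY] show ?thesis by (simp add: cent_def)
qed

end

section \<open>The Kolmogorov--Sinai generator theorem\<close>

locale measure_preserving = prob_space +
  fixes T :: "'a \<Rightarrow> 'a"
  assumes T_meas: "T \<in> measurable M M"
    and T_inv: "B \<in> sets M \<Longrightarrow> prob (T -` B \<inter> space M) = prob B"
begin

lemma T_space: "x \<in> space M \<Longrightarrow> T x \<in> space M"
  using T_meas by (rule measurable_space)

lemma Tk_meas: "(T ^^ k) \<in> measurable M M"
proof (induction k)
  case (Suc k)
  then show ?case using measurable_comp[OF Suc T_meas] by (simp only: funpow.simps(2))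
qed (simp add: id_def)

lemma Tk_space: "x \<in> space M \<Longrightarrow> (T ^^ k) x \<in> space M"
  using Tk_meas by (rule measurable_space)

lemma Tk_inv: "B \<in> sets M \<Longrightarrow> prob ((T ^^ k) -` B \<inter> space M) = prob B"
proof (induction k arbitrary: B)
  case (Suc k)
  have "(T ^^ Suc k) -` B \<inter> space M = T -` ((T ^^ k) -` B \<inter> space M) \<inter> space M"
    using T_space by (auto simp: funpow_swap1)
  then show ?case using Suc.IH[OF Suc.prems] T_inv[OF measurable_sets[OF Tk_meas Suc.prems], of k] by (simp only:)
qed (simp add: Int_absorb2 sets.sets_into_space)

lemma simple_Tk: "simple_function M X \<Longrightarrow> simple_function M (\<lambda>x. X ((T ^^ k) x))"
proof -
  assume X: "simple_function M X"
  have "(\<lambda>x. X ((T ^^ k) x)) ` space M \<subseteq> X ` space M" using Tk_space by auto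
  moreover have "(\<lambda>x. X ((T ^^ k) x)) -` {v} \<inter> space M = (T ^^ k) -` (X -` {v} \<inter> space M) \<inter> space M" for v
    using Tk_space by auto
  ultimately show ?thesis
    using X measurable_sets[OF Tk_meas simple_meas[OF X]] finite_subset
    unfolding simple_function_def by metis
qed

lemma ent_Tk:
  assumes X: "simple_function M X" shows "ent (\<lambda>x. X ((T ^^ k) x)) = ent X"
proof -
  have "(\<lambda>x. X ((T ^^ k) x)) ` space M \<subseteq> X ` space M" using Tk_space by auto
  moreover have "prob ((\<lambda>x. X ((T ^^ k) x)) -` {v} \<inter> space M) = prob (X -` {v} \<inter> space M)" for v
  proof -
    have "(\<lambda>x. X ((T ^^ k) x)) -` {v} \<inter> space M = (T ^^ k) -` (X -` {v} \<inter> space M) \<inter> space M"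
      using Tk_space by auto
    then show ?thesis using Tk_inv[OF simple_meas[OF X]] by simp
  qed
  ultimately show ?thesis using X simple_functionD(1)[OF X]
    by (subst ent_superset[of "X ` space M"]) (auto simp: ent_def)
qed

definition iter :: "('a \<Rightarrow> 'c) \<Rightarrow> nat \<Rightarrow> 'a \<Rightarrow> 'c list" where
  "iter X n x = map (\<lambda>k. X ((T ^^ k) x)) [0..<n]"

lemma iter_add: "iter X (n + k) x = iter X n x @ iter X k ((T ^^ n) x)"
proof -
  have "map (\<lambda>j. X ((T ^^ j) x)) [n..<n + k] = map (\<lambda>j. X ((T ^^ j) ((T ^^ n) x))) [0..<k]"
    by (intro nth_equalityI) (auto simp: funpow_add[symmetric] add.commute simp flip: comp_apply[of "T ^^ _"])
  then show ?thesis by (simp add: iter_def upt_add_eq_append[of 0])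
qed

lemma iter_Suc: "iter X (Suc n) x = iter X n x @ [X ((T ^^ n) x)]"
  by (simp add: iter_def)

lemma simple_iter: "simple_function M X \<Longrightarrow> simple_function M (iter X n)"
proof (induction n)
  case 0 then show ?case by (simp add: iter_def)
next
  case (Suc n)
  have "simple_function M (\<lambda>x. (\<lambda>l v. l @ [v]) (iter X n x) (X ((T ^^ n) x)))"
    by (rule simple_function_compose2[OF Suc.IH[OF Suc.prems] simple_Tk[OF Suc.prems]])
  then show ?case by (simp add: iter_Suc[abs_def])
qed

lemma ent_iter_subadditive:
  assumes X: "simple_function M X"
  shows "ent (iter X (n + k)) \<le> ent (iter X n) + ent (iter X k)"
proof -
  have "ent (iter X (n + k)) \<le> ent (\<lambda>x. (iter X n x, iter X k ((T ^^ n) x)))"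
    by (rule ent_mono[where g="\<lambda>(a,b). a @ b"]) (auto intro!: simple_function_Pair simple_iter simple_Tk X simp: iter_add)
  also have "\<dots> \<le> ent (iter X n) + ent (\<lambda>x. iter X k ((T ^^ n) x))"
    by (intro ent_subadditive simple_iter simple_Tk X)
  also have "ent (\<lambda>x. iter X k ((T ^^ n) x)) = ent (iter X k)" by (intro ent_Tk simple_iter X)
  finally show ?thesis .
qed

lemma ent_iter_rate:
  assumes "simple_function M X"
  shows "convergent (\<lambda>n. ent (iter X n) / n)" "\<And>n. n > 0 \<Longrightarrow> lim (\<lambda>n. ent (iter X n) / n) \<le> ent (iter X n) / n"
  using fekete[of "\<lambda>n. ent (iter X n)" 0, OF ent_iter_subadditive[OF assms]] ent_nonneg[OF simple_iter[OF assms]]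
  by auto

text \<open>Each further symbol adds at most \<open>cent X Y\<close> by \<open>cent_Pair_le\<close>,
  because invariance makes the conditional entropy of the shifted pair the same at every
  time.\<close>

lemma cent_iter_le:
  assumes X: "simple_function M X" and Y: "simple_function M Y"
  shows "cent (iter X n) (iter Y n) \<le> n * cent X Y"
proof (induction n)
  case 0
  have "(\<lambda>x. (iter X 0 x, iter Y 0 x)) = (\<lambda>x. ([], []))" "iter Y 0 = (\<lambda>x. [])" by (auto simp: iter_def)
  then show ?case by (simp add: cent_def ent_const)
next
  case (Suc n)
  let ?p = "\<lambda>x. ((iter X n x, X ((T ^^ n) x)), (iter Y n x, Y ((T ^^ n) x)))"
  note sf = simple_iter simple_Tk simple_function_Pair X Y
  have "ent (\<lambda>x. (iter X (Suc n) x, iter Y (Suc n) x)) = ent ?p"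
    by (rule ent_eq[where g="\<lambda>((a,b),(c,d)). (a @ [b], c @ [d])" and h="\<lambda>(l,l'). ((butlast l, last l), (butlast l', last l'))"])
      (rule sf | simp add: iter_Suc)+
  moreover have "ent (iter Y (Suc n)) = ent (\<lambda>x. (iter Y n x, Y ((T ^^ n) x)))"
    by (rule ent_eq[where g="\<lambda>(c,d). c @ [d]" and h="\<lambda>l'. (butlast l', last l')"])
      (rule sf | simp add: iter_Suc)+
  ultimately have "cent (iter X (Suc n)) (iter Y (Suc n)) =
      cent (\<lambda>x. (iter X n x, X ((T ^^ n) x))) (\<lambda>x. (iter Y n x, Y ((T ^^ n) x)))" by (simp add: cent_def)
  also have "\<dots> \<le> cent (iter X n) (iter Y n) + cent (\<lambda>x. X ((T ^^ n) x)) (\<lambda>x. Y ((T ^^ n) x))"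
    by (intro cent_Pair_le sf)
  also have "cent (\<lambda>x. X ((T ^^ n) x)) (\<lambda>x. Y ((T ^^ n) x)) = cent X Y"
    using ent_Tk[OF simple_function_Pair[OF X Y], of n] ent_Tk[OF Y, of n] by (simp add: cent_def)
  finally show ?case using Suc by (simp add: algebra_simps)
qed

text \<open>On a partition this is the singleton of the cell containing \<open>x\<close>. Being
  set-valued, it needs no choice of a cell and can be compared with approximate codings that hit
  several cells or none.\<close>

definition cell :: "'a set set \<Rightarrow> 'a \<Rightarrow> 'a set set" where
  "cell P x = {B \<in> P. x \<in> B}"

lemma simple_cell:
  assumes "finite P" "P \<subseteq> sets M" shows "simple_function M (cell P)"
proof -
  have "cell P ` space M \<subseteq> Pow P" by (auto simp: cell_def)
  moreover have "cell P -` {V} \<inter> space M \<in> events" for V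
  proof (cases "V \<subseteq> P")
    case True
    have "cell P -` {V} \<inter> space M = {x\<in>space M. (\<forall>B\<in>V. x \<in> B) \<and> (\<forall>B\<in>P-V. x \<notin> B)}"
      using True by (auto simp: cell_def)
    moreover have "{x\<in>space M. (\<forall>B\<in>V. x \<in> B) \<and> (\<forall>B\<in>P-V. x \<notin> B)} \<in> events"
    proof (intro sets.sets_Collect_conj sets.sets_Collect_finite_All sets.sets_Collect_neg)
      fix B assume "B \<in> V"
      then have "{x \<in> space M. x \<in> B} = B" using True assms sets.sets_into_space by blast
      then show "{x \<in> space M. x \<in> B} \<in> events" using \<open>B \<in> V\<close> True assms by auto
    next
      fix B assume "B \<in> P - V"
      then have "{x \<in> space M. x \<in> B} = B" using assms sets.sets_into_space by blast
      then show "{x \<in> space M. x \<in> B} \<in> events" using \<open>B \<in> P - V\<close> assms by auto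
    qed (use True assms finite_subset in auto)
    ultimately show ?thesis by simp
  next
    case False
    then have "cell P -` {V} \<inter> space M = {}" by (auto simp: cell_def)
    then show ?thesis by simp
  qed
  ultimately show ?thesis unfolding simple_function_def using assms finite_subset by (metis finite_Pow_iff)
qed

text \<open>The nonempty elements of the join are exactly the fibres of the itinerary map. The join
  may also contain the empty set, whose term vanishes because \<open>0 * ln 0 = 0\<close>.\<close>

lemma partition_entropy_join_iter:
  assumes P: "meas_partition M P"
  shows "partition_entropy M (join_iter M T P n) = ent (iter (cell P) n)"
proof -
  let ?X = "iter (cell P) n"
  let ?J = "join_iter M T P n"
  define G where "G l = ?X -` {l} \<inter> space M" for l
  have single: "cell P x = {B}" if "B \<in> P" "x \<in> B" for B x
    using P that by (auto simp: meas_partition_def cell_def disjoint_def)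
  have ex: "\<exists>B\<in>P. x \<in> B" if "x \<in> space M" for x using P that by (auto simp: meas_partition_def)
  have J1: "B \<in> G ` ?X ` space M" if BJ: "B \<in> ?J" "B \<noteq> {}" for B
  proof -
    obtain c where c: "B = space M \<inter> (\<Inter>k<n. (T ^^ k) -` c k)" "\<forall>k<n. c k \<in> P"
      using BJ(1) unfolding join_iter_def by blast
    obtain x where x: "x \<in> B" using BJ(2) by blast
    have eqx: "?X y = map (\<lambda>k. {c k}) [0..<n]" if "y \<in> B" for y
      using that c by (auto simp: iter_def intro!: single)
    have "B = G (?X x)"
    proof
      show "B \<subseteq> G (?X x)" using eqx x c by (auto simp: G_def)
      show "G (?X x) \<subseteq> B"
      proof
        fix y assume "y \<in> G (?X x)"
        then have y: "y \<in> space M" "?X y = map (\<lambda>k. {c k}) [0..<n]" using eqx[OF x] by (auto simp: G_def)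
        have "(T ^^ k) y \<in> c k" if "k < n" for k
        proof -
          have "?X y ! k = {c k}" using y(2) that by simp
          then have "cell P ((T ^^ k) y) = {c k}" using that by (simp add: iter_def)
          then show ?thesis by (auto simp: cell_def)
        qed
        then show "y \<in> B" using y(1) c by auto
      qed
    qed
    then show ?thesis using x c by auto
  qed
  have J2: "G (?X x) \<in> ?J" if x: "x \<in> space M" for x
  proof -
    have "\<forall>k. \<exists>B\<in>P. (T ^^ k) x \<in> B" using ex Tk_space[OF x] by blast
    then obtain c where c: "\<And>k. c k \<in> P" "\<And>k. (T ^^ k) x \<in> c k" by metis
    let ?B = "space M \<inter> (\<Inter>k<n. (T ^^ k) -` c k)"
    have B: "?B \<in> ?J" using c by (auto simp: join_iter_def)
    have xB: "x \<in> ?B" using x c by auto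
    then have "?B \<noteq> {}" by blast
    from J1[OF B this] obtain x' where x': "x' \<in> space M" "?B = G (?X x')" by blast
    then have "x \<in> G (?X x')" using xB by blast
    then have "?X x = ?X x'" by (auto simp: G_def)
    then show ?thesis using x' B by simp
  qed
  have sub: "?J \<subseteq> insert {} (G ` ?X ` space M)" using J1 by auto
  have fin: "finite (?X ` space M)"
    using simple_iter[OF simple_cell, of P n] P by (auto simp: meas_partition_def dest: simple_functionD(1))
  have finJ: "finite ?J" by (rule finite_subset[OF sub]) (use fin in simp)
  have "partition_entropy M ?J = - (\<Sum>B\<in>G ` ?X ` space M. measure M B * ln (measure M B))"
    unfolding partition_entropy_def using J2 sub finJ
    by (intro arg_cong[of _ _ uminus] sum.mono_neutral_right) auto
  also have "\<dots> = - (\<Sum>l\<in>?X ` space M. measure M (G l) * ln (measure M (G l)))"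
    by (subst sum.reindex) (auto simp: inj_on_def G_def)
  finally show ?thesis by (simp add: ent_def G_def)
qed

text \<open>Kolmogorov--Sinai: \<open>W n\<close> plays the role of the \<open>n\<close>-fold join of a generating partition.\<close>

lemma ks_entropy_le_generator:
  fixes W :: "nat \<Rightarrow> 'a \<Rightarrow> 'c"
  assumes W: "\<And>n. simple_function M (W n)"
    and shiftW: "\<And>n k x. x \<in> space M \<Longrightarrow> W n ((T ^^ k) x) = r n k (W (n + k) x)"
    and restrict: "\<And>n k x. x \<in> space M \<Longrightarrow> k \<le> n \<Longrightarrow> W k x = t n k (W n x)"
    and lim: "(\<lambda>n. ent (W n) / n) \<longlonglongrightarrow> h"
    and approx: "\<And>B \<epsilon>. B \<in> sets M \<Longrightarrow> \<epsilon> > 0 \<Longrightarrow> \<exists>n. \<exists>V. prob ((B - W n -` V) \<union> (W n -` V \<inter> space M - B)) < \<epsilon>"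
  shows "ks_entropy M T \<le> h"
  unfolding ks_entropy_def
proof (rule cSUP_least)
  have "meas_partition M {space M}" by (simp add: meas_partition_def)
  then show "{P. meas_partition M P} \<noteq> {}" by blast
next
  fix P assume "P \<in> {P. meas_partition M P}"
  then have P: "meas_partition M P" by simp
  then have fP: "finite P" "P \<subseteq> sets M" by (auto simp: meas_partition_def)
  let ?X = "cell P"
  have X: "simple_function M ?X" using fP by (rule simple_cell)
  define L where "L = lim (\<lambda>n. ent (iter ?X n) / n)"
  have L: "(\<lambda>n. ent (iter ?X n) / n) \<longlonglongrightarrow> L"
    using ent_iter_rate(1)[OF X] by (simp add: L_def convergent_LIMSEQ_iff)
  have "\<exists>n V. prob ((B - W n -` V) \<union> (W n -` V \<inter> space M - B)) < 1 / Suc j" if "B \<in> P" for B j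
    using approx[of B "1 / Suc j"] that fP by auto
  then obtain nn VV where nV: "\<And>B j. B \<in> P \<Longrightarrow> prob ((B - W (nn B j) -` VV B j) \<union> (W (nn B j) -` VV B j \<inter> space M - B)) < 1 / Suc j"
    by metis
  \<comment> \<open>An approximate version of \<open>cell P\<close> that depends on finitely many
    symbols. The approximating sets may overlap or leave gaps, so \<open>Y j x\<close> is just some
    subset of \<open>P\<close>.\<close>
  define Y where "Y j x = {B \<in> P. W (nn B j) x \<in> VV B j}" for j x
  define n0 where "n0 j = Max (insert 0 ((\<lambda>B. nn B j) ` P))" for j
  have n0: "nn B j \<le> n0 j" if "B \<in> P" for B j using that fP by (auto simp: n0_def)
  define g where "g j w = {B \<in> P. t (n0 j) (nn B j) w \<in> VV B j}" for j w
  have Yg: "Y j x = g j (W (n0 j) x)" if "x \<in> space M" for j x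
    unfolding Y_def g_def using restrict[OF that n0] by (intro Collect_cong conj_cong refl) simp
  have Ys: "simple_function M (Y j)" for j
    using simple_function_compose1[OF W, of "g j" "n0 j"] by (subst simple_function_cong[OF Yg])
  have bound: "L \<le> cent ?X (Y j) + h" for j
  proof -
    have "ent (iter ?X n) \<le> n * cent ?X (Y j) + ent (W (n + n0 j))" for n
    proof -
      have "ent (iter ?X n) \<le> ent (\<lambda>x. (iter ?X n x, iter (Y j) n x))"
        by (rule ent_mono[where g=fst]) (auto intro: simple_iter X Ys)
      also have "\<dots> \<le> n * cent ?X (Y j) + ent (iter (Y j) n)"
        using cent_iter_le[OF X Ys[of j], of n] by (simp add: cent_def)
      \<comment> \<open>\<open>Y j\<close> reads only \<open>W (n0 j)\<close>, so its first
        \<open>n\<close> iterates are a function of \<open>W (n + n0 j)\<close>.\<close>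
      also have "ent (iter (Y j) n) \<le> ent (W (n + n0 j))"
      proof (rule ent_mono[OF W, where g="\<lambda>w. map (\<lambda>k. g j (r (n0 j) k (t (n + n0 j) (n0 j + k) w))) [0..<n]"])
        fix x assume x: "x \<in> space M"
        have "Y j ((T ^^ k) x) = g j (r (n0 j) k (t (n + n0 j) (n0 j + k) (W (n + n0 j) x)))" if "k < n" for k
          using Yg[OF Tk_space[OF x], of j k] shiftW[OF x, of "n0 j" k] restrict[OF x, of "n0 j + k" "n + n0 j"] that by simp
        then show "iter (Y j) n x = map (\<lambda>k. g j (r (n0 j) k (t (n + n0 j) (n0 j + k) (W (n + n0 j) x)))) [0..<n]"
          by (simp add: iter_def)
      qed
      finally show ?thesis by simp
    qed
    then have le: "ent (iter ?X n) / n \<le> cent ?X (Y j) + ent (W (n + n0 j)) / real (n + n0 j) * (1 + real (n0 j) / n)" if "n > 0" for n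
    proof -
      have "ent (iter ?X n) / n \<le> (n * cent ?X (Y j) + ent (W (n + n0 j))) / n"
        using that \<open>\<And>n. ent (iter ?X n) \<le> n * cent ?X (Y j) + ent (W (n + n0 j))\<close> by (intro divide_right_mono) auto
      also have "\<dots> = cent ?X (Y j) + ent (W (n + n0 j)) / n" using that by (simp add: add_divide_distrib)
      also have "ent (W (n + n0 j)) / n = ent (W (n + n0 j)) / real (n + n0 j) * (real (n + n0 j) / n)"
        using that by simp
      also have "real (n + n0 j) / n = 1 + real (n0 j) / n" using that by (simp add: add_divide_distrib)
      finally show ?thesis .
    qed
    \<comment> \<open>The overhang \<open>n0 j\<close> is fixed while \<open>n\<close> grows, so it
      does not change the entropy rate.\<close>
    have "(\<lambda>n. cent ?X (Y j) + ent (W (n + n0 j)) / real (n + n0 j) * (1 + real (n0 j) / n)) \<longlonglongrightarrow> cent ?X (Y j) + h * (1 + 0)"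
      by (intro tendsto_intros LIMSEQ_ignore_initial_segment[OF lim] lim_const_over_n)
    then have "L \<le> cent ?X (Y j) + h * (1 + 0)"
      by (rule tendsto_le[OF sequentially_bot _ L]) (use le in \<open>auto simp: eventually_sequentially intro!: exI[of _ 1]\<close>)
    then show ?thesis by simp
  qed
  have "(\<lambda>j. prob {x \<in> space M. ?X x \<noteq> Y j x}) \<longlonglongrightarrow> 0"
  proof (rule Lim_null_comparison[OF always_eventually])
    show "\<forall>j. norm (prob {x \<in> space M. ?X x \<noteq> Y j x}) \<le> real (card P) / Suc j"
    proof
      fix j
      let ?D = "\<lambda>B. (B - W (nn B j) -` VV B j) \<union> (W (nn B j) -` VV B j \<inter> space M - B)"
      have D: "?D B \<in> events" if "B \<in> P" for B
      proof -
        have "B - W (nn B j) -` VV B j = B - (W (nn B j) -` VV B j \<inter> space M)"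
          using that fP sets.sets_into_space by blast
        then show ?thesis using that fP simple_meas[OF W] by auto
      qed
      have "prob {x \<in> space M. ?X x \<noteq> Y j x} \<le> prob (\<Union>B\<in>P. ?D B)"
        using fP D by (intro finite_measure_mono sets.finite_UN) (auto simp: cell_def Y_def)
      also have "\<dots> \<le> (\<Sum>B\<in>P. prob (?D B))" using fP D by (intro measure_UNION_le) auto
      also have "\<dots> \<le> (\<Sum>B\<in>P. 1 / Suc j)" using nV by (intro sum_mono less_imp_le) auto
      finally show "norm (prob {x \<in> space M. ?X x \<noteq> Y j x}) \<le> real (card P) / Suc j" by simp
    qed
    show "(\<lambda>j. real (card P) / Suc j) \<longlonglongrightarrow> 0"
      by (intro LIMSEQ_Suc[where f="\<lambda>j. real (card P) / real j"] lim_const_over_n)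
  qed
  then have "(\<lambda>j. cent ?X (Y j)) \<longlonglongrightarrow> 0"
    by (intro cent_tendsto_0[OF X Ys, of "Pow P"]) (use fP in \<open>auto simp: cell_def Y_def\<close>)
  then have "(\<lambda>j. cent ?X (Y j) + h) \<longlonglongrightarrow> 0 + h" by (intro tendsto_intros)
  then have "L \<le> h" by (intro LIMSEQ_le_const) (use bound in auto)
  then show "lim (\<lambda>n. partition_entropy M (join_iter M T P n) / real n) \<le> h"
    by (simp add: partition_entropy_join_iter[OF P] L_def)
qed

end

section \<open>The full shift\<close>

lemma prefix_word_Suc: "prefix_word x (Suc n) = prefix_word x n @ [x n]"
  by (simp add: prefix_word_def)

lemma length_prefix_word [simp]: "length (prefix_word x n) = n"
  by (simp add: prefix_word_def)

lemma prefix_word_nth [simp]: "k < n \<Longrightarrow> prefix_word x n ! k = x k"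
  by (simp add: prefix_word_def)

lemma shift_funpow: "(shift ^^ k) x = (\<lambda>j. x (j + k))"
  by (induction k) (auto simp: shift_def)

lemma prefix_word_add: "prefix_word x (n + k) = prefix_word x n @ prefix_word ((shift ^^ n) x) k"
  by (rule nth_equalityI) (auto simp: nth_append shift_funpow)

lemma prefix_word_in_words: "x \<in> Sigma_space N \<Longrightarrow> prefix_word x n \<in> words N n"
  by (auto simp: prefix_word_def words_def Sigma_space_def)

lemma cyl_eq: "cyl N w = {x \<in> Sigma_space N. prefix_word x (length w) = w}"
  by (auto simp: cyl_def list_eq_iff_nth_eq)

lemma cyl_Nil [simp]: "cyl N [] = Sigma_space N"
  by (simp add: cyl_def)

lemma open_coordinate: "open {x::nat \<Rightarrow> nat. x k = a}"
proof -
  have "open ((\<lambda>x::nat \<Rightarrow> nat. x k) -` {a})"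
  proof (rule open_vimage)
    show "open {a}" by (rule Topological_Spaces.open_discrete)
    show "continuous_on UNIV (\<lambda>x::nat \<Rightarrow> nat. x k)" by (rule continuous_on_product_coordinates)
  qed
  then show ?thesis by (simp add: vimage_def)
qed

lemma cyl_append: "cyl N (w @ [i]) = cyl N w \<inter> {x. x (length w) = i}"
  by (auto simp: cyl_def nth_append less_Suc_eq)

lemma word_extend:
  assumes "N > 0" "set w \<subseteq> {..<N}"
  shows "\<exists>x\<in>Sigma_space N. prefix_word x (length w) = w"
proof
  show "(\<lambda>k. if k < length w then w ! k else 0) \<in> Sigma_space N"
    using assms by (auto simp: Sigma_space_def subset_iff)
  show "prefix_word (\<lambda>k. if k < length w then w ! k else 0) (length w) = w"
    by (rule nth_equalityI) auto
qed

locale shift_invariant =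
  fixes N :: nat and \<mu> :: "(nat \<Rightarrow> nat) measure"
  assumes inv: "invariant_borel_prob N \<mu>" and N_pos: "N > 0"
begin

sublocale prob_space \<mu> using inv by (simp add: invariant_borel_prob_def)

lemma space_mu: "space \<mu> = Sigma_space N" and
  sets_mu: "sets \<mu> = sets (restrict_space borel (Sigma_space N))"
  using inv by (auto simp: invariant_borel_prob_def)

lemma shift_in: "x \<in> Sigma_space N \<Longrightarrow> shift x \<in> Sigma_space N"
  by (simp add: Sigma_space_def shift_def)

lemma continuous_shift: "continuous_on UNIV shift"
  unfolding shift_def
  by (intro continuous_on_coordinatewise_then_product continuous_on_product_coordinates)

lemma shift_meas: "shift \<in> measurable \<mu> \<mu>"
proof -
  have "shift \<in> measurable (restrict_space borel (Sigma_space N)) (restrict_space borel (Sigma_space N))"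
    using shift_in borel_measurable_continuous_onI[OF continuous_shift]
    by (intro measurable_restrict_space3) auto
  then show ?thesis by (simp cong: measurable_cong_sets add: measurable_cong_sets[OF sets_mu sets_mu])
qed

sublocale measure_preserving \<mu> shift
proof
  show "shift \<in> measurable \<mu> \<mu>" by (rule shift_meas)
  fix B assume "B \<in> events"
  then have "emeasure \<mu> (shift -` B \<inter> space \<mu>) = emeasure \<mu> B"
    using inv unfolding invariant_borel_prob_def by blast
  then show "prob (shift -` B \<inter> space \<mu>) = prob B" by (simp only: measure_def)
qed

lemma open_sets_mu: "open U \<Longrightarrow> U \<inter> Sigma_space N \<in> events"
  unfolding sets_mu sets_restrict_space by (subst Int_commute) (rule imageI, rule borel_open)

lemma cyl_meas: "cyl N w \<in> events"
proof -
  have "cyl N w = (\<Inter>k<length w. {x. x k = w ! k}) \<inter> Sigma_space N"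
    by (auto simp: cyl_def)
  moreover have "open (\<Inter>k<length w. {x::nat \<Rightarrow> nat. x k = w ! k})"
    by (intro open_INT) (auto simp: open_coordinate)
  ultimately show ?thesis using open_sets_mu by simp
qed

definition p :: "nat list \<Rightarrow> real" where "p w = prob (cyl N w)"

lemma p_nonneg: "p w \<ge> 0" by (simp add: p_def)

lemma p_Nil: "p [] = 1" using prob_space by (simp add: p_def space_mu)

lemma p_right:
  shows "(\<Sum>i<N. p (w @ [i])) = p w"
proof -
  have "cyl N w = (\<Union>i<N. cyl N (w @ [i]))"
    by (auto simp: cyl_append) (auto simp: cyl_def Sigma_space_def)
  then have "p w = prob (\<Union>i<N. cyl N (w @ [i]))" by (simp add: p_def)
  also have "\<dots> = (\<Sum>i<N. p (w @ [i]))" unfolding p_def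
  proof (rule finite_measure_finite_Union)
    show "disjoint_family_on (\<lambda>i. cyl N (w @ [i])) {..<N}"
      by (auto simp: disjoint_family_on_def cyl_append)
  qed (auto simp: cyl_meas)
  finally show ?thesis by simp
qed

lemma cyl_Cons: "i < N \<Longrightarrow> cyl N (i # w) = {x\<in>Sigma_space N. x 0 = i} \<inter> (shift -` cyl N w \<inter> space \<mu>)"
  by (auto simp: cyl_def space_mu shift_def Sigma_space_def nth_Cons split: nat.splits)

lemma p_left: "(\<Sum>i<N. p (i # w)) = p w"
proof -
  have "shift -` cyl N w \<inter> space \<mu> = (\<Union>i<N. cyl N (i # w))"
    by (auto simp: cyl_Cons) (auto simp: space_mu Sigma_space_def)
  then have "p w = prob (\<Union>i<N. cyl N (i # w))"
    using T_inv[OF cyl_meas, of w] by (simp add: p_def)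
  also have "\<dots> = (\<Sum>i<N. p (i # w))" unfolding p_def
  proof (rule finite_measure_finite_Union)
    show "disjoint_family_on (\<lambda>i. cyl N (i # w)) {..<N}"
      by (auto simp: disjoint_family_on_def cyl_Cons)
  qed (auto simp: cyl_meas)
  finally show ?thesis by simp
qed

sublocale weights: invariant_weights N p
  by unfold_locales (auto simp: p_nonneg p_Nil p_right p_left)

definition W :: "nat \<Rightarrow> (nat \<Rightarrow> nat) \<Rightarrow> nat list" where "W n x = prefix_word x n"

lemma W_vimage: "w \<in> words N n \<Longrightarrow> W n -` {w} \<inter> space \<mu> = cyl N w"
  by (auto simp: W_def cyl_eq space_mu words_def)

lemma W_range: "W n ` space \<mu> \<subseteq> words N n"
  by (auto simp: W_def space_mu prefix_word_in_words)

lemma W_simple: "simple_function \<mu> (W n)"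
  unfolding simple_function_def using W_range[of n] W_vimage cyl_meas
  by (auto intro: finite_subset[OF W_range] simp: subset_iff)

lemma ent_W: "ent (W n) = - (\<Sum>w\<in>words N n. p w * ln (p w))"
  using W_range by (subst ent_superset[of "words N n"]) (auto simp: W_vimage p_def)

lemma ent_W_subadditive: "ent (W (n + k)) \<le> ent (W n) + ent (W k)"
proof -
  have "ent (W (n + k)) \<le> ent (\<lambda>x. (W n x, W k ((shift ^^ n) x)))"
  proof (rule ent_mono[where g="\<lambda>(a,b). a @ b"])
    show "simple_function \<mu> (\<lambda>x. (W n x, W k ((shift ^^ n) x)))"
      by (intro simple_function_Pair W_simple simple_Tk)
  qed (simp add: W_def prefix_word_add)
  also have "\<dots> \<le> ent (W n) + ent (\<lambda>x. W k ((shift ^^ n) x))"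
    by (intro ent_subadditive W_simple simple_Tk)
  finally show ?thesis using ent_Tk[OF W_simple] by simp
qed

text \<open>Approximability in measure by finite unions of cylinders. Such a union is coded as a set
  \<open>V\<close> of words of one common length, which makes complements immediate.\<close>

definition cyl_approx :: "(nat \<Rightarrow> nat) set \<Rightarrow> bool" where
  "cyl_approx B \<longleftrightarrow> (\<forall>\<epsilon>>0. \<exists>n V. prob (sym_diff B (W n -` V \<inter> space \<mu>)) < \<epsilon>)"

lemma W_vimage_events: "W n -` V \<inter> space \<mu> \<in> events"
  by (rule simple_meas[OF W_simple])

lemma W_mono: "k \<le> n \<Longrightarrow> W k -` V \<inter> space \<mu> = W n -` (take k -` V) \<inter> space \<mu>"
proof -
  assume "k \<le> n"
  then have "W k x = take k (W n x)" for x by (auto simp: W_def prefix_word_def take_map)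
  then show ?thesis by auto
qed

lemma cyl_approx_compl:
  assumes "B \<in> events" "cyl_approx B" shows "cyl_approx (space \<mu> - B)"
  unfolding cyl_approx_def
proof (intro allI impI)
  fix \<epsilon> :: real assume "\<epsilon> > 0"
  then obtain n V where nV: "prob (sym_diff B (W n -` V \<inter> space \<mu>)) < \<epsilon>" using assms by (auto simp: cyl_approx_def)
  have "sym_diff (space \<mu> - B) (W n -` (- V) \<inter> space \<mu>) = sym_diff B (W n -` V \<inter> space \<mu>)"
    using sets.sets_into_space[OF assms(1)] by auto
  then show "\<exists>n V. prob (sym_diff (space \<mu> - B) (W n -` V \<inter> space \<mu>)) < \<epsilon>" using nV by metis
qed

text \<open>Cut the union where the tail has mass below \<open>\<epsilon> / 2\<close>, approximate
  the finitely many remaining sets with total error \<open>\<epsilon> / 2\<close>, and read all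
  approximations at the largest depth involved.\<close>

lemma cyl_approx_UN:
  fixes B :: "nat \<Rightarrow> (nat \<Rightarrow> nat) set"
  assumes B: "\<And>i. B i \<in> events" and a: "\<And>i. cyl_approx (B i)"
  shows "cyl_approx (\<Union>i. B i)"
  unfolding cyl_approx_def
proof (intro allI impI)
  fix \<epsilon> :: real assume e: "\<epsilon> > 0"
  have "(\<lambda>n. prob (\<Union>i\<le>n. B i)) \<longlonglongrightarrow> prob (\<Union>n. \<Union>i\<le>n. B i)"
    using B by (intro finite_Lim_measure_incseq) (auto simp: incseq_def intro: order_trans)
  moreover have "(\<Union>n. \<Union>i\<le>n. B i) = (\<Union>i. B i)" by auto
  ultimately have "\<forall>\<^sub>F n in sequentially. prob (\<Union>i. B i) - \<epsilon> / 2 < prob (\<Union>i\<le>n. B i)"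
    using e by (intro order_tendstoD(1)) auto
  then obtain m where m: "prob (\<Union>i. B i) - \<epsilon> / 2 < prob (\<Union>i\<le>m. B i)" by (auto simp: eventually_sequentially)
  have "\<exists>n V. prob (sym_diff (B i) (W n -` V \<inter> space \<mu>)) < \<epsilon> / (2 * Suc m)" for i
    using a[of i] e by (auto simp: cyl_approx_def)
  then obtain n V where nV: "\<And>i. prob (sym_diff (B i) (W (n i) -` V i \<inter> space \<mu>)) < \<epsilon> / (2 * Suc m)" by metis
  define n0 where "n0 = Max (n ` {..m})"
  have n0: "n i \<le> n0" if "i \<le> m" for i using that by (auto simp: n0_def)
  define V0 where "V0 = (\<Union>i\<le>m. take (n i) -` V i)"
  have V0: "W n0 -` V0 \<inter> space \<mu> = (\<Union>i\<le>m. W (n i) -` V i \<inter> space \<mu>)"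
  proof -
    have "W n0 -` V0 \<inter> space \<mu> = (\<Union>i\<le>m. W n0 -` (take (n i) -` V i) \<inter> space \<mu>)" by (auto simp: V0_def)
    also have "\<dots> = (\<Union>i\<le>m. W (n i) -` V i \<inter> space \<mu>)" using W_mono[OF n0] by (intro SUP_cong refl) (metis atMost_iff)
    finally show ?thesis .
  qed
  let ?D = "\<lambda>i. sym_diff (B i) (W (n i) -` V i \<inter> space \<mu>)"
  have D: "?D i \<in> events" for i using B W_vimage_events by (intro sets.Un sets.Diff) auto
  have "sym_diff (\<Union>i. B i) (W n0 -` V0 \<inter> space \<mu>) \<subseteq> ((\<Union>i. B i) - (\<Union>i\<le>m. B i)) \<union> (\<Union>i\<le>m. ?D i)"
    unfolding V0 by auto
  then have "prob (sym_diff (\<Union>i. B i) (W n0 -` V0 \<inter> space \<mu>)) \<le> prob (((\<Union>i. B i) - (\<Union>i\<le>m. B i)) \<union> (\<Union>i\<le>m. ?D i))"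
    using B D by (intro finite_measure_mono) auto
  also have "\<dots> \<le> prob ((\<Union>i. B i) - (\<Union>i\<le>m. B i)) + prob (\<Union>i\<le>m. ?D i)"
    using B D by (intro measure_Un_le) auto
  also have "prob ((\<Union>i. B i) - (\<Union>i\<le>m. B i)) = prob (\<Union>i. B i) - prob (\<Union>i\<le>m. B i)"
    using B by (intro finite_measure_Diff) auto
  also have "prob (\<Union>i\<le>m. ?D i) \<le> (\<Sum>i\<le>m. prob (?D i))" using D by (intro measure_UNION_le) auto
  also have "(\<Sum>i\<le>m. prob (?D i)) \<le> (\<Sum>i\<le>m. \<epsilon> / (2 * Suc m))" by (intro sum_mono less_imp_le nV)
  also have "\<dots> = \<epsilon> / 2" by (simp add: field_simps)
  finally have "prob (sym_diff (\<Union>i. B i) (W n0 -` V0 \<inter> space \<mu>)) < \<epsilon>" using m by linarith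
  then show "\<exists>n V. prob (sym_diff (\<Union>i. B i) (W n -` V \<inter> space \<mu>)) < \<epsilon>" by blast
qed

lemma cyl_approx_W: "cyl_approx (W n -` V \<inter> space \<mu>)"
  unfolding cyl_approx_def by (metis Diff_cancel Un_absorb measure_empty)

text \<open>A basic open set of the product topology restricts only finitely many coordinates, so an
  open set is the countable union over \<open>n\<close> of the cylinders of depth \<open>n\<close>
  that it contains.\<close>

lemma cyl_approx_open:
  assumes "open U" shows "cyl_approx (U \<inter> Sigma_space N)"
proof -
  define B where "B n = W n -` {w. \<forall>x\<in>Sigma_space N. prefix_word x n = w \<longrightarrow> x \<in> U} \<inter> space \<mu>" for n
  have "U \<inter> Sigma_space N = (\<Union>n. B n)"
  proof
    show "(\<Union>n. B n) \<subseteq> U \<inter> Sigma_space N" by (auto simp: B_def W_def space_mu)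
    show "U \<inter> Sigma_space N \<subseteq> (\<Union>n. B n)"
    proof
      fix x assume x: "x \<in> U \<inter> Sigma_space N"
      have "openin (product_topology (\<lambda>i. euclidean) UNIV) U" using assms unfolding open_fun_def by auto
      with product_topology_open_contains_basis[OF this, of x] x obtain X where X: "x \<in> (\<Pi>\<^sub>E i\<in>UNIV. X i)" "\<And>i. open (X i)" "finite {i. X i \<noteq> UNIV}" "(\<Pi>\<^sub>E i\<in>UNIV. X i) \<subseteq> U"
        by auto
      define n where "n = Suc (Max (insert 0 {i. X i \<noteq> UNIV}))"
      have n: "X i = UNIV" if "i \<ge> n" for i
      proof (rule ccontr)
        assume "X i \<noteq> UNIV"
        then have "i \<le> Max (insert 0 {i. X i \<noteq> UNIV})" using X(3) by (intro Max_ge) auto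
        then show False using that by (simp add: n_def)
      qed
      have "y \<in> U" if "y \<in> Sigma_space N" "prefix_word y n = prefix_word x n" for y
      proof -
        have "y i = x i" if "i < n" for i using \<open>prefix_word y n = prefix_word x n\<close> that by (metis prefix_word_nth)
        then have "y \<in> (\<Pi>\<^sub>E i\<in>UNIV. X i)" using X(1) n by (auto simp: PiE_iff) (metis UNIV_I not_le)
        then show ?thesis using X(4) by blast
      qed
      then show "x \<in> (\<Union>n. B n)" using x by (auto simp: B_def W_def space_mu)
    qed
  qed
  moreover have "cyl_approx (\<Union>n. B n)"
    unfolding B_def by (intro cyl_approx_UN W_vimage_events cyl_approx_W)
  ultimately show ?thesis by simp
qed

lemma cyl_approx_all:
  assumes "B \<in> events" shows "cyl_approx B"
proof -
  obtain C where C: "C \<in> sets borel" "B = C \<inter> Sigma_space N"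
    using assms unfolding sets_mu by (auto simp: sets_restrict_space)
  have ev: "C \<inter> Sigma_space N \<in> events" if "C \<in> sets borel" for C
    using that unfolding sets_mu by (auto simp: sets_restrict_space)
  have "C \<in> sigma_sets UNIV {S. open S}" using C by (simp add: borel_def)
  then have "cyl_approx (C \<inter> Sigma_space N)"
  proof (induction rule: sigma_sets.induct)
    case (Basic a) then show ?case using cyl_approx_open by simp
  next
    case Empty
    then show ?case using cyl_approx_W[of 0 "{}"] by simp
  next
    case (Compl a)
    have "a \<in> sets borel" using Compl.hyps by (simp add: borel_def)
    moreover have "(UNIV - a) \<inter> Sigma_space N = space \<mu> - a \<inter> Sigma_space N" by (auto simp: space_mu)
    ultimately show ?case using cyl_approx_compl[OF ev Compl.IH] by simp
  next
    case (Union a)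
    have "a i \<in> sets borel" for i using Union.hyps by (simp add: borel_def)
    then have "cyl_approx (\<Union>i. a i \<inter> Sigma_space N)" using Union.IH ev by (intro cyl_approx_UN) auto
    moreover have "(\<Union>i. a i \<inter> Sigma_space N) = (\<Union>i. a i) \<inter> Sigma_space N" by blast
    ultimately show ?case by simp
  qed
  then show ?thesis using C by simp
qed

text \<open>The cylinder codings generate, so their entropy rate bounds the Kolmogorov-Sinai
  entropy; by subadditivity that rate is below its value on each single level.\<close>

lemma ks_entropy_le:
  assumes "n > 0"
  shows "ks_entropy \<mu> shift \<le> - (\<Sum>w\<in>words N n. p w * ln (p w)) / n"
proof -
  define h where "h = lim (\<lambda>n. ent (W n) / n)"
  note F = fekete[of "\<lambda>n. ent (W n)" 0, OF ent_W_subadditive]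
  have lim: "(\<lambda>n. ent (W n) / n) \<longlonglongrightarrow> h"
    using F(1) ent_nonneg[OF W_simple] by (simp add: h_def convergent_LIMSEQ_iff)
  have "ks_entropy \<mu> shift \<le> h"
  proof (rule ks_entropy_le_generator[OF W_simple _ _ lim, where r="\<lambda>n k. drop k" and t="\<lambda>n k. take k"])
    fix n k :: nat and x
    show "W n ((shift ^^ k) x) = drop k (W (n + k) x)"
      by (simp add: W_def prefix_word_add add.commute[of n])
    show "W k x = take k (W n x)" if "k \<le> n" using that by (simp add: W_def prefix_word_def take_map)
  next
    fix B and \<epsilon> :: real assume B: "B \<in> events" and "\<epsilon> > 0"
    then obtain n V where nV: "prob (sym_diff B (W n -` V \<inter> space \<mu>)) < \<epsilon>"
      using cyl_approx_all[OF B] by (auto simp: cyl_approx_def)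
    have "B - (W n -` V \<inter> space \<mu>) = B - W n -` V" using sets.sets_into_space[OF B] by auto
    then show "\<exists>n V. prob ((B - W n -` V) \<union> (W n -` V \<inter> space \<mu> - B)) < \<epsilon>" using nV by auto
  qed
  also have "h \<le> ent (W n) / n" unfolding h_def using F(2)[OF _ assms] ent_nonneg[OF W_simple] by simp
  finally show ?thesis by (simp add: ent_W)
qed

end

section \<open>Plane linear algebra\<close>

text \<open>The determinant of the pair. For unit vectors its absolute value is the sine of the
  angle between their lines, and it serves as the projective distance throughout. Matrices scale it
  exactly by their determinant.\<close>

definition wedge :: "real^2 \<Rightarrow> real^2 \<Rightarrow> real" where
  "wedge x y = x$1 * y$2 - x$2 * y$1"

lemma norm_vec2_sq: "(norm (x::real^2))\<^sup>2 = (x$1)\<^sup>2 + (x$2)\<^sup>2"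
  by (simp add: norm_vec_def L2_set_def sum_2)

lemma inner_vec2: "x \<bullet> y = x$1 * y$1 + x$2 * y$2" for x y :: "real^2"
  by (simp add: inner_vec_def sum_2)

lemma matvec2: "(X *v x) $ 1 = X$1$1 * x$1 + X$1$2 * x$2" "(X *v x) $ 2 = X$2$1 * x$1 + X$2$2 * x$2"
  for X :: mat2
  by (simp_all add: matrix_vector_mult_def sum_2)

lemma wedge_matvec: "wedge (X *v x) (X *v y) = det X * wedge x y"
  by (simp add: wedge_def matvec2 det_2 algebra_simps)

lemma wedge_sq: "(wedge x y)\<^sup>2 + (x \<bullet> y)\<^sup>2 = (norm x)\<^sup>2 * (norm y)\<^sup>2"
  unfolding norm_vec2_sq wedge_def inner_vec2 by algebra

lemma abs_wedge_le: "\<bar>wedge x y\<bar> \<le> norm x * norm y"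
proof -
  have "(wedge x y)\<^sup>2 \<le> (norm x * norm y)\<^sup>2"
    using wedge_sq[of x y] zero_le_power2[of "x \<bullet> y"] unfolding power_mult_distrib by linarith
  then show ?thesis by (metis abs_ge_self abs_le_square_iff abs_norm_cancel abs_mult)
qed

lemma wedge_scaleR [simp]: "wedge (a *\<^sub>R x) y = a * wedge x y" "wedge x (a *\<^sub>R y) = a * wedge x y"
  by (simp_all add: wedge_def algebra_simps)

lemma wedge_minus [simp]: "wedge (- x) y = - wedge x y" "wedge x (- y) = - wedge x y"
  by (simp_all add: wedge_def)

lemma wedge_add: "wedge (x + y) z = wedge x z + wedge y z" "wedge x (y + z) = wedge x y + wedge x z"
  by (simp_all add: wedge_def algebra_simps)

lemma wedge_diff: "wedge (x - y) z = wedge x z - wedge y z" "wedge x (y - z) = wedge x y - wedge x z"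
  by (simp_all add: wedge_def algebra_simps)

lemma wedge_self [simp]: "wedge x x = 0"
  by (simp add: wedge_def)

lemma wedge_zero [simp]: "wedge 0 x = 0" "wedge x 0 = 0"
  by (simp_all add: wedge_def)

lemma wedge_commute: "wedge x y = - wedge y x"
  by (simp add: wedge_def)

text \<open>The triangle inequality for the sine distance, multiplied out by the norms so that no
  vector has to be normalised. It follows from an exact identity that expands along
  \<open>y\<close>.\<close>

lemma wedge_triangle:
  "\<bar>wedge x z\<bar> * norm y \<le> \<bar>wedge x y\<bar> * norm z + \<bar>wedge y z\<bar> * norm x"
proof (cases "y = 0")
  case False
  have "wedge x z * (norm y)\<^sup>2 = wedge x y * (y \<bullet> z) + wedge y z * (x \<bullet> y)"
    unfolding norm_vec2_sq wedge_def inner_vec2 by algebra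
  then have "\<bar>wedge x z\<bar> * (norm y)\<^sup>2 \<le> \<bar>wedge x y\<bar> * \<bar>y \<bullet> z\<bar> + \<bar>wedge y z\<bar> * \<bar>x \<bullet> y\<bar>"
    by (metis abs_mult abs_triangle_ineq abs_power2 abs_norm_cancel power_abs)
  also have "\<dots> \<le> \<bar>wedge x y\<bar> * (norm y * norm z) + \<bar>wedge y z\<bar> * (norm x * norm y)"
    by (intro add_mono mult_left_mono Cauchy_Schwarz_ineq2) auto
  finally have "norm y * (\<bar>wedge x z\<bar> * norm y) \<le> norm y * (\<bar>wedge x y\<bar> * norm z + \<bar>wedge y z\<bar> * norm x)"
    by (simp add: power2_eq_square algebra_simps)
  with False show ?thesis by simp
qed auto

lemma wedge_zero_imp_parallel:
  assumes "wedge x y = 0" "x \<noteq> 0"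
  shows "\<exists>t. y = t *\<^sub>R x"
proof -
  have n: "(norm x)\<^sup>2 \<noteq> 0" using assms by simp
  have "y = ((x \<bullet> y) / (norm x)\<^sup>2) *\<^sub>R x"
  proof -
    have "(norm x)\<^sup>2 *\<^sub>R y = (x \<bullet> y) *\<^sub>R x"
      using assms(1) by (simp only: vec_eq_iff forall_2 inner_vec2 norm_vec2_sq wedge_def vector_scaleR_component real_scaleR_def) algebra
    then have "(1 / (norm x)\<^sup>2) *\<^sub>R ((norm x)\<^sup>2 *\<^sub>R y) = (1 / (norm x)\<^sup>2) *\<^sub>R ((x \<bullet> y) *\<^sub>R x)"
      by simp
    with n show ?thesis by simp
  qed
  then show ?thesis by blast
qed

text \<open>$|x \mp y|^2 = 2 - 2|\cos| \le 2 \sin^2$.\<close>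

lemma unit_close_of_wedge:
  assumes "norm x = 1" "norm y = 1"
  shows "\<exists>\<sigma>\<in>{1,-1}. norm (x - \<sigma> *\<^sub>R y) \<le> 2 * \<bar>wedge x y\<bar>"
proof -
  define \<sigma> :: real where "\<sigma> = (if x \<bullet> y \<ge> 0 then 1 else -1)"
  have s: "\<sigma> * (x \<bullet> y) = \<bar>x \<bullet> y\<bar>" "\<sigma>\<^sup>2 = 1" "\<sigma> \<in> {1,-1}" by (auto simp: \<sigma>_def)
  have eq: "(wedge x y)\<^sup>2 + (x \<bullet> y)\<^sup>2 = 1" using wedge_sq[of x y] assms by simp
  have le1: "\<bar>x \<bullet> y\<bar> \<le> 1" using Cauchy_Schwarz_ineq2[of x y] assms by simp
  have norm_diff_square: "(norm (a - b))\<^sup>2 = (norm a)\<^sup>2 + (norm b)\<^sup>2 - 2 * (a \<bullet> b)" for a b :: "real^2"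
    unfolding norm_vec2_sq inner_vec2 vector_minus_component by algebra
  have "(norm (x - \<sigma> *\<^sub>R y))\<^sup>2 = 2 - 2 * \<bar>x \<bullet> y\<bar>"
    using s assms by (simp add: norm_diff_square)
  also have "\<dots> \<le> 2 * (1 - \<bar>x \<bullet> y\<bar>\<^sup>2)"
  proof -
    have "c \<le> 1 \<Longrightarrow> 0 \<le> c \<Longrightarrow> 2 - 2 * c \<le> 2 * (1 - c\<^sup>2)" for c :: real
      using mult_left_le[of c c] by (simp add: power2_eq_square)
    from this[OF le1 abs_ge_zero] show ?thesis .
  qed
  also have "\<dots> = 2 * (wedge x y)\<^sup>2" using eq by simp
  also have "\<dots> \<le> (2 * \<bar>wedge x y\<bar>)\<^sup>2" by (simp add: power_mult_distrib)
  finally have "norm (x - \<sigma> *\<^sub>R y) \<le> 2 * \<bar>wedge x y\<bar>"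
    by (rule power2_le_imp_le) simp
  with s show ?thesis by blast
qed

section \<open>Operator norm and determinant of plane matrices\<close>

lemma norm_matvec_le: "norm (X *v x) \<le> opnorm X * norm x"
  unfolding opnorm_def by (rule onorm) (rule matrix_vector_mul_bounded_linear)

lemma opnorm_nonneg [simp]: "0 \<le> opnorm X"
  unfolding opnorm_def by (rule onorm_pos_le) (rule matrix_vector_mul_bounded_linear)

lemma opnorm_leI:
  assumes "\<And>x. norm x = 1 \<Longrightarrow> norm (X *v x) \<le> b"
  shows "opnorm X \<le> b"
proof -
  have "norm (X *v x) \<le> b * norm x" for x
  proof (cases "x = 0")
    case False
    have "X *v x = norm x *\<^sub>R (X *v ((1 / norm x) *\<^sub>R x))"
      using False by (simp add: matrix_vector_mult_scaleR)
    moreover have "norm (X *v ((1 / norm x) *\<^sub>R x)) \<le> b" using False by (intro assms) simp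
    ultimately have "norm (X *v x) \<le> norm x * b"
      using mult_left_mono[of "norm (X *v ((1 / norm x) *\<^sub>R x))" b "norm x"]
      by (metis abs_norm_cancel norm_ge_zero norm_scaleR)
    then show ?thesis by (simp add: mult.commute)
  qed simp
  then show ?thesis unfolding opnorm_def by (rule onorm_le)
qed

lemma opnorm_attained: "\<exists>x. norm x = 1 \<and> norm (X *v x) = opnorm X"
proof -
  have "\<exists>x\<in>sphere (0::real^2) 1. \<forall>y\<in>sphere 0 1. norm (X *v y) \<le> norm (X *v x)"
    by (intro continuous_attains_sup continuous_intros) auto
  then obtain x where x: "norm x = 1" "\<And>y. norm y = 1 \<Longrightarrow> norm (X *v y) \<le> norm (X *v x)" by auto
  have "opnorm X \<le> norm (X *v x)" by (rule opnorm_leI) (rule x)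
  moreover have "norm (X *v x) \<le> opnorm X" using norm_matvec_le[of X x] x by simp
  ultimately show ?thesis using x by force
qed

lemma opnorm_mult_le: "opnorm (X ** Y) \<le> opnorm X * opnorm Y"
proof (rule opnorm_leI)
  fix x :: "real^2" assume "norm x = 1"
  have "norm ((X ** Y) *v x) \<le> opnorm X * norm (Y *v x)"
    by (simp add: matrix_vector_mul_assoc[symmetric] norm_matvec_le)
  also have "\<dots> \<le> opnorm X * (opnorm Y * norm x)" by (intro mult_left_mono norm_matvec_le) auto
  finally show "norm ((X ** Y) *v x) \<le> opnorm X * opnorm Y" using \<open>norm x = 1\<close> by simp
qed

lemma opnorm_mat_1 [simp]: "opnorm (mat 1) = 1"
  using opnorm_attained[of "mat 1"] by auto

lemma opnorm_scaleR: "opnorm (a *\<^sub>R X) = \<bar>a\<bar> * opnorm X"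
proof -
  have "opnorm (a *\<^sub>R X) = onorm (\<lambda>v. a *\<^sub>R (X *v v))"
    by (simp add: opnorm_def scaleR_matrix_vector_assoc)
  then show ?thesis by (simp add: opnorm_def onorm_scaleR matrix_vector_mul_bounded_linear)
qed

lemma invertible_matvec_zero:
  assumes "invertible (X::mat2)" "X *v x = 0" shows "x = 0"
  using assms by (metis matrix_left_invertible_ker invertible_def)

lemma opnorm_pos: assumes "invertible X" shows "0 < opnorm X"
proof (rule ccontr)
  assume "\<not> 0 < opnorm X"
  then have "opnorm X = 0" using opnorm_nonneg[of X] by linarith
  then have "X *v (axis 1 1) = 0" using norm_matvec_le[of X "axis 1 1"] by simp
  then show False using invertible_matvec_zero[OF assms] by (metis axis_eq_0_iff zero_neq_one)
qed

lemma abs_det_le: "\<bar>det X\<bar> \<le> (opnorm X)\<^sup>2"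
proof -
  have w: "wedge (axis 1 1) (axis 2 1) = 1" by (simp add: wedge_def axis_def)
  have "\<bar>det X\<bar> = \<bar>wedge (X *v axis 1 1) (X *v axis 2 1)\<bar>" by (simp add: wedge_matvec w)
  also have "\<dots> \<le> norm (X *v axis 1 1) * norm (X *v axis 2 1)" by (rule abs_wedge_le)
  also have "\<dots> \<le> opnorm X * opnorm X"
    using norm_matvec_le[of X "axis 1 1"] norm_matvec_le[of X "axis 2 1"]
    by (intro mult_mono) auto
  finally show ?thesis by (simp add: power2_eq_square)
qed

lemma invertible_mat_1: "invertible (mat 1 :: mat2)"
  unfolding invertible_def by (intro exI[of _ "mat 1"]) simp

lemma matrix_inv_mult:
  assumes "invertible (X::mat2)"
  shows "X ** matrix_inv X = mat 1" "matrix_inv X ** X = mat 1"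
  using assms unfolding invertible_def matrix_inv_def by (metis (mono_tags, lifting) someI_ex)+

text \<open>In the plane the largest singular value is the determinant times that of the inverse.
  Pair the image \<open>y\<close> of a maximally stretched vector with its rotation
  \<open>y'\<close> by a right angle: their wedge is the square of the norm of \<open>y\<close>, and
  pulling it back through \<open>X\<close> gives the estimate.\<close>

lemma opnorm_le_det_inv:
  assumes "invertible X"
  shows "opnorm X \<le> \<bar>det X\<bar> * opnorm (matrix_inv X)"
proof -
  obtain x where x: "norm x = 1" "norm (X *v x) = opnorm X" using opnorm_attained by blast
  define y where "y = X *v x"
  define y' :: "real^2" where "y' = vector [- y$2, y$1]"
  have ny: "norm y' = norm y"
  proof -
    have "(norm y')\<^sup>2 = (norm y)\<^sup>2" by (simp add: norm_vec2_sq y'_def vector_2)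
    then show ?thesis by simp
  qed
  have "X *v (matrix_inv X *v y') = y'"
    using assms by (simp add: matrix_vector_mul_assoc matrix_inv_mult)
  then have "wedge y y' = det X * wedge x (matrix_inv X *v y')"
    by (metis wedge_matvec y_def)
  moreover have "wedge y y' = (norm y)\<^sup>2"
    unfolding norm_vec2_sq by (simp add: wedge_def y'_def power2_eq_square)
  ultimately have "(norm y)\<^sup>2 = det X * wedge x (matrix_inv X *v y')" by simp
  then have "(norm y)\<^sup>2 \<le> \<bar>det X\<bar> * \<bar>wedge x (matrix_inv X *v y')\<bar>" by (metis abs_ge_self abs_mult)
  also have "\<dots> \<le> \<bar>det X\<bar> * (opnorm (matrix_inv X) * norm y)"
    using abs_wedge_le[of x "matrix_inv X *v y'"] norm_matvec_le[of "matrix_inv X" y'] x ny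
    by (intro mult_left_mono) auto
  finally have "norm y * norm y \<le> norm y * (\<bar>det X\<bar> * opnorm (matrix_inv X))"
    by (simp add: power2_eq_square algebra_simps)
  moreover have "norm y > 0" using x opnorm_pos[OF assms] y_def by simp
  ultimately show ?thesis using x y_def by simp
qed

lemma opnorm_diff_le: "opnorm X \<le> opnorm Y + opnorm (X - Y)"
proof (rule opnorm_leI)
  fix x :: "real^2" assume x: "norm x = 1"
  have "norm (X *v x) = norm (Y *v x + (X - Y) *v x)" by (simp add: algebra_simps)
  also have "\<dots> \<le> opnorm Y * norm x + opnorm (X - Y) * norm x"
    by (intro norm_triangle_mono norm_matvec_le)
  finally show "norm (X *v x) \<le> opnorm Y + opnorm (X - Y)" using x by simp
qed

lemma wprod_Nil [simp]: "wprod A [] = mat 1"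
  and wprod_Cons [simp]: "wprod A (i # w) = A i ** wprod A w"
  by (simp_all add: wprod_def)

lemma wprod_append: "wprod A (u @ w) = wprod A u ** wprod A w"
  by (induction u) (simp_all add: matrix_mul_assoc)

lemma wprod_invertible:
  assumes "\<forall>i<N. invertible (A i)" "set w \<subseteq> {..<N}"
  shows "invertible (wprod A w)"
  using assms(2) by (induction w) (auto simp: assms(1) invertible_mult invertible_mat_1)

lemma wprod_opnorm_pos:
  assumes "\<forall>i<N. invertible (A i)" "set w \<subseteq> {..<N}"
  shows "0 < opnorm (wprod A w)"
  using wprod_invertible[OF assms] by (rule opnorm_pos)

section \<open>Equilibrium states are Gibbs\<close>

text \<open>If every \<open>A i *v x\<close> were parallel to \<open>x\<close>, the line through
  \<open>x\<close> would be invariant; invertibility upgrades inclusion to equality.\<close>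

lemma irreducible_moves:
  assumes inv: "\<forall>i<N. invertible (A i)" and irr: "irreducible_tuple N A" and x: "x \<noteq> 0"
  shows "\<exists>i<N. wedge x (A i *v x) \<noteq> 0"
proof (rule ccontr)
  assume "\<not> ?thesis"
  then have par: "\<exists>t. A i *v x = t *\<^sub>R x" if "i < N" for i using that x wedge_zero_imp_parallel by blast
  have "(\<lambda>v. A i *v v) ` span {x} = span {x}" if i: "i < N" for i
  proof -
    obtain t where t: "A i *v x = t *\<^sub>R x" using par[OF i] by blast
    have t0: "t \<noteq> 0" using t x invertible_matvec_zero[of "A i" x] inv i by auto
    have "A i *v (k *\<^sub>R x) = (k * t) *\<^sub>R x" for k using t by (simp add: matrix_vector_mult_scaleR)
    moreover have "k *\<^sub>R x \<in> range (\<lambda>k. A i *v (k *\<^sub>R x))" for k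
      using t t0 by (intro image_eqI[of _ _ "k / t"]) (simp_all add: matrix_vector_mult_scaleR)
    ultimately show ?thesis unfolding span_singleton image_image
      by (intro equalityI image_subsetI) auto
  qed
  moreover have "dim (span {x}) = 1" using x by (simp add: dim_span)
  ultimately show False using irr subspace_span unfolding irreducible_tuple_def by blast
qed

text \<open>The constant is the minimum over pairs of unit vectors of \<open>g\<close>. It is
  positive because \<open>x\<close> and some \<open>A i *v x\<close> span the plane, so
  \<open>y\<close> cannot be orthogonal to both. The pair is then specialised to the direction onto
  which \<open>Y\<close> throws its most stretched vector and to a covector along which
  \<open>X\<close> is large.\<close>

lemma quasi_multiplicative:
  assumes inv: "\<forall>i<N. invertible (A i)" and irr: "irreducible_tuple N A"
  shows "\<exists>\<delta>>0. \<forall>X Y. \<delta> * opnorm X * opnorm Y \<le> opnorm (X ** Y) + (\<Sum>i<N. opnorm (X ** A i ** Y))"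
proof -
  define S where "S = sphere (0::real^2) 1 \<times> sphere (0::real^2) 1"
  define g where "g = (\<lambda>(x,y). \<bar>y \<bullet> x\<bar> + (\<Sum>i<N. \<bar>y \<bullet> (A i *v x)\<bar>))"
  have cont: "continuous_on S g"
    unfolding g_def case_prod_beta
    by (intro continuous_intros continuous_on_sum matrix_vector_mul_linear linear_continuous_on_compose[OF _ matrix_vector_mul_linear])
  have S: "compact S" "S \<noteq> {}"
  proof -
    have "(axis 1 1, axis 1 1) \<in> S" by (simp add: S_def)
    then show "S \<noteq> {}" by blast
    show "compact S" unfolding S_def by (intro compact_Times compact_sphere)
  qed
  obtain z where z: "z \<in> S" "\<And>w. w \<in> S \<Longrightarrow> g z \<le> g w"
    using continuous_attains_inf[OF S cont] by blast
  obtain x y where xy: "z = (x,y)" by (cases z)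
  have "g z > 0"
  proof (rule ccontr)
    assume "\<not> g z > 0"
    moreover have "g z \<ge> 0" unfolding g_def xy by (auto intro!: add_nonneg_nonneg sum_nonneg)
    ultimately have "g z = 0" by simp
    then have 0: "\<bar>y \<bullet> x\<bar> + (\<Sum>i<N. \<bar>y \<bullet> (A i *v x)\<bar>) = 0" by (simp add: g_def xy)
    then have s0: "y \<bullet> x = 0" "(\<Sum>i<N. \<bar>y \<bullet> (A i *v x)\<bar>) = 0"
      by (simp_all add: add_nonneg_eq_0_iff sum_nonneg)
    then have si: "y \<bullet> (A i *v x) = 0" if "i < N" for i
      using that by (subst (asm) sum_nonneg_eq_0_iff) auto
    have nz: "x \<noteq> 0" "y \<noteq> 0" using z(1) xy by (auto simp: S_def)
    obtain i where i: "i < N" "wedge x (A i *v x) \<noteq> 0" using irreducible_moves[OF inv irr nz(1)] by blast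
    define v where "v = A i *v x"
    have "y$1 * wedge x v = 0" "y$2 * wedge x v = 0"
      using s0(1) si[OF i(1)] unfolding v_def[symmetric] inner_vec2 wedge_def by algebra+
    then have "y = 0" using i(2) by (simp add: v_def vec_eq_iff forall_2)
    then show False using nz by simp
  qed
  moreover have "g z * opnorm X * opnorm Y \<le> opnorm (X ** Y) + (\<Sum>i<N. opnorm (X ** A i ** Y))" for X Y
  proof (cases "opnorm X = 0 \<or> opnorm Y = 0")
    case False
    then have pos: "opnorm X > 0" "opnorm Y > 0" using opnorm_nonneg[of X] opnorm_nonneg[of Y] by linarith+
    obtain v where v: "norm v = 1" "norm (Y *v v) = opnorm Y" using opnorm_attained by blast
    obtain t where t: "norm t = 1" "norm (X *v t) = opnorm X" using opnorm_attained by blast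
    \<comment> \<open>With \<open>t\<close> most stretched by \<open>X\<close>, this vector has norm
      at least the square of \<open>opnorm X\<close>, while its product with any z is at most
      \<open>opnorm X\<close> times the norm of \<open>X *v z\<close>. Normalised, it bounds the
      stretching of any z from below by \<open>opnorm X\<close> times its component along
      \<open>y\<close>.\<close>
    define \<xi> where "\<xi> = transpose X *v (X *v t)"
    have dot: "\<xi> \<bullet> z = (X *v t) \<bullet> (X *v z)" for z
      unfolding \<xi>_def by (simp add: dot_lmul_matrix[symmetric] vector_transpose_matrix inner_commute)
    have "(opnorm X)\<^sup>2 = \<xi> \<bullet> t" using t dot[of t] by (simp add: power2_norm_eq_inner[symmetric])
    also have "\<dots> \<le> norm \<xi>" using norm_cauchy_schwarz[of \<xi> t] t by simp
    finally have \<xi>: "(opnorm X)\<^sup>2 \<le> norm \<xi>" .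
    then have \<xi>0: "norm \<xi> > 0" using pos by (smt (verit) zero_less_power)
    define y where "y = (1 / norm \<xi>) *\<^sub>R \<xi>"
    define x where "x = (1 / opnorm Y) *\<^sub>R (Y *v v)"
    have xyS: "(x, y) \<in> S" using \<xi>0 pos v by (simp add: S_def x_def y_def)
    have key: "\<bar>y \<bullet> (B *v x)\<bar> * (opnorm X * opnorm Y) \<le> opnorm (X ** B ** Y)" for B
    proof -
      have "norm \<xi> * \<bar>y \<bullet> (B *v x)\<bar> = \<bar>\<xi> \<bullet> (B *v x)\<bar>" using \<xi>0 by (simp add: y_def abs_mult)
      also have "\<dots> \<le> opnorm X * norm (X *v (B *v x))"
        unfolding dot using Cauchy_Schwarz_ineq2[of "X *v t" "X *v (B *v x)"] t by simp
      finally have 1: "norm \<xi> * \<bar>y \<bullet> (B *v x)\<bar> \<le> opnorm X * norm (X *v (B *v x))" .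
      have "(opnorm X)\<^sup>2 * \<bar>y \<bullet> (B *v x)\<bar> \<le> norm \<xi> * \<bar>y \<bullet> (B *v x)\<bar>" using \<xi> by (intro mult_right_mono) auto
      then have "opnorm X * (opnorm X * \<bar>y \<bullet> (B *v x)\<bar>) \<le> opnorm X * norm (X *v (B *v x))"
        using 1 by (simp add: power2_eq_square mult.assoc)
      then have "opnorm X * \<bar>y \<bullet> (B *v x)\<bar> \<le> norm (X *v (B *v x))" using pos by simp
      then have "opnorm X * \<bar>y \<bullet> (B *v x)\<bar> * opnorm Y \<le> norm (X *v (B *v x)) * opnorm Y"
        using pos by (intro mult_right_mono) auto
      also have "\<dots> = norm ((X ** B ** Y) *v v)"
        using pos by (simp add: x_def matrix_vector_mult_scaleR matrix_vector_mul_assoc[symmetric])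
      also have "\<dots> \<le> opnorm (X ** B ** Y)" using norm_matvec_le[of "X ** B ** Y" v] v by simp
      finally show ?thesis by (simp add: algebra_simps)
    qed
    have "g z * (opnorm X * opnorm Y) \<le> g (x,y) * (opnorm X * opnorm Y)"
      using z(2)[OF xyS] pos by (intro mult_right_mono) auto
    also have "\<dots> = \<bar>y \<bullet> (mat 1 *v x)\<bar> * (opnorm X * opnorm Y) + (\<Sum>i<N. \<bar>y \<bullet> (A i *v x)\<bar> * (opnorm X * opnorm Y))"
      by (simp add: g_def distrib_right sum_distrib_right)
    also have "\<dots> \<le> opnorm (X ** mat 1 ** Y) + (\<Sum>i<N. opnorm (X ** A i ** Y))"
      by (intro add_mono sum_mono key)
    finally show ?thesis by (simp add: mult.assoc)
  qed (auto intro!: add_nonneg_nonneg sum_nonneg)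
  ultimately show ?thesis by blast
qed

text \<open>Raising to the power \<open>s\<close> does not commute with the sum, so the pigeonhole
  principle is applied first: one of the \<open>N + 1\<close> summands is at least
  \<open>e = \<delta> / (N + 1)\<close> times the product of the norms.\<close>

lemma quasi_multiplicative_powr:
  assumes inv: "\<forall>i<N. invertible (A i)" and irr: "irreducible_tuple N A" and s: "s > 0"
  shows "\<exists>c>0. \<forall>X Y. c * (opnorm X powr s) * (opnorm Y powr s) \<le> opnorm (X ** Y) powr s + (\<Sum>i<N. opnorm (X ** A i ** Y) powr s)"
proof -
  obtain \<delta> where d: "\<delta> > 0" "\<And>X Y. \<delta> * opnorm X * opnorm Y \<le> opnorm (X ** Y) + (\<Sum>i<N. opnorm (X ** A i ** Y))"
    using quasi_multiplicative[OF inv irr] by blast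
  define e where "e = \<delta> / (N + 1)"
  have e: "e > 0" using d by (simp add: e_def)
  have "e powr s * (opnorm X powr s) * (opnorm Y powr s) \<le> opnorm (X ** Y) powr s + (\<Sum>i<N. opnorm (X ** A i ** Y) powr s)" for X Y
  proof -
    let ?b = "e * opnorm X * opnorm Y"
    have b: "?b powr s = e powr s * (opnorm X powr s) * (opnorm Y powr s)" using e by (simp add: powr_mult)
    have b0: "?b \<ge> 0" using e by simp
    show ?thesis
    proof (cases "?b \<le> opnorm (X ** Y)")
      case True
      then have "?b powr s \<le> opnorm (X ** Y) powr s" using s b0 by (intro powr_mono2) auto
      then show ?thesis unfolding b by (smt (verit) sum_nonneg powr_ge_zero)
    next
      case F: False
      show ?thesis
      proof (cases "\<exists>i<N. ?b \<le> opnorm (X ** A i ** Y)")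
        case True
        then obtain i where i: "i < N" "?b \<le> opnorm (X ** A i ** Y)" by blast
        then have "?b powr s \<le> opnorm (X ** A i ** Y) powr s" using s b0 by (intro powr_mono2) auto
        also have "\<dots> \<le> (\<Sum>i<N. opnorm (X ** A i ** Y) powr s)"
          using i by (intro member_le_sum) auto
        finally show ?thesis unfolding b by (smt (verit) powr_ge_zero)
      next
        case False
        then have "(\<Sum>i<N. opnorm (X ** A i ** Y)) \<le> (\<Sum>i<N. ?b)" by (intro sum_mono) force
        then have "opnorm (X ** Y) + (\<Sum>i<N. opnorm (X ** A i ** Y)) < ?b + N * ?b" using F by simp
        also have "\<dots> = (e * (N + 1)) * opnorm X * opnorm Y" by (simp add: algebra_simps)
        also have "\<dots> = \<delta> * opnorm X * opnorm Y" by (simp add: e_def)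
        finally show ?thesis using d(2)[of X Y] by linarith
      qed
    qed
  qed
  then show ?thesis using e by (intro exI[of _ "e powr s"]) auto
qed

text \<open>Determinants are multiplicative and bounded by the squared norm. The resulting linear
  lower bound keeps the infima in Fekete's lemma finite.\<close>

lemma opnorm_powr_lower:
  assumes inv: "\<forall>i<N. invertible (A i)" and s: "s > 0"
  shows "\<exists>K::real. \<forall>w\<in>finite_words N. K * length w \<le> ln (opnorm (wprod A w) powr s)"
proof -
  obtain d where d: "d > 0" "\<And>i. i < N \<Longrightarrow> d \<le> \<bar>det (A i)\<bar>"
  proof
    show "Min (insert 1 ((\<lambda>i. \<bar>det (A i)\<bar>) ` {..<N})) > 0"
      using inv by (auto simp: invertible_det_nz)
    show "Min (insert 1 ((\<lambda>i. \<bar>det (A i)\<bar>) ` {..<N})) \<le> \<bar>det (A i)\<bar>" if "i < N" for i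
      using that by (intro Min_le) auto
  qed
  have det: "d ^ length w \<le> \<bar>det (wprod A w)\<bar>" if "w \<in> finite_words N" for w
    using that
  proof (induction w)
    case (Cons i w)
    then have "d * d ^ length w \<le> \<bar>det (A i)\<bar> * \<bar>det (wprod A w)\<bar>"
      using d by (intro mult_mono) (auto simp: finite_words_def)
    then show ?case by (simp add: det_mul abs_mult)
  qed simp
  have "(s / 2 * ln d) * length w \<le> ln (opnorm (wprod A w) powr s)" if w: "w \<in> finite_words N" for w
  proof -
    have o: "opnorm (wprod A w) > 0" using w inv wprod_opnorm_pos unfolding finite_words_def by blast
    have "d ^ length w \<le> (opnorm (wprod A w))\<^sup>2" using det[OF w] abs_det_le by (rule order_trans)
    then have "ln (d ^ length w) \<le> ln ((opnorm (wprod A w))\<^sup>2)" using d by (intro ln_mono) auto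
    then have "length w * ln d \<le> 2 * ln (opnorm (wprod A w))" using d o by (simp add: ln_realpow)
    then have "s / 2 * (length w * ln d) \<le> s / 2 * (2 * ln (opnorm (wprod A w)))" using s by (intro mult_left_mono) auto
    then show ?thesis using o by (simp add: ln_powr algebra_simps)
  qed
  then show ?thesis by (intro exI[of _ "s / 2 * ln d"] ballI)
qed

lemma words_subset_finite_words: "w \<in> words N n \<Longrightarrow> w \<in> finite_words N \<and> length w = n"
  by (auto simp: words_def finite_words_def)

lemma (in shift_invariant) integral_word_function:
  "(\<integral>x. f (prefix_word x n) \<partial>\<mu>) = (\<Sum>w\<in>words N n. p w * f w)" for f :: "nat list \<Rightarrow> real"
proof -
  have "(\<integral>x. f (prefix_word x n) \<partial>\<mu>) = (\<integral>x. (\<Sum>w\<in>words N n. indicator (cyl N w) x *\<^sub>R f w) \<partial>\<mu>)"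
  proof (rule Bochner_Integration.integral_cong[OF refl])
    fix x assume "x \<in> space \<mu>"
    then have x: "prefix_word x n \<in> words N n" and xs: "x \<in> Sigma_space N" by (auto simp: space_mu prefix_word_in_words)
    have "(\<Sum>w\<in>words N n. indicator (cyl N w) x *\<^sub>R f w) = (\<Sum>w\<in>words N n. if w = prefix_word x n then f w else 0)"
      by (intro sum.cong refl) (use xs in \<open>auto simp: indicator_def cyl_eq words_def\<close>)
    also have "\<dots> = f (prefix_word x n)" using x by (simp add: sum.delta')
    finally show "f (prefix_word x n) = (\<Sum>w\<in>words N n. indicator (cyl N w) x *\<^sub>R f w)" by simp
  qed
  also have "\<dots> = (\<Sum>w\<in>words N n. \<integral>x. indicator (cyl N w) x *\<^sub>R f w \<partial>\<mu>)"
    using cyl_meas by (intro Bochner_Integration.integral_sum integrable_scaleR_left) (auto intro: integrable_real_indicator simp: emeasure_eq_measure)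
  also have "\<dots> = (\<Sum>w\<in>words N n. p w * f w)"
    using cyl_meas by (intro sum.cong refl) (simp add: p_def)
  finally show ?thesis .
qed

text \<open>The weights are normalised by the pressure \<open>P\<close> so that
  \<open>zero_free_energy\<close> applies with the cylinder masses of \<open>\<mu>\<close>; its
  conclusion is the Gibbs property.\<close>

theorem equilibrium_gibbs:
  assumes N: "N \<ge> 2" and invA: "\<forall>i<N. invertible (A i)" and irr: "irreducible_tuple N A"
    and s: "s > 0" and eq: "equilibrium_state N A s \<mu>"
  shows "\<exists>K>0. \<exists>P::real. \<forall>w\<in>finite_words N.
    measure \<mu> (cyl N w) \<le> K * (exp (- P * length w) * opnorm (wprod A w) powr s) \<and>
    exp (- P * length w) * opnorm (wprod A w) powr s \<le> K * measure \<mu> (cyl N w)"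
proof -
  interpret shift_invariant N \<mu> using eq N by unfold_locales (auto simp: equilibrium_state_def)
  define \<phi> where "\<phi> w = opnorm (wprod A w) powr s" for w
  define Z where "Z n = (\<Sum>w\<in>words N n. \<phi> w)" for n
  have \<phi>_pos: "\<phi> w > 0" if "w \<in> finite_words N" for w
    using that invA wprod_opnorm_pos[of N A w] by (simp add: \<phi>_def finite_words_def)
  have \<phi>_sub: "\<phi> (u @ w) \<le> \<phi> u * \<phi> w" for u w
    unfolding \<phi>_def wprod_append using opnorm_mult_le[of "wprod A u" "wprod A w"] s
    by (subst powr_mult[symmetric]) (auto intro: powr_mono2)
  obtain K0 :: real where K0: "\<And>w. w \<in> finite_words N \<Longrightarrow> K0 * length w \<le> ln (\<phi> w)"
    using opnorm_powr_lower[OF invA s] unfolding \<phi>_def by blast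
  have wne: "replicate n 0 \<in> words N n" for n using N by (auto simp: words_def)
  have Z_pos: "Z n > 0" for n unfolding Z_def
    using wne by (intro sum_pos \<phi>_pos) (auto dest: words_subset_finite_words)
  have Z_sub: "Z (n + k) \<le> Z n * Z k" for n k
    unfolding Z_def sum_words_add sum_product by (intro sum_mono \<phi>_sub)
  have lnZ_sub: "ln (Z (n + k)) \<le> ln (Z n) + ln (Z k)" for n k
  proof -
    have "ln (Z (n + k)) \<le> ln (Z n * Z k)" using Z_sub Z_pos by (intro ln_mono) (auto)
    then show ?thesis using Z_pos[of n] Z_pos[of k] by (simp add: ln_mult)
  qed
  have lnZ_low: "K0 * n \<le> ln (Z n)" for n
  proof -
    have "K0 * n \<le> ln (\<phi> (replicate n 0))" using K0[of "replicate n 0"] wne[of n] words_subset_finite_words by force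
    also have "\<dots> \<le> ln (Z n)"
    proof (rule ln_mono)
      show "\<phi> (replicate n 0) \<le> Z n" unfolding Z_def using wne
        by (intro member_le_sum) (auto simp: \<phi>_def)
    qed (use wne \<phi>_pos words_subset_finite_words in blast)
    finally show ?thesis .
  qed
  define P where "P = pressure N A s"
  have phi_eq: "phi A s n y = ln (\<phi> (prefix_word y n))" for n y by (simp add: phi_def \<phi>_def)
  \<comment> \<open>\<open>phi A s n\<close> depends on the first \<open>n\<close> symbols only, so
    it is constant on the cylinder. The cylinder must be nonempty for the supremum to take this
    value.\<close>
  have sup: "(SUP y\<in>cyl N w. phi A s n y) = ln (\<phi> w)" if "w \<in> words N n" for w n
  proof -
    have "cyl N w \<noteq> {}"
      using word_extend[of N w] that N by (auto simp: cyl_eq words_def)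
    moreover have "phi A s n y = ln (\<phi> w)" if "y \<in> cyl N w" for y
      using that \<open>w \<in> words N n\<close> by (auto simp: phi_eq cyl_eq words_def)
    ultimately show ?thesis by simp
  qed
  have press: "P = lim (\<lambda>n. ln (Z n) / n)"
  proof -
    have "(\<Sum>w\<in>words N n. exp (SUP y\<in>cyl N w. phi A s n y)) = Z n" for n
      unfolding Z_def by (intro sum.cong) (auto simp: sup \<phi>_pos dest: words_subset_finite_words)
    then show ?thesis by (simp add: P_def pressure_def)
  qed
  have limP: "(\<lambda>n. ln (Z n) / n) \<longlonglongrightarrow> P"
    using fekete(1)[of "\<lambda>n. ln (Z n)" K0, OF lnZ_sub lnZ_low] unfolding press by (simp add: convergent_LIMSEQ_iff)
  define b where "b n = (\<Sum>w\<in>words N n. p w * ln (\<phi> w))" for n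
  have fwa: "u \<in> words N n \<Longrightarrow> u \<in> finite_words N" for u n using words_subset_finite_words by blast
  have b_sub: "b (n + k) \<le> b n + b k" for n k
  proof -
    have "b (n + k) \<le> (\<Sum>u\<in>words N n. \<Sum>v\<in>words N k. p (u @ v) * (ln (\<phi> u) + ln (\<phi> v)))"
      unfolding b_def sum_words_add
    proof (intro sum_mono mult_left_mono p_nonneg)
      fix u v assume uv: "u \<in> words N n" "v \<in> words N k"
      then have fin: "u \<in> finite_words N" "v \<in> finite_words N" "u @ v \<in> finite_words N"
        by (auto simp: words_def finite_words_def)
      have "ln (\<phi> (u @ v)) \<le> ln (\<phi> u * \<phi> v)" using \<phi>_sub \<phi>_pos[OF fin(3)] by (intro ln_mono) auto
      then show "ln (\<phi> (u @ v)) \<le> ln (\<phi> u) + ln (\<phi> v)" using \<phi>_pos[OF fin(1)] \<phi>_pos[OF fin(2)] by (simp add: ln_mult)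
    qed
    also have "\<dots> = (\<Sum>u\<in>words N n. \<Sum>v\<in>words N k. p (u @ v) * ln (\<phi> u)) + (\<Sum>v\<in>words N k. \<Sum>u\<in>words N n. p (u @ v) * ln (\<phi> v))"
      by (subst (3) sum.swap) (simp add: distrib_left sum.distrib)
    also have "\<dots> = b n + b k"
      unfolding b_def sum_distrib_right[symmetric] using weights.p_append_right weights.p_append_left fwa by (simp cong: sum.cong)
    finally show ?thesis .
  qed
  have b_low: "K0 * n \<le> b n" for n
  proof -
    have "K0 * n = (\<Sum>w\<in>words N n. p w * (K0 * n))" by (simp only: sum_distrib_right[symmetric] weights.p_sum_1)
    also have "\<dots> \<le> b n" unfolding b_def
      using K0 by (intro sum_mono mult_left_mono p_nonneg) (metis words_subset_finite_words)
    finally show ?thesis .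
  qed
  have b_int: "(\<integral>x. phi A s n x \<partial>\<mu>) = b n" for n
    unfolding phi_eq b_def by (rule integral_word_function)
  have Lam: "lim (\<lambda>n. b n / n) \<le> b n / n" if "n > 0" for n
    using fekete(2)[of b K0, OF b_sub b_low that] .
  have Peq: "P = ks_entropy \<mu> shift + lim (\<lambda>n. b n / n)"
    using eq by (simp add: equilibrium_state_def P_def b_int)
  \<comment> \<open>The variational equality holds only in the limit, but entropy and energy rates
    are both at most their values on level \<open>n\<close>; this turns it into an inequality on
    every level.\<close>
  have free: "n * P \<le> - (\<Sum>w\<in>words N n. p w * ln (p w)) + b n" if n: "n > 0" for n
  proof -
    have "P \<le> - (\<Sum>w\<in>words N n. p w * ln (p w)) / n + b n / n"
      using Peq ks_entropy_le[OF n] Lam[OF n] by linarith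
    then show ?thesis using n by (simp add: field_simps)
  qed
  define m where "m w = exp (- P * length w) * \<phi> w" for w
  have ln_m: "ln (m w) = ln (\<phi> w) - P * length w" if "w \<in> finite_words N" for w
    using \<phi>_pos[OF that] by (simp add: m_def ln_mult)
  obtain c where c: "c > 0" "\<And>X Y. c * (opnorm X powr s) * (opnorm Y powr s) \<le> opnorm (X ** Y) powr s + (\<Sum>i<N. opnorm (X ** A i ** Y) powr s)"
    using quasi_multiplicative_powr[OF invA irr s] by blast
  \<comment> \<open>The connecting letter carries its own factor \<open>exp (- P)\<close> in
    \<open>m\<close>; dividing by the maximum covers both signs of \<open>P\<close>.\<close>
  define c' where "c' = c / max 1 (exp P)"
  interpret zero_free_energy N m c' p
  proof
    show "m w > 0" if "w \<in> finite_words N" for w using \<phi>_pos[OF that] by (simp add: m_def)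
    show "m (u @ w) \<le> m u * m w" for u w
    proof -
      have "m (u @ w) = exp (- P * length u) * exp (- P * length w) * \<phi> (u @ w)"
        by (simp add: m_def exp_add[symmetric] algebra_simps)
      also have "\<dots> \<le> exp (- P * length u) * exp (- P * length w) * (\<phi> u * \<phi> w)"
        by (intro mult_left_mono \<phi>_sub) auto
      finally show ?thesis by (simp add: m_def mult_ac)
    qed
    show "c' > 0" using c by (simp add: c'_def)
    show "c' * m u * m w \<le> m (u @ w) + (\<Sum>i<N. m (u @ i # w))" for u w
    proof -
      define E where "E = exp (- P * length u) * exp (- P * length w)"
      have mE: "m u * m w = E * (\<phi> u * \<phi> w)" "m (u @ w) = E * \<phi> (u @ w)" "m (u @ i # w) = exp (- P) * (E * \<phi> (u @ i # w))" for i
        by (simp_all add: m_def E_def exp_add[symmetric] algebra_simps)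
      have E: "E > 0" by (simp add: E_def)
      let ?x = "max 1 (exp P)"
      have x: "?x > 0" "1 \<le> ?x" "1 \<le> ?x * exp (- P)"
        by (auto simp: less_max_iff_disj max_mult_distrib_right exp_add[symmetric])
      have "c * (\<phi> u * \<phi> w) \<le> \<phi> (u @ w) + (\<Sum>i<N. \<phi> (u @ i # w))"
        using c(2)[of "wprod A u" "wprod A w"] by (simp add: \<phi>_def wprod_append matrix_mul_assoc mult.assoc)
      then have "E * (c * (\<phi> u * \<phi> w)) \<le> E * (\<phi> (u @ w) + (\<Sum>i<N. \<phi> (u @ i # w)))"
        using E by (intro mult_left_mono) auto
      also have "\<dots> = 1 * (E * \<phi> (u @ w)) + 1 * (E * (\<Sum>i<N. \<phi> (u @ i # w)))" by (simp add: algebra_simps)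
      also have "\<dots> \<le> ?x * (E * \<phi> (u @ w)) + (?x * exp (- P)) * (E * (\<Sum>i<N. \<phi> (u @ i # w)))"
        using x E by (intro add_mono mult_right_mono mult_nonneg_nonneg sum_nonneg) (auto simp: \<phi>_def)
      also have "\<dots> = ?x * (m (u @ w) + (\<Sum>i<N. m (u @ i # w)))"
        by (simp add: mE sum_distrib_left algebra_simps)
      finally have "c * (m u * m w) \<le> ?x * (m (u @ w) + (\<Sum>i<N. m (u @ i # w)))"
        by (simp add: mE mult_ac)
      then show ?thesis using x(1) by (simp add: c'_def field_simps)
    qed
    have eqn: "ln (\<Sum>w\<in>words N n. m w) / n = ln (Z n) / n - P" if "n > 0" for n
    proof -
      have "(\<Sum>w\<in>words N n. m w) = exp (- P * n) * Z n"
        by (simp add: m_def Z_def sum_distrib_left words_def)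
      then have "ln (\<Sum>w\<in>words N n. m w) = - P * n + ln (Z n)" using Z_pos[of n] by (simp add: ln_mult)
      then show ?thesis using that by (simp add: field_simps)
    qed
    have l0: "(\<lambda>n. ln (Z n) / n - P) \<longlonglongrightarrow> 0" using tendsto_diff[OF limP tendsto_const[of P]] by simp
    show "(\<lambda>n. ln (\<Sum>w\<in>words N n. m w) / real n) \<longlonglongrightarrow> 0"
      by (rule Lim_transform_eventually[OF l0], rule eventually_mono[OF eventually_gt_at_top[of 0]]) (simp add: eqn)
    show "N > 0" using N by simp
    show "(\<Sum>w\<in>words N n. p w * ln (p w)) \<le> (\<Sum>w\<in>words N n. p w * ln (m w))" for n
    proof (cases "n = 0")
      case True
      then show ?thesis by (simp add: p_Nil m_def \<phi>_def)
    next
      case False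
      have "(\<Sum>w\<in>words N n. p w * ln (m w)) = (\<Sum>w\<in>words N n. p w * ln (\<phi> w) - p w * (P * n))"
        by (intro sum.cong refl) (auto simp: ln_m right_diff_distrib dest!: words_subset_finite_words)
      also have "\<dots> = b n - n * P"
        by (simp add: sum_subtractf b_def sum_distrib_right[symmetric] weights.p_sum_1)
      finally show ?thesis using free[of n] False by simp
    qed
  qed
  from gibbs obtain K where "K > 0" "\<forall>w\<in>finite_words N. p w \<le> K * m w \<and> m w \<le> K * p w" by blast
  then show ?thesis unfolding m_def \<phi>_def p_def by (intro exI[of _ K] exI[of _ P] conjI)
qed

section \<open>The projective line and invariant multicones\<close>

definition evec :: "real \<Rightarrow> real^2" where "evec t = vector [cos t, sin t]"

lemma evec_nth [simp]: "evec t $ 1 = cos t" "evec t $ 2 = sin t"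
  by (simp_all add: evec_def)

lemma norm_evec [simp]: "norm (evec t) = 1"
proof -
  have "(norm (evec t))\<^sup>2 = 1" unfolding norm_vec2_sq by simp
  then show ?thesis by (simp add: power2_eq_1_iff) (smt (verit) norm_ge_zero)
qed

lemma evec_nz [simp]: "evec t \<noteq> 0"
  using norm_evec[of t] by force

lemma ang_evec: "ang t = span {evec t}"
  by (simp add: ang_def evec_def)

lemma wedge_evec: "wedge (evec a) (evec b) = sin (b - a)"
  by (simp add: wedge_def sin_diff)

lemma continuous_evec: "continuous_on S evec"
proof -
  have e: "evec = (\<lambda>t. cos t *\<^sub>R axis 1 1 + sin t *\<^sub>R axis 2 1)"
    by (simp add: fun_eq_iff vec_eq_iff forall_2 axis_def)
  show ?thesis unfolding e by (intro continuous_intros)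
qed

lemma vec_eq_evec_combination:
  "v = (evec a \<bullet> v) *\<^sub>R evec a + wedge (evec a) v *\<^sub>R evec (a + pi / 2)"
proof -
  have "(cos a)\<^sup>2 + (sin a)\<^sup>2 = 1" by simp
  then have "v$1 = (cos a * v$1 + sin a * v$2) * cos a + (cos a * v$2 - sin a * v$1) * (- sin a)"
    "v$2 = (cos a * v$1 + sin a * v$2) * sin a + (cos a * v$2 - sin a * v$1) * cos a"
    by algebra+
  then show ?thesis by (simp add: vec_eq_iff forall_2 inner_vec2 wedge_def cos_add sin_add)
qed

lemma polar_half_plane:
  assumes "v \<noteq> 0" "wedge (evec a) v \<ge> 0"
  shows "\<exists>r>0. \<exists>t. a \<le> t \<and> t \<le> a + pi \<and> v = r *\<^sub>R evec t"
proof -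
  define r where "r = norm v"
  have r: "r > 0" using assms by (simp add: r_def)
  define c where "c = (evec a \<bullet> v) / r"
  define s where "s = wedge (evec a) v / r"
  have cs: "c\<^sup>2 + s\<^sup>2 = 1" using wedge_sq[of "evec a" v] r
    by (simp add: c_def s_def power_divide r_def add_divide_distrib[symmetric] add.commute)
  have "c\<^sup>2 \<le> 1" using cs zero_le_power2[of s] by linarith
  then have c: "-1 \<le> c" "c \<le> 1" by (auto simp: abs_square_le_1 abs_le_iff)
  define u where "u = arccos c"
  have u: "0 \<le> u" "u \<le> pi" "cos u = c" using c by (auto simp: u_def arccos_lbound arccos_ubound)
  have "sin u = sqrt (1 - c\<^sup>2)" unfolding u_def using c by (simp add: sin_arccos)
  also have "1 - c\<^sup>2 = s\<^sup>2" using cs by linarith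
  also have "sqrt (s\<^sup>2) = s" using assms r by (simp add: s_def)
  finally have su: "sin u = s" .
  have "v = r *\<^sub>R evec (a + u)"
  proof -
    have "v = (r * cos u) *\<^sub>R evec a + (r * sin u) *\<^sub>R evec (a + pi / 2)"
      using vec_eq_evec_combination[of v a] r by (simp add: u(3) su c_def s_def)
    also have "\<dots> = r *\<^sub>R evec (a + u)"
      by (simp add: vec_eq_iff forall_2 cos_add sin_add algebra_simps)
    finally show ?thesis .
  qed
  then show ?thesis using r u by (intro exI[of _ r] conjI exI[of _ "a + u"]) auto
qed

lemma polar: assumes "v \<noteq> 0" shows "\<exists>r>0. \<exists>t. v = r *\<^sub>R evec t"
proof (cases "wedge (evec 0) v \<ge> 0")
  case True then show ?thesis using polar_half_plane[OF assms] by blast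
next
  case False
  then have "wedge (evec 0) (- v) \<ge> 0" by simp
  then obtain r t where "r > 0" "- v = r *\<^sub>R evec t" using polar_half_plane[of "- v" 0] assms by auto
  moreover have "evec (t + pi) = - evec t" by (simp add: vec_eq_iff forall_2)
  ultimately have "v = r *\<^sub>R evec (t + pi)" by (metis minus_minus scaleR_minus_right)
  then show ?thesis using \<open>r > 0\<close> by blast
qed

lemma span_eq_iff_parallel:
  assumes "x \<noteq> 0" "y \<noteq> 0" shows "span {x} = span {y} \<longleftrightarrow> (\<exists>k. k \<noteq> 0 \<and> y = k *\<^sub>R (x::real^2))"
proof
  assume "span {x} = span {y}"
  then have "y \<in> span {x}" by (simp add: span_base)
  then show "\<exists>k. k \<noteq> 0 \<and> y = k *\<^sub>R x" using assms by (auto simp: span_singleton)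
next
  assume "\<exists>k. k \<noteq> 0 \<and> y = k *\<^sub>R x"
  then obtain k where k: "k \<noteq> 0" "y = k *\<^sub>R x" by blast
  have "x = (1 / k) *\<^sub>R y" using k by simp
  then have "x \<in> span {y}" "y \<in> span {x}" using k(2) unfolding span_singleton by blast+
  then show "span {x} = span {y}" by (simp add: span_eq)
qed

lemma span_scaleR_nz: "k \<noteq> 0 \<Longrightarrow> span {k *\<^sub>R x} = span {x::real^2}"
  by (cases "x = 0") (auto simp: span_eq_iff_parallel intro: exI[of _ "1 / k"])

lemma span_eq_wedge:
  assumes "x \<noteq> 0" "y \<noteq> 0" shows "span {x} = span {y} \<longleftrightarrow> wedge x y = 0"
  using wedge_zero_imp_parallel[of x y] assms by (auto simp: span_eq_iff_parallel[OF assms])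

lemma RP1_iff: "L \<in> RP1 \<longleftrightarrow> (\<exists>x. x \<noteq> 0 \<and> L = span {x})"
proof
  assume "L \<in> RP1" then show "\<exists>x. x \<noteq> 0 \<and> L = span {x}" by (auto simp: RP1_def ang_evec intro: exI[of _ "evec _"])
next
  assume "\<exists>x. x \<noteq> 0 \<and> L = span {x}"
  then obtain x where x: "x \<noteq> 0" "L = span {x}" by blast
  then obtain r t where "r > 0" "x = r *\<^sub>R evec t" using polar by blast
  then show "L \<in> RP1" using x by (simp add: RP1_def ang_evec span_scaleR_nz)
qed

lemma image_span_singleton: "(\<lambda>v. X *v v) ` span {x} = span {X *v x}" for X :: mat2
  by (simp add: span_singleton image_image matrix_vector_mult_scaleR)

text \<open>Turns sets of lines into symmetric cones of nonzero vectors, where compactness, balls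
  and matrix action are those of the plane.\<close>

definition vecs :: "(real^2) set set \<Rightarrow> (real^2) set" where
  "vecs C = {v. v \<noteq> 0 \<and> span {v} \<in> C}"

lemma vecs_scaleR: "k \<noteq> 0 \<Longrightarrow> k *\<^sub>R x \<in> vecs C \<longleftrightarrow> x \<in> vecs C"
  by (auto simp: vecs_def span_scaleR_nz)

lemma proj_act_vecs:
  assumes "proj_act X C \<subseteq> D" "invertible X" "v \<in> vecs C" shows "X *v v \<in> vecs D"
  using assms invertible_matvec_zero[of X v]
  by (auto simp: vecs_def proj_act_def image_subset_iff image_span_singleton)

lemma multicone_closed:
  assumes "multicone C" shows "compact (vecs C \<inter> sphere 0 1)"
proof -
  obtain \<I> where I: "finite \<I>" "\<And>I. I \<in> \<I> \<Longrightarrow> closed_proj_interval I" "C = \<Union>\<I>"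
    using assms by (auto simp: multicone_def)
  have "compact (vecs I \<inter> sphere 0 1)" if "I \<in> \<I>" for I
  proof -
    from I(2)[OF that] obtain a b where ab: "I = ang ` {a..b}" by (auto simp: closed_proj_interval_def)
    have "vecs I \<inter> sphere 0 1 = evec ` {a..b} \<union> (\<lambda>t. - evec t) ` {a..b}"
    proof (intro equalityI subsetI)
      fix v assume v: "v \<in> vecs I \<inter> sphere 0 1"
      then obtain t where t: "t \<in> {a..b}" "span {v} = span {evec t}" "v \<noteq> 0" by (auto simp: vecs_def ab ang_evec)
      then obtain k where k: "evec t = k *\<^sub>R v" using span_eq_iff_parallel[OF t(3) evec_nz] by blast
      then have "norm (evec t) = \<bar>k\<bar>" using v by simp
      then have "k = 1 \<or> k = -1" by auto
      then have "v = evec t \<or> v = - evec t" using k by auto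
      then show "v \<in> evec ` {a..b} \<union> (\<lambda>t. - evec t) ` {a..b}" using t(1) by blast
    next
      fix v assume "v \<in> evec ` {a..b} \<union> (\<lambda>t. - evec t) ` {a..b}"
      moreover have "span {- evec t} = span {evec t}" for t using span_scaleR_nz[of "-1" "evec t"] by simp
      ultimately show "v \<in> vecs I \<inter> sphere 0 1" by (auto simp: vecs_def ab ang_evec)
    qed
    then show ?thesis by (auto intro!: compact_Un compact_continuous_image continuous_evec continuous_intros)
  qed
  then have "compact (\<Union>I\<in>\<I>. vecs I \<inter> sphere 0 1)" using I(1) by (intro compact_UN) auto
  moreover have "(\<Union>I\<in>\<I>. vecs I \<inter> sphere 0 1) = vecs C \<inter> sphere 0 1" by (auto simp: I(3) vecs_def)
  ultimately show ?thesis by simp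
qed

text \<open>In the open half plane around \<open>v\<close> the map \<open>g\<close> is a continuous
  choice of angle with \<open>span {x} = ang (g x)\<close>. An open set of angles therefore pulls
  back to an open set of vectors.\<close>

lemma proj_interior_vecs:
  assumes "v \<in> vecs (proj_interior C)" shows "v \<in> interior (vecs C)"
proof -
  have v: "v \<noteq> 0" "span {v} \<in> proj_interior C" using assms by (auto simp: vecs_def)
  then obtain t where t: "span {v} = span {evec t}" "t \<in> interior (ang -` C)"
    by (auto simp: proj_interior_def ang_evec)
  then obtain k where k: "k \<noteq> 0" "v = k *\<^sub>R evec t" using span_eq_iff_parallel[of "evec t" v] v by auto
  define U where "U = {x. evec t \<bullet> (k *\<^sub>R x) > 0}"
  define g where "g x = t + arctan (wedge (evec t) x / (evec t \<bullet> x))" for x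
  have oU: "open U" unfolding U_def by (intro open_Collect_less continuous_intros)
  have cw: "continuous_on S (\<lambda>x. wedge (evec t) x)" for S unfolding wedge_def by (intro continuous_intros)
  have Unz: "evec t \<bullet> x \<noteq> 0" if "x \<in> U" for x using that by (auto simp: U_def)
  have "continuous_on U g" unfolding g_def using Unz by (intro continuous_intros cw) auto
  then have "open (g -` interior (ang -` C) \<inter> U)"
    by (rule continuous_on_open_vimage[OF oU, THEN iffD1, rule_format]) (rule open_interior)
  moreover have "v \<in> g -` interior (ang -` C) \<inter> U"
  proof -
    have e: "evec t \<bullet> evec t = 1" using norm_evec[of t] by (simp add: dot_square_norm)
    have "g v = t" using k by (simp add: g_def)
    moreover have "v \<in> U" using k e by (auto simp: U_def zero_less_mult_iff)
    ultimately show ?thesis using t by simp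
  qed
  moreover have "g -` interior (ang -` C) \<inter> U \<subseteq> vecs C"
  proof
    fix x assume x: "x \<in> g -` interior (ang -` C) \<inter> U"
    then have "ang (g x) \<in> C" using interior_subset by blast
    moreover have "span {x} = span {evec (g x)}"
    proof -
      define u where "u = wedge (evec t) x / (evec t \<bullet> x)"
      have ex0: "evec t \<bullet> x \<noteq> 0" using Unz x by auto
      have "x = (evec t \<bullet> x) *\<^sub>R (evec t + u *\<^sub>R evec (t + pi / 2))"
        using vec_eq_evec_combination[of x t] ex0 by (simp add: u_def scaleR_add_right)
      also have "evec t + u *\<^sub>R evec (t + pi / 2) = (1 / cos (arctan u)) *\<^sub>R evec (g x)"
        unfolding g_def u_def[symmetric] using cos_arctan_not_zero[of u] tan_arctan[of u]
        by (simp add: vec_eq_iff forall_2 tan_def cos_add[of t] sin_add[of t]) (simp add: field_simps)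
      finally have "x = ((evec t \<bullet> x) / cos (arctan u)) *\<^sub>R evec (g x)" by simp
      then show ?thesis using ex0 cos_arctan_not_zero[of u] span_scaleR_nz by (metis divide_eq_0_iff)
    qed
    moreover have "x \<noteq> 0" using Unz[of x] x by auto
    ultimately show "x \<in> vecs C" by (auto simp: vecs_def ang_evec)
  qed
  ultimately show ?thesis by (metis interiorI)
qed

text \<open>\<open>X\<^sup>-\<^sup>1\<close> maps the ball around \<open>p\<close> off the ball around \<open>v\<close>, hence it cannot be too large
  near \<open>p\<close> compared to \<open>X v\<close>.\<close>

lemma cone_expansion:
  assumes X: "invertible X" and inv: "\<And>x. x \<in> C \<Longrightarrow> X *v x \<in> C"
    and C: "\<And>x k. x \<in> C \<Longrightarrow> k \<noteq> 0 \<Longrightarrow> k *\<^sub>R x \<in> C"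
    and v: "norm v = 1" "ball v d \<subseteq> C" and p: "ball p \<eta> \<inter> C = {}" and d: "d > 0" and \<eta>: "\<eta> > 0" "\<eta> \<le> norm p"
  shows "\<eta> * d / (16 * norm p) * opnorm X \<le> norm (X *v v)"
proof -
  define Wx where "Wx = matrix_inv X"
  have XW: "X *v (Wx *v x) = x" for x using X by (simp add: Wx_def matrix_vector_mul_assoc matrix_inv_mult)
  \<comment> \<open>A vector outside the cone, normalised with a suitable sign, avoids the ball
    around \<open>v\<close>, so its line is separated from that of \<open>v\<close> in sine
    distance.\<close>
  have far: "d / 2 * norm u \<le> \<bar>wedge u v\<bar>" if "u \<notin> C" for u
  proof (cases "u = 0")
    case False
    define u' where "u' = (1 / norm u) *\<^sub>R u"
    have nu': "norm u' = 1" using False by (simp add: u'_def)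
    obtain \<sigma> where \<sigma>: "\<sigma> \<in> {1,-1::real}" "norm (u' - \<sigma> *\<^sub>R v) \<le> 2 * \<bar>wedge u' v\<bar>"
      using unit_close_of_wedge[OF nu' v(1)] by blast
    have "norm (\<sigma> *\<^sub>R u' - v) = norm (u' - \<sigma> *\<^sub>R v)" 
    proof -
      have "\<sigma> *\<^sub>R u' - v = \<sigma> *\<^sub>R (u' - \<sigma> *\<^sub>R v)" using \<sigma>(1) by (auto simp: scaleR_diff_right)
      then show ?thesis using \<sigma>(1) by auto
    qed
    moreover have "\<sigma> *\<^sub>R u' \<notin> C"
    proof
      assume "\<sigma> *\<^sub>R u' \<in> C"
      moreover have "u = (norm u * \<sigma>) *\<^sub>R (\<sigma> *\<^sub>R u')" using \<sigma>(1) False by (auto simp: u'_def)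
      moreover have "norm u * \<sigma> \<noteq> 0" using \<sigma>(1) False by auto
      ultimately have "u \<in> C" using C by metis
      then show False using that by simp
    qed
    then have "\<sigma> *\<^sub>R u' \<notin> ball v d" using v by blast
    ultimately have "d \<le> norm (u' - \<sigma> *\<^sub>R v)" by (simp add: dist_norm norm_minus_commute)
    then have "d \<le> 2 * \<bar>wedge u' v\<bar>" using \<sigma> by linarith
    also have "\<bar>wedge u' v\<bar> = \<bar>wedge u v\<bar> / norm u" by (simp add: u'_def abs_mult)
    finally show ?thesis using False by (simp add: field_simps)
  qed simp
  have W_bd: "\<bar>det X\<bar> * norm (Wx *v x) \<le> 4 * norm p / d * norm (X *v v)" if "x \<in> ball p \<eta>" for x
  proof -
    have "Wx *v x \<notin> C" using inv[of "Wx *v x"] XW p that by auto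
    then have "d / 2 * norm (Wx *v x) \<le> \<bar>wedge (Wx *v x) v\<bar>" by (rule far)
    then have "\<bar>det X\<bar> * (d / 2 * norm (Wx *v x)) \<le> \<bar>det X\<bar> * \<bar>wedge (Wx *v x) v\<bar>" by (intro mult_left_mono) auto
    also have "\<dots> = \<bar>wedge x (X *v v)\<bar>" using wedge_matvec[of X "Wx *v x" v] by (simp add: XW abs_mult)
    also have "\<dots> \<le> norm x * norm (X *v v)" by (rule abs_wedge_le)
    also have "\<dots> \<le> (2 * norm p) * norm (X *v v)"
    proof (intro mult_right_mono)
      have "norm x \<le> norm p + norm (p - x)" using norm_triangle_ineq4[of p "p - x"] by simp
      then show "norm x \<le> 2 * norm p" using that \<eta> by (simp add: dist_norm)
    qed simp
    finally show ?thesis using d by (simp add: field_simps)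
  qed
  \<comment> \<open>The direction most stretched by the inverse need not lie in the ball around
    \<open>p\<close>. It is reached as a multiple of the difference of the two points
    \<open>p\<close> and \<open>p + (\<eta> / 2) *\<^sub>R y\<close> of that ball.\<close>
  obtain y where y: "norm y = 1" "norm (Wx *v y) = opnorm Wx" using opnorm_attained by blast
  define a b where "a = norm (Wx *v (p + (\<eta> / 2) *\<^sub>R y))" and "b = norm (Wx *v p)"
  have "opnorm Wx = norm (Wx *v y)" using y by simp
  also have "\<dots> = 2 / \<eta> * norm (Wx *v (p + (\<eta> / 2) *\<^sub>R y) - Wx *v p)"
    using \<eta> by (simp add: matrix_vector_right_distrib matrix_vector_mult_scaleR)
  also have "\<dots> \<le> 2 / \<eta> * (a + b)"
    unfolding a_def b_def using \<eta> by (intro mult_left_mono norm_triangle_ineq4) auto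
  finally have "\<bar>det X\<bar> * opnorm Wx \<le> \<bar>det X\<bar> * (2 / \<eta> * (a + b))" by (intro mult_left_mono) auto
  then have "opnorm X \<le> \<bar>det X\<bar> * (2 / \<eta> * (a + b))"
    using opnorm_le_det_inv[OF X] unfolding Wx_def by linarith
  also have "\<dots> = 2 / \<eta> * (\<bar>det X\<bar> * a + \<bar>det X\<bar> * b)" by (simp add: algebra_simps add_divide_distrib)
  also have "\<dots> \<le> 2 / \<eta> * (4 * norm p / d * norm (X *v v) + 4 * norm p / d * norm (X *v v))"
    unfolding a_def b_def using \<eta> y by (intro mult_left_mono add_mono W_bd) (auto simp: dist_norm)
  finally have "opnorm X \<le> 16 * norm p / (\<eta> * d) * norm (X *v v)" by (simp add: field_simps)
  moreover have "norm p > 0" using \<eta> by linarith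
  ultimately show ?thesis using \<eta> d by (simp add: field_simps)
qed

section \<open>From the multicone to almost multiplicativity\<close>

lemma transpose_dot: "(transpose X *v y) \<bullet> z = y \<bullet> (X *v z)" for X :: mat2
  by (simp add: dot_lmul_matrix[symmetric] vector_transpose_matrix inner_commute)

lemma orthogonal_matrix_norm:
  assumes "orthogonal_matrix (Q :: mat2)" shows "norm (Q *v v) = norm v"
proof -
  have "(Q *v v) \<bullet> (Q *v v) = ((transpose Q ** Q) *v v) \<bullet> v"
    by (simp only: transpose_dot matrix_vector_mul_assoc[symmetric])
  then show ?thesis using assms by (simp add: orthogonal_matrix_def norm_eq)
qed

text \<open>Strong conformality in usable form: each matrix is a similarity for the Euclidean norm
  pulled back by \<open>M\<close>.\<close>

lemma strongly_conformal_norm: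
  fixes M X :: mat2
  assumes M: "invertible M" and X: "invertible X"
    and orth: "orthogonal_matrix (\<bar>det X\<bar> powr (-1/2) *\<^sub>R (M ** X ** matrix_inv M))"
  shows "norm (M *v (X *v x)) = sqrt \<bar>det X\<bar> * norm (M *v x)"
proof -
  define c where "c = \<bar>det X\<bar> powr (-1/2)"
  have d: "\<bar>det X\<bar> > 0" using X by (simp add: invertible_det_nz)
  have c: "c * sqrt \<bar>det X\<bar> = 1" "c > 0"
    using d by (auto simp: c_def powr_half_sqrt[symmetric] powr_add[symmetric])
  have "norm ((c *\<^sub>R (M ** X ** matrix_inv M)) *v (M *v x)) = norm (M *v x)"
    using orth unfolding c_def by (rule orthogonal_matrix_norm)
  also have "(c *\<^sub>R (M ** X ** matrix_inv M)) *v (M *v x) = c *\<^sub>R (M *v (X *v x))"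
  proof -
    have "(M ** X ** matrix_inv M) *v (M *v x) = (M ** X) *v ((matrix_inv M ** M) *v x)"
      by (simp add: matrix_vector_mul_assoc matrix_mul_assoc)
    also have "\<dots> = M *v (X *v x)" using matrix_inv_mult(2)[OF M] by (simp add: matrix_vector_mul_assoc)
    finally show ?thesis by (simp add: scaleR_matrix_vector_assoc[symmetric])
  qed
  finally have "c * norm (M *v (X *v x)) = norm (M *v x)" using c by simp
  then have "sqrt \<bar>det X\<bar> * norm (M *v x) = (c * sqrt \<bar>det X\<bar>) * norm (M *v (X *v x))" by (simp add: mult_ac)
  then show ?thesis using c by simp
qed

lemma similarity_words_expand:
  fixes M :: mat2
  assumes M: "invertible M" and w: "set w \<subseteq> E"
    and sim: "\<And>i x. i \<in> E \<Longrightarrow> norm (M *v (A i *v x)) = sqrt \<bar>det (A i)\<bar> * norm (M *v x)"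
  shows "opnorm (wprod A w) * norm x \<le> (opnorm M * opnorm (matrix_inv M))\<^sup>2 * norm (wprod A w *v x)"
proof -
  define a b where "a = opnorm M" and "b = opnorm (matrix_inv M)"
  have ab: "a \<ge> 0" "b \<ge> 0" by (auto simp: a_def b_def)
  have upper: "norm (M *v x) \<le> a * norm x" for x unfolding a_def by (rule norm_matvec_le)
  have lower: "norm x \<le> b * norm (M *v x)" for x
    using norm_matvec_le[of "matrix_inv M" "M *v x"] by (simp add: b_def matrix_vector_mul_assoc matrix_inv_mult[OF M])
  define r where "r = sqrt \<bar>det (wprod A w)\<bar>"
  have simw: "norm (M *v (wprod A w *v x)) = r * norm (M *v x)" for x
    unfolding r_def using w
    by (induction w) (auto simp: sim matrix_vector_mul_assoc[symmetric] det_mul abs_mult real_sqrt_mult)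
  have r: "r \<ge> 0" by (simp add: r_def)
  have "opnorm (wprod A w) \<le> b * r * a"
  proof (rule opnorm_leI)
    fix y :: "real^2" assume y: "norm y = 1"
    have "norm (wprod A w *v y) \<le> b * (r * norm (M *v y))" using lower[of "wprod A w *v y"] simw by simp
    also have "\<dots> \<le> b * (r * (a * norm y))" using ab r upper by (intro mult_left_mono) auto
    finally show "norm (wprod A w *v y) \<le> b * r * a" using y by simp
  qed
  then have "opnorm (wprod A w) * norm x \<le> (b * r * a) * (b * norm (M *v x))"
    using lower[of x] ab r by (intro mult_mono) auto
  also have "\<dots> = (a * b * b) * (r * norm (M *v x))" by (simp add: mult_ac)
  also have "\<dots> \<le> (a * b * b) * (a * norm (wprod A w *v x))"
    using upper[of "wprod A w *v x"] simw[of x] ab by (intro mult_left_mono) auto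
  finally show ?thesis by (simp add: a_def b_def power2_eq_square mult_ac)
qed

text \<open>A single vector \<open>v0\<close> of the invariant set is a test vector for every
  product: it is expanded by \<open>w\<close>, stays in \<open>V\<close>, and is expanded again by
  \<open>u\<close>. Each expansion costs one factor \<open>c\<close>.\<close>

lemma almost_multiplicative_of_expanding_cone:
  assumes c: "c > 0" and v0: "v0 \<in> V" "v0 \<noteq> 0"
    and inv: "\<And>i x. i < N \<Longrightarrow> x \<in> V \<Longrightarrow> A i *v x \<in> V"
    and exp: "\<And>w x. set w \<subseteq> {..<N} \<Longrightarrow> x \<in> V \<Longrightarrow> c * opnorm (wprod A w) * norm x \<le> norm (wprod A w *v x)"
  shows "almost_multiplicative (gen_semigroup N A)"
proof -
  have invw: "wprod A w *v x \<in> V" if "set w \<subseteq> {..<N}" "x \<in> V" for w x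
    using that by (induction w) (auto simp: matrix_vector_mul_assoc[symmetric] inv)
  have "c\<^sup>2 * opnorm (wprod A u) * opnorm (wprod A w) \<le> opnorm (wprod A u ** wprod A w)"
    if u: "set u \<subseteq> {..<N}" and w: "set w \<subseteq> {..<N}" for u w
  proof -
    have "c * opnorm (wprod A u) * (c * opnorm (wprod A w) * norm v0) \<le> c * opnorm (wprod A u) * norm (wprod A w *v v0)"
      using c exp[OF w v0(1)] by (intro mult_left_mono) auto
    also have "\<dots> \<le> norm (wprod A u *v (wprod A w *v v0))" by (intro exp u invw w v0)
    also have "\<dots> \<le> opnorm (wprod A u ** wprod A w) * norm v0"
      using norm_matvec_le[of "wprod A u ** wprod A w" v0] by (simp add: matrix_vector_mul_assoc)
    finally have "(c\<^sup>2 * opnorm (wprod A u) * opnorm (wprod A w)) * norm v0 \<le> opnorm (wprod A u ** wprod A w) * norm v0"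
      by (simp add: power2_eq_square mult_ac)
    then show ?thesis using v0 by simp
  qed
  then show ?thesis unfolding almost_multiplicative_def gen_semigroup_def using c
    by (intro exI[of _ "c\<^sup>2"]) auto
qed

text \<open>Cut a word at its last hyperbolic letter. The conformal tail distorts norms boundedly;
  the hyperbolic letter puts the vector at a uniform distance inside the cone, where
  \<open>cone_expansion\<close> handles the arbitrary remaining product. If there is no hyperbolic
  letter, the similarity bound alone suffices.\<close>

theorem decomposable_imp_almost_multiplicative:
  assumes invA: "\<forall>i<N. invertible (A i)" and dec: "decomposable N A"
  shows "almost_multiplicative (gen_semigroup N A)"
proof -
  obtain E H where EH: "E \<union> H = {..<N}" "E \<inter> H = {}" "strongly_conformal (A ` E)"
    and HC: "H \<noteq> {} \<Longrightarrow> \<exists>C. multicone C \<and> strongly_invariant C (A ` H) \<and> (\<forall>i\<in>E. proj_act (A i) C = C)"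
    using dec unfolding decomposable_def by blast
  obtain M :: mat2 where M: "invertible M" "\<And>X. X \<in> A ` E \<Longrightarrow> orthogonal_matrix (\<bar>det X\<bar> powr (-1/2) *\<^sub>R (M ** X ** matrix_inv M))"
    using EH(3) unfolding strongly_conformal_def by blast
  have invE: "invertible (A i)" if "i \<in> E \<union> H" for i using that EH(1) invA by auto
  have sim: "norm (M *v (A i *v x)) = sqrt \<bar>det (A i)\<bar> * norm (M *v x)" if "i \<in> E" for i x
    using that by (intro strongly_conformal_norm M invE) auto
  have invM: "invertible (matrix_inv M)" using M(1) matrix_inv_mult[OF M(1)] unfolding invertible_def by blast
  define k where "k = (opnorm M * opnorm (matrix_inv M))\<^sup>2"
  have k: "k > 0" using opnorm_pos[OF M(1)] opnorm_pos[OF invM] by (simp add: k_def)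
  have expE: "opnorm (wprod A w) * norm x \<le> k * norm (wprod A w *v x)" if "set w \<subseteq> E" for w x
    unfolding k_def by (rule similarity_words_expand[OF M(1) that sim])
  show ?thesis
  proof (cases "H = {}")
    case True
    show ?thesis
    proof (rule almost_multiplicative_of_expanding_cone[of "1 / k" "axis 1 1" UNIV])
      fix w and x :: "real^2" assume "set w \<subseteq> {..<N}"
      then show "1 / k * opnorm (wprod A w) * norm x \<le> norm (wprod A w *v x)"
        using expE[of w x] True EH(1) k by (simp add: field_simps)
    qed (use k in auto)
  next
    case False
    then obtain C where C: "multicone C" "strongly_invariant C (A ` H)" "\<And>i. i \<in> E \<Longrightarrow> proj_act (A i) C = C"
      using HC by blast
    define V where "V = vecs C"
    define K1 where "K1 = V \<inter> sphere 0 1"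
    have cK1: "compact K1" unfolding K1_def V_def by (rule multicone_closed[OF C(1)])
    have Vnz: "x \<noteq> 0" if "x \<in> V" for x using that by (simp add: V_def vecs_def)
    have Vsc: "s *\<^sub>R x \<in> V" if "x \<in> V" "s \<noteq> 0" for s x using that by (simp add: V_def vecs_scaleR)
    have Vu: "(1 / norm x) *\<^sub>R x \<in> K1" if "x \<in> V" for x
      using Vsc[OF that, of "1 / norm x"] Vnz[OF that] by (simp add: K1_def)
    have VH: "A i *v x \<in> interior V" if "i \<in> H" "x \<in> V" for i x
    proof -
      have "proj_act (A i) C \<subseteq> proj_interior C" using C(2) that(1) by (auto simp: strongly_invariant_def)
      then have "A i *v x \<in> vecs (proj_interior C)" using that invE unfolding V_def by (intro proj_act_vecs[of _ C]) auto
      then show ?thesis unfolding V_def by (rule proj_interior_vecs)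
    qed
    have VE: "A i *v x \<in> V" if "i \<in> E" "x \<in> V" for i x
      using that C(3) invE unfolding V_def by (intro proj_act_vecs[of _ C]) auto
    have Vinv: "A i *v x \<in> V" if "i < N" "x \<in> V" for i x
      using that EH(1) VE VH interior_subset by (metis Un_iff lessThan_iff subsetD)
    have Vw: "wprod A w *v x \<in> V" if "set w \<subseteq> {..<N}" "x \<in> V" for w x
      using that by (induction w) (auto simp: matrix_vector_mul_assoc[symmetric] Vinv)
    have finH: "finite H" using EH(1) by (metis finite_Un finite_lessThan)
    define F where "F i x = (1 / norm (A i *v x)) *\<^sub>R (A i *v x)" for i x
    have Anz: "A i *v x \<noteq> 0" if "i \<in> H" "x \<in> V" for i x
      using that invertible_matvec_zero[of "A i" x] invE Vnz by auto
    have F_int: "F i x \<in> interior V" if "i \<in> H" "x \<in> V" for i x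
    proof -
      define s where "s = norm (A i *v x)"
      have s: "s > 0" using Anz[OF that] by (simp add: s_def)
      have sub: "(\<lambda>y. s *\<^sub>R y) -` interior V \<subseteq> V"
      proof
        fix y assume "y \<in> (\<lambda>y. s *\<^sub>R y) -` interior V"
        then have "s *\<^sub>R y \<in> V" using interior_subset by blast
        then show "y \<in> V" using Vsc[of "s *\<^sub>R y" "1 / s"] s by simp
      qed
      have "open ((\<lambda>y. s *\<^sub>R y) -` interior V)" by (intro open_vimage open_interior continuous_intros)
      moreover have "F i x \<in> (\<lambda>y. s *\<^sub>R y) -` interior V" using VH[OF that] s by (simp add: F_def s_def)
      ultimately show ?thesis using sub by (metis interiorI)
    qed
    \<comment> \<open>All normalised images of cone vectors under hyperbolic letters. It is a
      compact subset of the interior, which gives one radius \<open>d\<close> for all of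
      them.\<close>
    define K where "K = (\<Union>i\<in>H. F i ` K1)"
    have "compact K" unfolding K_def F_def
      using finH cK1 Anz by (intro compact_UN compact_continuous_image continuous_intros) (auto simp: K1_def)
    moreover have "K \<subseteq> interior V" using F_int by (auto simp: K_def K1_def)
    ultimately obtain d where d: "d > 0" "(\<Union>x\<in>K. ball x d) \<subseteq> interior V"
      using compact_subset_open_imp_ball_epsilon_subset[OF _ open_interior] by metis
    have "\<exists>L. L \<in> RP1 \<and> L \<notin> C" using C(1) by (auto simp: multicone_def)
    then obtain p0 where p0: "p0 \<noteq> 0" "span {p0} \<notin> C" by (auto simp: RP1_iff)
    define p where "p = (1 / norm p0) *\<^sub>R p0"
    have p: "norm p = 1" "p \<notin> V" using p0 by (auto simp: p_def V_def vecs_def span_scaleR_nz)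
    have "open (- K1)" using cK1 by (simp add: compact_imp_closed open_Compl)
    then obtain e where e: "e > 0" "ball p e \<subseteq> - K1" using p by (metis ComplI IntD1 K1_def open_contains_ball)
    \<comment> \<open>\<open>ball p e\<close> avoids only the unit vectors of the cone. Normalising
      a point moves it away from \<open>p\<close> by a factor of at most 2, so half the radius
      avoids the whole cone; the minimum with 1 gives \<open>\<eta> \<le> norm p\<close>.\<close>
    define \<eta> where "\<eta> = min 1 (e / 2)"
    have \<eta>: "\<eta> > 0" "\<eta> \<le> norm p" using e p by (auto simp: \<eta>_def)
    have pV: "ball p \<eta> \<inter> V = {}"
    proof (rule ccontr)
      assume "ball p \<eta> \<inter> V \<noteq> {}"
      then obtain x where x: "norm (p - x) < \<eta>" "x \<in> V" by (auto simp: dist_norm)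
      define x' where "x' = (1 / norm x) *\<^sub>R x"
      have "norm x *\<^sub>R x' = x" using Vnz[OF x(2)] by (simp add: x'_def)
      then have "x' - x = (1 - norm x) *\<^sub>R x'" by (simp add: scaleR_diff_left)
      then have "norm (x' - x) = \<bar>1 - norm x\<bar>" using Vnz[OF x(2)] by (simp add: x'_def)
      also have "\<dots> \<le> norm (p - x)" using norm_triangle_ineq3[of p x] p by simp
      finally have "norm (p - x') \<le> 2 * norm (p - x)" using norm_triangle_ineq[of "p - x" "x - x'"] by (simp add: norm_minus_commute)
      then have "x' \<in> ball p e" using x by (simp add: dist_norm \<eta>_def)
      then show False using e Vu[OF x(2)] by (auto simp: x'_def)
    qed
    define c2 where "c2 = \<eta> * d / 16"
    have c2: "c2 > 0" using \<eta> d by (simp add: c2_def)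
    define b where "b = Max (insert 1 ((\<lambda>i. opnorm (A i) * opnorm (matrix_inv (A i))) ` H))"
    have b: "opnorm (A i) * opnorm (matrix_inv (A i)) \<le> b" if "i \<in> H" for i
      unfolding b_def using finH that by (intro Max_ge) auto
    have b1: "b \<ge> 1" unfolding b_def using finH by (intro Max_ge) auto
    have expH: "opnorm (A i) * norm x \<le> b * norm (A i *v x)" if "i \<in> H" for i x
    proof -
      have "norm x = norm (matrix_inv (A i) *v (A i *v x))"
        using invE that by (simp add: matrix_vector_mul_assoc matrix_inv_mult)
      also have "\<dots> \<le> opnorm (matrix_inv (A i)) * norm (A i *v x)" by (rule norm_matvec_le)
      finally have "opnorm (A i) * norm x \<le> opnorm (A i) * (opnorm (matrix_inv (A i)) * norm (A i *v x))"
        by (intro mult_left_mono) auto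
      also have "\<dots> \<le> b * norm (A i *v x)" unfolding mult.assoc[symmetric] using b[OF that] by (intro mult_right_mono) auto
      finally show ?thesis .
    qed
    define c where "c = min (1 / k) (c2 / (b * k))"
    have c: "c > 0" using k c2 b1 by (simp add: c_def)
    have exp: "c * opnorm (wprod A w) * norm x \<le> norm (wprod A w *v x)" if w: "set w \<subseteq> {..<N}" and x: "x \<in> V" for w x
    proof (cases "\<exists>i\<in>set w. i \<in> H")
      case False
      then have "set w \<subseteq> E" using w EH by blast
      then have "1 / k * (opnorm (wprod A w) * norm x) \<le> norm (wprod A w *v x)" using expE[of w x] k by (simp add: field_simps)
      moreover have "c * (opnorm (wprod A w) * norm x) \<le> 1 / k * (opnorm (wprod A w) * norm x)"
        by (intro mult_right_mono) (auto simp: c_def)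
      ultimately show ?thesis by (simp add: mult.assoc)
    next
      case True
      \<comment> \<open>The leftmost matrices act last, so the letters \<open>e'\<close> after the
        last hyperbolic one act first on \<open>x\<close>.\<close>
      then obtain u i e' where uie: "w = u @ i # e'" "i \<in> H" "\<forall>z\<in>set e'. z \<notin> H"
        using split_list_last_prop[of w "\<lambda>i. i \<in> H"] by blast
      have sets: "set u \<subseteq> {..<N}" "set e' \<subseteq> {..<N}" "set e' \<subseteq> E" using uie w EH by auto
      define v1 where "v1 = wprod A e' *v x"
      define v2 where "v2 = A i *v v1"
      have v1: "v1 \<in> V" unfolding v1_def by (intro Vw sets x)
      have v2: "norm v2 > 0" using Anz[OF uie(2) v1] by (simp add: v2_def)
      let ?u = "(1 / norm v2) *\<^sub>R v2"
      have v1u: "F i ((1 / norm v1) *\<^sub>R v1) = ?u"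
        using Vnz[OF v1] by (simp add: F_def v2_def matrix_vector_mult_scaleR)
      have "?u \<in> K" unfolding K_def v1u[symmetric] using Vu[OF v1] uie(2) by blast
      then have ball: "ball ?u d \<subseteq> V" using d interior_subset by blast
      have "\<eta> * d / (16 * norm p) * opnorm (wprod A u) \<le> norm (wprod A u *v ?u)"
        by (rule cone_expansion[where C=V]) (use wprod_invertible[OF invA sets(1)] Vw sets(1) Vsc v2 ball pV d \<eta> in auto)
      then have "c2 * opnorm (wprod A u) * norm v2 \<le> norm (wprod A u *v ?u) * norm v2"
        using p by (intro mult_right_mono) (auto simp: c2_def)
      also have "\<dots> = norm (wprod A u *v v2)" using v2 by (simp add: matrix_vector_mult_scaleR)
      also have "\<dots> = norm (wprod A w *v x)"
        by (simp add: uie v2_def v1_def wprod_append matrix_vector_mul_assoc[symmetric])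
      finally have 1: "c2 * opnorm (wprod A u) * norm v2 \<le> norm (wprod A w *v x)" .
      have "opnorm (wprod A w) \<le> opnorm (wprod A u) * (opnorm (A i) * opnorm (wprod A e'))"
        unfolding uie wprod_append wprod_Cons
        by (rule order_trans[OF opnorm_mult_le]) (intro mult_left_mono opnorm_mult_le opnorm_nonneg)
      then have "opnorm (wprod A w) * norm x \<le> opnorm (wprod A u) * (opnorm (A i) * opnorm (wprod A e')) * norm x"
        by (intro mult_right_mono) auto
      also have "\<dots> = opnorm (wprod A u) * (opnorm (A i) * (opnorm (wprod A e') * norm x))" by simp
      also have "\<dots> \<le> opnorm (wprod A u) * (opnorm (A i) * (k * norm v1))"
        unfolding v1_def by (intro mult_left_mono expE sets) auto
      also have "\<dots> = k * opnorm (wprod A u) * (opnorm (A i) * norm v1)" by simp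
      also have "\<dots> \<le> k * opnorm (wprod A u) * (b * norm v2)"
        unfolding v2_def using k by (intro mult_left_mono expH uie mult_nonneg_nonneg) auto
      finally have 2: "opnorm (wprod A w) * norm x \<le> k * opnorm (wprod A u) * (b * norm v2)" .
      have "c * (opnorm (wprod A w) * norm x) \<le> c2 / (b * k) * (opnorm (wprod A w) * norm x)"
        by (intro mult_right_mono) (auto simp: c_def)
      also have "\<dots> \<le> c2 / (b * k) * (k * opnorm (wprod A u) * (b * norm v2))"
        using c2 b1 k by (intro mult_left_mono 2) auto
      also have "\<dots> = c2 * opnorm (wprod A u) * norm v2" using b1 k by simp
      finally show ?thesis using 1 by (simp add: mult.assoc)
    qed
    have "C \<noteq> {}" using C(1) by (force simp: multicone_def closed_proj_interval_def)
    then obtain L where "L \<in> C" by blast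
    moreover have "C \<subseteq> RP1" using C(1) by (auto simp: multicone_def)
    ultimately obtain v0 where "v0 \<noteq> 0" "L = span {v0}" using RP1_iff[of L] by blast
    then have "v0 \<in> V" using \<open>L \<in> C\<close> by (simp add: V_def vecs_def)
    then show ?thesis using c exp Vinv Vnz by (intro almost_multiplicative_of_expanding_cone[of c v0 V]) auto
  qed
qed

section \<open>Bounded semigroups are conformal\<close>

lemma mat2_eq_iff: "X = Y \<longleftrightarrow> X$1$1 = Y$1$1 \<and> X$1$2 = Y$1$2 \<and> X$2$1 = Y$2$1 \<and> X$2$2 = Y$2$2" for X Y :: mat2
  by (auto simp: vec_eq_iff forall_2)

lemma matmul2: "(X ** Y) $ i $ j = X$i$1 * Y$1$j + X$i$2 * Y$2$j" for X Y :: mat2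
  by (simp add: matrix_matrix_mult_def sum_2)

lemma transpose_nth: "transpose X $ i $ j = X $ j $ i" for X :: mat2
  by (simp add: transpose_def)

lemma det_scaleR2: "det (c *\<^sub>R X) = c\<^sup>2 * det X" for X :: mat2
  by (simp add: det_2 power2_eq_square algebra_simps)

lemma norm_mat2_le: "norm X \<le> \<bar>X$1$1\<bar> + \<bar>X$1$2\<bar> + \<bar>X$2$1\<bar> + \<bar>X$2$2\<bar>" for X :: mat2
proof -
  have "norm X \<le> (\<Sum>i\<in>UNIV. norm (X$i))" unfolding norm_vec_def[of X] by (rule L2_set_le_sum) simp
  also have "\<dots> = norm (X$1) + norm (X$2)" by (simp add: sum_2)
  also have "\<dots> \<le> (\<bar>X$1$1\<bar> + \<bar>X$1$2\<bar>) + (\<bar>X$2$1\<bar> + \<bar>X$2$2\<bar>)"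
    using norm_le_l1_cart[of "X$1"] norm_le_l1_cart[of "X$2"] by (intro add_mono) (simp_all add: sum_2)
  finally show ?thesis by simp
qed

lemma gram_entry_bound: "\<bar>(transpose X ** X) $ i $ j\<bar> \<le> (opnorm X)\<^sup>2" for X :: mat2
proof -
  have "(transpose X ** X) $ i $ j = (X *v axis i 1) \<bullet> (X *v axis j 1)"
    using exhaust_2[of i] exhaust_2[of j] by (auto simp: matmul2 transpose_nth inner_vec2 matvec2 axis_def)
  also have "\<bar>\<dots>\<bar> \<le> norm (X *v axis i 1) * norm (X *v axis j 1)" by (rule Cauchy_Schwarz_ineq2)
  also have "\<dots> \<le> opnorm X * opnorm X"
    using norm_matvec_le[of X "axis i 1"] norm_matvec_le[of X "axis j 1"] by (intro mult_mono) auto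
  finally show ?thesis by (simp add: power2_eq_square)
qed

text \<open>Strict concavity of $\sqrt{\det}$ on positive forms, via
  $a a' (\mathrm{mixed} - 2 D) = D (a - a')^2 + (a b' - a' b)^2$.\<close>

lemma det_midpoint_rigid:
  fixes a b c a' b' c' D :: real
  assumes D: "D > 0" "a * c - b\<^sup>2 = D" "a' * c' - b'\<^sup>2 = D" and a: "a > 0" "a' > 0"
    and mid: "(a + a') / 2 * ((c + c') / 2) - ((b + b') / 2)\<^sup>2 \<le> D"
  shows "a = a' \<and> b = b' \<and> c = c'"
proof -
  have mix: "a * c' + c * a' - 2 * b * b' \<le> 2 * D"
  proof -
    have "4 * ((a + a') / 2 * ((c + c') / 2) - ((b + b') / 2)\<^sup>2) = (a * c - b\<^sup>2) + (a' * c' - b'\<^sup>2) + (a * c' + c * a' - 2 * b * b')"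
      by (simp add: power2_eq_square field_simps)
    moreover have "4 * ((a + a') / 2 * ((c + c') / 2) - ((b + b') / 2)\<^sup>2) \<le> 4 * D"
      using mid by (intro mult_left_mono) auto
    ultimately have "D + D + (a * c' + c * a' - 2 * b * b') \<le> 4 * D" using D(2,3) by (simp only:)
    then show ?thesis by simp
  qed
  have "D * (a - a')\<^sup>2 + (a * b' - a' * b)\<^sup>2 = a * a' * (a * c' + c * a' - 2 * b * b' - 2 * D)"
  proof -
    have e: "a * c = D + b\<^sup>2" "a' * c' = D + b'\<^sup>2" using D by auto
    have "a * a' * (a * c' + c * a' - 2 * b * b' - 2 * D) = a\<^sup>2 * (a' * c') + a'\<^sup>2 * (a * c) - 2 * a * a' * b * b' - 2 * D * a * a'"
      by (simp add: power2_eq_square algebra_simps)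
    also have "\<dots> = D * (a - a')\<^sup>2 + (a * b' - a' * b)\<^sup>2"
      unfolding e by (simp add: power2_eq_square algebra_simps)
    finally show ?thesis by simp
  qed
  also have "\<dots> \<le> 0" using mix a by (intro mult_nonneg_nonpos) auto
  finally have le: "D * (a - a')\<^sup>2 + (a * b' - a' * b)\<^sup>2 \<le> 0" .
  have "D * (a - a')\<^sup>2 \<ge> 0" "(a * b' - a' * b)\<^sup>2 \<ge> 0" using D by auto
  then have "D * (a - a')\<^sup>2 = 0" "(a * b' - a' * b)\<^sup>2 = 0" using le by linarith+
  then have aa: "a = a'" and "a * b' = a' * b" using D by auto
  then have bb: "b = b'" using a by simp
  have "a' * c = a' * c'" using D(2,3) unfolding aa bb by linarith
  then show ?thesis using aa bb a by simp
qed

text \<open>The map \<open>T\<close> belonging to a letter preserves determinants and the convex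
  compact set \<open>Q\<close>. So \<open>T g\<close> is another form of maximal determinant, the
  midpoint of \<open>g\<close> and \<open>T g\<close> lies in \<open>Q\<close>, and
  \<open>det_midpoint_rigid\<close> forces them to agree. The bound on the words is what makes
  \<open>Q\<close> compact.\<close>

lemma bounded_semigroup_invariant_form:
  fixes A :: "nat \<Rightarrow> mat2"
  assumes inv: "\<And>i. i \<in> E \<Longrightarrow> invertible (A i)" and c0: "c0 > 0"
    and bd: "\<And>w. set w \<subseteq> E \<Longrightarrow> c0 * (opnorm (wprod A w))\<^sup>2 \<le> \<bar>det (wprod A w)\<bar>"
  shows "\<exists>g. g$1$2 = g$2$1 \<and> g$1$1 > 0 \<and> det g > 0 \<and> (\<forall>i\<in>E. transpose (A i) ** g ** A i = \<bar>det (A i)\<bar> *\<^sub>R g)"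
proof -
  define gr where "gr X = (1 / \<bar>det X\<bar>) *\<^sub>R (transpose X ** X)" for X :: mat2
  define Q0 where "Q0 = {gr (wprod A w) | w. set w \<subseteq> E}"
  define Q where "Q = closure (convex hull Q0)"
  have invw: "invertible (wprod A w)" if "set w \<subseteq> E" for w
    using that by (induction w) (auto simp: inv invertible_mult invertible_mat_1)
  have one: "mat 1 \<in> Q0" unfolding Q0_def by (auto intro!: exI[of _ "[]"] simp: gr_def)
  have bdQ0: "bounded Q0"
  proof -
    have "norm g \<le> 4 / c0" if "g \<in> Q0" for g
    proof -
      from that obtain w where w: "set w \<subseteq> E" "g = gr (wprod A w)" by (auto simp: Q0_def)
      let ?X = "wprod A w"
      have d: "\<bar>det ?X\<bar> > 0" using invw[OF w(1)] by (simp add: invertible_det_nz)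
      have "\<bar>g $ i $ j\<bar> \<le> 1 / c0" for i j
      proof -
        have "\<bar>g $ i $ j\<bar> = \<bar>(transpose ?X ** ?X) $ i $ j\<bar> / \<bar>det ?X\<bar>" by (simp add: w gr_def abs_mult)
        also have "\<dots> \<le> (opnorm ?X)\<^sup>2 / \<bar>det ?X\<bar>" using d by (intro divide_right_mono gram_entry_bound) auto
        also have "\<dots> \<le> 1 / c0" using bd[OF w(1)] d c0 by (simp add: field_simps)
        finally show ?thesis .
      qed
      then have "norm g \<le> 1 / c0 + 1 / c0 + 1 / c0 + 1 / c0"
        by (intro order_trans[OF norm_mat2_le] add_mono)
      then show ?thesis by simp
    qed
    then show ?thesis unfolding bounded_iff by blast
  qed
  have cQ: "compact Q" unfolding Q_def using bdQ0 by (simp add: bounded_convex_hull)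
  have convQ: "convex Q" unfolding Q_def by (intro convex_closure convex_convex_hull)
  have Q0Q: "Q0 \<subseteq> Q" unfolding Q_def using hull_subset[of Q0 convex] closure_subset by blast
  \<comment> \<open>Closed convex conditions that survive the passage to the closed hull. Together
    with a positive determinant they make a form positive definite.\<close>
  define P where "P = {g::mat2. g$1$2 = g$2$1 \<and> g$1$1 \<ge> 0}"
  have "convex P" unfolding P_def by (auto simp: convex_def intro!: add_nonneg_nonneg mult_nonneg_nonneg)
  moreover have "closed P" unfolding P_def
    by (intro closed_Collect_conj closed_Collect_eq closed_Collect_le continuous_intros)
  moreover have "Q0 \<subseteq> P" by (auto simp: Q0_def P_def gr_def matmul2 transpose_nth)
  ultimately have QP: "Q \<subseteq> P" unfolding Q_def by (meson closure_minimal hull_minimal)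
  have contd: "continuous_on Q det" unfolding det_2 by (intro continuous_intros)
  have "\<exists>g\<in>Q. \<forall>g'\<in>Q. det g' \<le> det g"
    by (rule continuous_attains_sup[OF cQ _ contd]) (use one Q0Q in auto)
  then obtain g where g: "g \<in> Q" "\<And>g'. g' \<in> Q \<Longrightarrow> det g' \<le> det g" by blast
  \<comment> \<open>The empty word contributes the identity matrix, so the maximal determinant is at
    least 1 and \<open>g\<close> is nondegenerate.\<close>
  have dg: "det g \<ge> 1" using g(2)[of "mat 1"] one Q0Q by auto
  have pos: "h$1$1 > 0" if "h \<in> Q" "det h > 0" for h
  proof -
    have h: "h$1$2 = h$2$1" "h$1$1 \<ge> 0" using that QP by (auto simp: P_def)
    have "h$1$1 \<noteq> 0"
    proof
      assume "h$1$1 = 0"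
      then have "det h = - (h$2$1)\<^sup>2" using h by (simp add: det_2 power2_eq_square)
      then show False using that(2) by (smt (verit) zero_le_power2)
    qed
    then show ?thesis using h by simp
  qed
  have fixed: "transpose (A i) ** g ** A i = \<bar>det (A i)\<bar> *\<^sub>R g" if i: "i \<in> E" for i
  proof -
    define T where "T h = (1 / \<bar>det (A i)\<bar>) *\<^sub>R (transpose (A i) ** h ** A i)" for h
    have di: "\<bar>det (A i)\<bar> > 0" using inv[OF i] by (simp add: invertible_det_nz)
    have lin: "linear T"
      by (rule linearI) (simp_all add: T_def mat2_eq_iff matmul2 algebra_simps add_divide_distrib)
    have "T ` Q0 \<subseteq> Q0"
    proof
      fix h assume "h \<in> T ` Q0"
      then obtain w where w: "set w \<subseteq> E" "h = T (gr (wprod A w))" by (auto simp: Q0_def)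
      \<comment> \<open>Conjugating a Gram matrix by the letter amounts to appending that letter on
        the right of the word.\<close>
      have "h = gr (wprod A (w @ [i]))"
      proof -
        have sc: "X ** (k *\<^sub>R Y) ** Z = k *\<^sub>R (X ** Y ** Z)" for k and X Y Z :: mat2
          by (simp add: mat2_eq_iff matmul2 algebra_simps)
        show ?thesis unfolding w T_def gr_def wprod_append sc
          by (simp add: det_mul abs_mult matrix_transpose_mul matrix_mul_assoc mult.commute)
      qed
      then show "h \<in> Q0" using w(1) i by (auto simp: Q0_def intro!: exI[of _ "w @ [i]"])
    qed
    then have "T ` (convex hull Q0) \<subseteq> convex hull Q0"
      using convex_hull_linear_image[OF lin, of Q0] hull_mono by metis
    then have "T ` Q \<subseteq> Q" unfolding Q_def
      using closure_subset[of "convex hull Q0"]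
      by (intro image_closure_subset linear_continuous_on) (auto simp: linear_linear lin)
    then have Tg: "T g \<in> Q" using g by blast
    have "det (T g) = det g" unfolding T_def det_scaleR2 using di
      by (simp add: det_mul power_divide power2_eq_square)
    define h where "h = (1/2) *\<^sub>R g + (1/2) *\<^sub>R T g"
    have "h \<in> Q" unfolding h_def using convQ g(1) Tg by (intro convexD) auto
    then have "det h \<le> det g" by (rule g(2))
    have gP: "g$1$2 = g$2$1" "T g$1$2 = T g$2$1" using g(1) Tg QP by (auto simp: P_def)
    have "g$1$1 = T g$1$1 \<and> g$1$2 = T g$1$2 \<and> g$2$2 = T g$2$2"
    proof (rule det_midpoint_rigid[of "det g"])
      show "det g > 0" using dg by simp
      show "g$1$1 * g$2$2 - (g$1$2)\<^sup>2 = det g" using gP by (simp add: det_2 power2_eq_square)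
      show "T g$1$1 * T g$2$2 - (T g$1$2)\<^sup>2 = det g"
        using gP \<open>det (T g) = det g\<close> by (simp add: det_2 power2_eq_square)
      show "g$1$1 > 0" "T g$1$1 > 0" using pos g(1) Tg dg \<open>det (T g) = det g\<close> by auto
      have "det h = (g$1$1 + T g$1$1) / 2 * ((g$2$2 + T g$2$2) / 2) - ((g$1$2 + T g$1$2) / 2)\<^sup>2"
        using gP by (simp add: h_def det_2 power2_eq_square add_divide_distrib)
      then show "(g$1$1 + T g$1$1) / 2 * ((g$2$2 + T g$2$2) / 2) - ((g$1$2 + T g$1$2) / 2)\<^sup>2 \<le> det g"
        using \<open>det h \<le> det g\<close> by simp
    qed
    then have "T g = g" using gP by (simp add: mat2_eq_iff)
    then have "\<bar>det (A i)\<bar> *\<^sub>R T g = \<bar>det (A i)\<bar> *\<^sub>R g" by simp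
    then show ?thesis using di by (simp add: T_def)
  qed
  show ?thesis using fixed QP g(1) dg pos[OF g(1)] by (intro exI[of _ g]) (auto simp: P_def)
qed

text \<open>\<open>M\<close> is the upper triangular Cholesky factor of the invariant form, so
  invariance of \<open>g\<close> becomes orthogonality after conjugation with \<open>M\<close> and
  normalisation of the determinant.\<close>

lemma bounded_semigroup_strongly_conformal:
  fixes A :: "nat \<Rightarrow> mat2"
  assumes inv: "\<And>i. i \<in> E \<Longrightarrow> invertible (A i)" and c0: "c0 > 0"
    and bd: "\<And>w. set w \<subseteq> E \<Longrightarrow> c0 * (opnorm (wprod A w))\<^sup>2 \<le> \<bar>det (wprod A w)\<bar>"
  shows "strongly_conformal (A ` E)"
proof -
  obtain g where g: "g$1$2 = g$2$1" "g$1$1 > 0" "det g > 0"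
    and fixed: "\<And>i. i \<in> E \<Longrightarrow> transpose (A i) ** g ** A i = \<bar>det (A i)\<bar> *\<^sub>R g"
    using bounded_semigroup_invariant_form[OF assms] by blast
  define a where "a = g$1$1"
  define M :: mat2 where "M = vector [vector [sqrt a, g$1$2 / sqrt a], vector [0, sqrt (det g / a)]]"
  have a: "a > 0" using g by (simp add: a_def)
  have M: "M$1$1 = sqrt a" "M$1$2 = g$1$2 / sqrt a" "M$2$1 = 0" "M$2$2 = sqrt (det g / a)"
    by (simp_all add: M_def)
  have MM: "transpose M ** M = g"
  proof -
    have "(g$1$2)\<^sup>2 / a + det g / a = g$2$2" using a g by (simp add: a_def det_2 power2_eq_square field_simps)
    then show ?thesis using a g by (simp add: mat2_eq_iff matmul2 transpose_nth M a_def power2_eq_square)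
  qed
  have "det M = sqrt a * sqrt (det g / a)" by (simp add: det_2 M)
  also have "\<dots> > 0" using a g by simp
  finally have invM: "invertible M" by (simp add: invertible_det_nz)
  have "orthogonal_matrix (\<bar>det (A i)\<bar> powr (-1/2) *\<^sub>R (M ** A i ** matrix_inv M))" if i: "i \<in> E" for i
  proof -
    define c where "c = \<bar>det (A i)\<bar> powr (-1/2)"
    define W where "W = matrix_inv M"
    have MW: "M ** W = mat 1" using matrix_inv_mult[OF invM] by (simp add: W_def)
    have di: "\<bar>det (A i)\<bar> > 0" using inv[OF i] by (simp add: invertible_det_nz)
    have "c * c = \<bar>det (A i)\<bar> powr (-1)" by (simp add: c_def powr_add[symmetric])
    then have cc: "c * c * \<bar>det (A i)\<bar> = 1" using di by (simp add: powr_minus)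
    have tr: "transpose (c *\<^sub>R X) = c *\<^sub>R transpose X" for X :: mat2 by (simp add: mat2_eq_iff transpose_nth)
    have sc: "(c *\<^sub>R X) ** (c *\<^sub>R Y) = (c * c) *\<^sub>R (X ** Y)" for X Y :: mat2 by (simp add: mat2_eq_iff matmul2 algebra_simps)
    have "transpose (c *\<^sub>R (M ** A i ** W)) ** (c *\<^sub>R (M ** A i ** W)) =
        (c * c) *\<^sub>R (transpose W ** (transpose (A i) ** (transpose M ** M) ** A i) ** W)"
      by (simp add: tr sc matrix_transpose_mul matrix_mul_assoc)
    also have "\<dots> = (c * c * \<bar>det (A i)\<bar>) *\<^sub>R (transpose W ** (transpose M ** M) ** W)"
      unfolding MM fixed[OF i] by (simp add: mat2_eq_iff matmul2 algebra_simps)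
    also have "transpose W ** (transpose M ** M) ** W = transpose (M ** W) ** (M ** W)"
      by (simp add: matrix_transpose_mul matrix_mul_assoc)
    finally have "transpose (c *\<^sub>R (M ** A i ** W)) ** (c *\<^sub>R (M ** A i ** W)) = mat 1"
      using cc MW by simp
    then show ?thesis unfolding c_def W_def by (simp add: orthogonal_matrix)
  qed
  then show ?thesis unfolding strongly_conformal_def using invM by blast
qed

section \<open>Dominated semigroups\<close>

lemma abs_entry_le_opnorm: "\<bar>X $ i $ j\<bar> \<le> opnorm X" for X :: mat2
proof -
  have "X $ i $ j = (X *v axis j 1) $ i"
    using exhaust_2[of i] exhaust_2[of j] by (auto simp: matvec2 axis_def)
  then show ?thesis using component_le_norm_cart[of "X *v axis j 1" i] norm_matvec_le[of X "axis j 1"] by simp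
qed

lemma opnorm_le_norm: "opnorm X \<le> 4 * norm X" for X :: mat2
proof (rule opnorm_leI)
  fix x :: "real^2" assume x: "norm x = 1"
  have e: "\<bar>X$i$j\<bar> \<le> norm X" for i j
    using component_le_norm_cart[of "X$i" j] Finite_Cartesian_Product.norm_nth_le[of X i] by linarith
  have xj: "\<bar>x$j\<bar> \<le> 1" for j using component_le_norm_cart[of x j] x by simp
  have t: "\<bar>X$i$j * x$j\<bar> \<le> norm X" for i j
    using mult_mono[OF e[of i j] xj[of j]] by (simp add: abs_mult)
  have "norm (X *v x) \<le> \<bar>(X *v x)$1\<bar> + \<bar>(X *v x)$2\<bar>" using norm_le_l1_cart[of "X *v x"] by (simp add: sum_2)
  also have "\<dots> \<le> 4 * norm X" unfolding matvec2
    using t[of 1 1] t[of 1 2] t[of 2 1] t[of 2 2] by linarith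
  finally show "norm (X *v x) \<le> 4 * norm X" .
qed

lemma opnorm_tendsto:
  assumes "f \<longlonglongrightarrow> (Y::mat2)" shows "(\<lambda>n. opnorm (f n)) \<longlonglongrightarrow> opnorm Y"
proof -
  have "(\<lambda>n. f n - Y) \<longlonglongrightarrow> 0" using assms by (simp add: LIM_zero)
  then have l: "(\<lambda>n. 4 * norm (f n - Y)) \<longlonglongrightarrow> 0" using tendsto_norm_zero tendsto_mult_right_zero by blast
  have "norm (opnorm (f n) - opnorm Y) \<le> 4 * norm (f n - Y)" for n
    using opnorm_diff_le[of "f n" Y] opnorm_diff_le[of Y "f n"] opnorm_le_norm[of "f n - Y"] opnorm_le_norm[of "Y - f n"]
    by (simp add: norm_minus_commute)
  then have "(\<lambda>n. opnorm (f n) - opnorm Y) \<longlonglongrightarrow> 0" by (intro Lim_null_comparison[OF always_eventually l]) auto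
  then show ?thesis by (simp add: LIM_zero_iff)
qed

text \<open>\<open>Y\<close> maps the unit disc onto a segment of the line through
  \<open>x0\<close>, with \<open>x0\<close> at its end. The norm of \<open>X ** Y\<close> is
  therefore controlled by the action of \<open>X\<close> on this one vector.\<close>

lemma rank_one_image_expands:
  assumes "opnorm Y = 1" "det Y = 0"
  shows "\<exists>x0. norm x0 = 1 \<and> (\<forall>X. opnorm (X ** Y) \<le> norm (X *v x0))"
proof -
  obtain v where v: "norm v = 1" "norm (Y *v v) = 1" using opnorm_attained[of Y] assms by auto
  define x0 where "x0 = Y *v v"
  have "opnorm (X ** Y) \<le> norm (X *v x0)" for X
  proof (rule opnorm_leI)
    fix y :: "real^2" assume y: "norm y = 1"
    have "wedge x0 (Y *v y) = 0" using assms by (simp add: x0_def wedge_matvec)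
    moreover have "x0 \<noteq> 0" using v(2) by (auto simp: x0_def)
    ultimately obtain t where t: "Y *v y = t *\<^sub>R x0" using wedge_zero_imp_parallel[of x0 "Y *v y"] by blast
    have "\<bar>t\<bar> = norm (Y *v y)" using t v by (simp add: x0_def)
    also have "\<dots> \<le> 1" using norm_matvec_le[of Y y] assms y by simp
    finally have "\<bar>t\<bar> \<le> 1" .
    have "norm ((X ** Y) *v y) = \<bar>t\<bar> * norm (X *v x0)"
      by (simp add: matrix_vector_mul_assoc[symmetric] t matrix_vector_mult_scaleR)
    also have "\<dots> \<le> 1 * norm (X *v x0)" using \<open>\<bar>t\<bar> \<le> 1\<close> by (intro mult_right_mono) auto
    finally show "norm ((X ** Y) *v y) \<le> norm (X *v x0)" by simp
  qed
  then show ?thesis using v x0_def by blast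
qed

text \<open>The sine distance of unit vectors is at most their Euclidean distance, so separated sets
  are controlled by a finite cover of the circle by balls of radius
  \<open>\<eta> / 2\<close>.\<close>

lemma separated_card_bound:
  assumes "\<eta> > 0"
  shows "\<exists>K. \<forall>S::(real^2) set. finite S \<and> S \<subseteq> sphere 0 1 \<and> (\<forall>x\<in>S. \<forall>y\<in>S. x \<noteq> y \<longrightarrow> \<eta> \<le> \<bar>wedge x y\<bar>) \<longrightarrow> card S \<le> K"
proof -
  have "compact (sphere (0::real^2) 1)" by simp
  then obtain k where k: "finite k" "sphere (0::real^2) 1 \<subseteq> (\<Union>x\<in>k. ball x (\<eta> / 2))"
    using compact_eq_totally_bounded assms by (metis half_gt_zero)
  have "card S \<le> card k" if S: "finite S" "S \<subseteq> sphere 0 1" "\<And>x y. x \<in> S \<Longrightarrow> y \<in> S \<Longrightarrow> x \<noteq> y \<Longrightarrow> \<eta> \<le> \<bar>wedge x y\<bar>" for S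
  proof -
    have "\<forall>x\<in>S. \<exists>c\<in>k. dist c x < \<eta> / 2" using S(2) k(2) by fastforce
    then obtain f where f: "\<And>x. x \<in> S \<Longrightarrow> f x \<in> k \<and> dist (f x) x < \<eta> / 2" by metis
    have "inj_on f S"
    proof (rule inj_onI, rule ccontr)
      fix x y assume xy: "x \<in> S" "y \<in> S" "f x = f y" "x \<noteq> y"
      have "dist x y < \<eta>" using f[OF xy(1)] f[OF xy(2)] xy(3) by (metis dist_commute dist_triangle_half_r)
      moreover have "\<bar>wedge x y\<bar> \<le> dist x y"
      proof -
        have "wedge x y = wedge (x - y) y" by (simp add: wedge_diff)
        then show ?thesis using abs_wedge_le[of "x - y" y] xy S(2) by (auto simp: dist_norm)
      qed
      ultimately show False using S(3)[OF xy(1,2,4)] by linarith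
    qed
    then show ?thesis using f k(1) by (intro card_inj_on_le[of f]) auto
  qed
  then show ?thesis by (intro exI[of _ "card k"] allI impI) (elim conjE, simp)
qed

locale almost_mult_tuple =
  fixes N :: nat and A :: "nat \<Rightarrow> mat2" and \<kappa> :: real
  assumes invA: "\<And>i. i < N \<Longrightarrow> invertible (A i)"
    and \<kappa>: "0 < \<kappa>" "\<kappa> \<le> 1"
    and am: "set u \<subseteq> {..<N} \<Longrightarrow> set w \<subseteq> {..<N} \<Longrightarrow>
      \<kappa> * opnorm (wprod A u) * opnorm (wprod A w) \<le> opnorm (wprod A (u @ w))"
begin

abbreviation wd :: "nat list \<Rightarrow> bool" where "wd w \<equiv> set w \<subseteq> {..<N}"

lemma invw: "wd w \<Longrightarrow> invertible (wprod A w)"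
  using wprod_invertible[of N A w] invA by blast

lemma op_pos: "wd w \<Longrightarrow> opnorm (wprod A w) > 0"
  using invw opnorm_pos by blast

text \<open>The ratio of the smaller to the larger singular value. It measures how strongly the
  product contracts the projective line: small q means nearly rank one.\<close>

definition q :: "nat list \<Rightarrow> real" where "q w = \<bar>det (wprod A w)\<bar> / (opnorm (wprod A w))\<^sup>2"

lemma q_pos: "wd w \<Longrightarrow> q w > 0"
  unfolding q_def using invw op_pos by (intro divide_pos_pos zero_less_power) (auto simp: invertible_det_nz)

lemma q_le_1: "wd w \<Longrightarrow> q w \<le> 1"
  using op_pos[of w] abs_det_le[of "wprod A w"] by (simp add: q_def)

lemma det_q: "wd w \<Longrightarrow> \<bar>det (wprod A w)\<bar> = q w * (opnorm (wprod A w))\<^sup>2"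
  using op_pos[of w] by (simp add: q_def)

lemma q_append: assumes "wd u" "wd w" shows "q (u @ w) \<le> q u * q w / \<kappa>\<^sup>2"
proof -
  have p: "\<kappa> * opnorm (wprod A u) * opnorm (wprod A w) > 0" using op_pos assms \<kappa> by simp
  have p3: "opnorm (wprod A (u @ w)) > 0" using assms by (intro op_pos) auto
  have "(\<kappa> * opnorm (wprod A u) * opnorm (wprod A w))\<^sup>2 \<le> (opnorm (wprod A (u @ w)))\<^sup>2"
    using am[OF assms] p by (intro power_mono) auto
  then have "q (u @ w) \<le> \<bar>det (wprod A (u @ w))\<bar> / (\<kappa> * opnorm (wprod A u) * opnorm (wprod A w))\<^sup>2"
    unfolding q_def by (rule divide_left_mono[OF _ abs_ge_zero mult_pos_pos[OF zero_less_power[OF p3] zero_less_power[OF p]]])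
  also have "\<dots> = q u * q w / \<kappa>\<^sup>2"
    by (simp add: q_def wprod_append det_mul abs_mult power_mult_distrib)
  finally show ?thesis .
qed

text \<open>Norm-one multiples of products with q tending to 0 have, along a subsequence, a limit
  \<open>Y\<close> of rank one. Multiplying them on the left by a word loses at most the factor
  \<open>\<kappa>\<close>, this passes to the limit, and \<open>rank_one_image_expands\<close>
  converts it to a vector.\<close>

lemma exists_expanded_vector:
  assumes unb: "\<And>c. c > 0 \<Longrightarrow> \<exists>w. wd w \<and> q w < c"
  shows "\<exists>x0. norm x0 = 1 \<and> (\<forall>w. wd w \<longrightarrow> \<kappa> * opnorm (wprod A w) \<le> norm (wprod A w *v x0))"
proof -
  have "\<forall>n. \<exists>w. wd w \<and> q w < 1 / Suc n" using unb by simp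
  then obtain ws where ws: "\<And>n. wd (ws n)" "\<And>n. q (ws n) < 1 / Suc n" by metis
  define B where "B n = (1 / opnorm (wprod A (ws n))) *\<^sub>R wprod A (ws n)" for n
  have oB: "opnorm (B n) = 1" for n using op_pos[OF ws(1)[of n]] by (simp add: B_def opnorm_scaleR)
  have dB: "\<bar>det (B n)\<bar> = q (ws n)" for n by (simp add: B_def det_scaleR2 q_def abs_mult power_divide)
  have "norm (B n) \<le> 4" for n
    using norm_mat2_le[of "B n"] abs_entry_le_opnorm[of "B n" 1 1] abs_entry_le_opnorm[of "B n" 1 2]
      abs_entry_le_opnorm[of "B n" 2 1] abs_entry_le_opnorm[of "B n" 2 2] oB[of n] by linarith
  then have "\<forall>n. B n \<in> cball 0 4" by simp
  then obtain Y r where r: "strict_mono r" "(B \<circ> r) \<longlonglongrightarrow> Y"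
    using compact_cball[of "0::mat2" 4] unfolding compact_def by metis
  have oY: "opnorm Y = 1"
  proof -
    have "(\<lambda>n. opnorm ((B \<circ> r) n)) \<longlonglongrightarrow> opnorm Y" by (rule opnorm_tendsto[OF r(2)])
    then have "(\<lambda>n. 1::real) \<longlonglongrightarrow> opnorm Y" by (simp add: oB)
    then show ?thesis using LIMSEQ_unique tendsto_const by metis
  qed
  have dY: "det Y = 0"
  proof -
    have "(\<lambda>n. det ((B \<circ> r) n)) \<longlonglongrightarrow> det Y" unfolding det_2 by (intro tendsto_intros r(2))
    moreover have "(\<lambda>n. det (B n)) \<longlonglongrightarrow> 0"
    proof (rule Lim_null_comparison[OF always_eventually])
      show "\<forall>n. norm (det (B n)) \<le> 1 / Suc n" using ws(2) dB by (simp add: less_imp_le)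
      show "(\<lambda>n. 1 / real (Suc n)) \<longlonglongrightarrow> 0" by (rule LIMSEQ_Suc[OF lim_const_over_n])
    qed
    then have "(\<lambda>n. det ((B \<circ> r) n)) \<longlonglongrightarrow> 0" using LIMSEQ_subseq_LIMSEQ[OF _ r(1)] by (simp add: o_def)
    ultimately show ?thesis using LIMSEQ_unique by blast
  qed
  obtain x0 where x0: "norm x0 = 1" "\<And>X. opnorm (X ** Y) \<le> norm (X *v x0)"
    using rank_one_image_expands[OF oY dY] by blast
  have "\<kappa> * opnorm (wprod A w) \<le> norm (wprod A w *v x0)" if w: "wd w" for w
  proof -
    have "(\<lambda>n. wprod A w ** (B \<circ> r) n) \<longlonglongrightarrow> wprod A w ** Y"
    proof (intro vec_tendstoI)
      fix i j show "(\<lambda>n. (wprod A w ** (B \<circ> r) n) $ i $ j) \<longlonglongrightarrow> (wprod A w ** Y) $ i $ j"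
        unfolding matmul2 by (intro tendsto_intros r(2))
    qed
    then have l: "(\<lambda>n. opnorm (wprod A w ** (B \<circ> r) n)) \<longlonglongrightarrow> opnorm (wprod A w ** Y)" by (rule opnorm_tendsto)
    have "\<kappa> * opnorm (wprod A w) \<le> opnorm (wprod A w ** B n)" for n
    proof -
      have sc: "X ** (k *\<^sub>R Y) = k *\<^sub>R (X ** Y)" for k and X Y :: mat2 by (simp add: mat2_eq_iff matmul2 algebra_simps)
      have "opnorm (wprod A w ** B n) = opnorm (wprod A (w @ ws n)) / opnorm (wprod A (ws n))"
        unfolding B_def sc opnorm_scaleR wprod_append by simp
      then show ?thesis using am[OF w ws(1)[of n]] by (simp only: pos_le_divide_eq[OF op_pos[OF ws(1)[of n]]])
    qed
    then have "\<kappa> * opnorm (wprod A w) \<le> opnorm (wprod A w ** Y)" by (intro LIMSEQ_le_const[OF l]) auto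
    then show ?thesis using x0(2)[of "wprod A w"] by linarith
  qed
  then show ?thesis using x0 by blast
qed

end

text \<open>\<open>x0_moves\<close> guarantees that the orbit cone contains two different lines,
  which gives the area argument of \<open>E_bounded\<close> something to compare.\<close>

locale dominated_tuple = almost_mult_tuple +
  fixes x0 :: "real^2"
  assumes x0_unit: "norm x0 = 1"
    and x0_exp: "wd w \<Longrightarrow> \<kappa> * opnorm (wprod A w) \<le> norm (wprod A w *v x0)"
    and x0_moves: "\<exists>i<N. wedge x0 (A i *v x0) \<noteq> 0"
begin

text \<open>A closed union of lines, in general not convex; the scalars \<open>t\<close> of both
  signs and zero make it symmetric and put the origin in it.\<close>

definition F :: "(real^2) set" where
  "F = closure {t *\<^sub>R (wprod A w *v x0) | t w. wd w}"

lemma closed_F: "closed F" by (simp add: F_def)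

lemma F_image:
  assumes "linear f" "\<And>t w. wd w \<Longrightarrow> f (t *\<^sub>R (wprod A w *v x0)) \<in> F" "x \<in> F"
  shows "f x \<in> F"
proof -
  let ?O = "{t *\<^sub>R (wprod A w *v x0) | t w. wd w}"
  have "f ` closure ?O \<subseteq> F"
    using assms(2) by (intro image_closure_subset linear_continuous_on closed_F) (auto simp: linear_linear assms(1))
  then show ?thesis using assms(3) by (auto simp: F_def)
qed

lemma orbit_F: "wd w \<Longrightarrow> t *\<^sub>R (wprod A w *v x0) \<in> F"
  unfolding F_def by (rule subsetD[OF closure_subset]) blast

lemma x0_F: "x0 \<in> F" using orbit_F[of "[]" 1] by simp

lemma F_scale: "x \<in> F \<Longrightarrow> t *\<^sub>R x \<in> F"
  by (rule F_image[of "\<lambda>x. t *\<^sub>R x"]) (auto simp: orbit_F linear_scaleR)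

lemma zero_F: "0 \<in> F" using F_scale[OF x0_F, of 0] by simp

lemma F_inv: "i < N \<Longrightarrow> x \<in> F \<Longrightarrow> A i *v x \<in> F"
proof (rule F_image[of "\<lambda>x. A i *v x"])
  fix t w assume "i < N" "wd w"
  then show "A i *v (t *\<^sub>R (wprod A w *v x0)) \<in> F"
    using orbit_F[of "i # w" t] by (simp add: matrix_vector_mult_scaleR matrix_vector_mul_assoc)
qed auto

lemma F_invw: "wd w \<Longrightarrow> x \<in> F \<Longrightarrow> wprod A w *v x \<in> F"
  by (induction w) (auto simp: matrix_vector_mul_assoc[symmetric] F_inv)

text \<open>For orbit vectors this loses one \<open>\<kappa>\<close> in joining the two words and
  one in applying the result to \<open>x0\<close>. The inequality is a closed condition, so it
  extends to the closure.\<close>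

lemma F_exp: assumes "wd w" "x \<in> F" shows "\<kappa>\<^sup>2 * opnorm (wprod A w) * norm x \<le> norm (wprod A w *v x)"
proof -
  let ?S = "{x. \<kappa>\<^sup>2 * opnorm (wprod A w) * norm x \<le> norm (wprod A w *v x)}"
  have "closed ?S" by (intro closed_Collect_le continuous_intros)
  moreover have "{t *\<^sub>R (wprod A w *v x0) | t w. wd w} \<subseteq> ?S"
  proof clarify
    fix t u assume u: "wd u"
    have "norm (wprod A u *v x0) \<le> opnorm (wprod A u)" using norm_matvec_le[of "wprod A u" x0] x0_unit by simp
    then have "\<kappa>\<^sup>2 * opnorm (wprod A w) * norm (wprod A u *v x0) \<le> \<kappa>\<^sup>2 * opnorm (wprod A w) * opnorm (wprod A u)"
      by (intro mult_left_mono) auto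
    also have "\<dots> = \<kappa> * (\<kappa> * opnorm (wprod A w) * opnorm (wprod A u))" by (simp add: power2_eq_square)
    also have "\<dots> \<le> \<kappa> * opnorm (wprod A (w @ u))" using \<kappa> am[OF assms(1) u] by (intro mult_left_mono) auto
    also have "\<dots> \<le> norm (wprod A (w @ u) *v x0)" using assms(1) u by (intro x0_exp) auto
    finally have "\<bar>t\<bar> * (\<kappa>\<^sup>2 * opnorm (wprod A w) * norm (wprod A u *v x0)) \<le> \<bar>t\<bar> * norm (wprod A w *v (wprod A u *v x0))"
      by (intro mult_left_mono) (auto simp: wprod_append matrix_vector_mul_assoc)
    then show "\<kappa>\<^sup>2 * opnorm (wprod A w) * norm (t *\<^sub>R (wprod A u *v x0)) \<le> norm (wprod A w *v (t *\<^sub>R (wprod A u *v x0)))"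
      by (simp add: matrix_vector_mult_scaleR mult_ac)
  qed
  ultimately have "F \<subseteq> ?S" unfolding F_def by (rule closure_minimal[rotated])
  then show ?thesis using assms by blast
qed

definition E :: "nat set" where "E = {i. i < N \<and> (\<lambda>x. A i *v x) ` F = F}"
definition H :: "nat set" where "H = {..<N} - E"

lemma E_sub: "E \<subseteq> {..<N}" and H_sub: "H \<subseteq> {..<N}" by (auto simp: E_def H_def)

lemma E_words_F: "set w \<subseteq> E \<Longrightarrow> (\<lambda>x. wprod A w *v x) ` F = F"
proof (induction w)
  case (Cons i w)
  have "(\<lambda>x. wprod A (i # w) *v x) ` F = (\<lambda>x. A i *v x) ` ((\<lambda>x. wprod A w *v x) ` F)"
    by (simp add: image_image matrix_vector_mul_assoc)
  then show ?case using Cons by (simp add: E_def)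
qed simp

text \<open>Words in E map F onto itself, so \<open>x0\<close> and the nonparallel vector
  \<open>z\<close> have preimages in F. Both preimages are stretched at the full rate, and comparing
  the areas of the two pairs bounds the determinant from below by the squared norm.\<close>

lemma E_bounded: "\<exists>c>0. \<forall>w. set w \<subseteq> E \<longrightarrow> c \<le> q w"
proof -
  obtain i where i: "i < N" "wedge x0 (A i *v x0) \<noteq> 0" using x0_moves by blast
  define z where "z = A i *v x0"
  have nz: "x0 \<noteq> 0" "z \<noteq> 0" using i x0_unit by (auto simp: z_def)
  define d where "d = \<bar>wedge x0 z\<bar> / (norm x0 * norm z)"
  have d: "d > 0" using i nz by (simp add: d_def z_def)
  have "\<kappa>^4 * d \<le> q w" if w: "set w \<subseteq> E" for w
  proof -
    have wd: "wd w" using w E_sub by blast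
    let ?X = "wprod A w"
    have zF: "z \<in> F" unfolding z_def by (intro F_inv i x0_F)
    have "x0 \<in> (\<lambda>x. ?X *v x) ` F" "z \<in> (\<lambda>x. ?X *v x) ` F" unfolding E_words_F[OF w] using x0_F zF by auto
    then obtain x y where x: "x \<in> F" "x0 = ?X *v x" and y: "y \<in> F" "z = ?X *v y" by blast
    have "\<bar>wedge x0 z\<bar> = \<bar>det ?X\<bar> * \<bar>wedge x y\<bar>" unfolding x(2) y(2) wedge_matvec by (simp add: abs_mult)
    also have "\<dots> \<le> \<bar>det ?X\<bar> * (norm x * norm y)" by (intro mult_left_mono abs_wedge_le) auto
    also have "\<dots> = q w * ((opnorm ?X * norm x) * (opnorm ?X * norm y))"
      unfolding det_q[OF wd] by (simp add: power2_eq_square)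
    finally have "\<kappa>^4 * \<bar>wedge x0 z\<bar> \<le> \<kappa>^4 * (q w * ((opnorm ?X * norm x) * (opnorm ?X * norm y)))"
      using \<kappa> by (intro mult_left_mono) auto
    also have "\<dots> = q w * ((\<kappa>\<^sup>2 * opnorm ?X * norm x) * (\<kappa>\<^sup>2 * opnorm ?X * norm y))"
      by (simp add: power2_eq_square power4_eq_xxxx mult_ac)
    also have "\<dots> \<le> q w * (norm x0 * norm z)"
      using F_exp[OF wd x(1)] F_exp[OF wd y(1)] x(2) y(2) q_pos[OF wd] \<kappa> by (intro mult_left_mono mult_mono) auto
    finally show ?thesis using nz by (simp add: d_def field_simps)
  qed
  then show ?thesis using d \<kappa> by (intro exI[of _ "\<kappa>^4 * d"]) auto
qed

lemma closed_image_F: "i < N \<Longrightarrow> closed ((\<lambda>x. A i *v x) ` F)"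
proof -
  assume i: "i < N"
  have "(\<lambda>x. A i *v x) ` F = (\<lambda>x. matrix_inv (A i) *v x) -` F"
    using matrix_inv_mult[OF invA[OF i]]
    by (auto simp: image_iff matrix_vector_mul_assoc intro!: bexI[of _ "matrix_inv (A i) *v _"])
  then show ?thesis using closed_F by (simp add: closed_vimage continuous_intros)
qed

text \<open>For a hyperbolic letter the image of F is a closed cone properly contained in F; a unit
  vector of F outside it has positive sine distance from that image.\<close>

lemma H_separated:
  assumes "i \<in> H"
  shows "\<exists>z r. z \<in> F \<and> norm z = 1 \<and> r > 0 \<and> (\<forall>y\<in>F. r * norm (A i *v y) \<le> \<bar>wedge z (A i *v y)\<bar>)"
proof -
  have iN: "i < N" using assms H_sub by auto
  let ?G = "(\<lambda>x. A i *v x) ` F"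
  have "?G \<subseteq> F" using F_inv[OF iN] by auto
  moreover have "?G \<noteq> F" using assms by (auto simp: H_def E_def)
  ultimately obtain z' where z': "z' \<in> F" "z' \<notin> ?G" by blast
  have Gsc: "t *\<^sub>R y \<in> ?G" if "y \<in> ?G" for t y
    using that F_scale by (auto simp: matrix_vector_mult_scaleR[symmetric])
  have z'0: "z' \<noteq> 0" using z' zero_F by (metis image_eqI matrix_vector_mult_0_right)
  define z where "z = (1 / norm z') *\<^sub>R z'"
  have z: "z \<in> F" "norm z = 1" using z' z'0 F_scale by (auto simp: z_def)
  have "z \<notin> ?G" using Gsc[of z "norm z'"] z' z'0 by (auto simp: z_def)
  then obtain e where e: "e > 0" "ball z e \<subseteq> - ?G"
    using closed_image_F[OF iN] by (metis ComplI open_Compl open_contains_ball)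
  have "e / 2 * norm y \<le> \<bar>wedge z y\<bar>" if y: "y \<in> ?G" for y
  proof (cases "y = 0")
    case False
    define y' where "y' = (1 / norm y) *\<^sub>R y"
    have y': "norm y' = 1" using False by (simp add: y'_def)
    obtain \<sigma> :: real where s: "norm (z - \<sigma> *\<^sub>R y') \<le> 2 * \<bar>wedge z y'\<bar>" using unit_close_of_wedge[OF z(2) y'] by blast
    have "\<sigma> *\<^sub>R y' \<in> ?G" using Gsc[OF y, of "\<sigma> / norm y"] by (simp add: y'_def)
    then have "\<sigma> *\<^sub>R y' \<notin> ball z e" using e by blast
    then have "e \<le> 2 * \<bar>wedge z y'\<bar>" using s by (simp add: dist_norm)
    also have "\<bar>wedge z y'\<bar> = \<bar>wedge z y\<bar> / norm y" by (simp add: y'_def abs_mult)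
    finally show ?thesis using False by (simp add: field_simps)
  qed simp
  then show ?thesis using z e by (intro exI[of _ z] exI[of _ "e / 2"]) auto
qed

definition nH :: "nat list \<Rightarrow> nat" where "nH w = length (filter (\<lambda>i. i \<in> H) w)"

lemma nH_simps [simp]: "nH [] = 0" "nH (i # w) = (if i \<in> H then 1 else 0) + nH w" "nH (u @ w) = nH u + nH w"
  by (auto simp: nH_def)

text \<open>The sine distance shrinks at most by the factor q: the wedge is multiplied by the
  determinant, while each norm grows at most by the operator norm.\<close>

lemma wedge_lower: "wd w \<Longrightarrow> q w * (norm (wprod A w *v x) * norm (wprod A w *v y)) * \<bar>wedge x y\<bar> \<le> \<bar>wedge (wprod A w *v x) (wprod A w *v y)\<bar> * (norm x * norm y)"
proof -
  assume w: "wd w"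
  let ?X = "wprod A w"
  have "norm (?X *v x) * norm (?X *v y) \<le> (opnorm ?X * norm x) * (opnorm ?X * norm y)"
    by (intro mult_mono norm_matvec_le) auto
  then have "(q w * \<bar>wedge x y\<bar>) * (norm (?X *v x) * norm (?X *v y)) \<le> (q w * \<bar>wedge x y\<bar>) * ((opnorm ?X * norm x) * (opnorm ?X * norm y))"
    using q_pos[OF w] by (intro mult_left_mono) auto
  also have "\<dots> = \<bar>det ?X\<bar> * \<bar>wedge x y\<bar> * (norm x * norm y)" unfolding det_q[OF w] by (simp add: power2_eq_square)
  finally show ?thesis by (simp add: wedge_matvec abs_mult mult_ac)
qed

text \<open>Each hyperbolic letter \<open>h\<close> contributes a point of \<open>F\<close> outside \<open>A h F\<close>; pushed forward by the
  prefixes of \<open>w\<close> these points stay separated as long as \<open>q\<close> is bounded below.\<close>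

lemma separated_points:
  assumes zr: "\<And>i. i \<in> H \<Longrightarrow> z i \<in> F \<and> norm (z i) = 1 \<and> (\<forall>y\<in>F. r * norm (A i *v y) \<le> \<bar>wedge (z i) (A i *v y)\<bar>)"
    and r: "r > 0" and e: "e > 0"
  shows "wd u \<Longrightarrow> wd w \<Longrightarrow> (\<And>v v'. w = v @ v' \<Longrightarrow> e \<le> q (u @ v)) \<Longrightarrow>
    \<exists>S. finite S \<and> card S = nH w \<and> (\<forall>x\<in>S. norm x = 1 \<and> (\<exists>y\<in>F. x = wprod A u *v y)) \<and>
      (\<forall>x\<in>S. \<forall>y\<in>S. x \<noteq> y \<longrightarrow> e * r \<le> \<bar>wedge x y\<bar>)"
proof (induction w arbitrary: u)
  case Nil
  show ?case by (rule exI[of _ "{}"]) simp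
next
  case (Cons i w)
  have wd': "wd (u @ [i])" "wd w" "wd u" "i < N" using Cons.prems by auto
  have "\<exists>S. finite S \<and> card S = nH w \<and> (\<forall>x\<in>S. norm x = 1 \<and> (\<exists>y\<in>F. x = wprod A (u @ [i]) *v y)) \<and>
      (\<forall>x\<in>S. \<forall>y\<in>S. x \<noteq> y \<longrightarrow> e * r \<le> \<bar>wedge x y\<bar>)"
  proof (rule Cons.IH[OF wd'(1,2)])
    fix v v' assume "w = v @ v'"
    then show "e \<le> q ((u @ [i]) @ v)" using Cons.prems(3)[of "i # v" v'] by simp
  qed
  then obtain S where S: "finite S" "card S = nH w"
    "\<And>x. x \<in> S \<Longrightarrow> norm x = 1 \<and> (\<exists>y\<in>F. x = wprod A (u @ [i]) *v y)"
    "\<And>x y. x \<in> S \<Longrightarrow> y \<in> S \<Longrightarrow> x \<noteq> y \<Longrightarrow> e * r \<le> \<bar>wedge x y\<bar>"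
    by (elim exE conjE) (rule that, auto)
  have SF: "\<exists>y\<in>F. x = wprod A u *v y" if x: "x \<in> S" for x
  proof -
    obtain y where y: "y \<in> F" "x = wprod A (u @ [i]) *v y" using S(3)[OF x] by blast
    then have "x = wprod A u *v (A i *v y)" by (simp add: wprod_append matrix_vector_mul_assoc)
    then show ?thesis using F_inv[OF wd'(4) y(1)] by blast
  qed
  show ?case
  proof (cases "i \<in> H")
    case False
    then show ?thesis using S SF by (intro exI[of _ S]) auto
  next
    case True
    let ?X = "wprod A u"
    have z: "z i \<in> F" "norm (z i) = 1" using zr[OF True] by auto
    have Xz: "norm (?X *v z i) > 0"
      using invertible_matvec_zero[OF invw[OF wd'(3)], of "z i"] z(2) by auto
    define p where "p = (1 / norm (?X *v z i)) *\<^sub>R (?X *v z i)"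
    have p1: "norm p = 1" using Xz by (simp add: p_def)
    have pF: "\<exists>y\<in>F. p = ?X *v y"
      using F_scale[OF z(1), of "1 / norm (?X *v z i)"] by (auto simp: p_def matrix_vector_mult_scaleR[symmetric])
    \<comment> \<open>The older points lie in the image of \<open>A i ** F\<close> under the prefix
      product \<open>?X\<close>, the new one is the image of \<open>z i\<close>, which has distance
      at least \<open>r\<close> from \<open>A i ** F\<close>. The prefix shrinks this at most by
      \<open>q u\<close>, and \<open>q u \<ge> e\<close>.\<close>
    have sep: "e * r \<le> \<bar>wedge p x\<bar>" if x: "x \<in> S" for x
    proof -
      obtain y where y: "y \<in> F" "x = wprod A (u @ [i]) *v y" using S(3)[OF x] by blast
      define y' where "y' = A i *v y"
      have xy: "x = ?X *v y'" using y(2) by (simp add: y'_def wprod_append matrix_vector_mul_assoc)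
      have nx: "norm x = 1" using S(3)[OF x] by blast
      then have y'0: "norm y' > 0" using xy by auto
      have ry: "r * norm y' \<le> \<bar>wedge (z i) y'\<bar>" using zr[OF True] y(1) by (simp add: y'_def)
      have "e \<le> q u" using Cons.prems(3)[of "[]" "i # w"] by simp
      have "q u * (norm (?X *v z i) * norm x) * \<bar>wedge (z i) y'\<bar> \<le> \<bar>wedge (?X *v z i) x\<bar> * (norm (z i) * norm y')"
        unfolding xy by (rule wedge_lower[OF wd'(3)])
      then have "q u * norm (?X *v z i) * \<bar>wedge (z i) y'\<bar> \<le> \<bar>wedge (?X *v z i) x\<bar> * norm y'" using nx z by simp
      moreover have "q u * norm (?X *v z i) * (r * norm y') \<le> q u * norm (?X *v z i) * \<bar>wedge (z i) y'\<bar>"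
        using ry q_pos[OF wd'(3)] by (intro mult_left_mono) auto
      ultimately have "(q u * norm (?X *v z i) * r) * norm y' \<le> \<bar>wedge (?X *v z i) x\<bar> * norm y'" by (simp add: mult.assoc)
      then have "q u * norm (?X *v z i) * r \<le> \<bar>wedge (?X *v z i) x\<bar>" using y'0 by simp
      moreover have "\<bar>wedge (?X *v z i) x\<bar> = \<bar>wedge p x\<bar> * norm (?X *v z i)" using Xz by (simp add: p_def abs_mult)
      ultimately have "(q u * r) * norm (?X *v z i) \<le> \<bar>wedge p x\<bar> * norm (?X *v z i)" by (simp add: mult_ac)
      then have "q u * r \<le> \<bar>wedge p x\<bar>" using Xz by simp
      then show ?thesis using \<open>e \<le> q u\<close> r by (meson mult_right_mono order_trans less_imp_le)
    qed
    have "p \<notin> S" using sep[of p] e r by (auto simp: mult_le_0_iff not_le[symmetric])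
    then have "card (insert p S) = nH (i # w)" using S True by simp
    moreover have "e * r \<le> \<bar>wedge x y\<bar>" if "x \<in> insert p S" "y \<in> insert p S" "x \<noteq> y" for x y
      using that S(4) sep by (metis insertE wedge_commute abs_minus_cancel)
    ultimately show ?thesis using S SF p1 pF by (intro exI[of _ "insert p S"]) auto
  qed
qed

lemma finite_H: "finite H" using H_sub finite_subset by blast

text \<open>If q of a word is at least \<open>\<epsilon>\<close>, then
  \<open>separated_points\<close> places as many uniformly separated unit vectors on the circle as
  the word has hyperbolic letters, and packing bounds their number.\<close>

lemma many_H_small_q: assumes "\<epsilon> > 0" shows "\<exists>m. \<forall>w. wd w \<longrightarrow> m \<le> nH w \<longrightarrow> q w < \<epsilon>"
proof -
  have "\<forall>i\<in>H. \<exists>z r. z \<in> F \<and> norm z = 1 \<and> r > 0 \<and> (\<forall>y\<in>F. r * norm (A i *v y) \<le> \<bar>wedge z (A i *v y)\<bar>)"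
    using H_separated by blast
  then obtain z rr where zr: "\<And>i. i \<in> H \<Longrightarrow> z i \<in> F \<and> norm (z i) = 1 \<and> rr i > (0::real) \<and> (\<forall>y\<in>F. rr i * norm (A i *v y) \<le> \<bar>wedge (z i) (A i *v y)\<bar>)"
    by metis
  define r where "r = Min (insert 1 (rr ` H))"
  have r: "r > 0" unfolding r_def using zr finite_H by (subst Min_gr_iff) auto
  have rle: "r \<le> rr i" if "i \<in> H" for i unfolding r_def using that finite_H by (intro Min_le) auto
  have zr': "z i \<in> F \<and> norm (z i) = 1 \<and> (\<forall>y\<in>F. r * norm (A i *v y) \<le> \<bar>wedge (z i) (A i *v y)\<bar>)" if "i \<in> H" for i
  proof -
    have "r * norm (A i *v y) \<le> rr i * norm (A i *v y)" for y using rle[OF that] by (intro mult_right_mono) auto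
    then show ?thesis using zr[OF that] by (meson order_trans)
  qed
  define e where "e = \<kappa>\<^sup>2 * \<epsilon>"
  have e: "e > 0" using assms \<kappa> by (simp add: e_def)
  obtain K where K: "\<forall>S::(real^2) set. finite S \<and> S \<subseteq> sphere 0 1 \<and> (\<forall>x\<in>S. \<forall>y\<in>S. x \<noteq> y \<longrightarrow> e * r \<le> \<bar>wedge x y\<bar>) \<longrightarrow> card S \<le> K"
    using separated_card_bound[OF mult_pos_pos[OF e r]] by (rule exE)
  have "q w < \<epsilon>" if w: "wd w" and m: "Suc K \<le> nH w" for w
  proof (rule ccontr)
    assume "\<not> q w < \<epsilon>"
    then have qw: "\<epsilon> \<le> q w" by simp
    \<comment> \<open>A lower bound on q passes from a word to its prefixes by
      \<open>q_append\<close>, losing the factor \<open>\<kappa>\<^sup>2\<close>.\<close>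
    have pre: "e \<le> q ([] @ v)" if v: "w = v @ v'" for v v'
    proof -
      have wv: "wd v" "wd v'" using w v by auto
      have "\<epsilon> \<le> q v * q v' / \<kappa>\<^sup>2" using q_append[OF wv] qw v by simp
      also have "\<dots> \<le> q v * 1 / \<kappa>\<^sup>2" using q_le_1[OF wv(2)] q_pos[OF wv(1)] \<kappa> by (intro divide_right_mono mult_left_mono) auto
      finally show ?thesis using \<kappa> by (simp add: e_def field_simps)
    qed
    have "\<exists>S. finite S \<and> card S = nH w \<and> (\<forall>x\<in>S. norm x = 1 \<and> (\<exists>y\<in>F. x = wprod A [] *v y)) \<and>
        (\<forall>x\<in>S. \<forall>y\<in>S. x \<noteq> y \<longrightarrow> e * r \<le> \<bar>wedge x y\<bar>)"
      by (rule separated_points[OF zr' r e _ w pre]) auto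
    then obtain S where S: "finite S" "card S = nH w"
      "\<forall>x\<in>S. norm x = 1 \<and> (\<exists>y\<in>F. x = wprod A [] *v y)" "\<forall>x\<in>S. \<forall>y\<in>S. x \<noteq> y \<longrightarrow> e * r \<le> \<bar>wedge x y\<bar>"
      by (elim exE conjE)
    have "card S \<le> K" by (rule K[rule_format]) (use S in auto)
    then show False using S m by simp
  qed
  then show ?thesis by blast
qed

lemma split_nH: "k \<le> nH w \<Longrightarrow> \<exists>u v. w = u @ v \<and> nH u = k"
proof (induction w arbitrary: k)
  case (Cons i w)
  show ?case
  proof (cases "k = 0")
    case True then show ?thesis by (intro exI[of _ "[]"] exI[of _ "i # w"]) auto
  next
    case False
    define k' where "k' = (if i \<in> H then k - 1 else k)"
    have "k' \<le> nH w" using Cons.prems False by (auto simp: k'_def split: if_splits)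
    then obtain u v where uv: "w = u @ v" "nH u = k'" using Cons.IH by blast
    then show ?thesis using False by (intro exI[of _ "i # u"] exI[of _ v]) (auto simp: k'_def)
  qed
qed simp

text \<open>Cut the word into blocks with \<open>m\<close> hyperbolic letters each. The threshold
  \<open>\<kappa>\<^sup>2 / 2\<close> pays for the loss in \<open>q_append\<close>, so every block
  gains a full factor 1/2.\<close>

lemma q_exponential: "\<exists>m>0. \<forall>j w. wd w \<longrightarrow> j * m \<le> nH w \<longrightarrow> q w \<le> (1 / 2) ^ j"
proof -
  obtain m0 where m0: "\<And>w. wd w \<Longrightarrow> m0 \<le> nH w \<Longrightarrow> q w < \<kappa>\<^sup>2 / 2"
    using many_H_small_q[of "\<kappa>\<^sup>2 / 2"] \<kappa> by auto
  define m where "m = Suc m0"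
  have "wd w \<Longrightarrow> j * m \<le> nH w \<Longrightarrow> q w \<le> (1 / 2) ^ j" for j w
  proof (induction j arbitrary: w)
    case 0 then show ?case using q_le_1 by simp
  next
    case (Suc j)
    then obtain u v where uv: "w = u @ v" "nH u = m" using split_nH[of m w] by auto
    have wduv: "wd u" "wd v" using Suc.prems uv by auto
    have "j * m \<le> nH v" using Suc.prems(2) uv by simp
    then have qv: "q v \<le> (1/2)^j" using Suc.IH wduv by blast
    have qu: "q u \<le> \<kappa>\<^sup>2 / 2" using m0[OF wduv(1)] uv by (simp add: m_def less_imp_le)
    have "q w \<le> q u * q v / \<kappa>\<^sup>2" using q_append[OF wduv] uv by simp
    also have "\<dots> \<le> (\<kappa>\<^sup>2 / 2) * (1/2)^j / \<kappa>\<^sup>2"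
      using qu qv q_pos[OF wduv(2)] \<kappa> by (intro divide_right_mono mult_mono) auto
    finally show ?case using \<kappa> by simp
  qed
  then show ?thesis by (intro exI[of _ m]) (auto simp: m_def)
qed

end

section \<open>Projective intervals\<close>

text \<open>Describes a projective interval by the nonnegative combinations of its end vectors.
  Matrices act on this description linearly, which angles would not allow.\<close>

definition proj_cone :: "real^2 \<Rightarrow> real^2 \<Rightarrow> (real^2) set set" where
  "proj_cone u w = {span {s *\<^sub>R u + t *\<^sub>R w} | s t. s \<ge> 0 \<and> t \<ge> 0 \<and> (s > 0 \<or> t > 0)}"

lemma ang_interval_eq_cone:
  assumes ab: "a < b" "b < a + pi"
  shows "ang ` {a..b} = proj_cone (evec a) (evec b)"
proof (intro equalityI subsetI)
  have W: "sin (b - a) > 0" using ab by (intro sin_gt_zero) auto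
  {
    fix L assume "L \<in> ang ` {a..b}"
    then obtain t where t: "a \<le> t" "t \<le> b" "L = span {evec t}" by (auto simp: ang_evec)
    define s1 s2 where "s1 = sin (b - t) / sin (b - a)" and "s2 = sin (t - a) / sin (b - a)"
    have s: "s1 \<ge> 0" "s2 \<ge> 0" unfolding s1_def s2_def using W t ab by (auto intro!: divide_nonneg_pos sin_ge_zero)
    have "sin (b - a) *\<^sub>R evec t = sin (b - t) *\<^sub>R evec a + sin (t - a) *\<^sub>R evec b"
    proof -
      have "(sin a)\<^sup>2 + (cos a)\<^sup>2 = 1" "(sin b)\<^sup>2 + (cos b)\<^sup>2 = 1" "(sin t)\<^sup>2 + (cos t)\<^sup>2 = 1" by auto
      then show ?thesis by (simp add: vec_eq_iff forall_2 sin_diff algebra_simps)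
    qed
    then have "(1 / sin (b - a)) *\<^sub>R (sin (b - a) *\<^sub>R evec t) = (1 / sin (b - a)) *\<^sub>R (sin (b - t) *\<^sub>R evec a + sin (t - a) *\<^sub>R evec b)"
      by simp
    then have e: "evec t = s1 *\<^sub>R evec a + s2 *\<^sub>R evec b" using W by (simp add: s1_def s2_def scaleR_add_right)
    have "s1 > 0 \<or> s2 > 0"
    proof (rule ccontr)
      assume "\<not> ?thesis"
      then have "s1 = 0" "s2 = 0" using s by auto
      then show False using e by simp
    qed
    then show "L \<in> proj_cone (evec a) (evec b)" using t(3) e s unfolding proj_cone_def by auto
  }
  {
    fix L assume "L \<in> proj_cone (evec a) (evec b)"
    then obtain s t where st: "s \<ge> 0" "t \<ge> 0" "s > 0 \<or> t > 0" "L = span {s *\<^sub>R evec a + t *\<^sub>R evec b}"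
      unfolding proj_cone_def by blast
    define v where "v = s *\<^sub>R evec a + t *\<^sub>R evec b"
    have w1: "wedge (evec a) v = t * sin (b - a)" by (simp add: v_def wedge_add wedge_evec)
    have w2: "wedge v (evec b) = s * sin (b - a)" by (simp add: v_def wedge_add wedge_evec)
    have v0: "v \<noteq> 0" using w1 w2 st(3) W by auto
    have "wedge (evec a) v \<ge> 0" using w1 st W by simp
    then obtain r th where r: "r > 0" "a \<le> th" "th \<le> a + pi" "v = r *\<^sub>R evec th" using polar_half_plane[OF v0] by blast
    have "th \<le> b"
    proof (rule ccontr)
      assume "\<not> th \<le> b"
      then have "sin (th - b) > 0" using r ab by (intro sin_gt_zero) auto
      moreover have "sin (b - th) = - sin (th - b)" by (metis minus_diff_eq sin_minus)
      moreover have "r * sin (b - th) = s * sin (b - a)" using w2 r(4) by (simp add: wedge_evec)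
      moreover have "s * sin (b - a) \<ge> 0" using st W by simp
      ultimately have "r * sin (th - b) \<le> 0" by simp
      then show False using mult_pos_pos[OF r(1) \<open>sin (th - b) > 0\<close>] by linarith
    qed
    then show "L \<in> ang ` {a..b}" using r st(4) by (auto simp: v_def[symmetric] ang_evec span_scaleR_nz)
  }
qed

lemma proj_cone_scale:
  assumes "r > 0" "r' > 0" shows "proj_cone (r *\<^sub>R u) (r' *\<^sub>R w) = proj_cone u w"
proof (intro equalityI subsetI)
  fix L assume "L \<in> proj_cone (r *\<^sub>R u) (r' *\<^sub>R w)"
  then obtain s t where "s \<ge> 0" "t \<ge> 0" "s > 0 \<or> t > 0" "L = span {s *\<^sub>R r *\<^sub>R u + t *\<^sub>R r' *\<^sub>R w}"
    unfolding proj_cone_def by blast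
  then show "L \<in> proj_cone u w" unfolding proj_cone_def using assms
    by (intro CollectI exI[of _ "s * r"] exI[of _ "t * r'"]) auto
next
  fix L assume "L \<in> proj_cone u w"
  then obtain s t where "s \<ge> 0" "t \<ge> 0" "s > 0 \<or> t > 0" "L = span {s *\<^sub>R u + t *\<^sub>R w}"
    unfolding proj_cone_def by blast
  then show "L \<in> proj_cone (r *\<^sub>R u) (r' *\<^sub>R w)" unfolding proj_cone_def using assms
    by (intro CollectI exI[of _ "s / r"] exI[of _ "t / r'"]) auto
qed

lemma proj_cone_commute: "proj_cone u w = proj_cone w u"
proof -
  have "proj_cone u w \<subseteq> proj_cone w u" for u w
  proof
    fix L assume "L \<in> proj_cone u w"
    then obtain s t where "s \<ge> 0" "t \<ge> 0" "s > 0 \<or> t > 0" "L = span {s *\<^sub>R u + t *\<^sub>R w}"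
      unfolding proj_cone_def by blast
    then show "L \<in> proj_cone w u" unfolding proj_cone_def
      by (intro CollectI exI[of _ t] exI[of _ s]) (auto simp: add.commute)
  qed
  then show ?thesis by blast
qed

lemma closed_proj_interval_cone:
  assumes "wedge u w \<noteq> 0" shows "closed_proj_interval (proj_cone u w)"
proof -
  have pos: "closed_proj_interval (proj_cone u w)" if "wedge u w > 0" for u w
  proof -
    have "u \<noteq> 0" "w \<noteq> 0" using that by auto
    obtain r a where r: "r > 0" "u = r *\<^sub>R evec a" using polar[OF \<open>u \<noteq> 0\<close>] by blast
    have "wedge (evec a) w > 0" using that r by (simp add: zero_less_mult_iff)
    then obtain r' b where b: "r' > 0" "a \<le> b" "b \<le> a + pi" "w = r' *\<^sub>R evec b"
      using polar_half_plane[OF \<open>w \<noteq> 0\<close>, of a] by auto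
    have "sin (b - a) > 0" using \<open>wedge (evec a) w > 0\<close> b by (simp add: wedge_evec zero_less_mult_iff)
    then have "b \<noteq> a" "b \<noteq> a + pi" by auto
    then have "a < b" "b < a + pi" using b by auto
    moreover have "proj_cone u w = ang ` {a..b}"
      using r b calculation by (simp add: proj_cone_scale ang_interval_eq_cone)
    ultimately show ?thesis unfolding closed_proj_interval_def by blast
  qed
  show ?thesis
  proof (cases "wedge u w > 0")
    case False
    then have "wedge w u > 0" using assms wedge_commute[of u w] by simp
    then show ?thesis using pos proj_cone_commute by metis
  qed (rule pos)
qed

lemma closed_proj_interval_image:
  assumes "closed_proj_interval I" "invertible X"
  shows "closed_proj_interval (proj_act X I)"
proof -
  obtain a b where ab: "a < b" "b < a + pi" "I = ang ` {a..b}" using assms(1) by (auto simp: closed_proj_interval_def)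
  have "sin (b - a) > 0" using ab by (intro sin_gt_zero) auto
  then have w: "wedge (X *v evec a) (X *v evec b) \<noteq> 0"
    using assms(2) by (simp add: wedge_matvec wedge_evec invertible_det_nz)
  have lin: "X *v (s *\<^sub>R evec a + t *\<^sub>R evec b) = s *\<^sub>R (X *v evec a) + t *\<^sub>R (X *v evec b)" for s t
    by (simp add: matrix_vector_right_distrib matrix_vector_mult_scaleR)
  have "proj_act X (proj_cone (evec a) (evec b)) = proj_cone (X *v evec a) (X *v evec b)"
  proof (intro equalityI subsetI)
    fix L assume "L \<in> proj_act X (proj_cone (evec a) (evec b))"
    then obtain s t where "s \<ge> 0" "t \<ge> 0" "s > 0 \<or> t > 0" "L = (\<lambda>v. X *v v) ` span {s *\<^sub>R evec a + t *\<^sub>R evec b}"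
      unfolding proj_act_def proj_cone_def by blast
    then show "L \<in> proj_cone (X *v evec a) (X *v evec b)"
      unfolding proj_cone_def image_span_singleton lin by blast
  next
    fix L assume "L \<in> proj_cone (X *v evec a) (X *v evec b)"
    then obtain s t where "s \<ge> 0" "t \<ge> 0" "s > 0 \<or> t > 0" "L = span {X *v (s *\<^sub>R evec a + t *\<^sub>R evec b)}"
      unfolding proj_cone_def lin by blast
    then show "L \<in> proj_act X (proj_cone (evec a) (evec b))"
      unfolding proj_act_def proj_cone_def image_span_singleton[symmetric] by blast
  qed
  then show ?thesis using closed_proj_interval_cone[OF w] ab by (simp add: ang_interval_eq_cone)
qed

lemma shift_into_period: "\<exists>j::int. c \<le> x + of_int j * pi \<and> x + of_int j * pi < c + pi"
proof -
  define j where "j = - \<lfloor>(x - c) / pi\<rfloor>"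
  have "of_int \<lfloor>(x - c) / pi\<rfloor> \<le> (x - c) / pi" "(x - c) / pi < of_int \<lfloor>(x - c) / pi\<rfloor> + 1" by linarith+
  then have "of_int \<lfloor>(x - c) / pi\<rfloor> * pi \<le> x - c" "x - c < (of_int \<lfloor>(x - c) / pi\<rfloor> + 1) * pi"
    by (simp_all only: pos_le_divide_eq[OF pi_gt_zero] pos_divide_less_eq[OF pi_gt_zero])
  then show ?thesis by (intro exI[of _ j]) (auto simp: j_def algebra_simps)
qed

lemma wedge_evec_period: "wedge (evec x) (evec (x + of_int j * pi)) = 0"
  by (simp add: wedge_evec mult.commute sin_npi_int)

lemma ang_period: "ang (x + of_int j * pi) = ang x"
  using wedge_evec_period[of x j] span_eq_wedge[of "evec x" "evec (x + of_int j * pi)"] by (simp add: ang_evec)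

text \<open>A closed set of lines may have infinitely many components. One period of angles is cut
  into cells of length \<open>h\<close>, and in each cell only the extreme points \<open>a k\<close>
  and \<open>b k\<close> of the set are kept. Because \<open>h < 2 * \<eta>\<close>, every angle of
  the enlarged interval is within \<open>\<eta>\<close> of one of these two, so the thickening is a
  finite union of intervals.\<close>

lemma thickening_finite_intervals:
  assumes sc: "\<And>x k. x \<in> Z \<Longrightarrow> k \<noteq> 0 \<Longrightarrow> k *\<^sub>R x \<in> Z" and Z0: "0 \<notin> Z"
    and cl: "closed (Z \<inter> sphere 0 1)" and d: "0 < \<delta>" "\<delta> < 1" and ne: "Z \<noteq> {}"
  shows "\<exists>\<I>. finite \<I> \<and> \<I> \<noteq> {} \<and> (\<forall>I\<in>\<I>. closed_proj_interval I) \<and>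
    {span {x} | x. x \<noteq> 0 \<and> (\<exists>z\<in>Z. \<bar>wedge x z\<bar> \<le> \<delta> * norm x * norm z)} = \<Union>\<I>"
proof -
  define \<eta> where "\<eta> = arcsin \<delta>"
  have sin\<eta>: "sin \<eta> = \<delta>" using d by (simp add: \<eta>_def)
  have \<eta>: "0 < \<eta>" "\<eta> < pi / 2"
  proof -
    show "0 < \<eta>" using d arcsin_less_arcsin[of 0 \<delta>] by (simp add: \<eta>_def)
    show "\<eta> < pi / 2" using d arcsin_lt_bounded[of \<delta>] by (simp add: \<eta>_def)
  qed
  define D where "D = {t. evec t \<in> Z}"
  have "D = evec -` (Z \<inter> sphere 0 1)" by (auto simp: D_def)
  then have clD: "closed D" using closed_vimage[OF cl continuous_evec] by (simp only:)
  have Dper: "x + of_int j * pi \<in> D" if "x \<in> D" for x j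
  proof -
    have "\<exists>k. k \<noteq> 0 \<and> evec (x + of_int j * pi) = k *\<^sub>R evec x"
      using wedge_evec_period[of x j] span_eq_wedge[of "evec x" "evec (x + of_int j * pi)"]
        span_eq_iff_parallel[of "evec x" "evec (x + of_int j * pi)"] by simp
    then show ?thesis using that sc by (auto simp: D_def)
  qed
  \<comment> \<open>Two demands on the cell length: \<open>h < 2 * \<eta>\<close> for the covering,
    and \<open>2 * \<eta> + h < pi\<close> so that each enlarged cell is a genuine projective
    interval.\<close>
  obtain n :: nat where n: "pi / min (2 * \<eta>) (pi / 2 - \<eta>) < n" using reals_Archimedean2 by blast
  define h where "h = pi / n"
  have m0: "min (2 * \<eta>) (pi / 2 - \<eta>) > 0" using \<eta> by simp
  have n0: "n > 0" using n m0 by (cases n) (auto simp: divide_less_0_iff)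
  have "pi < n * min (2 * \<eta>) (pi / 2 - \<eta>)" using n by (simp only: pos_divide_less_eq[OF m0])
  then have "h < min (2 * \<eta>) (pi / 2 - \<eta>)"
    unfolding h_def using n0 by (subst pos_divide_less_eq) (simp_all only: of_nat_0_less_iff mult.commute)
  then have h: "h < 2 * \<eta>" "2 * \<eta> + h < pi" "h > 0" using n0 \<eta> by (auto simp: h_def)
  define cellD where "cellD k = D \<inter> {real k * h..real (Suc k) * h}" for k
  define a where "a k = Inf (cellD k)" for k
  define b where "b k = Sup (cellD k)" for k
  define J where "J = {k. k < n \<and> cellD k \<noteq> {}}"
  have cell: "a k \<in> D" "b k \<in> D" "\<And>x. x \<in> cellD k \<Longrightarrow> a k \<le> x \<and> x \<le> b k" "b k - a k \<le> h" "a k \<le> b k" if "k \<in> J" for k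
  proof -
    have ne: "cellD k \<noteq> {}" using that by (simp add: J_def)
    have bd: "bdd_below (cellD k)" "bdd_above (cellD k)" unfolding cellD_def by auto
    have cl: "closed (cellD k)" unfolding cellD_def using clD by (intro closed_Int) auto
    have aD: "a k \<in> cellD k" unfolding a_def by (rule closed_contains_Inf[OF ne bd(1) cl])
    have bD: "b k \<in> cellD k" unfolding b_def by (rule closed_contains_Sup[OF ne bd(2) cl])
    show "a k \<in> D" "b k \<in> D" using aD bD by (auto simp: cellD_def)
    show *: "a k \<le> x \<and> x \<le> b k" if "x \<in> cellD k" for x
      unfolding a_def b_def using that bd by (auto intro: cInf_lower cSup_upper)
    show "a k \<le> b k" using *[OF aD] by simp
    show "b k - a k \<le> h" using aD bD by (auto simp: cellD_def algebra_simps)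
  qed
  define \<I> where "\<I> = (\<lambda>k. ang ` {a k - \<eta>..b k + \<eta>}) ` J"
  define C where "C = {span {x} | x. x \<noteq> 0 \<and> (\<exists>z\<in>Z. \<bar>wedge x z\<bar> \<le> \<delta> * norm x * norm z)}"
  have in_cell: "\<exists>k\<in>J. \<exists>j::int. x + of_int j * pi \<in> cellD k" if "x \<in> D" for x
  proof -
    obtain j :: int where j: "0 \<le> x + of_int j * pi" "x + of_int j * pi < 0 + pi" using shift_into_period[of 0 x] by auto
    define y where "y = x + of_int j * pi"
    define k where "k = nat \<lfloor>y / h\<rfloor>"
    have y: "0 \<le> y" "y < pi" "y \<in> D" using j Dper[OF that] by (auto simp: y_def)
    have fl: "of_int \<lfloor>y / h\<rfloor> \<le> y / h" "y / h < of_int \<lfloor>y / h\<rfloor> + 1" by linarith+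
    have "real k = of_int \<lfloor>y / h\<rfloor>" unfolding k_def using y h by (simp add: of_nat_nat)
    then have k: "real k \<le> y / h" "y / h < real k + 1" using fl by auto
    then have yk: "real k * h \<le> y" "y < (real k + 1) * h" using h(3) by (simp_all add: pos_le_divide_eq pos_divide_less_eq)
    have "real k * h < n * h" using yk(1) y(2) n0 by (simp add: h_def)
    then have "k < n" using h(3) by simp
    then have "k \<in> J" "y \<in> cellD k" using y yk by (auto simp: J_def cellD_def algebra_simps)
    then show ?thesis unfolding y_def by blast
  qed
  have "C = \<Union>\<I>"
  proof (intro equalityI subsetI)
    fix L assume "L \<in> C"
    then obtain x z where xz: "x \<noteq> 0" "z \<in> Z" "\<bar>wedge x z\<bar> \<le> \<delta> * norm x * norm z" "L = span {x}" by (auto simp: C_def)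
    have z0: "z \<noteq> 0" using xz Z0 by auto
    obtain r th where x: "r > 0" "x = r *\<^sub>R evec th" using polar[OF xz(1)] by blast
    obtain r' ph where z: "r' > 0" "z = r' *\<^sub>R evec ph" using polar[OF z0] by blast
    have "(r * r') * \<bar>sin (ph - th)\<bar> \<le> (r * r') * \<delta>" using xz(3) x z by (simp add: wedge_evec abs_mult mult_ac)
    then have s1: "\<bar>sin (ph - th)\<bar> \<le> \<delta>" using x z by simp
    have "evec ph = (1 / r') *\<^sub>R z" using z by simp
    then have "ph \<in> D" using sc[OF xz(2), of "1 / r'"] z by (simp add: D_def)
    then obtain k j where k: "k \<in> J" "ph + of_int j * pi \<in> cellD k" using in_cell by blast
    define p where "p = ph + of_int j * pi"
    obtain i :: int where i: "p - pi / 2 \<le> th + of_int i * pi" "th + of_int i * pi < p - pi / 2 + pi"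
      using shift_into_period[of "p - pi / 2" th] by auto
    define t where "t = th + of_int i * pi"
    have "\<bar>sin (p - t)\<bar> = \<bar>sin (ph - th)\<bar>"
    proof -
      define l where "l = j - i"
      have s0: "sin (of_int l * pi) = 0" by (metis mult.commute sin_npi_int)
      have "p - t = (ph - th) + of_int l * pi" by (simp add: p_def t_def l_def algebra_simps)
      then have "sin (p - t) = sin (ph - th) * cos (of_int l * pi)" by (simp add: sin_add s0)
      moreover have "\<bar>cos (of_int l * pi)\<bar> = 1" by (rule sin_zero_abs_cos_one[OF s0])
      ultimately show ?thesis by (simp add: abs_mult)
    qed
    then have s2: "\<bar>sin (p - t)\<bar> \<le> sin \<eta>" using s1 sin\<eta> by simp
    have pt: "\<bar>p - t\<bar> \<le> pi / 2" using i unfolding t_def by linarith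
    have "sin \<bar>p - t\<bar> \<le> sin \<eta>"
      using s2 by (smt (verit) sin_minus)
    then have "\<bar>p - t\<bar> \<le> \<eta>" using sin_mono_le_eq[of "\<bar>p - t\<bar>" \<eta>] pt \<eta> by simp
    moreover have "a k \<le> p" "p \<le> b k" using cell(3)[OF k(1)] k(2) by (auto simp: p_def)
    ultimately have "t \<in> {a k - \<eta>..b k + \<eta>}" by (auto simp: abs_le_iff)
    moreover have "L = ang t" unfolding t_def ang_period using xz(4) x by (simp add: ang_evec span_scaleR_nz)
    ultimately show "L \<in> \<Union>\<I>" unfolding \<I>_def using k(1) by blast
  next
    fix L assume "L \<in> \<Union>\<I>"
    then obtain k t where k: "k \<in> J" "a k - \<eta> \<le> t" "t \<le> b k + \<eta>" "L = ang t" by (auto simp: \<I>_def)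
    have "\<exists>p\<in>D. \<bar>p - t\<bar> \<le> \<eta>"
    proof (cases "t \<le> a k + \<eta>")
      case True then show ?thesis using k cell(1)[OF k(1)] by (intro bexI[of _ "a k"]) auto
    next
      case False then show ?thesis using k cell(2,4)[OF k(1)] h(1) by (intro bexI[of _ "b k"]) auto
    qed
    then obtain p where p: "p \<in> D" "\<bar>p - t\<bar> \<le> \<eta>" by blast
    have "sin \<bar>p - t\<bar> \<le> sin \<eta>" using p \<eta> by (intro sin_monotone_2pi_le) auto
    moreover have "sin \<bar>p - t\<bar> \<ge> 0" using p \<eta> by (intro sin_ge_zero) auto
    ultimately have "\<bar>sin (p - t)\<bar> \<le> \<delta>" using sin\<eta> by (smt (verit) sin_minus)
    then have "\<bar>wedge (evec t) (evec p)\<bar> \<le> \<delta> * norm (evec t) * norm (evec p)" by (simp add: wedge_evec)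
    moreover have "evec p \<in> Z" "L = span {evec t}" using p(1) k(4) by (auto simp: D_def ang_evec)
    ultimately show "L \<in> C" unfolding C_def using evec_nz by blast
  qed
  moreover have "finite \<I>" by (simp add: \<I>_def J_def)
  moreover have "\<I> \<noteq> {}"
  proof -
    obtain z where z: "z \<in> Z" using ne by blast
    then have "z \<noteq> 0" using Z0 by auto
    then obtain r t where "r > 0" "z = r *\<^sub>R evec t" using polar by blast
    then have "t \<in> D" using sc[OF z, of "1 / r"] by (simp add: D_def)
    then show ?thesis using in_cell by (auto simp: \<I>_def)
  qed
  moreover have "closed_proj_interval I" if "I \<in> \<I>" for I
  proof -
    from that obtain k where k: "k \<in> J" "I = ang ` {a k - \<eta>..b k + \<eta>}" by (auto simp: \<I>_def)
    then show ?thesis unfolding closed_proj_interval_def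
      using cell(4,5)[OF k(1)] \<eta> h by (intro exI[of _ "a k - \<eta>"] exI[of _ "b k + \<eta>"]) auto
  qed
  ultimately show ?thesis unfolding C_def by (intro exI[of _ \<I>]) auto
qed

section \<open>Construction of the multicone\<close>

lemma closed_sine_limit:
  assumes sc: "\<And>x k. x \<in> Z \<Longrightarrow> k \<noteq> 0 \<Longrightarrow> k *\<^sub>R x \<in> Z" and Z0: "0 \<notin> Z"
    and cl: "closed (Z \<inter> sphere 0 1)" and x: "x \<noteq> 0"
    and lim: "\<And>\<eta>. \<eta> > 0 \<Longrightarrow> \<exists>y\<in>Z. \<bar>wedge x y\<bar> \<le> \<eta> * norm x * norm y"
  shows "x \<in> Z"
proof -
  define x' where "x' = (1 / norm x) *\<^sub>R x"
  have x': "norm x' = 1" using x by (simp add: x'_def)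
  have "x' \<in> closure (Z \<inter> sphere 0 1)"
    unfolding closure_approachable
  proof (intro allI impI)
    fix e :: real assume e: "e > 0"
    obtain y where y: "y \<in> Z" "\<bar>wedge x y\<bar> \<le> e / 4 * norm x * norm y" using lim[of "e / 4"] e by auto
    have y0: "y \<noteq> 0" using y Z0 by auto
    define y' where "y' = (1 / norm y) *\<^sub>R y"
    have y': "norm y' = 1" using y0 by (simp add: y'_def)
    obtain \<sigma> where s: "\<sigma> \<in> {1,-1::real}" "norm (x' - \<sigma> *\<^sub>R y') \<le> 2 * \<bar>wedge x' y'\<bar>"
      using unit_close_of_wedge[OF x' y'] by blast
    have "\<bar>wedge x' y'\<bar> = \<bar>wedge x y\<bar> / (norm x * norm y)" by (simp add: x'_def y'_def abs_mult)
    also have "\<dots> \<le> e / 4" using y(2) x y0 by (simp add: pos_divide_le_eq mult.assoc)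
    finally have "dist (\<sigma> *\<^sub>R y') x' < e" using s(2) e by (simp add: dist_norm norm_minus_commute)
    moreover have "\<sigma> *\<^sub>R y' = (\<sigma> / norm y) *\<^sub>R y" by (simp add: y'_def)
    then have "\<sigma> *\<^sub>R y' \<in> Z \<inter> sphere 0 1" using sc[OF y(1), of "\<sigma> / norm y"] s(1) y0 y' by auto
    ultimately show "\<exists>y\<in>Z \<inter> sphere 0 1. dist y x' < e" by blast
  qed
  then have "x' \<in> Z" using cl by (simp add: closure_closed)
  then have "norm x *\<^sub>R x' \<in> Z" using x by (intro sc) auto
  then show ?thesis using x by (simp add: x'_def)
qed

text \<open>The powers of a projective isometry return close to the identity.\<close>

lemma similarity_image_onto:
  fixes M X :: mat2
  assumes M: "invertible M" and X: "invertible X"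
    and sim: "\<And>x. norm (M *v (X *v x)) = sqrt \<bar>det X\<bar> * norm (M *v x)"
    and sc: "\<And>x k. x \<in> Z \<Longrightarrow> k \<noteq> 0 \<Longrightarrow> k *\<^sub>R x \<in> Z" and Z0: "0 \<notin> Z"
    and cl: "closed (Z \<inter> sphere 0 1)" and into: "\<And>x. x \<in> Z \<Longrightarrow> X *v x \<in> Z" and z: "X *v x \<in> Z"
  shows "x \<in> Z"
proof (rule closed_sine_limit[OF sc Z0 cl])
  show x0: "x \<noteq> 0" using z Z0 by auto
  define P where "P n y = ((\<lambda>v. X *v v) ^^ n) y" for n y
  have Pz: "P n y \<in> Z" if "y \<in> Z" for n y unfolding P_def using that by (induction n) (auto intro: into)
  have Padd: "P (n + k) y = P n (P k y)" for n k y by (simp add: P_def funpow_add)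
  have dX: "\<bar>det X\<bar> > 0" using X by (simp add: invertible_det_nz)
  have Pn: "norm (M *v P n y) = sqrt \<bar>det X\<bar> ^ n * norm (M *v y)" for n y
    unfolding P_def by (induction n) (auto simp: sim)
  have Pw: "\<bar>wedge (M *v P n y) (M *v P n y')\<bar> = \<bar>det X\<bar> ^ n * \<bar>wedge (M *v y) (M *v y')\<bar>" for n y y'
    unfolding P_def by (induction n) (auto simp: wedge_matvec abs_mult)
  have Mnz: "M *v y \<noteq> 0" if "y \<noteq> 0" for y using invertible_matvec_zero[OF M] that by blast
  have inv: "\<bar>wedge (M *v P n y) (M *v P n y')\<bar> \<le> \<epsilon> * norm (M *v P n y) * norm (M *v P n y') \<Longrightarrow>
      \<bar>wedge (M *v y) (M *v y')\<bar> \<le> \<epsilon> * norm (M *v y) * norm (M *v y')" for n y y' \<epsilon>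
  proof -
    assume "\<bar>wedge (M *v P n y) (M *v P n y')\<bar> \<le> \<epsilon> * norm (M *v P n y) * norm (M *v P n y')"
    then have "\<bar>det X\<bar> ^ n * \<bar>wedge (M *v y) (M *v y')\<bar> \<le> (sqrt \<bar>det X\<bar> ^ n * sqrt \<bar>det X\<bar> ^ n) * (\<epsilon> * norm (M *v y) * norm (M *v y'))"
      unfolding Pw Pn by (simp add: mult_ac)
    also have "sqrt \<bar>det X\<bar> ^ n * sqrt \<bar>det X\<bar> ^ n = \<bar>det X\<bar> ^ n" by (simp add: power_mult_distrib[symmetric])
    finally show ?thesis using dX by simp
  qed
  fix \<eta> :: real assume \<eta>: "\<eta> > 0"
  \<comment> \<open>The factor by which a bound on the sine in the coordinates given by
    \<open>M\<close> turns into the bound \<open>\<eta>\<close> on the original sine.\<close>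
  define \<epsilon> where "\<epsilon> = \<eta> * \<bar>det M\<bar> / (opnorm M)\<^sup>2"
  have dM: "\<bar>det M\<bar> > 0" "opnorm M > 0" using M opnorm_pos by (auto simp: invertible_det_nz)
  have \<epsilon>: "\<epsilon> > 0" using \<eta> dM by (simp add: \<epsilon>_def)
  define z where "z n = P n (X *v x)" for n
  have zZ: "z n \<in> Z" for n unfolding z_def using Pz[OF z] .
  define u where "u n = (1 / norm (M *v z n)) *\<^sub>R (M *v z n)" for n
  have zn0: "M *v z n \<noteq> 0" for n using Mnz zZ Z0 by metis
  have u1: "norm (u n) = 1" for n using zn0 by (simp add: u_def)
  obtain K where K: "\<forall>S::(real^2) set. finite S \<and> S \<subseteq> sphere 0 1 \<and> (\<forall>x\<in>S. \<forall>y\<in>S. x \<noteq> y \<longrightarrow> \<epsilon> \<le> \<bar>wedge x y\<bar>) \<longrightarrow> card S \<le> K"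
    using separated_card_bound[OF \<epsilon>] by (rule exE)
  have "\<exists>i j. i < j \<and> \<bar>wedge (u i) (u j)\<bar> < \<epsilon>"
  proof (rule ccontr)
    assume "\<not> ?thesis"
    then have far: "\<epsilon> \<le> \<bar>wedge (u i) (u j)\<bar>" if "i \<noteq> j" for i j
      using that wedge_commute[of "u i" "u j"] by (metis abs_minus_cancel linorder_neqE_nat not_le)
    have "inj_on u {..K}" using far \<epsilon> by (intro inj_onI) (metis abs_zero not_le wedge_self)
    then have "card (u ` {..K}) = Suc K" by (simp add: card_image)
    moreover have "card (u ` {..K}) \<le> K"
      by (rule K[rule_format]) (use far u1 in \<open>auto intro: far\<close>)
    ultimately show False by simp
  qed
  then obtain i j where ij: "i < j" "\<bar>wedge (u i) (u j)\<bar> < \<epsilon>" by blast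
  \<comment> \<open>By packing, the iterates with indices \<open>i\<close> and \<open>j\<close> are
    close. An isometry allows both to be pulled back by \<open>Suc i\<close> steps: the first
    becomes \<open>x\<close>, the second becomes \<open>y\<close>, a forward iterate of
    \<open>X *v x\<close> and hence in \<open>Z\<close>.\<close>
  define y where "y = P (j - i - 1) (X *v x)"
  have yZ: "y \<in> Z" unfolding y_def by (rule Pz[OF z])
  have zi: "z i = P (Suc i) x" by (simp add: z_def P_def funpow_swap1)
  have zj: "z j = P (Suc i) y"
    unfolding z_def y_def Padd[symmetric] using ij(1) by simp
  have "\<bar>wedge (M *v z i) (M *v z j)\<bar> \<le> \<epsilon> * norm (M *v z i) * norm (M *v z j)"
  proof -
    have "\<bar>wedge (u i) (u j)\<bar> = \<bar>wedge (M *v z i) (M *v z j)\<bar> / (norm (M *v z i) * norm (M *v z j))"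
      by (simp add: u_def abs_mult)
    then have "\<bar>wedge (M *v z i) (M *v z j)\<bar> / (norm (M *v z i) * norm (M *v z j)) \<le> \<epsilon>" using ij(2) by simp
    then show ?thesis using zn0[of i] zn0[of j] by (simp add: pos_divide_le_eq mult.assoc)
  qed
  then have "\<bar>wedge (M *v x) (M *v y)\<bar> \<le> \<epsilon> * norm (M *v x) * norm (M *v y)" unfolding zi zj by (rule inv)
  also have "\<dots> \<le> \<epsilon> * (opnorm M * norm x) * (opnorm M * norm y)"
    using \<epsilon> by (intro mult_mono mult_left_mono norm_matvec_le) auto
  also have "\<dots> = \<bar>det M\<bar> * (\<eta> * norm x * norm y)" using dM by (simp add: \<epsilon>_def power2_eq_square)
  finally have "\<bar>det M\<bar> * \<bar>wedge x y\<bar> \<le> \<bar>det M\<bar> * (\<eta> * norm x * norm y)" by (simp add: wedge_matvec abs_mult)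
  then have "\<bar>wedge x y\<bar> \<le> \<eta> * norm x * norm y" by (simp only: mult_le_cancel_left_pos[OF dM(1)])
  then show "\<exists>y\<in>Z. \<bar>wedge x y\<bar> \<le> \<eta> * norm x * norm y" using yZ by blast
qed

context dominated_tuple begin

text \<open>A line close to F differs from a unit vector of F by at most
  \<open>\<kappa>\<^sup>2 / 2\<close> after normalisation; this perturbation uses up only half of
  the expansion given by \<open>F_exp\<close>.\<close>

lemma near_expands:
  assumes w: "wd w" and y: "y \<in> F" "norm y = 1" "\<bar>wedge x y\<bar> \<le> \<epsilon> * norm x" and e: "\<epsilon> \<le> \<kappa>\<^sup>2 / 4"
  shows "\<kappa>\<^sup>2 / 2 * opnorm (wprod A w) * norm x \<le> norm (wprod A w *v x)"
proof (cases "x = 0")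
  case False
  define x' where "x' = (1 / norm x) *\<^sub>R x"
  have x': "norm x' = 1" using False by (simp add: x'_def)
  let ?X = "wprod A w"
  obtain \<sigma> where s: "\<sigma> \<in> {1,-1::real}" "norm (x' - \<sigma> *\<^sub>R y) \<le> 2 * \<bar>wedge x' y\<bar>"
    using unit_close_of_wedge[OF x' y(2)] by blast
  have "\<bar>wedge x' y\<bar> = \<bar>wedge x y\<bar> / norm x" by (simp add: x'_def abs_mult)
  also have "\<dots> \<le> \<epsilon>" using y(3) False by (simp add: pos_divide_le_eq)
  finally have close: "norm (x' - \<sigma> *\<^sub>R y) \<le> \<kappa>\<^sup>2 / 2" using s e by linarith
  have "\<kappa>\<^sup>2 * opnorm ?X \<le> norm (?X *v (\<sigma> *\<^sub>R y))"
    using F_exp[OF w F_scale[OF y(1)], of \<sigma>] s(1) y(2) by auto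
  also have "\<dots> = norm (?X *v x' - ?X *v (x' - \<sigma> *\<^sub>R y))" by (simp add: matrix_vector_mult_diff_distrib)
  also have "\<dots> \<le> norm (?X *v x') + norm (?X *v (x' - \<sigma> *\<^sub>R y))" by (rule norm_triangle_ineq4)
  also have "norm (?X *v (x' - \<sigma> *\<^sub>R y)) \<le> opnorm ?X * (\<kappa>\<^sup>2 / 2)"
    using close by (intro order_trans[OF norm_matvec_le] mult_left_mono) auto
  finally have "\<kappa>\<^sup>2 / 2 * opnorm ?X \<le> norm (?X *v x')" by (simp add: field_simps)
  then have "\<kappa>\<^sup>2 / 2 * opnorm ?X * norm x \<le> norm (?X *v x') * norm x" by (intro mult_right_mono) auto
  also have "\<dots> = norm (?X *v x)" using False by (simp add: x'_def matrix_vector_mult_scaleR)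
  finally show ?thesis .
qed simp

text \<open>Hyperbolic letters map \<open>Zs \<epsilon>\<close> into the smaller set
  \<open>Z\<close>, conformal letters map \<open>Z\<close> onto itself, and a neighbourhood of
  \<open>Z\<close> stays inside \<open>Zs \<epsilon>\<close>. A thickening C of \<open>Z\<close>
  between the two is thus mapped into \<open>Z\<close>, in the interior of C, by hyperbolic letters.
  Thickening in the metric of \<open>M\<close> makes C exactly invariant under the conformal
  ones.\<close>

theorem decomposable_if_unbounded:
  assumes unb: "\<And>c. c > 0 \<Longrightarrow> \<exists>w. wd w \<and> q w < c"
  shows "decomposable N A"
proof -
  obtain m where m: "m > 0" "\<And>j w. wd w \<Longrightarrow> j * m \<le> nH w \<Longrightarrow> q w \<le> (1/2)^j" using q_exponential by blast
  \<comment> \<open>Doubles once per \<open>m\<close> hyperbolic letters, the same rate at which q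
    halves by \<open>q_exponential\<close>; the product of both stays below 2 despite
    rounding.\<close>
  define wt where "wt w = 2 powr (real (nH w) / m)" for w
  define lam where "lam = 2 powr (1 / real m)"
  have lam: "lam > 1" using m by (simp add: lam_def)
  have wt_app: "wt (u @ v) = wt u * wt v" for u v by (simp add: wt_def powr_add add_divide_distrib)
  have wt1: "wt [i] = (if i \<in> H then lam else 1)" for i by (simp add: wt_def lam_def)
  have wt_pos: "wt w > 0" for w by (simp add: wt_def)
  have wtq: "wt w * q w \<le> 2" if w: "wd w" for w
  proof -
    define j where "j = nH w div m"
    have "j * m \<le> nH w" by (simp add: j_def)
    then have qj: "q w \<le> (1/2)^j" using m(2) w by blast
    have "nH w < (j + 1) * m" using m(1) by (simp add: j_def) (metis dividend_less_div_times add.commute)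
    then have "real (nH w) < real ((j + 1) * m)" by linarith
    then have "real (nH w) / m \<le> real (j + 1)" using m(1) by (simp add: pos_divide_le_eq algebra_simps)
    then have "wt w \<le> 2 powr real (j + 1)" unfolding wt_def by (intro powr_mono) auto
    also have "\<dots> = 2 ^ (j + 1)" by (simp only: powr_realpow)
    finally have "wt w * q w \<le> 2 ^ (j + 1) * (1/2)^j" using qj q_pos[OF w] by (intro mult_mono) auto
    also have "\<dots> = 2" by (simp add: power_divide)
    finally show ?thesis .
  qed
  define c where "c = \<kappa>\<^sup>2"
  have c: "0 < c" "c \<le> 1" using \<kappa> by (auto simp: c_def power_le_one)
  \<comment> \<open>The comparison vector \<open>y\<close> may depend on the word. Applying a letter
    \<open>i\<close> to \<open>x\<close> amounts to appending \<open>i\<close> to the word, and for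
    a hyperbolic letter the larger weight improves the tolerance by the factor
    \<open>lam\<close>.\<close>
  define Zs where "Zs \<epsilon> = {x. x \<noteq> 0 \<and> (\<forall>w. wd w \<longrightarrow> (\<exists>y\<in>F. norm y = 1 \<and> wt w * \<bar>wedge (wprod A w *v x) y\<bar> \<le> \<epsilon> * norm (wprod A w *v x)))}" for \<epsilon>
  \<comment> \<open>The largest tolerance for which \<open>near_expands\<close> applies.\<close>
  define \<epsilon> where "\<epsilon> = c / 4"
  \<comment> \<open>The tolerance gained by one hyperbolic letter; the gap between
    \<open>\<epsilon>'\<close> and \<open>\<epsilon>\<close> is the room for the thickening.\<close>
  define \<epsilon>' where "\<epsilon>' = \<epsilon> / lam"
  have \<epsilon>: "\<epsilon> > 0" "\<epsilon>' > 0" "\<epsilon>' < \<epsilon>" using c lam by (auto simp: \<epsilon>_def \<epsilon>'_def divide_less_eq)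
  define Z where "Z = Zs \<epsilon>'"
  have Zs_scale: "k *\<^sub>R x \<in> Zs e" if "x \<in> Zs e" "k \<noteq> 0" for x k e
  proof -
    have "wt w * \<bar>wedge (wprod A w *v (k *\<^sub>R x)) y\<bar> \<le> e * norm (wprod A w *v (k *\<^sub>R x))"
      if "wt w * \<bar>wedge (wprod A w *v x) y\<bar> \<le> e * norm (wprod A w *v x)" for w y
      using mult_left_mono[OF that, of "\<bar>k\<bar>"] by (simp add: matrix_vector_mult_scaleR abs_mult mult_ac)
    then show ?thesis using that unfolding Zs_def by (auto simp del: wedge_scaleR) blast
  qed
  have Zs_0: "0 \<notin> Zs e" for e by (simp add: Zs_def)
  have Zs_near: "\<exists>y\<in>F. norm y = 1 \<and> \<bar>wedge x y\<bar> \<le> e * norm x" if "x \<in> Zs e" for x e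
    using that unfolding Zs_def by (auto dest!: spec[of _ "[]"] simp: wt_def)
  have compF: "compact (F \<inter> sphere 0 1)" using closed_F by (intro closed_Int_compact) auto
  have Zs_closed: "closed (Zs e \<inter> sphere 0 1)" for e
  proof -
    \<comment> \<open>For one word the existential over the compact set of unit vectors of F is the
      projection of a closed set along a compact factor, hence closed; the set in question is the
      intersection over all words.\<close>
    define G where "G w = {x. \<exists>y. y \<in> F \<inter> sphere 0 1 \<and> (y,x) \<in> {z. wt w * \<bar>wedge (wprod A w *v snd z) (fst z)\<bar> \<le> e * norm (wprod A w *v snd z)}}" for w
    have "closed (G w)" for w unfolding G_def
    proof (rule closed_compact_projection[OF compF])
      have "continuous_on UNIV (\<lambda>z. wedge (wprod A w *v snd z) (fst z))"
        unfolding wedge_def matvec2 by (intro continuous_intros)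
      moreover have "continuous_on UNIV (\<lambda>z::(real^2)\<times>(real^2). norm (wprod A w *v snd z))"
        by (intro continuous_intros linear_continuous_on_compose[OF _ matrix_vector_mul_linear])
      ultimately show "closed {z. wt w * \<bar>wedge (wprod A w *v snd z) (fst z)\<bar> \<le> e * norm (wprod A w *v snd z)}"
        by (intro closed_Collect_le continuous_on_mult continuous_on_const continuous_on_rabs)
    qed
    then have "closed ((\<Inter>w\<in>{w. wd w}. G w) \<inter> sphere 0 1)" by (intro closed_Int closed_INT) auto
    moreover have "Zs e \<inter> sphere 0 1 = (\<Inter>w\<in>{w. wd w}. G w) \<inter> sphere 0 1"
      unfolding Zs_def G_def by (auto simp: Bex_def) 
    ultimately show ?thesis by simp
  qed
  have F_Zs: "x0 \<in> Zs e" if "e \<ge> 0" for e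
  proof -
    have "\<exists>y\<in>F. norm y = 1 \<and> wt w * \<bar>wedge (wprod A w *v x0) y\<bar> \<le> e * norm (wprod A w *v x0)" if w: "wd w" for w
    proof -
      define v where "v = wprod A w *v x0"
      have v0: "v \<noteq> 0" using invertible_matvec_zero[OF invw[OF w], of x0] x0_unit by (auto simp: v_def)
      have "v \<in> F" unfolding v_def by (rule F_invw[OF w x0_F])
      then show ?thesis unfolding v_def[symmetric] using v0 F_scale \<open>e \<ge> 0\<close>
        by (intro bexI[of _ "(1 / norm v) *\<^sub>R v"]) auto
    qed
    then show ?thesis using x0_unit by (auto simp: Zs_def)
  qed
  have Anz: "A i *v x \<noteq> 0" if "i < N" "x \<noteq> 0" for i x using invertible_matvec_zero[OF invA[OF that(1)]] that by blast
  have Zs_step: "A i *v x \<in> Zs (if i \<in> H then e / lam else e)" if i: "i < N" and x: "x \<in> Zs e" for i x e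
  proof -
    have "\<exists>y\<in>F. norm y = 1 \<and> wt w * \<bar>wedge (wprod A w *v (A i *v x)) y\<bar> \<le> (if i \<in> H then e / lam else e) * norm (wprod A w *v (A i *v x))"
      if w: "wd w" for w
    proof -
      have "wd (w @ [i])" using w i by auto
      then obtain y where y: "y \<in> F" "norm y = 1" "wt (w @ [i]) * \<bar>wedge (wprod A (w @ [i]) *v x) y\<bar> \<le> e * norm (wprod A (w @ [i]) *v x)"
        using x unfolding Zs_def by blast
      have eq: "wprod A (w @ [i]) *v x = wprod A w *v (A i *v x)" by (simp add: wprod_append matrix_vector_mul_assoc)
      show ?thesis using y lam unfolding eq wt_app wt1
        by (intro bexI[of _ y]) (auto simp: field_simps)
    qed
    then show ?thesis using x Anz[OF i] by (auto simp: Zs_def)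
  qed
  have Z_H: "A i *v x \<in> Z" if "i \<in> H" "x \<in> Zs \<epsilon>" for i x
    using Zs_step[OF _ that(2), of i] that(1) H_sub by (auto simp: Z_def \<epsilon>'_def)
  have Z_E: "A i *v x \<in> Z" if "i \<in> E" "x \<in> Z" for i x
  proof -
    have "i < N" "i \<notin> H" using that(1) E_sub by (auto simp: H_def)
    then show ?thesis using Zs_step[of i x \<epsilon>'] that(2) by (simp add: Z_def)
  qed
  \<comment> \<open>Chosen so that \<open>8 / c\<^sup>2 * \<delta>\<close> is the available gap: 2
    bounds weight times q, and two expansions at rate \<open>c / 2\<close> contribute
    \<open>4 / c\<^sup>2\<close>.\<close>
  define \<delta> where "\<delta> = (\<epsilon> - \<epsilon>') * c\<^sup>2 / 8"
  have \<delta>: "\<delta> > 0" using \<epsilon> c by (simp add: \<delta>_def)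
  have \<delta>8: "8 / c\<^sup>2 * \<delta> = \<epsilon> - \<epsilon>'" using c by (simp add: \<delta>_def)
  have "1 \<le> 8 / c\<^sup>2" using c power_le_one[of c 2] by (simp add: field_simps)
  then have \<delta>1: "\<delta> \<le> \<epsilon> - \<epsilon>'" using \<delta> \<delta>8 mult_right_mono[of 1 "8 / c\<^sup>2" \<delta>] by simp
  \<comment> \<open>Both \<open>x\<close> and \<open>y\<close> are expanded at nearly the full rate,
    so \<open>A_w\<close> shrinks their sine distance by a factor comparable to q, which compensates
    the weight uniformly in the word. The triangle inequality then transfers the condition from
    \<open>x\<close> to \<open>y\<close>.\<close>
  have margin: "y \<in> Zs \<epsilon>" if x: "x \<in> Z" and y0: "y \<noteq> 0" and xy: "\<bar>wedge x y\<bar> \<le> \<delta> * norm x * norm y" for x y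
  proof -
    have x0: "x \<noteq> 0" using x by (simp add: Z_def Zs_def)
    obtain f where f: "f \<in> F" "norm f = 1" "\<bar>wedge x f\<bar> \<le> \<epsilon>' * norm x" using Zs_near x unfolding Z_def by blast
    have "\<bar>wedge y f\<bar> * norm x \<le> \<bar>wedge y x\<bar> * norm f + \<bar>wedge x f\<bar> * norm y" by (rule wedge_triangle)
    also have "\<dots> \<le> (\<delta> * norm x * norm y) * 1 + (\<epsilon>' * norm x) * norm y"
      using xy f wedge_commute[of x y] by (intro add_mono mult_right_mono) auto
    also have "\<dots> = ((\<delta> + \<epsilon>') * norm y) * norm x" by (simp add: algebra_simps)
    finally have "\<bar>wedge y f\<bar> \<le> (\<delta> + \<epsilon>') * norm y" using x0 by simp
    also have "\<dots> \<le> \<epsilon> * norm y" using \<delta>1 by (intro mult_right_mono) auto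
    finally have yf: "\<bar>wedge y f\<bar> \<le> \<epsilon> * norm y" .
    have xf: "\<bar>wedge x f\<bar> \<le> \<epsilon> * norm x" using f(3) \<epsilon> by (meson less_imp_le mult_right_mono norm_ge_zero order_trans)
    have "\<exists>g\<in>F. norm g = 1 \<and> wt w * \<bar>wedge (wprod A w *v y) g\<bar> \<le> \<epsilon> * norm (wprod A w *v y)" if w: "wd w" for w
    proof -
      let ?X = "wprod A w"
      define a b where "a = norm (?X *v x)" and "b = norm (?X *v y)"
      have ab: "a > 0" "b > 0" using invertible_matvec_zero[OF invw[OF w]] x0 y0 by (auto simp: a_def b_def)
      have ax: "c / 2 * opnorm ?X * norm x \<le> a" unfolding a_def c_def
        by (rule near_expands[OF w f(1,2) xf]) (simp add: \<epsilon>_def c_def)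
      have bx: "c / 2 * opnorm ?X * norm y \<le> b" unfolding b_def c_def
        by (rule near_expands[OF w f(1,2) yf]) (simp add: \<epsilon>_def c_def)
      obtain g where g: "g \<in> F" "norm g = 1" "wt w * \<bar>wedge (?X *v x) g\<bar> \<le> \<epsilon>' * a"
        using x w unfolding Z_def Zs_def a_def by blast
      have "\<bar>wedge (?X *v y) (?X *v x)\<bar> = \<bar>det ?X\<bar> * \<bar>wedge x y\<bar>"
        using wedge_commute[of x y] by (simp add: wedge_matvec abs_mult)
      also have "\<dots> \<le> \<bar>det ?X\<bar> * (\<delta> * norm x * norm y)" by (intro mult_left_mono xy) auto
      also have "\<dots> = q w * \<delta> * (4 / c\<^sup>2) * ((c / 2 * opnorm ?X * norm x) * (c / 2 * opnorm ?X * norm y))"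
        unfolding det_q[OF w] using c by (simp add: power2_eq_square field_simps)
      also have "\<dots> \<le> q w * \<delta> * (4 / c\<^sup>2) * (a * b)"
        using ax bx q_pos[OF w] \<delta> ab c by (intro mult_left_mono mult_mono) auto
      finally have 1: "wt w * \<bar>wedge (?X *v y) (?X *v x)\<bar> \<le> wt w * (q w * \<delta> * (4 / c\<^sup>2) * (a * b))"
        using wt_pos[of w] by (intro mult_left_mono) auto
      also have "\<dots> = (wt w * q w) * (\<delta> * (4 / c\<^sup>2) * (a * b))" by simp
      also have "\<dots> \<le> 2 * (\<delta> * (4 / c\<^sup>2) * (a * b))" using wtq[OF w] \<delta> ab by (intro mult_right_mono) auto
      also have "\<dots> = (8 / c\<^sup>2 * \<delta>) * (a * b)" by simp
      finally have 2: "wt w * \<bar>wedge (?X *v y) (?X *v x)\<bar> \<le> (\<epsilon> - \<epsilon>') * (a * b)" unfolding \<delta>8 .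
      have "\<bar>wedge (?X *v y) g\<bar> * a \<le> \<bar>wedge (?X *v y) (?X *v x)\<bar> * norm g + \<bar>wedge (?X *v x) g\<bar> * b"
        unfolding a_def b_def by (rule wedge_triangle)
      then have "wt w * (\<bar>wedge (?X *v y) g\<bar> * a) \<le> wt w * (\<bar>wedge (?X *v y) (?X *v x)\<bar> * norm g + \<bar>wedge (?X *v x) g\<bar> * b)"
        using wt_pos[of w] by (intro mult_left_mono) auto
      also have "\<dots> = wt w * \<bar>wedge (?X *v y) (?X *v x)\<bar> + (wt w * \<bar>wedge (?X *v x) g\<bar>) * b"
        using g by (simp add: algebra_simps)
      also have "\<dots> \<le> (\<epsilon> - \<epsilon>') * (a * b) + (\<epsilon>' * a) * b"
        using 2 g ab by (intro add_mono mult_right_mono) auto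
      also have "\<dots> = (\<epsilon> * b) * a" by (simp add: algebra_simps)
      finally have "(wt w * \<bar>wedge (?X *v y) g\<bar>) * a \<le> (\<epsilon> * b) * a" by (simp add: mult.assoc)
      then have "wt w * \<bar>wedge (?X *v y) g\<bar> \<le> \<epsilon> * b" using ab by simp
      then show ?thesis using g unfolding b_def by blast
    qed
    then show ?thesis using y0 by (simp add: Zs_def)
  qed
  obtain cE where cE: "cE > 0" "\<And>w. set w \<subseteq> E \<Longrightarrow> cE \<le> q w" using E_bounded by blast
  have sconf: "strongly_conformal (A ` E)"
  proof (rule bounded_semigroup_strongly_conformal[OF _ cE(1)])
    fix i assume "i \<in> E" then show "invertible (A i)" using E_sub invA by auto
  next
    fix w assume w: "set w \<subseteq> E"
    then have "wd w" using E_sub by blast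
    then show "cE * (opnorm (wprod A w))\<^sup>2 \<le> \<bar>det (wprod A w)\<bar>"
      unfolding det_q[OF \<open>wd w\<close>] by (intro mult_right_mono cE(2)[OF w]) auto
  qed
  then obtain M :: mat2 where M: "invertible M" "\<And>X. X \<in> A ` E \<Longrightarrow> orthogonal_matrix (\<bar>det X\<bar> powr (-1/2) *\<^sub>R (M ** X ** matrix_inv M))"
    unfolding strongly_conformal_def by blast
  have sim: "norm (M *v (A i *v x)) = sqrt \<bar>det (A i)\<bar> * norm (M *v x)" if "i \<in> E" for i x
    using that E_sub invA by (intro strongly_conformal_norm M) auto
  have dM: "\<bar>det M\<bar> > 0" "opnorm M > 0" using M(1) opnorm_pos by (auto simp: invertible_det_nz)
  \<comment> \<open>Translates \<open>\<delta>\<close> to the sine distance in the coordinates of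
    \<open>M\<close>. The bound 1/2 keeps it below 1, as the thickening lemma requires.\<close>
  define \<delta>' where "\<delta>' = min (1/2) (\<delta> * \<bar>det M\<bar> / (opnorm M)\<^sup>2)"
  have \<delta>': "0 < \<delta>'" "\<delta>' < 1" using \<delta> dM by (auto simp: \<delta>'_def)
  have dM_imp: "\<bar>wedge x z\<bar> \<le> \<delta> * norm x * norm z" if "\<bar>wedge (M *v x) (M *v z)\<bar> \<le> \<delta>' * norm (M *v x) * norm (M *v z)" for x z
  proof -
    have "\<bar>det M\<bar> * \<bar>wedge x z\<bar> \<le> \<delta>' * norm (M *v x) * norm (M *v z)" using that by (simp add: wedge_matvec abs_mult)
    also have "\<dots> \<le> (\<delta> * \<bar>det M\<bar> / (opnorm M)\<^sup>2) * (opnorm M * norm x) * (opnorm M * norm z)"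
      using \<delta>' \<delta> dM by (intro mult_mono norm_matvec_le) (auto simp: \<delta>'_def)
    also have "\<dots> = \<bar>det M\<bar> * (\<delta> * norm x * norm z)" using dM by (simp add: power2_eq_square)
    finally show ?thesis using dM by simp
  qed
  define C where "C = {span {x} | x. x \<noteq> 0 \<and> (\<exists>z\<in>Z. \<bar>wedge (M *v x) (M *v z)\<bar> \<le> \<delta>' * norm (M *v x) * norm (M *v z))}"
  have C_iff: "span {x} \<in> C \<longleftrightarrow> (\<exists>z\<in>Z. \<bar>wedge (M *v x) (M *v z)\<bar> \<le> \<delta>' * norm (M *v x) * norm (M *v z))" if xn: "x \<noteq> 0" for x
  proof
    assume "span {x} \<in> C"
    then obtain x' z where x': "x' \<noteq> 0" "span {x} = span {x'}" "z \<in> Z" "\<bar>wedge (M *v x') (M *v z)\<bar> \<le> \<delta>' * norm (M *v x') * norm (M *v z)"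
      by (auto simp: C_def)
    then obtain k where k: "k \<noteq> 0" "x = k *\<^sub>R x'" using span_eq_iff_parallel[OF x'(1) xn] by auto
    have "\<bar>k\<bar> * \<bar>wedge (M *v x') (M *v z)\<bar> \<le> \<bar>k\<bar> * (\<delta>' * norm (M *v x') * norm (M *v z))" using x'(4) by (intro mult_left_mono) auto
    then have "\<bar>wedge (M *v x) (M *v z)\<bar> \<le> \<delta>' * norm (M *v x) * norm (M *v z)"
      by (simp add: k matrix_vector_mult_scaleR abs_mult mult_ac)
    then show "\<exists>z\<in>Z. \<bar>wedge (M *v x) (M *v z)\<bar> \<le> \<delta>' * norm (M *v x) * norm (M *v z)" using x'(3) by blast
  qed (use that in \<open>auto simp: C_def\<close>)
  have C_Zs: "x \<in> Zs \<epsilon>" if xn: "x \<noteq> 0" "span {x} \<in> C" for x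
  proof -
    obtain z where z: "z \<in> Z" "\<bar>wedge (M *v x) (M *v z)\<bar> \<le> \<delta>' * norm (M *v x) * norm (M *v z)" using xn C_iff by blast
    have "\<bar>wedge x z\<bar> \<le> \<delta> * norm x * norm z" by (rule dM_imp[OF z(2)])
    then have "\<bar>wedge z x\<bar> \<le> \<delta> * norm z * norm x" using wedge_commute[of x z] by (simp add: mult_ac)
    then show ?thesis using margin[OF z(1) xn(1)] by blast
  qed
  \<comment> \<open>If every line were close to F, every product would expand all vectors at nearly
    its norm, and q would be bounded below. This is what makes C a proper subset of the projective
    line.\<close>
  have not_all: "\<exists>x. x \<noteq> 0 \<and> x \<notin> Zs \<epsilon>"
  proof (rule ccontr)
    assume "\<not> ?thesis"
    then have all: "x \<in> Zs \<epsilon>" if "x \<noteq> 0" for x using that by blast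
    have "c\<^sup>2 / 4 \<le> q w" if w: "wd w" for w
    proof -
      let ?X = "wprod A w"
      have ex: "c / 2 * opnorm ?X * norm x \<le> norm (?X *v x)" for x
      proof (cases "x = 0")
        case False
        obtain f where f: "f \<in> F" "norm f = 1" "\<bar>wedge x f\<bar> \<le> \<epsilon> * norm x" using Zs_near[OF all[OF False]] by blast
        show ?thesis unfolding c_def by (rule near_expands[OF w f]) (simp add: \<epsilon>_def c_def)
      qed simp
      have o: "opnorm ?X > 0" by (rule op_pos[OF w])
      have "opnorm (matrix_inv ?X) \<le> 2 / (c * opnorm ?X)"
      proof (rule opnorm_leI)
        fix y :: "real^2" assume "norm y = 1"
        then have "c / 2 * opnorm ?X * norm (matrix_inv ?X *v y) \<le> 1"
          using ex[of "matrix_inv ?X *v y"] matrix_inv_mult[OF invw[OF w]] by (simp add: matrix_vector_mul_assoc)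
        then show "norm (matrix_inv ?X *v y) \<le> 2 / (c * opnorm ?X)" using c o by (simp add: field_simps)
      qed
      then have "\<bar>det ?X\<bar> * opnorm (matrix_inv ?X) \<le> \<bar>det ?X\<bar> * (2 / (c * opnorm ?X))" by (intro mult_left_mono) auto
      then have "opnorm ?X \<le> \<bar>det ?X\<bar> * (2 / (c * opnorm ?X))" using opnorm_le_det_inv[OF invw[OF w]] by linarith
      also have "\<dots> = 2 / c * q w * opnorm ?X" unfolding det_q[OF w] using o by (simp add: power2_eq_square)
      finally have "1 * opnorm ?X \<le> 2 / c * q w * opnorm ?X" by simp
      then have "1 \<le> 2 / c * q w" by (simp only: mult_le_cancel_right_pos[OF o])
      then have "c / 2 \<le> q w" using c by (simp add: field_simps)
      moreover have "c\<^sup>2 / 4 \<le> c / 2" using c by (simp add: power2_eq_square)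
      ultimately show ?thesis by linarith
    qed
    moreover obtain w where "wd w" "q w < c\<^sup>2 / 4" using unb[of "c\<^sup>2 / 4"] c by auto
    ultimately show False by force
  qed
  have "multicone C"
  proof -
    have sub: "C \<subseteq> RP1" by (auto simp: C_def RP1_iff)
    moreover have "C \<noteq> RP1"
    proof -
      obtain x where "x \<noteq> 0" "x \<notin> Zs \<epsilon>" using not_all by blast
      then have "span {x} \<in> RP1" "span {x} \<notin> C" using C_Zs[of x] RP1_iff by auto
      then show ?thesis by blast
    qed
    moreover have "\<exists>\<I>. finite \<I> \<and> \<I> \<noteq> {} \<and> (\<forall>I\<in>\<I>. closed_proj_interval I) \<and> C = \<Union>\<I>"
    proof -
      \<comment> \<open>The thickening lemma concerns the Euclidean sine distance, so it is applied
        to the image of \<open>Z\<close> under \<open>M\<close>, and the intervals are carried back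
        by the inverse.\<close>
      let ?W = "matrix_inv M"
      have MW: "M *v (?W *v x) = x" "?W *v (M *v x) = x" for x using matrix_inv_mult[OF M(1)] by (simp_all add: matrix_vector_mul_assoc)
      have invW: "invertible ?W" using matrix_inv_mult[OF M(1)] unfolding invertible_def by blast
      define MZ where "MZ = (\<lambda>z. M *v z) ` Z"
      have MZ_iff: "x \<in> MZ \<longleftrightarrow> ?W *v x \<in> Z" for x unfolding MZ_def using MW by (metis image_iff)
      have MZ_sc: "k *\<^sub>R x \<in> MZ" if "x \<in> MZ" "k \<noteq> 0" for x k
        using that Zs_scale unfolding MZ_iff Z_def by (simp add: matrix_vector_mult_scaleR)
      have MZ_cl: "closed (MZ \<inter> sphere 0 1)"
      proof -
        define g where "g x = (1 / norm (?W *v x)) *\<^sub>R (?W *v x)" for x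
        have Wnz: "?W *v x \<noteq> 0" if "x \<noteq> 0" for x using that invertible_matvec_zero[OF invW] by blast
        have "MZ \<inter> sphere 0 1 = sphere 0 1 \<inter> g -` (Z \<inter> sphere 0 1)"
        proof (intro equalityI subsetI)
          fix x assume x: "x \<in> MZ \<inter> sphere 0 1"
          then have "x \<noteq> 0" by auto
          then show "x \<in> sphere 0 1 \<inter> g -` (Z \<inter> sphere 0 1)"
            using x Wnz[of x] Zs_scale[of "?W *v x" \<epsilon>' "1 / norm (?W *v x)"] by (auto simp: MZ_iff g_def Z_def)
        next
          fix x assume x: "x \<in> sphere 0 1 \<inter> g -` (Z \<inter> sphere 0 1)"
          then have "x \<noteq> 0" "g x \<in> Z" by auto
          then have "norm (?W *v x) *\<^sub>R g x \<in> Z" using Wnz[of x] Zs_scale unfolding Z_def by simp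
          then show "x \<in> MZ \<inter> sphere 0 1" using x Wnz[OF \<open>x \<noteq> 0\<close>] by (auto simp: MZ_iff g_def)
        qed
        moreover have "continuous_on (sphere 0 1) g"
        proof -
          have cW: "continuous_on (sphere 0 1) (\<lambda>x. ?W *v x)"
            by (rule linear_continuous_on[OF matrix_vector_mul_bounded_linear])
          have "\<forall>x\<in>sphere 0 1. norm (?W *v x) \<noteq> 0" using Wnz by (metis norm_eq_zero mem_sphere_0 zero_neq_one)
          then show ?thesis unfolding g_def
            by (intro continuous_on_scaleR continuous_on_divide continuous_on_norm continuous_on_const cW)
        qed
        ultimately show ?thesis
          using continuous_closed_preimage[of "sphere 0 1" g "Z \<inter> sphere 0 1"] Zs_closed[of \<epsilon>'] by (simp add: Z_def)
      qed
      have MZ_0: "0 \<notin> MZ" using Zs_0 by (simp add: MZ_iff Z_def)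
      have MZ_ne: "MZ \<noteq> {}" using F_Zs[of \<epsilon>'] \<epsilon> by (auto simp: MZ_def Z_def)
      have "\<exists>\<I>. finite \<I> \<and> \<I> \<noteq> {} \<and> (\<forall>I\<in>\<I>. closed_proj_interval I) \<and>
          {span {x} | x. x \<noteq> 0 \<and> (\<exists>z\<in>MZ. \<bar>wedge x z\<bar> \<le> \<delta>' * norm x * norm z)} = \<Union>\<I>"
        by (rule thickening_finite_intervals[OF _ MZ_0 MZ_cl \<delta>' MZ_ne]) (rule MZ_sc)
      then obtain \<I> where I: "finite \<I>" "\<I> \<noteq> {}" "\<forall>I\<in>\<I>. closed_proj_interval I"
        "{span {x} | x. x \<noteq> 0 \<and> (\<exists>z\<in>MZ. \<bar>wedge x z\<bar> \<le> \<delta>' * norm x * norm z)} = \<Union>\<I>"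
        by (elim exE conjE)
      have "C = proj_act ?W (\<Union>\<I>)"
      proof (intro equalityI subsetI)
        fix L assume "L \<in> C"
        then obtain x z where x: "x \<noteq> 0" "L = span {x}" "z \<in> Z" "\<bar>wedge (M *v x) (M *v z)\<bar> \<le> \<delta>' * norm (M *v x) * norm (M *v z)"
          by (auto simp: C_def)
        have "M *v x \<noteq> 0" using x(1) invertible_matvec_zero[OF M(1)] by blast
        then have "span {M *v x} \<in> \<Union>\<I>" unfolding I(4)[symmetric] using x(3,4) by (auto simp: MZ_def)
        then have "(\<lambda>v. ?W *v v) ` span {M *v x} \<in> proj_act ?W (\<Union>\<I>)" unfolding proj_act_def by blast
        then show "L \<in> proj_act ?W (\<Union>\<I>)" using x(2) by (simp add: image_span_singleton MW)
      next
        fix L assume "L \<in> proj_act ?W (\<Union>\<I>)"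
        then obtain x z where x: "x \<noteq> 0" "L = span {?W *v x}" "z \<in> Z" "\<bar>wedge x (M *v z)\<bar> \<le> \<delta>' * norm x * norm (M *v z)"
          unfolding proj_act_def I(4)[symmetric] by (auto simp: image_span_singleton MZ_def)
        have "?W *v x \<noteq> 0" using x(1) invertible_matvec_zero[OF invW] by blast
        then show "L \<in> C" unfolding C_def using x by (auto simp: MW intro!: exI[of _ "?W *v x"])
      qed
      also have "\<dots> = \<Union>(proj_act ?W ` \<I>)" unfolding proj_act_def by blast
      finally show ?thesis using I closed_proj_interval_image[OF _ invW]
        by (intro exI[of _ "proj_act ?W ` \<I>"]) auto
    qed
    ultimately show ?thesis unfolding multicone_def by blast
  qed
  moreover have "strongly_invariant C (A ` H)"
    unfolding strongly_invariant_def
  proof (intro ballI subsetI)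
    fix X L assume "X \<in> A ` H" "L \<in> proj_act X C"
    then obtain i L' where i: "i \<in> H" "X = A i" "L' \<in> C" "L = (\<lambda>v. A i *v v) ` L'" by (auto simp: proj_act_def)
    then obtain x where x: "x \<noteq> 0" "L' = span {x}" by (auto simp: C_def)
    have "x \<in> Zs \<epsilon>" using C_Zs x i by blast
    then have z: "A i *v x \<in> Z" by (rule Z_H[OF i(1)])
    have L: "L = span {A i *v x}" using i x by (simp add: image_span_singleton)
    have z0: "A i *v x \<noteq> 0" using z Zs_0 by (auto simp: Z_def)
    obtain r t where rt: "r > 0" "A i *v x = r *\<^sub>R evec t" using polar[OF z0] by blast
    \<comment> \<open>The strict form of the condition defining C. It is open in the angle and
      contains that of \<open>A i *v x\<close>, which lies in \<open>Z\<close> and has distance zero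
      to itself.\<close>
    define U where "U = {s. \<bar>wedge (M *v evec s) (M *v (A i *v x))\<bar> < \<delta>' * norm (M *v evec s) * norm (M *v (A i *v x))}"
    have ce: "continuous_on UNIV (\<lambda>s. M *v evec s)"
      by (rule linear_continuous_on_compose[OF continuous_evec matrix_vector_mul_linear])
    have "open U" unfolding U_def wedge_def
      by (intro open_Collect_less continuous_intros ce)
    moreover have "t \<in> U"
    proof -
      have "M *v evec t \<noteq> 0" "M *v (A i *v x) \<noteq> 0" using z0 evec_nz invertible_matvec_zero[OF M(1)] by blast+
      then have "0 < \<delta>' * norm (M *v evec t) * norm (M *v (A i *v x))" using \<delta>' by simp
      moreover have "wedge (M *v evec t) (M *v (A i *v x)) = 0" by (simp add: wedge_matvec rt)
      ultimately show ?thesis by (simp add: U_def)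
    qed
    moreover have "U \<subseteq> ang -` C"
    proof
      fix s assume "s \<in> U"
      then have "\<bar>wedge (M *v evec s) (M *v (A i *v x))\<bar> \<le> \<delta>' * norm (M *v evec s) * norm (M *v (A i *v x))"
        unfolding U_def by (intro less_imp_le) (rule CollectD)
      then have "span {evec s} \<in> C" unfolding C_iff[OF evec_nz] using z by blast
      then show "s \<in> ang -` C" by (simp add: ang_evec)
    qed
    ultimately have "t \<in> interior (ang -` C)" by (metis interiorI)
    then show "L \<in> proj_interior C" unfolding proj_interior_def L rt(2)
      using rt(1) by (auto simp: span_scaleR_nz ang_evec[symmetric])
  qed
  moreover have "proj_act (A i) C = C" if i: "i \<in> E" for i
  proof -
    have iN: "i < N" using i E_sub by auto
    have di: "\<bar>det (A i)\<bar> > 0" using invA[OF iN] by (simp add: invertible_det_nz)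
    have scale: "\<bar>wedge (M *v (A i *v x)) (M *v (A i *v z))\<bar> \<le> \<delta>' * norm (M *v (A i *v x)) * norm (M *v (A i *v z)) \<longleftrightarrow>
       \<bar>wedge (M *v x) (M *v z)\<bar> \<le> \<delta>' * norm (M *v x) * norm (M *v z)" for x z
    proof -
      have "\<bar>wedge (M *v (A i *v x)) (M *v (A i *v z))\<bar> = \<bar>det (A i)\<bar> * \<bar>wedge (M *v x) (M *v z)\<bar>"
        by (simp add: wedge_matvec abs_mult)
      moreover have "\<delta>' * norm (M *v (A i *v x)) * norm (M *v (A i *v z)) = \<bar>det (A i)\<bar> * (\<delta>' * norm (M *v x) * norm (M *v z))"
      proof -
        have "sqrt \<bar>det (A i)\<bar> * sqrt \<bar>det (A i)\<bar> = \<bar>det (A i)\<bar>" by simp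
        then show ?thesis unfolding sim[OF i] by (metis (no_types, lifting) mult.assoc mult.left_commute)
      qed
      ultimately show ?thesis by (simp only: mult_le_cancel_left_pos[OF di])
    qed
    show ?thesis
    proof (intro equalityI subsetI)
      fix L assume "L \<in> proj_act (A i) C"
      then obtain x z where x: "x \<noteq> 0" "L = span {A i *v x}" "z \<in> Z" "\<bar>wedge (M *v x) (M *v z)\<bar> \<le> \<delta>' * norm (M *v x) * norm (M *v z)"
        unfolding proj_act_def C_def by (auto simp: image_span_singleton)
      have "\<bar>wedge (M *v (A i *v x)) (M *v (A i *v z))\<bar> \<le> \<delta>' * norm (M *v (A i *v x)) * norm (M *v (A i *v z))"
        using x(4) scale by blast
      then show "L \<in> C" unfolding x(2) C_iff[OF Anz[OF iN x(1)]] using Z_E[OF i x(3)] by blast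
    next
      fix L assume "L \<in> C"
      then obtain x z where x: "x \<noteq> 0" "L = span {x}" "z \<in> Z" "\<bar>wedge (M *v x) (M *v z)\<bar> \<le> \<delta>' * norm (M *v x) * norm (M *v z)"
        by (auto simp: C_def)
      define x' z' where "x' = matrix_inv (A i) *v x" and "z' = matrix_inv (A i) *v z"
      have e: "A i *v x' = x" "A i *v z' = z" using matrix_inv_mult[OF invA[OF iN]] by (simp_all add: x'_def z'_def matrix_vector_mul_assoc)
      \<comment> \<open>Only forward invariance of \<open>Z\<close> has been built in; that a
        conformal letter also pulls \<open>Z\<close> back into itself comes from recurrence of
        isometries, through \<open>similarity_image_onto\<close>.\<close>
      have "z' \<in> Z"
        by (rule similarity_image_onto[OF M(1) invA[OF iN] sim[OF i]])
          (use Zs_scale Zs_0 Zs_closed[of \<epsilon>'] Z_E[OF i] x(3) e in \<open>auto simp: Z_def\<close>)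
      moreover have "\<bar>wedge (M *v x') (M *v z')\<bar> \<le> \<delta>' * norm (M *v x') * norm (M *v z')"
        using x(4) scale[of x' z'] unfolding e by blast
      moreover have x'0: "x' \<noteq> 0" using e(1) x(1) by auto
      ultimately have "span {x'} \<in> C" using C_iff by blast
      then have "(\<lambda>v. A i *v v) ` span {x'} \<in> proj_act (A i) C" unfolding proj_act_def by blast
      then show "L \<in> proj_act (A i) C" using x(2) e(1) by (simp add: image_span_singleton)
    qed
  qed
  ultimately show ?thesis unfolding decomposable_def using sconf E_sub
    by (intro exI[of _ E] exI[of _ H]) (auto simp: H_def)
qed

end

section \<open>The additive cocycle\<close>

text \<open>Cuts a word after its last letter in \<open>S\<close>. With \<open>S = H\<close>,
  appending conformal letters leaves this prefix unchanged.\<close>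

fun upto_last :: "nat set \<Rightarrow> nat list \<Rightarrow> nat list" where
  "upto_last S [] = []"
| "upto_last S (i # w) = (if set (i # w) \<inter> S = {} then [] else i # upto_last S w)"

fun after_last :: "nat set \<Rightarrow> nat list \<Rightarrow> nat list" where
  "after_last S [] = []"
| "after_last S (i # w) = (if set (i # w) \<inter> S = {} then i # w else after_last S w)"

lemma upto_after: "upto_last S w @ after_last S w = w"
  by (induction w) auto

lemma after_last_set: "set (after_last S w) \<inter> S = {}"
  by (induction w) auto

lemma upto_last_none: "set w \<inter> S = {} \<Longrightarrow> upto_last S w = []"
  by (cases w) auto

lemma upto_last_append_none: "set r \<inter> S = {} \<Longrightarrow> upto_last S (w @ r) = upto_last S w"
  by (induction w) (auto simp: upto_last_none)

lemma upto_last_append_some: "set r \<inter> S \<noteq> {} \<Longrightarrow> upto_last S (w @ r) = w @ upto_last S r"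
  by (induction w) auto

lemma upto_last_extends: "\<exists>v. upto_last S (w @ r) = upto_last S w @ v \<and> set v \<subseteq> set (w @ r)"
proof (cases "set r \<inter> S = {}")
  case True then show ?thesis by (intro exI[of _ "[]"]) (simp add: upto_last_append_none)
next
  case False
  have "w @ upto_last S r = upto_last S w @ (after_last S w @ upto_last S r)"
    by (simp only: append_assoc[symmetric] upto_after)
  moreover have "set (after_last S w) \<subseteq> set w" "set (upto_last S r) \<subseteq> set r"
    using upto_after[of S w] upto_after[of S r] by (metis set_append Un_upper2, metis set_append Un_upper1)
  ultimately show ?thesis using False
    by (intro exI[of _ "after_last S w @ upto_last S r"]) (auto simp: upto_last_append_some)
qed

text \<open>The stretching of unit vectors by \<open>X\<close> is bounded below by the reciprocal of
  the norm of the inverse, where \<open>ln\<close> is Lipschitz; lines at small sine distance have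
  nearby unit vectors after a choice of sign.\<close>

lemma ln_expansion_lipschitz:
  fixes X :: mat2
  assumes X: "invertible X" and v: "v \<noteq> 0" and v': "v' \<noteq> 0" and d: "\<bar>wedge v v'\<bar> \<le> d * norm v * norm v'"
  shows "\<bar>ln (norm (X *v v) / norm v) - ln (norm (X *v v') / norm v')\<bar> \<le> 2 * opnorm X * opnorm (matrix_inv X) * d"
proof -
  define u where "u = (1 / norm v) *\<^sub>R v"
  define u' where "u' = (1 / norm v') *\<^sub>R v'"
  have u: "norm u = 1" "norm u' = 1" using v v' by (auto simp: u_def u'_def)
  define b where "b = 1 / opnorm (matrix_inv X)"
  have invI: "invertible (matrix_inv X)" using matrix_inv_mult[OF X] unfolding invertible_def by blast
  have b: "b > 0" using opnorm_pos[OF invI] by (simp add: b_def)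
  have low: "b \<le> norm (X *v z)" if "norm z = 1" for z
  proof -
    have "1 \<le> opnorm (matrix_inv X) * norm (X *v z)"
      using norm_matvec_le[of "matrix_inv X" "X *v z"] that matrix_inv_mult[OF X] by (simp add: matrix_vector_mul_assoc)
    then show ?thesis using opnorm_pos[OF invI] by (simp add: b_def pos_divide_le_eq mult.commute)
  qed
  obtain \<sigma> where s: "\<sigma> \<in> {1,-1::real}" "norm (u - \<sigma> *\<^sub>R u') \<le> 2 * \<bar>wedge u u'\<bar>" using unit_close_of_wedge[OF u] by blast
  have "\<bar>wedge u u'\<bar> = \<bar>wedge v v'\<bar> / (norm v * norm v')" by (simp add: u_def u'_def abs_mult)
  also have "\<dots> \<le> d" using d v v' by (simp add: pos_divide_le_eq mult.assoc)
  finally have close: "norm (u - \<sigma> *\<^sub>R u') \<le> 2 * d" using s by linarith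
  define a a' where "a = norm (X *v u)" and "a' = norm (X *v u')"
  have aa': "a \<ge> b" "a' \<ge> b" unfolding a_def a'_def by (intro low u)+
  have "a' = norm (X *v (\<sigma> *\<^sub>R u'))" using s(1) by (auto simp: a'_def matrix_vector_mult_scaleR)
  then have "\<bar>a - a'\<bar> \<le> norm (X *v u - X *v (\<sigma> *\<^sub>R u'))" unfolding a_def by (simp add: norm_triangle_ineq3)
  also have "\<dots> = norm (X *v (u - \<sigma> *\<^sub>R u'))" by (simp add: matrix_vector_mult_diff_distrib)
  also have "\<dots> \<le> opnorm X * (2 * d)" using close by (intro order_trans[OF norm_matvec_le] mult_left_mono) auto
  finally have diff: "\<bar>a - a'\<bar> \<le> 2 * opnorm X * d" by simp
  have lnb: "ln x - ln y \<le> \<bar>x - y\<bar> / b" if "x \<ge> b" "y \<ge> b" for x y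
  proof -
    have "ln x - ln y = ln (x / y)" using that b by (simp add: ln_div)
    also have "\<dots> \<le> x / y - 1" using that b by (intro ln_le_minus_one) auto
    also have "\<dots> = (x - y) / y" using that b by (simp add: diff_divide_distrib)
    also have "\<dots> \<le> \<bar>x - y\<bar> / y" using that b by (intro divide_right_mono) auto
    also have "\<dots> \<le> \<bar>x - y\<bar> / b" using that b by (intro divide_left_mono) auto
    finally show ?thesis .
  qed
  have "\<bar>ln a - ln a'\<bar> \<le> \<bar>a - a'\<bar> / b" using lnb[OF aa'] lnb[OF aa'(2,1)] by (simp add: abs_minus_commute abs_le_iff)
  also have "\<dots> \<le> (2 * opnorm X * d) / b" using diff b by (intro divide_right_mono) auto
  finally have "\<bar>ln a - ln a'\<bar> \<le> 2 * opnorm X * opnorm (matrix_inv X) * d" by (simp add: b_def mult_ac)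
  moreover have "a = norm (X *v v) / norm v" "a' = norm (X *v v') / norm v'"
    by (simp_all add: a_def a'_def u_def u'_def matrix_vector_mult_scaleR)
  ultimately show ?thesis by simp
qed

context dominated_tuple begin

text \<open>\<open>G w\<close> is a version of $\ln \|A_w\|$ whose first difference \<open>Dg\<close> converges along prefixes: only the
  letters up to the last hyperbolic one act on \<open>x0\<close>, the conformal rest enters through its determinant.\<close>

definition Dg :: "nat \<Rightarrow> nat list \<Rightarrow> real" where
  "Dg i w = (if set (i # w) \<inter> H = {} then ln \<bar>det (A i)\<bar> / 2
     else ln (norm (A i *v (wprod A (upto_last H w) *v x0)) / norm (wprod A (upto_last H w) *v x0)))"

fun G :: "nat list \<Rightarrow> real" where
  "G [] = 0" | "G (i # w) = Dg i w + G w"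

lemma orbit_nz: "wd w \<Longrightarrow> wprod A w *v x0 \<noteq> 0"
  using invertible_matvec_zero[OF invw, of w x0] x0_unit by auto

lemma wd_upto: "wd w \<Longrightarrow> wd (upto_last H w)" and wd_after: "wd w \<Longrightarrow> wd (after_last H w)"
  using upto_after[of H w] by (metis set_append le_sup_iff)+

lemma det_pos: "wd w \<Longrightarrow> \<bar>det (wprod A w)\<bar> > 0"
  using invw by (simp add: invertible_det_nz)

text \<open>Telescoping: the norm quotients cancel along the prefix ending at the last hyperbolic
  letter, and the determinants multiply along the conformal tail.\<close>

lemma G_closed: "wd w \<Longrightarrow> G w = ln (norm (wprod A (upto_last H w) *v x0)) + ln \<bar>det (wprod A (after_last H w))\<bar> / 2"
proof (induction w)
  case Nil then show ?case by (simp add: x0_unit)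
next
  case (Cons i w)
  then have w: "wd w" "i < N" "wd (i # w)" by auto
  note IH = Cons.IH[OF w(1)]
  show ?case
  proof (cases "set (i # w) \<inter> H = {}")
    case True
    then have none: "upto_last H w = []" by (intro upto_last_none) auto
    then have aw: "after_last H w = w" using upto_after[of H w] by simp
    have "\<bar>det (A i)\<bar> > 0" using invA[OF w(2)] by (simp add: invertible_det_nz)
    then show ?thesis using True IH none aw det_pos[OF w(1)]
      by (simp add: Dg_def det_mul abs_mult ln_mult add_divide_distrib)
  next
    case False
    let ?p = "upto_last H w"
    have p: "wd ?p" "wd (i # ?p)" using wd_upto[OF w(1)] w(2) by auto
    have "norm (wprod A ?p *v x0) > 0" "norm (wprod A (i # ?p) *v x0) > 0" using orbit_nz[OF p(1)] orbit_nz[OF p(2)] by auto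
    then have "ln (norm (wprod A (i # ?p) *v x0) / norm (wprod A ?p *v x0)) = ln (norm (wprod A (i # ?p) *v x0)) - ln (norm (wprod A ?p *v x0))"
      by (simp add: ln_div del: wprod_Cons)
    moreover have "Dg i w = ln (norm (wprod A (i # ?p) *v x0) / norm (wprod A ?p *v x0))"
      unfolding Dg_def using False by (simp only: if_False matrix_vector_mul_assoc wprod_Cons)
    moreover have "upto_last H (i # w) = i # ?p" "after_last H (i # w) = after_last H w" using False by auto
    ultimately show ?thesis using IH by (simp only: G.simps)
  qed
qed

text \<open>On the hyperbolic prefix the stretching of \<open>x0\<close> is comparable to the norm,
  on the conformal tail half the log determinant is, by \<open>E_bounded\<close>; almost
  multiplicativity joins the two parts.\<close>

lemma G_bound: "\<exists>C\<ge>0. \<forall>w. wd w \<longrightarrow> \<bar>G w - ln (opnorm (wprod A w))\<bar> \<le> C"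
proof -
  obtain cE where cE: "cE > 0" "\<And>w. set w \<subseteq> E \<Longrightarrow> cE \<le> q w" using E_bounded by blast
  have cE1: "cE \<le> 1" using cE(2)[of "[]"] q_le_1[of "[]"] by simp
  define C where "C = - ln \<kappa> - ln cE / 2"
  have lk: "ln \<kappa> \<le> 0" "ln cE \<le> 0" using \<kappa> cE cE1 by auto
  have "\<bar>G w - ln (opnorm (wprod A w))\<bar> \<le> C" if w: "wd w" for w
  proof -
    define u v where "u = upto_last H w" and "v = after_last H w"
    have uv: "w = u @ v" "wd u" "wd v" using upto_after[of H w] wd_upto[OF w] wd_after[OF w] by (auto simp: u_def v_def)
    have vE: "set v \<subseteq> E" using after_last_set[of H w] uv(3) by (auto simp: v_def H_def)
    define a b where "a = opnorm (wprod A u)" and "b = opnorm (wprod A v)"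
    have ab: "a > 0" "b > 0" using op_pos uv by (auto simp: a_def b_def)
    have u1: "ln (norm (wprod A u *v x0)) \<le> ln a"
      using norm_matvec_le[of "wprod A u" x0] x0_unit orbit_nz[OF uv(2)] by (intro ln_mono) (auto simp: a_def)
    have u2: "ln \<kappa> + ln a \<le> ln (norm (wprod A u *v x0))"
    proof -
      have "ln (\<kappa> * a) \<le> ln (norm (wprod A u *v x0))" using x0_exp[OF uv(2)] \<kappa> ab by (intro ln_mono) (auto simp: a_def)
      then show ?thesis using \<kappa> ab by (simp add: ln_mult)
    qed
    have v1: "ln \<bar>det (wprod A v)\<bar> / 2 \<le> ln b"
    proof -
      have "ln \<bar>det (wprod A v)\<bar> \<le> ln (b\<^sup>2)" using abs_det_le[of "wprod A v"] det_pos[OF uv(3)] by (intro ln_mono) (auto simp: b_def)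
      then show ?thesis using ab by (simp add: ln_realpow)
    qed
    have v2: "ln cE / 2 + ln b \<le> ln \<bar>det (wprod A v)\<bar> / 2"
    proof -
      have "cE * b\<^sup>2 \<le> \<bar>det (wprod A v)\<bar>" unfolding det_q[OF uv(3)] b_def by (intro mult_right_mono cE vE) auto
      then have "ln (cE * b\<^sup>2) \<le> ln \<bar>det (wprod A v)\<bar>" using cE ab by (intro ln_mono) auto
      then show ?thesis using cE ab by (simp add: ln_mult ln_realpow)
    qed
    have w1: "ln (opnorm (wprod A w)) \<le> ln a + ln b"
    proof -
      have "ln (opnorm (wprod A w)) \<le> ln (a * b)"
        using opnorm_mult_le[of "wprod A u" "wprod A v"] op_pos[OF w] by (intro ln_mono) (auto simp: uv(1) wprod_append a_def b_def)
      then show ?thesis using ab by (simp add: ln_mult)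
    qed
    have w2: "ln \<kappa> + ln a + ln b \<le> ln (opnorm (wprod A w))"
    proof -
      have "ln (\<kappa> * a * b) \<le> ln (opnorm (wprod A w))"
        using am[OF uv(2,3)] \<kappa> ab by (intro ln_mono) (auto simp: uv(1) a_def b_def)
      then show ?thesis using \<kappa> ab by (simp add: ln_mult)
    qed
    have Gw: "G w = ln (norm (wprod A u *v x0)) + ln \<bar>det (wprod A v)\<bar> / 2"
      using G_closed[OF w] by (simp add: u_def v_def)
    show ?thesis unfolding Gw C_def using u1 u2 v1 v2 w1 w2 lk by linarith
  qed
  then show ?thesis using lk by (intro exI[of _ C]) (auto simp: C_def)
qed

text \<open>Extending the word changes the vector acted on by \<open>A i\<close> from the image of
  \<open>x0\<close> under the prefix \<open>p\<close> to the image of another vector of F under the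
  same \<open>p\<close>. The product along \<open>p\<close> contracts F by
  \<open>q p / \<kappa>^4\<close> in sine distance, and \<open>ln_expansion_lipschitz\<close> does
  the rest.\<close>

lemma Dg_lipschitz: "\<exists>L\<ge>0. \<forall>i w r. i < N \<longrightarrow> wd (w @ r) \<longrightarrow> set w \<inter> H \<noteq> {} \<longrightarrow> \<bar>Dg i (w @ r) - Dg i w\<bar> \<le> L * q (upto_last H w)"
proof -
  define L where "L = (\<Sum>i<N. 2 * opnorm (A i) * opnorm (matrix_inv (A i))) / \<kappa>^4"
  have L0: "L \<ge> 0" unfolding L_def using \<kappa> by (intro divide_nonneg_nonneg sum_nonneg) auto
  have "\<bar>Dg i (w @ r) - Dg i w\<bar> \<le> L * q (upto_last H w)" if i: "i < N" and w: "wd (w @ r)" and h: "set w \<inter> H \<noteq> {}" for i w r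
  proof -
    define p where "p = upto_last H w"
    obtain t where t: "upto_last H (w @ r) = p @ t" "set t \<subseteq> set (w @ r)" using upto_last_extends unfolding p_def by blast
    have wp: "wd p" "wd t" "wd (p @ t)" using wd_upto[of w] w t by (auto simp: p_def)
    define v' where "v' = wprod A p *v x0"
    define y where "y = wprod A t *v x0"
    define v where "v = wprod A p *v y"
    have vv: "v = wprod A (p @ t) *v x0" by (simp add: v_def y_def wprod_append matrix_vector_mul_assoc)
    have nz: "v \<noteq> 0" "v' \<noteq> 0" "y \<noteq> 0" unfolding vv v'_def y_def by (intro orbit_nz wp)+
    have yF: "y \<in> F" unfolding y_def by (rule F_invw[OF wp(2) x0_F])
    have vl: "\<kappa>\<^sup>2 * opnorm (wprod A p) * norm y \<le> norm v" unfolding v_def by (rule F_exp[OF wp(1) yF])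
    have v'l: "\<kappa>\<^sup>2 * opnorm (wprod A p) * norm x0 \<le> norm v'" unfolding v'_def by (rule F_exp[OF wp(1) x0_F])
    have "\<bar>wedge v v'\<bar> = \<bar>det (wprod A p)\<bar> * \<bar>wedge y x0\<bar>" by (simp add: v_def v'_def wedge_matvec abs_mult)
    also have "\<dots> \<le> \<bar>det (wprod A p)\<bar> * (norm y * norm x0)" by (intro mult_left_mono abs_wedge_le) auto
    also have "\<dots> = q p / \<kappa>^4 * ((\<kappa>\<^sup>2 * opnorm (wprod A p) * norm y) * (\<kappa>\<^sup>2 * opnorm (wprod A p) * norm x0))"
      unfolding det_q[OF wp(1)] using \<kappa> by (simp add: power2_eq_square power4_eq_xxxx)
    also have "\<dots> \<le> q p / \<kappa>^4 * (norm v * norm v')"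
      using vl v'l q_pos[OF wp(1)] \<kappa> by (intro mult_left_mono mult_mono) auto
    finally have d: "\<bar>wedge v v'\<bar> \<le> q p / \<kappa>^4 * norm v * norm v'" by simp
    have "Dg i (w @ r) = ln (norm (A i *v v) / norm v)" using h t by (auto simp: Dg_def vv)
    moreover have "Dg i w = ln (norm (A i *v v') / norm v')" using h by (auto simp: Dg_def v'_def p_def)
    ultimately have "\<bar>Dg i (w @ r) - Dg i w\<bar> \<le> 2 * opnorm (A i) * opnorm (matrix_inv (A i)) * (q p / \<kappa>^4)"
      using ln_expansion_lipschitz[OF invA[OF i] nz(1,2) d] by simp
    also have "\<dots> \<le> (\<Sum>i<N. 2 * opnorm (A i) * opnorm (matrix_inv (A i))) * (q p / \<kappa>^4)"
      using i q_pos[OF wp(1)] \<kappa> by (intro mult_right_mono member_le_sum) auto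
    finally show ?thesis by (simp add: L_def p_def)
  qed
  then show ?thesis using L0 by (intro exI[of _ L]) auto
qed

lemma Dg_bounded: "\<exists>B. \<forall>i w. i < N \<longrightarrow> wd w \<longrightarrow> \<bar>Dg i w\<bar> \<le> B"
proof -
  define t where "t i = \<bar>ln \<bar>det (A i)\<bar> / 2\<bar> + \<bar>ln (opnorm (A i))\<bar> + \<bar>ln (opnorm (matrix_inv (A i)))\<bar>" for i
  have "\<bar>Dg i w\<bar> \<le> t i" if i: "i < N" and w: "wd w" for i w
  proof (cases "set (i # w) \<inter> H = {}")
    case True then show ?thesis by (simp add: Dg_def t_def)
  next
    case False
    define v where "v = wprod A (upto_last H w) *v x0"
    have v: "norm v > 0" using orbit_nz[OF wd_upto[OF w]] by (simp add: v_def)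
    have invI: "invertible (matrix_inv (A i))" using matrix_inv_mult[OF invA[OF i]] unfolding invertible_def by blast
    have o: "opnorm (A i) > 0" "opnorm (matrix_inv (A i)) > 0" using opnorm_pos invA[OF i] invI by auto
    have Av: "norm (A i *v v) > 0" using v invertible_matvec_zero[OF invA[OF i], of v] by auto
    have D: "Dg i w = ln (norm (A i *v v)) - ln (norm v)" using False v Av by (auto simp: Dg_def v_def[symmetric] ln_div)
    have "ln (norm (A i *v v)) \<le> ln (opnorm (A i) * norm v)" using norm_matvec_le[of "A i" v] Av by (intro ln_mono) auto
    then have 1: "ln (norm (A i *v v)) \<le> ln (opnorm (A i)) + ln (norm v)" using o v by (simp add: ln_mult)
    have "norm v \<le> opnorm (matrix_inv (A i)) * norm (A i *v v)"
      using norm_matvec_le[of "matrix_inv (A i)" "A i *v v"] matrix_inv_mult[OF invA[OF i]] by (simp add: matrix_vector_mul_assoc)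
    then have "ln (norm v) \<le> ln (opnorm (matrix_inv (A i)) * norm (A i *v v))" using v by (intro ln_mono) auto
    then have 2: "ln (norm v) \<le> ln (opnorm (matrix_inv (A i))) + ln (norm (A i *v v))" using o Av by (simp add: ln_mult)
    show ?thesis unfolding D t_def using 1 2 by linarith
  qed
  moreover have "t i \<le> (\<Sum>i<N. t i)" if "i < N" for i using that by (intro member_le_sum) (auto simp: t_def)
  ultimately have "\<forall>i w. i < N \<longrightarrow> wd w \<longrightarrow> \<bar>Dg i w\<bar> \<le> (\<Sum>i<N. t i)" by (meson order_trans)
  then show ?thesis by blast
qed

end

lemma prefix_word_Cons: "prefix_word x (Suc n) = x 0 # prefix_word (shift x) n"
  by (rule nth_equalityI) (auto simp: shift_def nth_Cons split: nat.splits)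

lemma prefix_word_wd: "x \<in> Sigma_space N \<Longrightarrow> set (prefix_word x n) \<subseteq> {..<N}"
  using prefix_word_in_words[of x N n] by (simp add: words_def)

lemma shift_Sigma: "x \<in> Sigma_space N \<Longrightarrow> shift x \<in> Sigma_space N"
  by (simp add: Sigma_space_def shift_def)

lemma shift_funpow_Sigma: "x \<in> Sigma_space N \<Longrightarrow> (shift ^^ k) x \<in> Sigma_space N"
  by (simp add: Sigma_space_def shift_funpow)

section \<open>The limit potential and its Birkhoff sums\<close>

context dominated_tuple begin

definition fn :: "nat \<Rightarrow> (nat \<Rightarrow> nat) \<Rightarrow> real" where
  "fn n x = Dg (x 0) (prefix_word (shift x) n)"

definition f :: "(nat \<Rightarrow> nat) \<Rightarrow> real" where "f x = lim (\<lambda>n. fn n x)"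

definition recurrent :: "(nat \<Rightarrow> nat) \<Rightarrow> bool" where
  "recurrent x \<longleftrightarrow> (\<forall>m. \<exists>k>m. x k \<in> H)"

lemma nH_pos: "nH w > 0 \<longleftrightarrow> set w \<inter> H \<noteq> {}"
  by (induction w) auto

lemma nH_upto: "nH (upto_last H w) = nH w"
proof -
  have "nH (after_last H w) = 0" using after_last_set[of H w] nH_pos by (metis gr0I)
  moreover have "nH w = nH (upto_last H w) + nH (after_last H w)"
    by (metis nH_simps(3) upto_after)
  ultimately show ?thesis by simp
qed

lemma recurrent_nH: assumes "recurrent x" shows "\<exists>n. m \<le> nH (prefix_word (shift x) n)"
proof (induction m)
  case (Suc m)
  then obtain n where n: "m \<le> nH (prefix_word (shift x) n)" by blast
  obtain k where k: "k > Suc n" "x k \<in> H" using assms by (auto simp: recurrent_def)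
  define j where "j = k - 1"
  have j: "j \<ge> n" "shift x j \<in> H" using k by (auto simp: j_def shift_def)
  have "prefix_word (shift x) (n + (j - n)) = prefix_word (shift x) n @ prefix_word ((shift ^^ n) (shift x)) (j - n)"
    by (rule prefix_word_add)
  then have "m \<le> nH (prefix_word (shift x) j)" using n j by simp
  then have "Suc m \<le> nH (prefix_word (shift x) (Suc j))" using j by (simp add: prefix_word_Suc)
  then show ?case by blast
qed auto

text \<open>Enough hyperbolic letters in the common prefix make its q small, so later symbols hardly
  matter. The estimate is uniform over all \<open>y\<close> in the cylinder, and so yields both
  convergence at \<open>x\<close> and continuity of the limit there.\<close>

lemma fn_uniform:
  assumes "\<epsilon> > 0" and x: "x \<in> Sigma_space N" "recurrent x"
  shows "\<exists>k. \<forall>y\<in>Sigma_space N. prefix_word y (Suc k) = prefix_word x (Suc k) \<longrightarrow> (\<forall>n\<ge>k. \<bar>fn n y - fn k x\<bar> \<le> \<epsilon>)"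
proof -
  obtain L where L: "L \<ge> 0" "\<And>i w r. i < N \<Longrightarrow> wd (w @ r) \<Longrightarrow> set w \<inter> H \<noteq> {} \<Longrightarrow> \<bar>Dg i (w @ r) - Dg i w\<bar> \<le> L * q (upto_last H w)"
    using Dg_lipschitz by blast
  have "\<epsilon> / (L + 1) > 0" using assms(1) L(1) by simp
  then obtain m where m: "\<And>w. wd w \<Longrightarrow> m \<le> nH w \<Longrightarrow> q w < \<epsilon> / (L + 1)" using many_H_small_q by blast
  obtain k where k: "Suc m \<le> nH (prefix_word (shift x) k)" using recurrent_nH[OF x(2)] by blast
  let ?w = "prefix_word (shift x) k"
  have w: "wd ?w" by (rule prefix_word_wd[OF shift_Sigma[OF x(1)]])
  have "q (upto_last H ?w) < \<epsilon> / (L + 1)" using k by (intro m wd_upto[OF w]) (simp add: nH_upto)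
  then have "L * q (upto_last H ?w) \<le> L * (\<epsilon> / (L + 1))" using L(1) by (intro mult_left_mono) auto
  also have "\<dots> \<le> \<epsilon>" using L(1) assms(1) by (simp add: field_simps)
  finally have Le: "L * q (upto_last H ?w) \<le> \<epsilon>" .
  have "\<bar>fn n y - fn k x\<bar> \<le> \<epsilon>"
    if y: "y \<in> Sigma_space N" "prefix_word y (Suc k) = prefix_word x (Suc k)" and n: "n \<ge> k" for y n
  proof -
    have y0: "y 0 = x 0" and yw: "prefix_word (shift y) k = ?w" using y(2) by (auto simp: prefix_word_Cons)
    have "prefix_word (shift y) (k + (n - k)) = prefix_word (shift y) k @ prefix_word ((shift ^^ k) (shift y)) (n - k)"
      by (rule prefix_word_add)
    then obtain r where r: "prefix_word (shift y) n = ?w @ r" using n yw by auto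
    have "wd (?w @ r)" unfolding r[symmetric] by (rule prefix_word_wd[OF shift_Sigma[OF y(1)]])
    moreover have "set ?w \<inter> H \<noteq> {}" using k nH_pos by fastforce
    moreover have "x 0 < N" using x by (simp add: Sigma_space_def)
    ultimately have "\<bar>Dg (x 0) (?w @ r) - Dg (x 0) ?w\<bar> \<le> L * q (upto_last H ?w)" by (intro L(2))
    then show ?thesis using Le by (simp add: fn_def y0 r)
  qed
  then show ?thesis by blast
qed

text \<open>At recurrent sequences the approximations form a Cauchy sequence; elsewhere they are
  eventually constant, since later letters are conformal and no longer change the prefix. Hence
  \<open>f\<close> is a true limit at every point, as needed for Birkhoff sums without exceptional
  set.\<close>

lemma fn_tendsto: assumes x: "x \<in> Sigma_space N" shows "(\<lambda>n. fn n x) \<longlonglongrightarrow> f x"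
proof -
  have "convergent (\<lambda>n. fn n x)"
  proof (cases "recurrent x")
    case True
    have "Cauchy (\<lambda>n. fn n x)"
    proof (rule metric_CauchyI)
      fix e :: real assume "e > 0"
      then obtain k where k: "\<And>n. n \<ge> k \<Longrightarrow> \<bar>fn n x - fn k x\<bar> \<le> e / 3"
        using fn_uniform[of "e / 3" x] x True by auto
      have "dist (fn m x) (fn n x) < e" if "m \<ge> k" "n \<ge> k" for m n
        unfolding dist_real_def using k[OF that(1)] k[OF that(2)] \<open>e > 0\<close> by linarith
      then show "\<exists>M. \<forall>m\<ge>M. \<forall>n\<ge>M. dist (fn m x) (fn n x) < e" by blast
    qed
    then show ?thesis by (rule Cauchy_convergent)
  next
    case False
    then obtain m where m: "\<And>k. k > m \<Longrightarrow> x k \<notin> H" by (auto simp: recurrent_def)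
    have "fn n x = fn m x" if "n \<ge> m" for n
    proof -
      have "prefix_word (shift x) (m + (n - m)) = prefix_word (shift x) m @ prefix_word ((shift ^^ m) (shift x)) (n - m)"
        by (rule prefix_word_add)
      moreover define r where "r = prefix_word ((shift ^^ m) (shift x)) (n - m)"
      ultimately have r: "prefix_word (shift x) n = prefix_word (shift x) m @ r" using that by simp
      have "set r \<inter> H = {}" using m by (auto simp: r_def prefix_word_def shift_funpow shift_def)
      then show ?thesis unfolding fn_def r Dg_def by (auto simp: upto_last_append_none)
    qed
    then have "(\<lambda>n. fn n x) \<longlonglongrightarrow> fn m x"
      by (intro tendsto_eventually eventually_sequentiallyI)
    then show ?thesis by (rule convergentI)
  qed
  then show ?thesis by (simp add: f_def convergent_LIMSEQ_iff)
qed

lemma f_continuous: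
  assumes x: "x \<in> Sigma_space N" "recurrent x"
  shows "(f \<longlongrightarrow> f x) (at x within Sigma_space N)"
proof (rule tendstoI)
  fix e :: real assume e: "e > 0"
  obtain k where k: "\<And>y n. y \<in> Sigma_space N \<Longrightarrow> prefix_word y (Suc k) = prefix_word x (Suc k) \<Longrightarrow> n \<ge> k \<Longrightarrow> \<bar>fn n y - fn k x\<bar> \<le> e / 3"
    using fn_uniform[of "e / 3" x] x e by auto
  have lim: "\<bar>f y - fn k x\<bar> \<le> e / 3" if "y \<in> Sigma_space N" "prefix_word y (Suc k) = prefix_word x (Suc k)" for y
  proof -
    have "(\<lambda>n. \<bar>fn n y - fn k x\<bar>) \<longlonglongrightarrow> \<bar>f y - fn k x\<bar>" by (intro tendsto_intros fn_tendsto that)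
    then show ?thesis by (rule LIMSEQ_le_const2) (use k[OF that] in blast)
  qed
  define U where "U = (\<Inter>j<Suc k. {y::nat \<Rightarrow> nat. y j = x j})"
  have "open U" unfolding U_def by (intro open_INT) (auto simp: open_coordinate)
  moreover have "x \<in> U" by (simp add: U_def)
  moreover have "dist (f y) (f x) < e" if "y \<in> U" "y \<in> Sigma_space N" for y
  proof -
    have "prefix_word y (Suc k) = prefix_word x (Suc k)" using that(1) by (simp add: prefix_word_def U_def)
    then show ?thesis unfolding dist_real_def using lim[OF that(2)] lim[OF x(1) refl] e by linarith
  qed
  ultimately show "\<forall>\<^sub>F y in at x within Sigma_space N. dist (f y) (f x) < e"
    unfolding eventually_at_topological by blast
qed

text \<open>The look-ahead shrinks by one with each shift, so all windows end at the same
  coordinate, and the terms are successive differences of \<open>G\<close> along suffixes of one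
  word.\<close>

lemma telescope:
  "(\<Sum>k<n. fn (m + n - Suc k) ((shift ^^ k) x)) = G (prefix_word x (n + m)) - G (prefix_word ((shift ^^ n) x) m)"
proof (induction n arbitrary: x)
  case (Suc n)
  have "(\<Sum>k<Suc n. fn (m + Suc n - Suc k) ((shift ^^ k) x)) =
      fn (m + n) x + (\<Sum>k<n. fn (m + n - Suc k) ((shift ^^ k) (shift x)))"
    unfolding sum.lessThan_Suc_shift by (simp add: funpow_swap1)
  also have "\<dots> = G (prefix_word x (Suc n + m)) - G (prefix_word ((shift ^^ Suc n) x) m)"
    unfolding Suc.IH by (simp add: fn_def prefix_word_Cons funpow_swap1 add.commute)
  finally show ?case .
qed simp

text \<open>For long look-ahead the sum is \<open>G (u @ v) - G v\<close>, with \<open>u\<close> the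
  word of interest. \<open>G\<close> is the log norm up to a constant, and almost multiplicativity
  leaves the log norm of \<open>u\<close>. All constants are independent of the look-ahead, which
  then tends to infinity.\<close>

lemma f_birkhoff: "\<exists>C>0. \<forall>x\<in>Sigma_space N. \<forall>n. \<bar>(\<Sum>k<n. f ((shift ^^ k) x)) - ln (opnorm (wprod A (prefix_word x n)))\<bar> \<le> C"
proof -
  obtain C1 where C1: "C1 \<ge> 0" "\<And>w. wd w \<Longrightarrow> \<bar>G w - ln (opnorm (wprod A w))\<bar> \<le> C1" using G_bound by blast
  define C where "C = 2 * C1 - ln \<kappa> + 1"
  have lk: "ln \<kappa> \<le> 0" using \<kappa> by simp
  have "\<bar>(\<Sum>k<n. f ((shift ^^ k) x)) - ln (opnorm (wprod A (prefix_word x n)))\<bar> \<le> C" if x: "x \<in> Sigma_space N" for x n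
  proof -
    let ?l = "\<lambda>w. ln (opnorm (wprod A w))"
    define T where "T m = (\<Sum>k<n. fn (m + n - Suc k) ((shift ^^ k) x))" for m
    have "T \<longlonglongrightarrow> (\<Sum>k<n. f ((shift ^^ k) x))"
      unfolding T_def
    proof (intro tendsto_sum)
      fix k assume "k \<in> {..<n}"
      then have "(\<lambda>m. fn (m + n - Suc k) ((shift ^^ k) x)) = (\<lambda>m. fn (m + (n - Suc k)) ((shift ^^ k) x))" by auto
      then show "(\<lambda>m. fn (m + n - Suc k) ((shift ^^ k) x)) \<longlonglongrightarrow> f ((shift ^^ k) x)"
        using LIMSEQ_ignore_initial_segment[OF fn_tendsto[OF shift_funpow_Sigma[OF x]]] by simp
    qed
    then have l: "(\<lambda>m. \<bar>T m - ?l (prefix_word x n)\<bar>) \<longlonglongrightarrow> \<bar>(\<Sum>k<n. f ((shift ^^ k) x)) - ?l (prefix_word x n)\<bar>"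
      by (intro tendsto_intros)
    have "\<bar>T m - ?l (prefix_word x n)\<bar> \<le> C" for m
    proof -
      let ?u = "prefix_word x n" and ?v = "prefix_word ((shift ^^ n) x) m"
      have uv: "wd ?u" "wd ?v" "wd (?u @ ?v)" using prefix_word_wd x shift_funpow_Sigma by auto
      have "T m = G (?u @ ?v) - G ?v" unfolding T_def telescope by (simp add: prefix_word_add)
      moreover have "?l (?u @ ?v) \<le> ?l ?u + ?l ?v"
      proof -
        have "?l (?u @ ?v) \<le> ln (opnorm (wprod A ?u) * opnorm (wprod A ?v))"
          using op_pos[OF uv(3)] opnorm_mult_le by (intro ln_mono) (auto simp: wprod_append)
        then show ?thesis using op_pos[OF uv(1)] op_pos[OF uv(2)] by (simp add: ln_mult)
      qed
      moreover have "ln \<kappa> + ?l ?u + ?l ?v \<le> ?l (?u @ ?v)"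
      proof -
        have "ln (\<kappa> * opnorm (wprod A ?u) * opnorm (wprod A ?v)) \<le> ?l (?u @ ?v)"
          using am[OF uv(1,2)] op_pos[OF uv(1)] op_pos[OF uv(2)] \<kappa> by (intro ln_mono) auto
        then show ?thesis using op_pos[OF uv(1)] op_pos[OF uv(2)] \<kappa> by (simp add: ln_mult)
      qed
      ultimately show ?thesis using C1(2)[OF uv(3)] C1(2)[OF uv(2)] lk unfolding C_def by linarith
    qed
    then show ?thesis by (intro LIMSEQ_le_const2[OF l]) auto
  qed
  moreover have "C > 0" using C1 lk by (simp add: C_def)
  ultimately show ?thesis by blast
qed

end

text \<open>The mass of words using only letters of \<open>S\<close> decays geometrically: by the
  quasi-Bernoulli lower bound a fixed proportion of each level is lost to the words starting with
  \<open>h\<close>. The set of sequences confined to \<open>S\<close> is null, and so are its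
  preimages under the shift.\<close>

lemma (in shift_invariant) avoiding_null:
  assumes qb: "quasi_bernoulli N \<mu>" and h: "h < N" "h \<notin> S" "p [h] > 0"
  shows "AE x in \<mu>. \<forall>m. \<exists>k>m. x k \<notin> S"
proof -
  obtain C where C: "C \<ge> 1" "\<And>u w. u \<in> finite_words N \<Longrightarrow> w \<in> finite_words N \<Longrightarrow> p u * p w / C \<le> p (u @ w)"
    using qb unfolding quasi_bernoulli_def p_def by blast
  define e where "e w = (if set w \<subseteq> S then 1 else 0 :: real)" for w
  define a where "a n = (\<Sum>w\<in>words N n. p w * e w)" for n
  have a0: "a n \<ge> 0" for n unfolding a_def e_def by (intro sum_nonneg) (auto simp: p_nonneg)
  define \<rho> where "\<rho> = 1 - p [h] / C"
  have step: "a (Suc n) \<le> \<rho> * a n" for n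
  proof -
    have "a (Suc n) = (\<Sum>w\<in>words N n. \<Sum>i<N. p (i # w) * e (i # w))"
      unfolding a_def sum_words_Suc by (rule sum.swap)
    also have "\<dots> \<le> (\<Sum>w\<in>words N n. (p w - p [h] * p w / C) * e w)"
    proof (rule sum_mono)
      fix w assume w: "w \<in> words N n"
      show "(\<Sum>i<N. p (i # w) * e (i # w)) \<le> (p w - p [h] * p w / C) * e w"
      proof (cases "set w \<subseteq> S")
        case True
        have "(\<Sum>i<N. p (i # w) * e (i # w)) + p (h # w) = (\<Sum>i<N. p (i # w) * e (i # w) + (if i = h then p (i # w) else 0))"
          using h by (simp add: sum.distrib)
        also have "\<dots> \<le> (\<Sum>i<N. p (i # w))"
          using h by (intro sum_mono) (auto simp: e_def p_nonneg)
        also have "\<dots> = p w" by (rule p_left)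
        finally have "(\<Sum>i<N. p (i # w) * e (i # w)) \<le> p w - p (h # w)" by simp
        moreover have "p [h] * p w / C \<le> p (h # w)" using C(2)[of "[h]" w] h w by (auto simp: finite_words_def words_def)
        ultimately show ?thesis using True by (simp add: e_def)
      qed (auto simp: e_def)
    qed
    also have "\<dots> = \<rho> * a n" unfolding a_def \<rho>_def sum_distrib_left by (intro sum.cong) (auto simp: algebra_simps)
    finally show ?thesis .
  qed
  have p1: "p w \<le> 1" for w by (simp add: p_def)
  have \<rho>: "0 \<le> \<rho>" "\<rho> < 1" using C(1) h(3) p1[of "[h]"] by (auto simp: \<rho>_def field_simps)
  have a_geo: "a n \<le> \<rho> ^ n * a 0" for n
  proof (induction n)
    case (Suc n)
    have "a (Suc n) \<le> \<rho> * a n" by (rule step)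
    also have "\<dots> \<le> \<rho> * (\<rho> ^ n * a 0)" using \<rho> Suc by (intro mult_left_mono) auto
    finally show ?case by simp
  qed simp
  define B where "B = {x \<in> space \<mu>. \<forall>k. x k \<in> S}"
  define Bn where "Bn n = {x \<in> space \<mu>. \<forall>k<n. x k \<in> S}" for n
  have Bn_W: "Bn n = W n -` {w. set w \<subseteq> S} \<inter> space \<mu>" for n
    by (auto simp: Bn_def W_def prefix_word_def)
  have Bn_ev: "Bn n \<in> events" for n unfolding Bn_W by (rule W_vimage_events)
  have B_eq: "B = (\<Inter>n. Bn n)" by (auto simp: B_def Bn_def)
  have B_ev: "B \<in> events" unfolding B_eq using Bn_ev by auto
  have prob_Bn: "prob (Bn n) = a n" for n
  proof -
    have "a n = (\<integral>x. e (prefix_word x n) \<partial>\<mu>)" unfolding a_def by (rule integral_word_function[symmetric])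
    also have "\<dots> = (\<integral>x. indicator (Bn n) x \<partial>\<mu>)"
      by (rule Bochner_Integration.integral_cong[OF refl]) (auto simp: e_def Bn_W W_def indicator_def)
    also have "\<dots> = prob (Bn n)" using Bn_ev[of n] sets.sets_into_space[OF Bn_ev[of n]] by (simp add: Int_absorb1)
    finally show ?thesis by simp
  qed
  have "prob B \<le> \<rho> ^ n * a 0" for n
    using finite_measure_mono[of B "Bn n"] Bn_ev[of n] B_eq prob_Bn[of n] a_geo[of n] by force
  moreover have "(\<lambda>n. \<rho> ^ n * a 0) \<longlonglongrightarrow> 0 * a 0" using \<rho> by (intro tendsto_intros LIMSEQ_realpow_zero)
  ultimately have "prob B \<le> 0" using LIMSEQ_le_const by (metis (no_types, lifting) mult_zero_left)
  then have B0: "prob B = 0" using measure_nonneg[of \<mu> B] by linarith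
  \<comment> \<open>The successor matches the strict inequality \<open>k > m\<close> in the
    claim.\<close>
  have "AE x in \<mu>. \<forall>m. (shift ^^ Suc m) x \<notin> B"
  proof (subst AE_all_countable, intro allI)
    fix m
    have "(shift ^^ Suc m) -` B \<inter> space \<mu> \<in> events" using measurable_sets[OF Tk_meas B_ev] .
    moreover have "prob ((shift ^^ Suc m) -` B \<inter> space \<mu>) = 0" unfolding Tk_inv[OF B_ev] by (rule B0)
    ultimately have "(shift ^^ Suc m) -` B \<inter> space \<mu> \<in> null_sets \<mu>" by (simp add: emeasure_eq_measure null_sets_def)
    then show "AE x in \<mu>. (shift ^^ Suc m) x \<notin> B" by (rule AE_I') auto
  qed
  then show ?thesis
  proof (rule AE_mp, intro AE_I2 impI allI)
    fix x m assume x: "x \<in> space \<mu>" and a: "\<forall>m. (shift ^^ Suc m) x \<notin> B"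
    have "(shift ^^ Suc m) x \<in> space \<mu>" using x by (rule Tk_space)
    then obtain j where "(shift ^^ Suc m) x j \<notin> S" using a unfolding B_def by blast
    then show "\<exists>k>m. x k \<notin> S" unfolding shift_funpow by (intro exI[of _ "j + Suc m"]) auto
  qed
qed

text \<open>Hyperbolic letters exist because otherwise \<open>E_bounded\<close> would contradict
  \<open>unb\<close>. Almost every sequence then meets them infinitely often, and \<open>f\<close>
  is continuous at those sequences.\<close>

theorem (in dominated_tuple) additive_cocycle_if_unbounded:
  assumes unb: "\<And>c. c > 0 \<Longrightarrow> \<exists>w. wd w \<and> q w < c"
    and mu: "shift_invariant N \<mu>" and qb: "quasi_bernoulli N \<mu>"
    and pos: "\<And>i. i < N \<Longrightarrow> measure \<mu> (cyl N [i]) > 0"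
  shows "additive_cocycle_cond N A \<mu>"
proof -
  interpret shift_invariant N \<mu> by (rule mu)
  have "H \<noteq> {}"
  proof
    assume "H = {}"
    then have "E = {..<N}" using E_sub by (auto simp: H_def)
    then obtain c where c: "c > 0" "\<And>w. wd w \<Longrightarrow> c \<le> q w" using E_bounded by auto
    then show False using unb[OF c(1)] by force
  qed
  then obtain h where h: "h \<in> H" by blast
  then have hN: "h < N" "h \<notin> E" using H_sub by (auto simp: H_def)
  have ae: "AE x in \<mu>. \<forall>m. \<exists>k>m. x k \<notin> E"
    using avoiding_null[OF qb hN] pos[OF hN(1)] by (simp add: p_def)
  have "AE x in \<mu>. (f \<longlongrightarrow> f x) (at x within Sigma_space N)"
    using ae
  proof (rule AE_mp, intro AE_I2 impI)
    fix x assume x: "x \<in> space \<mu>" and r: "\<forall>m. \<exists>k>m. x k \<notin> E"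
    have xS: "x \<in> Sigma_space N" using x by (simp add: space_mu)
    then have "x k < N" for k by (simp add: Sigma_space_def)
    then have "recurrent x" using r unfolding recurrent_def H_def by auto
    then show "(f \<longlongrightarrow> f x) (at x within Sigma_space N)" by (rule f_continuous[OF xS])
  qed
  moreover have "integrable \<mu> f"
  proof -
    obtain B where B: "\<And>i w. i < N \<Longrightarrow> wd w \<Longrightarrow> \<bar>Dg i w\<bar> \<le> B" using Dg_bounded by blast
    have fnW: "fn n = (\<lambda>x. (\<lambda>w. Dg (hd w) (tl w)) (W (Suc n) x))" for n
      by (rule ext) (simp add: fn_def W_def prefix_word_Cons)
    have meas: "fn n \<in> borel_measurable \<mu>" for n
      unfolding fnW by (rule borel_measurable_simple_function[OF simple_function_compose1[OF W_simple]])
    have fm: "f \<in> borel_measurable \<mu>"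
      by (rule borel_measurable_LIMSEQ_real[where u=fn, OF _ meas]) (simp add: space_mu fn_tendsto)
    have bd: "\<bar>f x\<bar> \<le> B" if x: "x \<in> Sigma_space N" for x
    proof -
      have "\<bar>fn n x\<bar> \<le> B" for n unfolding fn_def using x prefix_word_wd[OF shift_Sigma[OF x]]
        by (intro B) (auto simp: Sigma_space_def)
      then show ?thesis by (intro LIMSEQ_le_const2[OF tendsto_rabs[OF fn_tendsto[OF x]]]) auto
    qed
    show ?thesis by (rule integrable_const_bound[of _ B]) (auto intro!: AE_I2 simp: space_mu bd fm)
  qed
  moreover note f_birkhoff
  ultimately show ?thesis unfolding additive_cocycle_cond_def by blast
qed

text \<open>When q is bounded below, the log norm is half the log determinant up to a constant, and
  the latter is exactly additive and depends on one symbol.\<close>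

theorem (in almost_mult_tuple) additive_cocycle_if_bounded:
  assumes c: "c > 0" and bd: "\<And>w. wd w \<Longrightarrow> c \<le> q w" and mu: "shift_invariant N \<mu>"
  shows "additive_cocycle_cond N A \<mu>"
proof -
  interpret shift_invariant N \<mu> by (rule mu)
  define f where "f x = ln \<bar>det (A (x 0))\<bar> / 2" for x :: "nat \<Rightarrow> nat"
  have c1: "c \<le> 1" using bd[of "[]"] q_le_1[of "[]"] by simp
  have f_loc: "(f \<longlongrightarrow> f x) (at x within Sigma_space N)" for x
  proof (rule tendsto_eventually)
    have "open {y::nat \<Rightarrow> nat. y 0 = x 0}" by (rule open_coordinate)
    then show "\<forall>\<^sub>F y in at x within Sigma_space N. f y = f x"
      unfolding eventually_at_topological by (intro exI[of _ "{y. y 0 = x 0}"]) (auto simp: f_def)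
  qed
  have "integrable \<mu> f"
  proof -
    have fW: "f = (\<lambda>x. (\<lambda>w. ln \<bar>det (A (hd w))\<bar> / 2) (W 1 x))"
      by (rule ext) (simp add: f_def W_def prefix_word_def)
    have fm: "f \<in> borel_measurable \<mu>"
      unfolding fW by (rule borel_measurable_simple_function[OF simple_function_compose1[OF W_simple]])
    have "\<bar>f x\<bar> \<le> (\<Sum>i<N. \<bar>ln \<bar>det (A i)\<bar> / 2\<bar>)" if "x \<in> space \<mu>" for x
      unfolding f_def using that member_le_sum[of "x 0" "{..<N}" "\<lambda>i. \<bar>ln \<bar>det (A i)\<bar> / 2\<bar>"]
      by (auto simp: space_mu Sigma_space_def)
    then show ?thesis by (intro integrable_const_bound[of _ "\<Sum>i<N. \<bar>ln \<bar>det (A i)\<bar> / 2\<bar>"] AE_I2 fm) auto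
  qed
  moreover have "\<bar>(\<Sum>k<n. f ((shift ^^ k) x)) - ln (opnorm (wprod A (prefix_word x n)))\<bar> \<le> 1 - ln c / 2" if x: "x \<in> Sigma_space N" for x n
  proof -
    let ?w = "prefix_word x n"
    have w: "wd ?w" by (rule prefix_word_wd[OF x])
    have xN: "x k < N" for k using x by (simp add: Sigma_space_def)
    have dp: "\<bar>det (wprod A (prefix_word x n))\<bar> > 0" for n using invw[OF prefix_word_wd[OF x]] by (simp add: invertible_det_nz)
    have sum: "(\<Sum>k<n. f ((shift ^^ k) x)) = ln \<bar>det (wprod A ?w)\<bar> / 2"
    proof (induction n)
      case (Suc n)
      have "\<bar>det (A (x n))\<bar> > 0" using invA[OF xN] by (simp add: invertible_det_nz)
      then have "ln \<bar>det (wprod A (prefix_word x (Suc n)))\<bar> = ln \<bar>det (wprod A (prefix_word x n))\<bar> + ln \<bar>det (A (x n))\<bar>"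
        using dp[of n] by (simp add: prefix_word_Suc wprod_append det_mul abs_mult ln_mult)
      then show ?case using Suc by (simp add: f_def shift_funpow add_divide_distrib)
    qed (simp add: prefix_word_def)
    define b where "b = opnorm (wprod A ?w)"
    have b: "b > 0" using op_pos[OF w] by (simp add: b_def)
    have "ln \<bar>det (wprod A ?w)\<bar> \<le> ln (b\<^sup>2)" using abs_det_le[of "wprod A ?w"] dp by (intro ln_mono) (auto simp: b_def)
    then have 1: "ln \<bar>det (wprod A ?w)\<bar> / 2 \<le> ln b" using b by (simp add: ln_realpow)
    have "c * b\<^sup>2 \<le> \<bar>det (wprod A ?w)\<bar>" unfolding det_q[OF w] b_def by (intro mult_right_mono bd w) auto
    then have "ln (c * b\<^sup>2) \<le> ln \<bar>det (wprod A ?w)\<bar>" using c b by (intro ln_mono) auto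
    then have 2: "ln c / 2 + ln b \<le> ln \<bar>det (wprod A ?w)\<bar> / 2" using c b by (simp add: ln_mult ln_realpow)
    have "ln c \<le> 0" using c c1 by simp
    then show ?thesis unfolding sum b_def[symmetric] using 1 2 by linarith
  qed
  moreover have "1 - ln c / 2 > 0"
  proof -
    have "ln c \<le> 0" using c c1 by simp
    then show ?thesis by linarith
  qed
  ultimately show ?thesis unfolding additive_cocycle_cond_def using f_loc
    by (intro exI[of _ "1 - ln c / 2"] conjI exI[of _ f]) auto
qed

section \<open>The remaining implications\<close>

lemma sum_split_lessThan: "(\<Sum>k<n + m. g k) = (\<Sum>k<n. g k) + (\<Sum>k<m. g (n + k))" for g :: "nat \<Rightarrow> real"
  by (induction m) auto

text \<open>Birkhoff sums are additive, so at a point of the cylinder of \<open>u @ w\<close> the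
  three comparisons for \<open>u\<close>, \<open>w\<close> and \<open>u @ w\<close> each cost one
  \<open>C\<close>. The comparison holds at every point, so every pair of words is reached.\<close>

lemma additive_cocycle_imp_almost_multiplicative:
  assumes N: "N > 0" and inv: "\<forall>i<N. invertible (A i)" and coc: "additive_cocycle_cond N A \<mu>"
  shows "almost_multiplicative (gen_semigroup N A)"
proof -
  obtain C f where C: "C > 0" "\<And>x n. x \<in> Sigma_space N \<Longrightarrow> \<bar>(\<Sum>k<n. f ((shift ^^ k) x)) - ln (opnorm (wprod A (prefix_word x n)))\<bar> \<le> C"
    using coc unfolding additive_cocycle_cond_def by blast
  have "exp (- (3 * C)) * opnorm (wprod A u) * opnorm (wprod A w) \<le> opnorm (wprod A u ** wprod A w)"
    if u: "set u \<subseteq> {..<N}" and w: "set w \<subseteq> {..<N}" for u w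
  proof -
    obtain x where x: "x \<in> Sigma_space N" "prefix_word x (length (u @ w)) = u @ w"
      using word_extend[OF N, of "u @ w"] u w by auto
    define y where "y = (shift ^^ length u) x"
    have y: "y \<in> Sigma_space N" unfolding y_def by (rule shift_funpow_Sigma[OF x(1)])
    have "prefix_word x (length u) @ prefix_word y (length w) = u @ w"
      using x(2) by (simp add: prefix_word_add y_def)
    then have pu: "prefix_word x (length u) = u" and pw: "prefix_word y (length w) = w" by (auto simp: append_eq_append_conv)
    have "(\<Sum>k<length u + length w. f ((shift ^^ k) x)) = (\<Sum>k<length u. f ((shift ^^ k) x)) + (\<Sum>k<length w. f ((shift ^^ k) y))"
    proof -
      have "(shift ^^ k) y = (shift ^^ (length u + k)) x" for k by (simp add: y_def shift_funpow add_ac)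
      then show ?thesis by (simp add: sum_split_lessThan)
    qed
    then have key: "ln (opnorm (wprod A u)) + ln (opnorm (wprod A w)) - 3 * C \<le> ln (opnorm (wprod A (u @ w)))"
      using C(2)[OF x(1), of "length u + length w"] C(2)[OF x(1), of "length u"] C(2)[OF y, of "length w"] x(2) pu pw by simp
    have op: "opnorm (wprod A u) > 0" "opnorm (wprod A w) > 0" "opnorm (wprod A (u @ w)) > 0"
      using wprod_opnorm_pos[OF inv] u w by auto
    have "exp (- (3 * C)) * opnorm (wprod A u) * opnorm (wprod A w) = exp (ln (opnorm (wprod A u)) + ln (opnorm (wprod A w)) - 3 * C)"
      using op by (simp add: exp_add exp_diff exp_minus field_simps)
    also have "\<dots> \<le> exp (ln (opnorm (wprod A (u @ w))))" using key by simp
    also have "\<dots> = opnorm (wprod A u ** wprod A w)" using op by (simp add: wprod_append)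
    finally show ?thesis .
  qed
  then show ?thesis unfolding almost_multiplicative_def gen_semigroup_def
    by (intro exI[of _ "exp (- (3 * C))"]) auto
qed

text \<open>The semigroup consists of products of nonempty words; lowering the constant to at most 1
  covers the empty word as well.\<close>

lemma almost_mult_tuple_of_almost_multiplicative:
  assumes inv: "\<forall>i<N. invertible (A i)" and am: "almost_multiplicative (gen_semigroup N A)"
  shows "\<exists>\<kappa>. almost_mult_tuple N A \<kappa>"
proof -
  obtain \<kappa> where k: "\<kappa> > 0" "\<And>X Y. X \<in> gen_semigroup N A \<Longrightarrow> Y \<in> gen_semigroup N A \<Longrightarrow> opnorm (X ** Y) \<ge> \<kappa> * opnorm X * opnorm Y"
    using am unfolding almost_multiplicative_def by blast
  have "almost_mult_tuple N A (min \<kappa> 1)"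
  proof
    show "invertible (A i)" if "i < N" for i using inv that by blast
    show "0 < min \<kappa> 1" "min \<kappa> 1 \<le> 1" using k by auto
    fix u w assume uw: "set u \<subseteq> {..<N}" "set w \<subseteq> {..<N}"
    have op: "opnorm (wprod A u) \<ge> 0" "opnorm (wprod A w) \<ge> 0" by auto
    show "min \<kappa> 1 * opnorm (wprod A u) * opnorm (wprod A w) \<le> opnorm (wprod A (u @ w))"
    proof (cases "u = [] \<or> w = []")
      case True
      have "min \<kappa> 1 * (opnorm (wprod A u) * opnorm (wprod A w)) \<le> 1 * (opnorm (wprod A u) * opnorm (wprod A w))"
        by (intro mult_right_mono) auto
      also have "\<dots> = opnorm (wprod A (u @ w))" using True by auto
      finally show ?thesis by (simp add: mult.assoc)
    next
      case False
      have "min \<kappa> 1 * (opnorm (wprod A u) * opnorm (wprod A w)) \<le> \<kappa> * (opnorm (wprod A u) * opnorm (wprod A w))"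
        by (intro mult_right_mono) auto
      also have "\<dots> \<le> opnorm (wprod A u ** wprod A w)"
        using k(2)[of "wprod A u" "wprod A w"] uw False by (auto simp: gen_semigroup_def mult.assoc)
      finally show ?thesis by (simp add: wprod_append mult.assoc)
    qed
  qed
  then show ?thesis by blast
qed

lemma (in almost_mult_tuple) dominated_tuple_if_unbounded:
  assumes irr: "irreducible_tuple N A" and unb: "\<And>c. c > 0 \<Longrightarrow> \<exists>w. wd w \<and> q w < c"
  shows "\<exists>x0. dominated_tuple N A \<kappa> x0"
proof -
  obtain x0 where x0: "norm x0 = 1" "\<And>w. wd w \<Longrightarrow> \<kappa> * opnorm (wprod A w) \<le> norm (wprod A w *v x0)"
    using exists_expanded_vector[OF unb] by blast
  have "x0 \<noteq> 0" using x0 by auto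
  then have "\<exists>i<N. wedge x0 (A i *v x0) \<noteq> 0" using irreducible_moves[OF _ irr] invA by blast
  then have "dominated_tuple N A \<kappa> x0" using x0 by unfold_locales auto
  then show ?thesis by blast
qed

lemma almost_multiplicative_imp_decomposable:
  assumes inv: "\<forall>i<N. invertible (A i)" and irr: "irreducible_tuple N A" and am: "almost_multiplicative (gen_semigroup N A)"
  shows "decomposable N A"
proof -
  obtain \<kappa> where "almost_mult_tuple N A \<kappa>" using almost_mult_tuple_of_almost_multiplicative[OF inv am] by blast
  then interpret almost_mult_tuple N A \<kappa> .
  show ?thesis
  proof (cases "\<exists>c>0. \<forall>w. wd w \<longrightarrow> c \<le> q w")
    case True
    then obtain c where c: "c > 0" "\<And>w. wd w \<Longrightarrow> c \<le> q w" by blast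
    have "strongly_conformal (A ` {..<N})"
    proof (rule bounded_semigroup_strongly_conformal[OF _ c(1)])
      fix w assume w: "wd w"
      show "c * (opnorm (wprod A w))\<^sup>2 \<le> \<bar>det (wprod A w)\<bar>" unfolding det_q[OF w] by (intro mult_right_mono c w) auto
    qed (use inv in auto)
    then show ?thesis unfolding decomposable_def by (intro exI[of _ "{..<N}"] exI[of _ "{}"]) auto
  next
    case False
    then have unb: "\<exists>w. wd w \<and> q w < c" if "c > 0" for c using that by (meson not_le)
    obtain x0 where "dominated_tuple N A \<kappa> x0" using dominated_tuple_if_unbounded[OF irr unb] by blast
    then interpret dominated_tuple N A \<kappa> x0 .
    show ?thesis by (rule decomposable_if_unbounded[OF unb])
  qed
qed

lemma almost_multiplicative_imp_additive_cocycle: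
  assumes inv: "\<forall>i<N. invertible (A i)" and irr: "irreducible_tuple N A" and am: "almost_multiplicative (gen_semigroup N A)"
    and mu: "shift_invariant N \<mu>" and qb: "quasi_bernoulli N \<mu>"
    and pos: "\<And>i. i < N \<Longrightarrow> measure \<mu> (cyl N [i]) > 0"
  shows "additive_cocycle_cond N A \<mu>"
proof -
  obtain \<kappa> where "almost_mult_tuple N A \<kappa>" using almost_mult_tuple_of_almost_multiplicative[OF inv am] by blast
  then interpret almost_mult_tuple N A \<kappa> .
  show ?thesis
  proof (cases "\<exists>c>0. \<forall>w. wd w \<longrightarrow> c \<le> q w")
    case True
    then show ?thesis using additive_cocycle_if_bounded[OF _ _ mu] by blast
  next
    case False
    then have unb: "\<exists>w. wd w \<and> q w < c" if "c > 0" for c using that by (meson not_le)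
    obtain x0 where "dominated_tuple N A \<kappa> x0" using dominated_tuple_if_unbounded[OF irr unb] by blast
    then interpret dominated_tuple N A \<kappa> x0 .
    show ?thesis by (rule additive_cocycle_if_unbounded[OF unb mu qb pos])
  qed
qed

theorem theorem2p8:
  fixes N :: nat and A :: "nat \<Rightarrow> real^2^2" and s :: real and \<mu> :: "(nat \<Rightarrow> nat) measure"
  assumes "N \<ge> 2"
    and "\<forall>i<N. invertible (A i)"
    and "irreducible_tuple N A"
    and "s > 0"
    and "equilibrium_state N A s \<mu>"
  shows "(quasi_bernoulli N \<mu> \<longleftrightarrow> almost_multiplicative (gen_semigroup N A)) \<and>
         (almost_multiplicative (gen_semigroup N A) \<longleftrightarrow> decomposable N A) \<and>
         (decomposable N A \<longleftrightarrow> additive_cocycle_cond N A \<mu>)"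
proof -
  have mu: "shift_invariant N \<mu>" using assms(1,5) by unfold_locales (auto simp: equilibrium_state_def)
  obtain K and P :: real where K: "K > 0" and
    gibbs: "\<And>w. w \<in> finite_words N \<Longrightarrow>
      measure \<mu> (cyl N w) \<le> K * (exp (- P * length w) * opnorm (wprod A w) powr s) \<and>
      exp (- P * length w) * opnorm (wprod A w) powr s \<le> K * measure \<mu> (cyl N w)"
    using equilibrium_gibbs[OF assms] by blast
  define m where "m w = exp (- P * length w) * opnorm (wprod A w) powr s" for w
  define p where "p w = measure \<mu> (cyl N w)" for w
  have op: "opnorm (wprod A w) > 0" if "w \<in> finite_words N" for w
    using that wprod_opnorm_pos[OF assms(2)] by (simp add: finite_words_def)
  have m_pos: "m w > 0" if "w \<in> finite_words N" for w using op[OF that] by (simp add: m_def)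
  have p_up: "p w \<le> K * m w" and p_low: "m w \<le> K * p w" if "w \<in> finite_words N" for w
    using gibbs[OF that] by (auto simp: m_def p_def)
  have p_nn: "p w \<ge> 0" for w by (simp add: p_def)
  have p_pos: "p w > 0" if "w \<in> finite_words N" for w
    using p_low[OF that] m_pos[OF that] K p_nn[of w] by (metis less_le_trans less_eq_real_def mult_zero_right not_less)
  have m_app: "m (u @ w) = exp (- P * length u) * exp (- P * length w) * opnorm (wprod A u ** wprod A w) powr s" for u w
    by (simp add: m_def wprod_append exp_add[symmetric] algebra_simps)
  have m_prod: "m u * m w = exp (- P * length u) * exp (- P * length w) * (opnorm (wprod A u) * opnorm (wprod A w)) powr s" for u w
    by (simp add: m_def powr_mult)
  have m_sub: "m (u @ w) \<le> m u * m w" for u w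
    unfolding m_app m_prod using assms(4) opnorm_mult_le[of "wprod A u" "wprod A w"]
    by (intro mult_left_mono powr_mono2) auto
  have qb_am: "almost_multiplicative (gen_semigroup N A)" if qb: "quasi_bernoulli N \<mu>"
  proof -
    obtain C where C: "C \<ge> 1" "\<And>u w. u \<in> finite_words N \<Longrightarrow> w \<in> finite_words N \<Longrightarrow> p u * p w / C \<le> p (u @ w)"
      using qb unfolding quasi_bernoulli_def p_def by blast
    \<comment> \<open>Its power \<open>s\<close> is the total loss: one \<open>K\<close> for each of
      the two passages from weights to masses, one \<open>K\<close> for the way back, and the
      quasi-Bernoulli constant \<open>C\<close>.\<close>
    define k where "k = (1 / (K ^ 3 * C)) powr (1 / s)"
    have kpos: "k > 0" using K C(1) by (simp add: k_def)
    have ks: "k powr s = 1 / (K ^ 3 * C)" using K C(1) assms(4) by (simp add: k_def powr_powr)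
    have "k * opnorm (wprod A u) * opnorm (wprod A w) \<le> opnorm (wprod A u ** wprod A w)"
      if u: "u \<in> finite_words N" and w: "w \<in> finite_words N" for u w
    proof -
      have uw: "u @ w \<in> finite_words N" using u w by (auto simp: finite_words_def)
      have "m u * m w \<le> (K * p u) * (K * p w)"
        using p_low[OF u] p_low[OF w] m_pos[OF u] m_pos[OF w] K p_nn by (intro mult_mono) auto
      also have "\<dots> = K\<^sup>2 * C * (p u * p w / C)" using C(1) by (simp add: power2_eq_square)
      also have "\<dots> \<le> K\<^sup>2 * C * p (u @ w)" using C K u w by (intro mult_left_mono) auto
      also have "\<dots> \<le> K\<^sup>2 * C * (K * m (u @ w))" using C K p_up[OF uw] by (intro mult_left_mono) auto
      finally have "m u * m w \<le> (K ^ 3 * C) * m (u @ w)" by (simp add: power2_eq_square power3_eq_cube mult_ac)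
      then have "k powr s * (m u * m w) \<le> m (u @ w)" unfolding ks using K C(1) by (simp add: field_simps)
      then have "(exp (- P * length u) * exp (- P * length w)) * (k powr s * (opnorm (wprod A u) * opnorm (wprod A w)) powr s)
          \<le> (exp (- P * length u) * exp (- P * length w)) * opnorm (wprod A u ** wprod A w) powr s"
        unfolding m_app m_prod by (simp only: mult_ac)
      then have "k powr s * (opnorm (wprod A u) * opnorm (wprod A w)) powr s \<le> opnorm (wprod A u ** wprod A w) powr s"
        by simp
      then have "(k * opnorm (wprod A u) * opnorm (wprod A w)) powr s \<le> opnorm (wprod A u ** wprod A w) powr s"
        using kpos by (simp add: powr_mult mult.assoc)
      moreover have "0 < opnorm (wprod A u ** wprod A w)" using op[OF uw] by (simp add: wprod_append)
      ultimately show ?thesis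
        by (metis assms(4) opnorm_nonneg powr_less_mono2 not_le)
    qed
    then show ?thesis unfolding almost_multiplicative_def gen_semigroup_def finite_words_def using kpos
      by (intro exI[of _ k]) auto
  qed
  have am_qb: "quasi_bernoulli N \<mu>" if am: "almost_multiplicative (gen_semigroup N A)"
  proof -
    obtain \<kappa> where "almost_mult_tuple N A \<kappa>" using almost_mult_tuple_of_almost_multiplicative[OF assms(2) am] by blast
    then interpret almost_mult_tuple N A \<kappa> .
    \<comment> \<open>\<open>K ^ 3\<close> serves the upper bound, where the weights are
      submultiplicative; the lower bound also pays \<open>\<kappa> powr s\<close>.\<close>
    define C where "C = max 1 (max (K ^ 3) (K ^ 3 / \<kappa> powr s))"
    have C1: "C \<ge> 1" "C \<ge> K ^ 3" "C \<ge> K ^ 3 / \<kappa> powr s" by (auto simp: C_def)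
    have "p u * p w / C \<le> p (u @ w) \<and> p (u @ w) \<le> C * p u * p w"
      if u: "u \<in> finite_words N" and w: "w \<in> finite_words N" for u w
    proof
      have uw: "u @ w \<in> finite_words N" using u w by (auto simp: finite_words_def)
      have "p (u @ w) \<le> K * m (u @ w)" by (rule p_up[OF uw])
      also have "\<dots> \<le> K * (m u * m w)" using K m_sub by (intro mult_left_mono) auto
      also have "\<dots> \<le> K * ((K * p u) * (K * p w))"
        using K p_low[OF u] p_low[OF w] m_pos[OF u] m_pos[OF w] p_nn by (intro mult_left_mono mult_mono) auto
      also have "\<dots> = K ^ 3 * (p u * p w)" by (simp add: power3_eq_cube)
      also have "\<dots> \<le> C * (p u * p w)" using C1 p_nn by (intro mult_right_mono) auto
      finally show "p (u @ w) \<le> C * p u * p w" by (simp add: mult.assoc)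
      have "\<kappa> * (opnorm (wprod A u) * opnorm (wprod A w)) \<le> opnorm (wprod A u ** wprod A w)"
        using am[of u w] u w by (simp add: finite_words_def wprod_append mult.assoc)
      then have "(\<kappa> * (opnorm (wprod A u) * opnorm (wprod A w))) powr s \<le> opnorm (wprod A u ** wprod A w) powr s"
        using \<kappa> assms(4) by (intro powr_mono2) auto
      then have "\<kappa> powr s * (opnorm (wprod A u) * opnorm (wprod A w)) powr s \<le> opnorm (wprod A u ** wprod A w) powr s"
        using \<kappa> by (simp add: powr_mult)
      then have "(exp (- P * length u) * exp (- P * length w)) * (\<kappa> powr s * (opnorm (wprod A u) * opnorm (wprod A w)) powr s)
          \<le> (exp (- P * length u) * exp (- P * length w)) * opnorm (wprod A u ** wprod A w) powr s"
        by (intro mult_left_mono) auto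
      then have low: "\<kappa> powr s * (m u * m w) \<le> m (u @ w)" unfolding m_app m_prod by (simp only: mult_ac)
      have kp: "\<kappa> powr s > 0" using \<kappa> by simp
      have "p u * p w \<le> (K * m u) * (K * m w)"
        using p_up[OF u] p_up[OF w] p_nn K m_pos[OF u] by (intro mult_mono) auto
      also have "\<dots> = K\<^sup>2 / \<kappa> powr s * (\<kappa> powr s * (m u * m w))" using kp by (simp add: power2_eq_square)
      also have "\<dots> \<le> K\<^sup>2 / \<kappa> powr s * m (u @ w)" using low kp by (intro mult_left_mono) auto
      also have "\<dots> \<le> K\<^sup>2 / \<kappa> powr s * (K * p (u @ w))" using p_low[OF uw] kp by (intro mult_left_mono) auto
      also have "\<dots> = K ^ 3 / \<kappa> powr s * p (u @ w)" by (simp add: power2_eq_square power3_eq_cube)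
      also have "\<dots> \<le> C * p (u @ w)" using C1 p_nn by (intro mult_right_mono) auto
      finally show "p u * p w / C \<le> p (u @ w)" using C1(1) by (simp add: pos_divide_le_eq mult.commute)
    qed
    then show ?thesis unfolding quasi_bernoulli_def p_def using C1(1) by blast
  qed
  have pos: "measure \<mu> (cyl N [i]) > 0" if "i < N" for i
    using p_pos[of "[i]"] that by (simp add: p_def finite_words_def)
  have N0: "N > 0" using assms(1) by simp
  \<comment> \<open>Almost multiplicativity is the hub. Its implication to the additive cocycle
    takes the quasi-Bernoulli property as a further premise, which \<open>am_qb\<close>
    supplies.\<close>
  show ?thesis
    using qb_am am_qb decomposable_imp_almost_multiplicative[OF assms(2)]
      almost_multiplicative_imp_decomposable[OF assms(2,3)]
      almost_multiplicative_imp_additive_cocycle[OF assms(2,3) _ mu _ pos]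
      additive_cocycle_imp_almost_multiplicative[OF N0 assms(2)]
    by blast
qed

end
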